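(* Let $R$ be a commutative ring, let $s$ be a positive integer, let $C$ be a non-negatively graded chain complex in $\mathcal{P}_{s,R}$, and let $X$ be an $(n-1)$-connected simplicial $R$-module ($n$ a non-negative integer) which is degreewise finitely generated and projective over $R$. (1) For $i<ns$, $H_i(c_XC)$ is a torsion abelian group. (2) For every prime $p$ and every integer $d$ with $\Sigma_p(s)\le d<s$, for $i<nd$ the $p$-primary torsion of $H_i(c_XC)$ is bounded by $p^r$ (i.e. killed by $p^r$) with $r=\left\lceil\frac{d-\Sigma_p(s)}{p-1}\right\rceil$. (3) In particular, for every prime $p$ and $i<n\Sigma_p(s)$ the $p$-primary part of $H_i(c_XC)$ is zero, and for $i<n$, $H_i(c_XC)$ is equal to zero.
   Context: Let $\mathrm{P}_R$ be the category of finitely generated projective $R$-modules. For an integer $s\ge 0$, the Schur category $\Gamma^s\mathrm{P}_R$ is the $R$-linear category with the same objects as $\mathrm{P}_R$, with morphisms $\mathrm{Hom}_{\Gamma^s\mathrm{P}_R}(M,N)=\mathrm{Hom}_{\mathfrak{S}_s}(M^{\otimes s},N^{\otimes s})\simeq\Gamma^s(\mathrm{Hom}_R(M,N))$ (the $\mathfrak{S}_s$-equivariant $R$-linear maps, $\mathfrak{S}_s$ permuting tensor factors; $M^{\otimes 0}=R$), and composition of equivariant maps. The category $\mathcal{P}_{s,R}$ of homogeneous strict polynomial functors of weight $s$ is the abelian category of $R$-linear functors $\Gamma^s\mathrm{P}_R\to R\text{-Mod}$. Each $F\in\mathcal{P}_{s,R}$ has an underlying ordinary functor $\mathrm{P}_R\to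 R\text{-Mod}$, obtained by precomposing with the functor $\mathrm{P}_R\to\Gamma^s\mathrm{P}_R$ which is the identity on objects and $f\mapsto f^{\otimes s}$ on morphisms. Given a non-negatively graded chain complex $C$ of functors $\mathrm{P}_R\to R\text{-Mod}$ (for $C$ in $\mathcal{P}_{s,R}$, use the underlying ordinary functors) and a simplicial object $X$ of $\mathrm{P}_R$, the bigraded object $C_i(X_j)$ has a differential with respect to $i$ and a simplicial structure with respect to $j$; $c_X(C)=c_XC$ denotes the chain complex of $R$-modules obtained by taking normalized chains with respect to $j$ and then the total complex. $X$ is $(n-1)$-connected if $\pi_i(X)=0$ for $i\le n-1$. $\Sigma_p(s)$ denotes the sum of the digits of the $p$-adic expansion of $s$; $\lceil x\rceil$ is the smallest integer $\ge x$. *)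

theory Defs
  imports Complex_Main "HOL-Algebra.Module" "HOL-Algebra.AbelCoset" "HOL-Combinatorics.Permutations" "HOL-Computational_Algebra.Primes"
begin

section \<open>Modules and linear maps\<close>

text \<open>
  A module record extends a ring record; the two multiplicative fields play no role in
  \<open>module R M\<close> and are left unspecified in the constructions below.
\<close>

definition mk_module ::
    "'a set \<Rightarrow> 'a \<Rightarrow> ('a \<Rightarrow> 'a \<Rightarrow> 'a) \<Rightarrow> ('r \<Rightarrow> 'a \<Rightarrow> 'a) \<Rightarrow> ('r, 'a) module" where
  "mk_module A z pl sc =
     \<lparr>carrier = A, monoid.mult = undefined, one = undefined, ring.zero = z, ring.add = pl, smult = sc\<rparr>"

definition linear_map ::
    "('r, 'x) ring_scheme \<Rightarrow> ('r, 'a) module \<Rightarrow> ('r, 'b) module \<Rightarrow> ('a \<Rightarrow> 'b) \<Rightarrow> bool" where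
  "linear_map R M N f \<longleftrightarrow>
     f \<in> carrier M \<rightarrow> carrier N \<and>
     (\<forall>x\<in>carrier M. \<forall>y\<in>carrier M. f (x \<oplus>\<^bsub>M\<^esub> y) = f x \<oplus>\<^bsub>N\<^esub> f y) \<and>
     (\<forall>r\<in>carrier R. \<forall>x\<in>carrier M. f (r \<odot>\<^bsub>M\<^esub> x) = r \<odot>\<^bsub>N\<^esub> f x)"

text \<open>
  Morphisms are linear maps that are \<open>undefined\<close> outside the carrier of the source, so that
  equality of morphisms is equality of functions.
\<close>

definition lin_hom ::
    "('r, 'x) ring_scheme \<Rightarrow> ('r, 'a) module \<Rightarrow> ('r, 'b) module \<Rightarrow> ('a \<Rightarrow> 'b) set" where
  "lin_hom R M N = {f. linear_map R M N f \<and> f \<in> extensional (carrier M)}"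

definition hom_module ::
    "('r, 'x) ring_scheme \<Rightarrow> ('r, 'a) module \<Rightarrow> ('r, 'b) module \<Rightarrow> ('r, 'a \<Rightarrow> 'b) module" where
  "hom_module R M N = mk_module (lin_hom R M N) (\<lambda>x\<in>carrier M. \<zero>\<^bsub>N\<^esub>)
     (\<lambda>f g. \<lambda>x\<in>carrier M. f x \<oplus>\<^bsub>N\<^esub> g x) (\<lambda>r f. \<lambda>x\<in>carrier M. r \<odot>\<^bsub>N\<^esub> f x)"

definition submodule_span ::
    "('r, 'x) ring_scheme \<Rightarrow> ('r, 'a) module \<Rightarrow> 'a set \<Rightarrow> 'a set" where
  "submodule_span R M S = \<Inter>{H. submodule H R M \<and> S \<subseteq> H}"

definition finitely_generated :: "('r, 'x) ring_scheme \<Rightarrow> ('r, 'm) module \<Rightarrow> bool" where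
  "finitely_generated R M \<longleftrightarrow>
     (\<exists>S. finite S \<and> S \<subseteq> carrier M \<and> submodule_span R M S = carrier M)"

text \<open>
  The lifting property. There is no quantifier over types; testing against surjections
  from modules on \<open>'m \<Rightarrow> 'r\<close> onto modules on \<open>'m\<close> gives the usual notion, because the canonical
  surjection onto \<open>M\<close> from the free module with basis the carrier of \<open>M\<close> (finitely supported
  functions \<open>'m \<Rightarrow> 'r\<close>) is among them, and a splitting of it gives the lifting property against
  all surjections.
\<close>

definition projective :: "('r, 'x) ring_scheme \<Rightarrow> ('r, 'm) module \<Rightarrow> bool" where
  "projective R M \<longleftrightarrow>
     (\<forall>(A :: ('r, 'm \<Rightarrow> 'r) module) (B :: ('r, 'm) module) g h.
        module R A \<and> module R B \<and> g \<in> lin_hom R A B \<and> g ` carrier A = carrier B \<and>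
        h \<in> lin_hom R M B \<longrightarrow>
        (\<exists>k \<in> lin_hom R M A. \<forall>x\<in>carrier M. g (k x) = h x))"

text \<open>
  The objects of $\mathrm{P}_R$, with underlying set in the type \<open>'m\<close>.
\<close>

definition proj_objects :: "('r, 'x) ring_scheme \<Rightarrow> ('r, 'm) module set" where
  "proj_objects R = {M. module R M \<and> finitely_generated R M \<and> projective R M}"

definition quot_module :: "('r, 'a) module \<Rightarrow> 'a set \<Rightarrow> ('r, 'a set) module" where
  "quot_module M H = mk_module (a_rcosets\<^bsub>M\<^esub> H) H (set_add M)
     (\<lambda>r T. \<Union>x\<in>T. H +>\<^bsub>M\<^esub> (r \<odot>\<^bsub>M\<^esub> x))"

text \<open>The direct sum, for a finite index set.\<close>

definition direct_sum :: "'i set \<Rightarrow> ('i \<Rightarrow> ('r, 'a) module) \<Rightarrow> ('r, 'i \<Rightarrow> 'a) module" where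
  "direct_sum I M = mk_module (\<Pi>\<^sub>E i\<in>I. carrier (M i)) (\<lambda>i\<in>I. \<zero>\<^bsub>M i\<^esub>)
     (\<lambda>f g. \<lambda>i\<in>I. f i \<oplus>\<^bsub>M i\<^esub> g i) (\<lambda>r f. \<lambda>i\<in>I. r \<odot>\<^bsub>M i\<^esub> f i)"


section \<open>Tensor powers\<close>

definition free_module :: "('r, 'x) ring_scheme \<Rightarrow> 'b set \<Rightarrow> ('r, 'b \<Rightarrow> 'r) module" where
  "free_module R B = mk_module
     {\<phi>. (\<forall>b\<in>B. \<phi> b \<in> carrier R) \<and> (\<forall>b. b \<notin> B \<longrightarrow> \<phi> b = \<zero>\<^bsub>R\<^esub>) \<and> finite {b. \<phi> b \<noteq> \<zero>\<^bsub>R\<^esub>}}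
     (\<lambda>b. \<zero>\<^bsub>R\<^esub>) (\<lambda>\<phi> \<psi> b. \<phi> b \<oplus>\<^bsub>R\<^esub> \<psi> b) (\<lambda>r \<phi> b. r \<otimes>\<^bsub>R\<^esub> \<phi> b)"

definition free_basis :: "('r, 'x) ring_scheme \<Rightarrow> 'b \<Rightarrow> 'b \<Rightarrow> 'r" where
  "free_basis R b = (\<lambda>c. if c = b then \<one>\<^bsub>R\<^esub> else \<zero>\<^bsub>R\<^esub>)"

text \<open>The linear extension of a map \<open>h\<close> between the bases of two free modules.\<close>

definition free_map :: "('r, 'x) ring_scheme \<Rightarrow> ('b \<Rightarrow> 'c) \<Rightarrow> ('b \<Rightarrow> 'r) \<Rightarrow> 'c \<Rightarrow> 'r" where
  "free_map R h \<phi> = (\<lambda>c. \<Oplus>\<^bsub>R\<^esub> b \<in> {b. \<phi> b \<noteq> \<zero>\<^bsub>R\<^esub> \<and> h b = c}. \<phi> b)"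

definition tuples :: "nat \<Rightarrow> ('r, 'm) module \<Rightarrow> 'm list set" where
  "tuples s M = {xs. length xs = s \<and> set xs \<subseteq> carrier M}"

definition multilinear_relations ::
    "('r, 'x) ring_scheme \<Rightarrow> nat \<Rightarrow> ('r, 'm) module \<Rightarrow> ('m list \<Rightarrow> 'r) set" where
  "multilinear_relations R s M =
     (let F = free_module R (tuples s M); e = free_basis R in
       {e (xs[k := x \<oplus>\<^bsub>M\<^esub> y]) \<ominus>\<^bsub>F\<^esub> (e (xs[k := x]) \<oplus>\<^bsub>F\<^esub> e (xs[k := y])) | xs k x y.
          xs \<in> tuples s M \<and> k < s \<and> x \<in> carrier M \<and> y \<in> carrier M} \<union>
       {e (xs[k := r \<odot>\<^bsub>M\<^esub> x]) \<ominus>\<^bsub>F\<^esub> (r \<odot>\<^bsub>F\<^esub> e (xs[k := x])) | xs k r x.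
          xs \<in> tuples s M \<and> k < s \<and> r \<in> carrier R \<and> x \<in> carrier M})"

definition tensor_kernel ::
    "('r, 'x) ring_scheme \<Rightarrow> nat \<Rightarrow> ('r, 'm) module \<Rightarrow> ('m list \<Rightarrow> 'r) set" where
  "tensor_kernel R s M =
     submodule_span R (free_module R (tuples s M)) (multilinear_relations R s M)"

text \<open>
  $M^{\otimes s}$ is the free module on the \<open>s\<close>-tuples of elements of \<open>M\<close> modulo multilinearity;
  for \<open>s = 0\<close> it is free of rank one on the empty tuple.
\<close>

definition tensor_power ::
    "('r, 'x) ring_scheme \<Rightarrow> nat \<Rightarrow> ('r, 'm) module \<Rightarrow> ('r, ('m list \<Rightarrow> 'r) set) module" where
  "tensor_power R s M = quot_module (free_module R (tuples s M)) (tensor_kernel R s M)"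

text \<open>
  The linear map $M^{\otimes s} \to N^{\otimes s}$ induced by an operation \<open>h\<close> on tuples that
  is compatible with the multilinear relations.
\<close>

definition tensor_map ::
    "('r, 'x) ring_scheme \<Rightarrow> nat \<Rightarrow> ('r, 'm) module \<Rightarrow> ('r, 'm) module \<Rightarrow>
     ('m list \<Rightarrow> 'm list) \<Rightarrow> ('m list \<Rightarrow> 'r) set \<Rightarrow> ('m list \<Rightarrow> 'r) set" where
  "tensor_map R s M N h =
     (\<lambda>t\<in>carrier (tensor_power R s M).
        \<Union>\<phi>\<in>t. tensor_kernel R s N +>\<^bsub>free_module R (tuples s N)\<^esub> free_map R h \<phi>)"

text \<open>$f^{\otimes s}$, that is, $x_1 \otimes \dots \otimes x_s \mapsto f(x_1) \otimes \dots \otimes f(x_s)$.\<close>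

definition tensor_power_map ::
    "('r, 'x) ring_scheme \<Rightarrow> nat \<Rightarrow> ('r, 'm) module \<Rightarrow> ('r, 'm) module \<Rightarrow>
     ('m \<Rightarrow> 'm) \<Rightarrow> ('m list \<Rightarrow> 'r) set \<Rightarrow> ('m list \<Rightarrow> 'r) set" where
  "tensor_power_map R s M N f = tensor_map R s M N (map f)"

text \<open>
  The action of \<open>\<sigma>\<close> on $M^{\otimes s}$ by
  $x_1 \otimes \dots \otimes x_s \mapsto x_{\sigma(1)} \otimes \dots \otimes x_{\sigma(s)}$. This is a
  right action; its equivariant maps are those of the left action by inverses.
\<close>

definition tensor_perm ::
    "('r, 'x) ring_scheme \<Rightarrow> nat \<Rightarrow> ('r, 'm) module \<Rightarrow> (nat \<Rightarrow> nat) \<Rightarrow>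
     ('m list \<Rightarrow> 'r) set \<Rightarrow> ('m list \<Rightarrow> 'r) set" where
  "tensor_perm R s M \<sigma> = tensor_map R s M M (permute_list \<sigma>)"


section \<open>Strict polynomial functors\<close>

text \<open>The module of morphisms from \<open>M\<close> to \<open>N\<close> in $\Gamma^s\mathrm{P}_R$.\<close>

definition schur_hom ::
    "('r, 'x) ring_scheme \<Rightarrow> nat \<Rightarrow> ('r, 'm) module \<Rightarrow> ('r, 'm) module \<Rightarrow>
     ('r, ('m list \<Rightarrow> 'r) set \<Rightarrow> ('m list \<Rightarrow> 'r) set) module" where
  "schur_hom R s M N =
     (hom_module R (tensor_power R s M) (tensor_power R s N))
       \<lparr>carrier := {f \<in> lin_hom R (tensor_power R s M) (tensor_power R s N).
          \<forall>\<sigma>. \<sigma> permutes {..<s} \<longrightarrow>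
            (\<forall>t\<in>carrier (tensor_power R s M).
               f (tensor_perm R s M \<sigma> t) = tensor_perm R s N \<sigma> (f t))}\<rparr>"

text \<open>
  The data of a functor to \<open>R\<close>-modules, from a category whose objects are modules on \<open>'m\<close> and
  whose morphisms are of type \<open>'h\<close>; \<open>farr F M N f\<close> is the value on \<open>f\<close> regarded as a morphism
  from \<open>M\<close> to \<open>N\<close>.
\<close>

record ('r, 'm, 'h, 'n) functor_data =
  fobj :: "('r, 'm) module \<Rightarrow> ('r, 'n) module"
  farr :: "('r, 'm) module \<Rightarrow> ('r, 'm) module \<Rightarrow> 'h \<Rightarrow> 'n \<Rightarrow> 'n"

type_synonym ('r, 'm, 'n) ord_functor = "('r, 'm, 'm \<Rightarrow> 'm, 'n) functor_data"

type_synonym ('r, 'm, 'n) poly_functor =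
  "('r, 'm, ('m list \<Rightarrow> 'r) set \<Rightarrow> ('m list \<Rightarrow> 'r) set, 'n) functor_data"

text \<open>An \<open>R\<close>-linear functor $\Gamma^s\mathrm{P}_R \to R\text{-Mod}$.\<close>

locale strict_poly_functor =
  fixes R :: "('r, 'x) ring_scheme" and s :: nat and F :: "('r, 'm, 'n) poly_functor"
  assumes fobj_module: "M \<in> proj_objects R \<Longrightarrow> module R (fobj F M)"
    and farr_linear: "\<lbrakk>M \<in> proj_objects R; N \<in> proj_objects R\<rbrakk> \<Longrightarrow>
      linear_map R (schur_hom R s M N) (hom_module R (fobj F M) (fobj F N)) (farr F M N)"
    and farr_id: "M \<in> proj_objects R \<Longrightarrow>
      farr F M M (\<lambda>t\<in>carrier (tensor_power R s M). t) = (\<lambda>x\<in>carrier (fobj F M). x)"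
    and farr_comp: "\<lbrakk>L \<in> proj_objects R; M \<in> proj_objects R; N \<in> proj_objects R;
      f \<in> carrier (schur_hom R s L M); g \<in> carrier (schur_hom R s M N)\<rbrakk> \<Longrightarrow>
      farr F L N (compose (carrier (tensor_power R s L)) g f) =
        compose (carrier (fobj F L)) (farr F M N g) (farr F L M f)"

locale strict_poly_transformation =
  source: strict_poly_functor R s F + target: strict_poly_functor R s G
  for R :: "('r, 'x) ring_scheme" and s :: nat and F G :: "('r, 'm, 'n) poly_functor" +
  fixes \<eta> :: "('r, 'm) module \<Rightarrow> 'n \<Rightarrow> 'n"
  assumes component: "M \<in> proj_objects R \<Longrightarrow> \<eta> M \<in> lin_hom R (fobj F M) (fobj G M)"
    and natural: "\<lbrakk>M \<in> proj_objects R; N \<in> proj_objects R;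
      f \<in> carrier (schur_hom R s M N); x \<in> carrier (fobj F M)\<rbrakk> \<Longrightarrow>
      \<eta> N (farr F M N f x) = farr G M N f (\<eta> M x)"

text \<open>
  A non-negatively graded chain complex in $\mathcal{P}_{s,R}$, with differential
  \<open>\<delta> i\<close> from \<open>C (Suc i)\<close> to \<open>C i\<close>.
\<close>

locale strict_poly_complex =
  fixes R :: "('r, 'x) ring_scheme" and s :: nat
    and C :: "nat \<Rightarrow> ('r, 'm, 'n) poly_functor"
    and \<delta> :: "nat \<Rightarrow> ('r, 'm) module \<Rightarrow> 'n \<Rightarrow> 'n"
  assumes differential: "strict_poly_transformation R s (C (Suc i)) (C i) (\<delta> i)"
    and differential_squared: "\<lbrakk>M \<in> proj_objects R; x \<in> carrier (fobj (C (Suc (Suc i))) M)\<rbrakk> \<Longrightarrow>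
      \<delta> i M (\<delta> (Suc i) M x) = \<zero>\<^bsub>fobj (C i) M\<^esub>"

definition underlying_functor ::
    "('r, 'x) ring_scheme \<Rightarrow> nat \<Rightarrow> ('r, 'm, 'n) poly_functor \<Rightarrow> ('r, 'm, 'n) ord_functor" where
  "underlying_functor R s F =
     \<lparr>fobj = fobj F, farr = (\<lambda>M N f. farr F M N (tensor_power_map R s M N f))\<rparr>"


section \<open>Simplicial modules, chain complexes, and the complex $c_X C$\<close>

text \<open>\<open>face Xs n i\<close> maps $X_{n+1}$ to $X_n$ and \<open>degen Xs n i\<close> maps $X_n$ to $X_{n+1}$.\<close>

record ('r, 'a) simplicial_data =
  sobj :: "nat \<Rightarrow> ('r, 'a) module"
  face :: "nat \<Rightarrow> nat \<Rightarrow> 'a \<Rightarrow> 'a"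
  degen :: "nat \<Rightarrow> nat \<Rightarrow> 'a \<Rightarrow> 'a"

locale simplicial_module =
  fixes R :: "('r, 'x) ring_scheme" and Xs :: "('r, 'a) simplicial_data"
  assumes sobj_module: "module R (sobj Xs n)"
    and face_hom: "i \<le> Suc n \<Longrightarrow> face Xs n i \<in> lin_hom R (sobj Xs (Suc n)) (sobj Xs n)"
    and degen_hom: "i \<le> n \<Longrightarrow> degen Xs n i \<in> lin_hom R (sobj Xs n) (sobj Xs (Suc n))"
    and face_face: "\<lbrakk>i < j; j \<le> Suc (Suc n); x \<in> carrier (sobj Xs (Suc (Suc n)))\<rbrakk> \<Longrightarrow>
      face Xs n i (face Xs (Suc n) j x) = face Xs n (j - 1) (face Xs (Suc n) i x)"
    and face_degen_less: "\<lbrakk>i < j; j \<le> Suc n; x \<in> carrier (sobj Xs (Suc n))\<rbrakk> \<Longrightarrow>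
      face Xs (Suc n) i (degen Xs (Suc n) j x) = degen Xs n (j - 1) (face Xs n i x)"
    and face_degen_same: "\<lbrakk>i = j \<or> i = Suc j; j \<le> n; x \<in> carrier (sobj Xs n)\<rbrakk> \<Longrightarrow>
      face Xs n i (degen Xs n j x) = x"
    and face_degen_greater: "\<lbrakk>Suc j < i; i \<le> Suc (Suc n); x \<in> carrier (sobj Xs (Suc n))\<rbrakk> \<Longrightarrow>
      face Xs (Suc n) i (degen Xs (Suc n) j x) = degen Xs n j (face Xs n (i - 1) x)"
    and degen_degen: "\<lbrakk>i \<le> j; j \<le> n; x \<in> carrier (sobj Xs n)\<rbrakk> \<Longrightarrow>
      degen Xs (Suc n) i (degen Xs n j x) = degen Xs (Suc n) (Suc j) (degen Xs n i x)"

definition apply_functor ::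
    "('r, 'm, 'n) ord_functor \<Rightarrow> ('r, 'm) simplicial_data \<Rightarrow> ('r, 'n) simplicial_data" where
  "apply_functor F Xs =
     \<lparr>sobj = (\<lambda>n. fobj F (sobj Xs n)),
      face = (\<lambda>n i. farr F (sobj Xs (Suc n)) (sobj Xs n) (face Xs n i)),
      degen = (\<lambda>n i. farr F (sobj Xs n) (sobj Xs (Suc n)) (degen Xs n i))\<rparr>"

text \<open>Non-negatively graded complexes of modules; \<open>cdiff K k\<close> maps degree \<open>k + 1\<close> to degree \<open>k\<close>.\<close>

record ('r, 'a) complex_data =
  cobj :: "nat \<Rightarrow> ('r, 'a) module"
  cdiff :: "nat \<Rightarrow> 'a \<Rightarrow> 'a"

definition cycles :: "('r, 'a) complex_data \<Rightarrow> nat \<Rightarrow> 'a set" where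
  "cycles K i = {x \<in> carrier (cobj K i).
     \<forall>k. i = Suc k \<longrightarrow> cdiff K k x = \<zero>\<^bsub>cobj K k\<^esub>}"

definition boundaries :: "('r, 'a) complex_data \<Rightarrow> nat \<Rightarrow> 'a set" where
  "boundaries K i = cdiff K i ` carrier (cobj K (Suc i))"

definition homology :: "('r, 'a) complex_data \<Rightarrow> nat \<Rightarrow> ('r, 'a set) module" where
  "homology K i = quot_module ((cobj K i)\<lparr>carrier := cycles K i\<rparr>) (boundaries K i)"

text \<open>
  Normalized (Moore) chains: in degree \<open>j\<close> the elements of $X_j$ killed by all faces $d_i$ with
  $1 \le i \le j$, with differential $d_0$.
\<close>

definition normalized_chains :: "('r, 'a) simplicial_data \<Rightarrow> ('r, 'a) complex_data" where
  "normalized_chains Xs =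
     \<lparr>cobj = (\<lambda>j. (sobj Xs j)\<lparr>carrier := {x \<in> carrier (sobj Xs j).
        \<forall>k. j = Suc k \<longrightarrow> (\<forall>i\<in>{1..Suc k}. face Xs k i x = \<zero>\<^bsub>sobj Xs k\<^esub>)}\<rparr>),
      cdiff = (\<lambda>j. face Xs j 0)\<rparr>"

text \<open>
  $\pi_i(X)$. A cycle of the normalized chains is an \<open>i\<close>-simplex with all faces zero, and a
  boundary is the face $d_0$ of an \<open>(i+1)\<close>-simplex whose other faces are zero; these are the
  simplicial spheres and null-homotopies, based at zero, of the underlying Kan complex.
\<close>

definition homotopy_group :: "('r, 'a) simplicial_data \<Rightarrow> nat \<Rightarrow> ('r, 'a set) module" where
  "homotopy_group Xs i = homology (normalized_chains Xs) i"

definition trivial_module :: "('r, 'a) module \<Rightarrow> bool" where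
  "trivial_module M \<longleftrightarrow> carrier M = {\<zero>\<^bsub>M\<^esub>}"

text \<open>
  The total complex has $\bigoplus_{i \le k} N_{k-i}(C_i(X))$ in degree \<open>k\<close>, and its differential
  is the sum of the differential of \<open>C\<close> and of $(-1)^i d_0$ on the summand of index \<open>i\<close>.
\<close>

definition c_complex ::
    "(nat \<Rightarrow> ('r, 'm, 'n) ord_functor) \<Rightarrow> (nat \<Rightarrow> ('r, 'm) module \<Rightarrow> 'n \<Rightarrow> 'n) \<Rightarrow>
     ('r, 'm) simplicial_data \<Rightarrow> ('r, nat \<Rightarrow> 'n) complex_data" where
  "c_complex C \<delta> Xs =
     (let N = (\<lambda>i. normalized_chains (apply_functor (C i) Xs)) in
      \<lparr>cobj = (\<lambda>k. direct_sum {..k} (\<lambda>i. cobj (N i) (k - i))),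
       cdiff = (\<lambda>k f. \<lambda>i\<in>{..k}.
         (let A = fobj (C i) (sobj Xs (k - i)); y = cdiff (N i) (k - i) (f i) in
            \<delta> i (sobj Xs (k - i)) (f (Suc i)) \<oplus>\<^bsub>A\<^esub> (if even i then y else \<ominus>\<^bsub>A\<^esub> y)))\<rparr>)"


section \<open>Torsion\<close>

definition torsion_group :: "('r, 'a) module \<Rightarrow> bool" where
  "torsion_group M \<longleftrightarrow> (\<forall>x\<in>carrier M. \<exists>k::nat. k > 0 \<and> [k] \<cdot>\<^bsub>M\<^esub> x = \<zero>\<^bsub>M\<^esub>)"

definition primary_part :: "nat \<Rightarrow> ('r, 'a) module \<Rightarrow> 'a set" where
  "primary_part p M = {x \<in> carrier M. \<exists>k::nat. [(p ^ k)] \<cdot>\<^bsub>M\<^esub> x = \<zero>\<^bsub>M\<^esub>}"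

text \<open>The range contains every nonzero digit, since \<open>p ^ k > s\<close> for \<open>k > s\<close> and \<open>p \<ge> 2\<close>.\<close>

definition digit_sum :: "nat \<Rightarrow> nat \<Rightarrow> nat" where
  "digit_sum p s = (\<Sum>k\<le>s. (s div p ^ k) mod p)"

end

(*
  For a partition of s into D positive parts a_1, ..., a_D, polarizing f |-> f^{(x)s} gives an
  operation gamma(f_1, ..., f_D) in Gamma^s Hom(M, N), the sum over all words with a_c letters c of
  the corresponding tensor products. It satisfies gamma(f, ..., f) = m f^{(x)s}, where m is the
  multinomial coefficient of the partition, and it vanishes as soon as one f_c does.

  Since X is (n-1)-connected and projective, it carries linear maps X_k -> X_{k+1} that commute with
  the faces d_i, i > 0, as a cone would, and satisfy d_0 cone = id for k < n. Hence
  trunc = id - d_0 cone is homotopic to the identity and zero in degrees below n. A diagonal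
  approximation Delta^k -> (Delta^k)^D of small width shows that in degrees k < n D every term of
  gamma, evaluated on simplicial operators of trunc, has an entry factoring through some X_j with
  j < n. So m is null-homotopic on F(X) below degree n D, naturally in F, and therefore m kills
  H_i(c_X C) for i < n D.

  By Legendre's formula, splitting s into digit_sum p s + (p - 1) r powers of p makes the p-adic
  valuation of m equal to r. The partitions 1 + ... + 1 and s give the torsion statement and the
  vanishing below n.
*)

theory Submission
  imports Defs "HOL-Algebra.Free_Abelian_Groups" "HOL-Combinatorics.Multiset_Permutations"
    "HOL-Algebra.Multiplicative_Group"
begin

section \<open>Augmented simplicial chains\<close>

text \<open>A strict polynomial functor is not additive, so a chain homotopy between
  \<open>trunc\<close> and the identity on X says nothing about F(X). Each homotopy is therefore
  kept as a system of operators X_j -> X_l indexed by the simplices of a test space; gamma is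
  applied to the operators attached to one simplex, and integer combinations are formed only in
  F(X). Two test spaces occur. Over Delta^j x Delta^1 the prism joins m = gamma(id, ..., id) to
  gamma(trunc, ..., trunc). Over (Delta^j)^D the diagonal simplex, which again gives gamma(trunc,
  ..., trunc), is joined to a chain in each of whose simplices the coordinates take at most j + D
  values in all; for j < n D one of them takes at most n values. The resulting null-homotopy of m
  lands in unnormalized chains and is brought back by the Moore projector. It is built from the cone
  and from polarized powers alone, hence commutes with natural transformations, and this is what
  lets it pass to the total complex of C.\<close>

definition prepend :: "'v \<Rightarrow> ('v list \<Rightarrow>\<^sub>0 int) \<Rightarrow> ('v list \<Rightarrow>\<^sub>0 int)" where
  "prepend v = frag_extend (\<lambda>\<sigma>. frag_of (v # \<sigma>))"

definition push :: "('v \<Rightarrow> 'w) \<Rightarrow> ('v list \<Rightarrow>\<^sub>0 int) \<Rightarrow> ('w list \<Rightarrow>\<^sub>0 int)" where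
  "push g = frag_extend (\<lambda>\<sigma>. frag_of (map g \<sigma>))"

text \<open>A list of length l is a simplex of dimension l - 1 and the empty list has dimension -1,
  so the complex is augmented. Lists with repeated vertices are basis elements too; degenerate
  simplices are not divided out.\<close>

fun simplex_boundary :: "'v list \<Rightarrow> ('v list \<Rightarrow>\<^sub>0 int)" where
  "simplex_boundary [] = 0"
| "simplex_boundary (v # \<sigma>) = frag_of \<sigma> - prepend v (simplex_boundary \<sigma>)"

definition boundary :: "('v list \<Rightarrow>\<^sub>0 int) \<Rightarrow> ('v list \<Rightarrow>\<^sub>0 int)" where
  "boundary = frag_extend simplex_boundary"

text \<open>Unfolds to the sum of (-1)^i [e v_0, ..., e v_i, v_i, ..., v_k], the triangulated prism
  of the homotopy between \<open>e\<close> and the identity.\<close>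

fun simplex_prism :: "('v \<Rightarrow> 'v) \<Rightarrow> 'v list \<Rightarrow> ('v list \<Rightarrow>\<^sub>0 int)" where
  "simplex_prism e [] = 0"
| "simplex_prism e (v # \<sigma>) = frag_of (e v # v # \<sigma>) - prepend (e v) (simplex_prism e \<sigma>)"

definition prism :: "('v \<Rightarrow> 'v) \<Rightarrow> ('v list \<Rightarrow>\<^sub>0 int) \<Rightarrow> ('v list \<Rightarrow>\<^sub>0 int)" where
  "prism e = frag_extend (simplex_prism e)"

lemma frag_induct [case_names zero one diff]:
  fixes c :: "'a \<Rightarrow>\<^sub>0 int"
  assumes "P 0" "\<And>x. P (frag_of x)" "\<And>a b. P a \<Longrightarrow> P b \<Longrightarrow> P (a - b)"
  shows "P c"
  using frag_induction[of c UNIV P] assms by auto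

lemma prepend_simps [simp]:
  "prepend v 0 = 0" "prepend v (frag_of \<sigma>) = frag_of (v # \<sigma>)"
  "prepend v (a + b) = prepend v a + prepend v b" "prepend v (a - b) = prepend v a - prepend v b"
  "prepend v (frag_cmul m a) = frag_cmul m (prepend v a)" "prepend v (- a) = - prepend v a"
  by (simp_all add: prepend_def frag_extend_add frag_extend_diff frag_extend_cmul frag_extend_minus)

lemma push_simps [simp]:
  "push g 0 = 0" "push g (frag_of \<sigma>) = frag_of (map g \<sigma>)"
  "push g (a + b) = push g a + push g b" "push g (a - b) = push g a - push g b"
  "push g (frag_cmul m a) = frag_cmul m (push g a)" "push g (- a) = - push g a"
  by (simp_all add: push_def frag_extend_add frag_extend_diff frag_extend_cmul frag_extend_minus)

lemma boundary_simps [simp]: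
  "boundary 0 = 0" "boundary (frag_of \<sigma>) = simplex_boundary \<sigma>"
  "boundary (a + b) = boundary a + boundary b" "boundary (a - b) = boundary a - boundary b"
  "boundary (frag_cmul m a) = frag_cmul m (boundary a)"
  by (simp_all add: boundary_def frag_extend_add frag_extend_diff frag_extend_cmul)

lemma prism_simps [simp]:
  "prism e 0 = 0" "prism e (frag_of \<sigma>) = simplex_prism e \<sigma>"
  "prism e (a + b) = prism e a + prism e b" "prism e (a - b) = prism e a - prism e b"
  by (simp_all add: prism_def frag_extend_add frag_extend_diff frag_extend_cmul)

lemma push_sum: "push g (\<Sum>i\<in>I. f i) = (\<Sum>i\<in>I. push g (f i))"
  by (induction I rule: infinite_finite_induct) simp_all

lemma boundary_sum: "boundary (\<Sum>i\<in>I. f i) = (\<Sum>i\<in>I. boundary (f i))"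
  by (induction I rule: infinite_finite_induct) simp_all

lemma prepend_sum: "prepend v (\<Sum>i\<in>I. f i) = (\<Sum>i\<in>I. prepend v (f i))"
  by (induction I rule: infinite_finite_induct) simp_all

text \<open>The cone contracts the augmented complex. Because the boundary of a vertex is the empty
  simplex, the formula has no exception in degree 0.\<close>

lemma boundary_prepend: "boundary (prepend v z) = z - prepend v (boundary z)"
  by (induction z rule: frag_induct) (simp_all add: algebra_simps)

lemma push_push: "push f (push g z) = push (f \<circ> g) z"
  by (induction z rule: frag_induct) (simp_all add: comp_def)

lemma push_prepend: "push g (prepend v z) = prepend (g v) (push g z)"
  by (induction z rule: frag_induct) simp_all

lemma push_simplex_boundary: "push g (simplex_boundary \<sigma>) = simplex_boundary (map g \<sigma>)"
  by (induction \<sigma>) (simp_all add: push_prepend)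

lemma push_boundary: "push g (boundary z) = boundary (push g z)"
  by (induction z rule: frag_induct) (simp_all add: push_simplex_boundary)

lemma push_simplex_prism:
  assumes "\<And>v. g (e v) = e (g v)"
  shows "push g (simplex_prism e \<sigma>) = simplex_prism e (map g \<sigma>)"
  by (induction \<sigma>) (simp_all add: push_prepend assms)

text \<open>Induction on the first vertex: \<open>simplex_prism\<close> treats v # \<sigma> as a
  cone, and \<open>boundary_prepend\<close> reduces the claim for it to the claim for \<sigma> with
  e v put in front.\<close>

lemma boundary_prism: "boundary (prism e z) + prism e (boundary z) = z - push e z"
proof -
  have prism_prepend: "prism e (prepend v z) = prepend (e v) (prepend v z) - prepend (e v) (prism e z)"
    for v z by (induction z rule: frag_induct) (simp_all add: algebra_simps)
  have "boundary (simplex_prism e \<sigma>) + prism e (simplex_boundary \<sigma>) = frag_of \<sigma> - frag_of (map e \<sigma>)" for \<sigma>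
  proof (induction \<sigma>)
    case (Cons v \<sigma>)
    have "boundary (simplex_prism e (v # \<sigma>)) + prism e (simplex_boundary (v # \<sigma>)) =
       frag_of (v # \<sigma>) - frag_of (e v # \<sigma>)
       + prepend (e v) (boundary (simplex_prism e \<sigma>) + prism e (simplex_boundary \<sigma>))"
      by (simp add: boundary_prepend prism_prepend algebra_simps)
    then show ?case by (simp add: Cons.IH)
  qed simp
  then show ?thesis
    by (induction z rule: frag_induct) (simp_all add: algebra_simps)
qed

section \<open>Faces by deletion and the cosimplicial differential\<close>

definition delete_nth :: "nat \<Rightarrow> 'v list \<Rightarrow> 'v list" where
  "delete_nth i \<sigma> = take i \<sigma> @ drop (Suc i) \<sigma>"

lemma delete_nth_Cons [simp]:
  "delete_nth 0 (v # \<sigma>) = \<sigma>" "delete_nth (Suc i) (v # \<sigma>) = v # delete_nth i \<sigma>"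
  by (simp_all add: delete_nth_def)

lemma map_delete_nth: "map f (delete_nth i \<sigma>) = delete_nth i (map f \<sigma>)"
  by (simp add: delete_nth_def take_map drop_map)

lemma length_delete_nth [simp]: "i < length \<sigma> \<Longrightarrow> length (delete_nth i \<sigma>) = length \<sigma> - 1"
  by (simp add: delete_nth_def)

lemma simplex_boundary_eq_sum:
  "simplex_boundary \<sigma> = (\<Sum>i<length \<sigma>. frag_cmul ((-1)^i) (frag_of (delete_nth i \<sigma>)))"
proof (induction \<sigma>)
  case (Cons v \<sigma>)
  then show ?case
    by (simp add: sum.lessThan_Suc_shift prepend_sum sum_negf[symmetric] flip: minus_frag_cmul
       del: sum.lessThan_Suc minus_frag_cmul)
qed simp

text \<open>For a chain z on the standard simplex [k - 1] and cofaces \<open>g i\<close>, this is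
  the value that naturality assigns to the boundary of [k]. A family of chains z_k is compatible
  with faces when the boundary of z_k is this sum for z_(k-1).\<close>

definition coboundary_sum :: "(nat \<Rightarrow> 'v \<Rightarrow> 'v) \<Rightarrow> nat \<Rightarrow> ('v list \<Rightarrow>\<^sub>0 int) \<Rightarrow> ('v list \<Rightarrow>\<^sub>0 int)" where
  "coboundary_sum g k z = (\<Sum>i\<le>k. frag_cmul ((-1)^i) (push (g i) z))"

lemma coboundary_sum_simps [simp]:
  "coboundary_sum g k 0 = 0"
  "coboundary_sum g k (a + b) = coboundary_sum g k a + coboundary_sum g k b"
  "coboundary_sum g k (a - b) = coboundary_sum g k a - coboundary_sum g k b"
proof -
  have cd: "frag_cmul c (x - y) = frag_cmul c x - frag_cmul c y" for c and x y :: "'v list \<Rightarrow>\<^sub>0 int"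
    using frag_cmul_distrib2[of c "x - y" y] by (simp add: algebra_simps)
  show "coboundary_sum g k 0 = 0"
   "coboundary_sum g k (a + b) = coboundary_sum g k a + coboundary_sum g k b"
   "coboundary_sum g k (a - b) = coboundary_sum g k a - coboundary_sum g k b"
   by (simp_all add: coboundary_sum_def frag_cmul_distrib2 cd sum.distrib sum_subtractf)
qed

lemma boundary_coboundary_sum: "boundary (coboundary_sum g k z) = coboundary_sum g k (boundary z)"
  by (simp add: coboundary_sum_def boundary_sum push_boundary)

text \<open>The cosimplicial identity pairs the term (j, i) with i < j against (i, j - 1), which
  carries the opposite sign.\<close>

lemma coboundary_sum_twice:
  assumes "\<And>i j v. i < j \<Longrightarrow> g j (g i v) = g i (g (j - 1) v)"
  shows "coboundary_sum g (Suc k) (coboundary_sum g k z) = 0"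
proof -
  let ?F = "\<lambda>(j, i). frag_cmul ((-1)^(i + j)) (push (g j \<circ> g i) z)"
  let ?A = "{(j, i). j \<le> Suc k \<and> i \<le> k \<and> i < j}" and ?B = "{(j, i). j \<le> Suc k \<and> i \<le> k \<and> j \<le> i}"
  have "coboundary_sum g (Suc k) (coboundary_sum g k z) = (\<Sum>j\<le>Suc k. \<Sum>i\<le>k. ?F (j, i))"
    by (simp add: coboundary_sum_def push_sum push_push frag_cmul_sum power_add mult.commute del: sum.atMost_Suc)
  also have "\<dots> = sum ?F ({..Suc k} \<times> {..k})" by (simp add: sum.cartesian_product del: sum.atMost_Suc)
  also have "{..Suc k} \<times> {..k} = ?A \<union> ?B" by auto
  also have "sum ?F (?A \<union> ?B) = sum ?F ?A + sum ?F ?B"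
    by (rule sum.union_disjoint) (auto intro: finite_subset[of _ "{..Suc k} \<times> {..k}"])
  also have "sum ?F ?A = (\<Sum>p\<in>?B. - ?F p)"
  proof (rule sum.reindex_bij_witness[of _ "\<lambda>(j, i). (Suc i, j)" "\<lambda>(j, i). (i, j - 1)"])
    fix a assume "a \<in> ?A"
    then obtain j i where a: "a = (j, i)" "j \<le> Suc k" "i \<le> k" "i < j" by auto
    then have *: "g j \<circ> g i = g i \<circ> g (j - 1)" using assms[of i j] by auto
    show "- ?F (case a of (j, i) \<Rightarrow> (i, j - 1)) = ?F a"
      using a(4) by (simp add: a(1) * minus_one_power_iff)
  qed auto
  finally show ?thesis by (simp only: sum_negf add.left_inverse)
qed

definition shift :: "nat \<Rightarrow> nat \<Rightarrow> nat" where "shift i v = (if v < i then v else Suc v)"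

lemma shift_shift: "i < j \<Longrightarrow> shift j (shift i v) = shift i (shift (j - 1) v)"
  by (auto simp: shift_def)

lemma delete_nth_upt: "i \<le> Suc k \<Longrightarrow> delete_nth i [0..<Suc (Suc k)] = map (shift i) [0..<Suc k]"
proof -
  assume i: "i \<le> Suc k"
  have "map (shift i) [0..<Suc k] = map (shift i) [0..<i] @ map (shift i) [i..<Suc k]"
    using i by (metis map_append upt_add_eq_append le0 le_add_diff_inverse)
  also have "map (shift i) [0..<i] = [0..<i]" by (rule map_idI) (simp add: shift_def)
  also have "map (shift i) [i..<Suc k] = map Suc [i..<Suc k]" by (rule map_cong) (auto simp: shift_def)
  also have "\<dots> = [Suc i..<Suc (Suc k)]" by (simp only: map_Suc_upt)
  finally show ?thesis using i by (simp add: delete_nth_def take_upt del: upt_Suc)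
qed

text \<open>Deleting vertex i of [k + 1] leaves the image of the i-th coface. The labelling
  \<open>e\<close> only has to commute with cofaces, so the same lemma serves the diagonal of a
  product and an end of a prism.\<close>

lemma boundary_diagonal:
  assumes "\<And>i v. g i (e v) = e (shift i v)"
  shows "boundary (frag_of (map e [0..<Suc (Suc k)])) = coboundary_sum g (Suc k) (frag_of (map e [0..<Suc k]))"
proof -
  have "map (g i) (map e [0..<Suc k]) = map e (delete_nth i [0..<Suc (Suc k)])" if "i \<le> Suc k" for i
    by (simp add: delete_nth_upt[OF that] assms del: upt_Suc)
  then show ?thesis
    by (simp add: simplex_boundary_eq_sum coboundary_sum_def lessThan_Suc_atMost map_delete_nth
        del: upt_Suc sum.atMost_Suc map_map)
qed

section \<open>A diagonal approximation of small width\<close>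

text \<open>The value list of a monotone map [l - 1] -> [j], that is, a possibly degenerate simplex
  of Delta^j; \<open>l\<close> counts vertices and is not the dimension.\<close>

definition monotone_simplex :: "nat \<Rightarrow> nat \<Rightarrow> nat list \<Rightarrow> bool" where
  "monotone_simplex j l as \<longleftrightarrow> length as = l \<and> sorted as \<and> (\<forall>a\<in>set as. a \<le> j)"

definition product_simplex :: "nat \<Rightarrow> nat \<Rightarrow> nat \<Rightarrow> (nat \<Rightarrow> nat) list \<Rightarrow> bool" where
  "product_simplex D j l \<sigma> \<longleftrightarrow> length \<sigma> = l \<and> (\<forall>c<D. monotone_simplex j l (map (\<lambda>v. v c) \<sigma>))"

text \<open>The summand of c is the number of vertices of the face into which coordinate c maps; if
  it is at most n, that coordinate factors through a simplex of dimension below n.\<close>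

definition width :: "nat \<Rightarrow> (nat \<Rightarrow> nat) list \<Rightarrow> nat" where
  "width D \<sigma> = (\<Sum>c<D. card ((\<lambda>v. v c) ` set \<sigma>))"

definition zero_coord :: "nat \<Rightarrow> (nat \<Rightarrow> nat) \<Rightarrow> (nat \<Rightarrow> nat)" where
  "zero_coord c v = v(c := 0)"

definition shift_vertex :: "nat \<Rightarrow> (nat \<Rightarrow> nat) \<Rightarrow> (nat \<Rightarrow> nat)" where
  "shift_vertex i v = (\<lambda>c. shift i (v c))"

text \<open>
  Each coordinate is contracted separately, so that an added vertex enlarges the width by at most 1;
  coning directly at the origin would add a new value in every coordinate.
\<close>

fun contraction :: "nat \<Rightarrow> ((nat \<Rightarrow> nat) list \<Rightarrow>\<^sub>0 int) \<Rightarrow> ((nat \<Rightarrow> nat) list \<Rightarrow>\<^sub>0 int)" where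
  "contraction 0 z = prepend (\<lambda>_. 0) z"
| "contraction (Suc c) z = prism (zero_coord c) z + contraction c (push (zero_coord c) z)"

text \<open>The homotopies telescope: the prism in coordinate c moves z to its image with that
  coordinate set to 0, the smaller coordinates follow in turn, and the last cone at the origin
  contracts what is left.\<close>

lemma boundary_contraction: "boundary (contraction c z) = z - contraction c (boundary z)"
proof (induction c arbitrary: z)
  case (Suc c)
  have "boundary (prism (zero_coord c) z) = z - push (zero_coord c) z - prism (zero_coord c) (boundary z)"
    using boundary_prism[of "zero_coord c" z] by (simp add: algebra_simps)
  then show ?case by (simp add: Suc.IH push_boundary)
qed (simp add: boundary_prepend)

lemma keys_prependD: "\<tau> \<in> Poly_Mapping.keys (prepend v z) \<Longrightarrow> \<exists>\<sigma>\<in>Poly_Mapping.keys z. \<tau> = v # \<sigma>"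
  unfolding prepend_def using keys_frag_extend[of "\<lambda>\<sigma>. frag_of (v # \<sigma>)" z] by auto

lemma keys_pushD: "\<tau> \<in> Poly_Mapping.keys (push g z) \<Longrightarrow> \<exists>\<sigma>\<in>Poly_Mapping.keys z. \<tau> = map g \<sigma>"
  unfolding push_def using keys_frag_extend[of "\<lambda>\<sigma>. frag_of (map g \<sigma>)" z] by auto

lemma keys_simplex_prismD:
  "\<tau> \<in> Poly_Mapping.keys (simplex_prism e \<sigma>) \<Longrightarrow> \<exists>a v b. \<sigma> = a @ v # b \<and> \<tau> = map e a @ e v # v # b"
proof (induction \<sigma> arbitrary: \<tau>)
  case (Cons w \<sigma>)
  from Cons.prems have "\<tau> = e w # w # \<sigma> \<or> \<tau> \<in> Poly_Mapping.keys (prepend (e w) (simplex_prism e \<sigma>))"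
    using keys_diff by fastforce
  then show ?case
  proof
    assume "\<tau> = e w # w # \<sigma>"
    then show ?thesis by (intro exI[of _ "[]"] exI[of _ w] exI[of _ \<sigma>]) simp
  next
    assume "\<tau> \<in> Poly_Mapping.keys (prepend (e w) (simplex_prism e \<sigma>))"
    then obtain \<rho> where "\<rho> \<in> Poly_Mapping.keys (simplex_prism e \<sigma>)" "\<tau> = e w # \<rho>" using keys_prependD by metis
    with Cons.IH obtain a v b where "\<sigma> = a @ v # b" "\<tau> = e w # map e a @ e v # v # b" by metis
    then show ?thesis by (intro exI[of _ "w # a"] exI[of _ v] exI[of _ b]) simp
  qed
qed simp

lemma keys_prismD:
  "\<tau> \<in> Poly_Mapping.keys (prism e z) \<Longrightarrow> \<exists>a v b. a @ v # b \<in> Poly_Mapping.keys z \<and> \<tau> = map e a @ e v # v # b"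
proof -
  assume "\<tau> \<in> Poly_Mapping.keys (prism e z)"
  then obtain \<sigma> where "\<sigma> \<in> Poly_Mapping.keys z" "\<tau> \<in> Poly_Mapping.keys (simplex_prism e \<sigma>)"
    unfolding prism_def using keys_frag_extend[of "simplex_prism e" z] by blast
  then show ?thesis using keys_simplex_prismD[of \<tau> e \<sigma>] by metis
qed

lemma keys_coboundary_sumD:
  "\<tau> \<in> Poly_Mapping.keys (coboundary_sum g k z) \<Longrightarrow> \<exists>i\<le>k. \<exists>\<sigma>\<in>Poly_Mapping.keys z. \<tau> = map (g i) \<sigma>"
proof -
  assume "\<tau> \<in> Poly_Mapping.keys (coboundary_sum g k z)"
  then obtain i where "i \<le> k" "\<tau> \<in> Poly_Mapping.keys (push (g i) z)"
    unfolding coboundary_sum_def using keys_sum[of "\<lambda>i. frag_cmul ((-1)^i) (push (g i) z)" "{..k}"] by auto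
  then show ?thesis using keys_pushD by metis
qed

text \<open>Coordinate c becomes a run of zeros followed by an unchanged tail, which is sorted
  because 0 is the least vertex; the other coordinates merely repeat the entry at v.\<close>

lemma product_simplex_prism:
  assumes "product_simplex D j l (a @ v # b)"
  shows "product_simplex D j (Suc l) (map (zero_coord c) a @ zero_coord c v # v # b)"
proof -
  have "monotone_simplex j (Suc l) (map (\<lambda>v. v c') (map (zero_coord c) a @ zero_coord c v # v # b))"
    if "c' < D" for c'
  proof -
    have *: "length a + length b + 1 = l" "sorted (map (\<lambda>v. v c') (a @ v # b))"
      "\<forall>w\<in>set (a @ v # b). w c' \<le> j"
      using assms that by (auto simp: product_simplex_def monotone_simplex_def)
    have "map (\<lambda>v. v c') (map (zero_coord c) a) = (if c' = c then map (\<lambda>_. 0) a else map (\<lambda>v. v c') a)"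
      by (auto simp: zero_coord_def)
    moreover have "sorted (map (\<lambda>_. 0::nat) a)" by (induction a) auto
    ultimately show ?thesis using *
      by (cases "c' = c") (auto simp: monotone_simplex_def zero_coord_def sorted_append simp del: map_map)
  qed
  then show ?thesis using assms by (auto simp: product_simplex_def)
qed

text \<open>A prism moves one coordinate, and the only value it can add there is 0.\<close>

lemma width_prism: "width D (map (zero_coord c) a @ zero_coord c v # v # b) \<le> Suc (width D (a @ v # b))"
proof -
  let ?\<sigma> = "a @ v # b" and ?\<tau> = "map (zero_coord c) a @ zero_coord c v # v # b"
  have le: "card ((\<lambda>v. v c') ` set ?\<tau>) \<le> card ((\<lambda>v. v c') ` set ?\<sigma>) + (if c' = c then 1 else 0)" for c'
  proof (cases "c' = c")
    case True
    have "card ((\<lambda>v. v c') ` set ?\<tau>) \<le> card (insert 0 ((\<lambda>v. v c') ` set ?\<sigma>))"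
      by (rule card_mono) (auto simp: zero_coord_def True)
    also have "\<dots> \<le> Suc (card ((\<lambda>v. v c') ` set ?\<sigma>))" by (rule card_insert_le_m1) auto
    finally show ?thesis using True by simp
  next
    case False
    then show ?thesis by (auto simp: zero_coord_def intro!: card_mono)
  qed
  have "width D ?\<tau> \<le> (\<Sum>c'<D. card ((\<lambda>v. v c') ` set ?\<sigma>) + (if c' = c then 1 else 0))"
    unfolding width_def by (rule sum_mono) (rule le)
  also have "\<dots> = width D ?\<sigma> + (\<Sum>c'<D. (if c' = c then 1 else 0))"
    by (simp only: width_def sum.distrib)
  also have "\<dots> \<le> Suc (width D ?\<sigma>)" by simp
  finally show ?thesis .
qed

lemma width_zero_coord: "width D (map (zero_coord c) \<sigma>) \<le> width D \<sigma>"
  unfolding width_def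
proof (rule sum_mono)
  fix c' show "card ((\<lambda>v. v c') ` set (map (zero_coord c) \<sigma>)) \<le> card ((\<lambda>v. v c') ` set \<sigma>)"
  proof (cases "c' = c")
    case True
    have "(\<lambda>v. v c') ` set (map (zero_coord c) \<sigma>) = (\<lambda>_. 0) ` ((\<lambda>v. v c') ` set \<sigma>)"
      by (simp add: True zero_coord_def image_image)
    then show ?thesis by (simp only: card_image_le finite_imageI finite_set)
  next
    case False
    then have "(\<lambda>v. v c') ` set (map (zero_coord c) \<sigma>) = (\<lambda>v. v c') ` set \<sigma>"
      by (auto simp: zero_coord_def image_iff)
    then show ?thesis by simp
  qed
qed

lemma product_simplex_zero_coord:
  "product_simplex D j l \<sigma> \<Longrightarrow> product_simplex D j l (map (zero_coord c) \<sigma>)"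
proof -
  assume *: "product_simplex D j l \<sigma>"
  have "monotone_simplex j l (map (\<lambda>v. v c') (map (zero_coord c) \<sigma>))" if "c' < D" for c'
    using * that by (cases "c' = c")
      (auto simp: product_simplex_def monotone_simplex_def zero_coord_def comp_def sorted_map sorted_wrt_true)
  then show ?thesis using * by (auto simp: product_simplex_def)
qed

text \<open>A term of the result arises in one single prism or in the final cone, so the width grows
  once and not once per coordinate. The invariant that the coordinates from c on are already 0 makes
  the final cone free: its apex, the origin, brings no new value, the simplex being
  nonempty.\<close>

lemma keys_contraction:
  assumes "\<And>\<sigma>. \<sigma> \<in> Poly_Mapping.keys z \<Longrightarrow> product_simplex D j l \<sigma> \<and> width D \<sigma> \<le> w \<and> \<sigma> \<noteq> [] \<and>
      (\<forall>v\<in>set \<sigma>. \<forall>c'. c \<le> c' \<and> c' < D \<longrightarrow> v c' = 0)"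
    and "\<tau> \<in> Poly_Mapping.keys (contraction c z)"
  shows "product_simplex D j (Suc l) \<tau> \<and> width D \<tau> \<le> Suc w"
  using assms
proof (induction c arbitrary: z)
  case 0
  then obtain \<sigma> where \<sigma>: "\<sigma> \<in> Poly_Mapping.keys z" "\<tau> = (\<lambda>_. 0) # \<sigma>" using keys_prependD by (metis contraction.simps(1))
  with 0 have *: "product_simplex D j l \<sigma>" "width D \<sigma> \<le> w" "\<sigma> \<noteq> []" "\<And>v c'. v \<in> set \<sigma> \<Longrightarrow> c' < D \<Longrightarrow> v c' = 0"
    by auto
  have "(\<lambda>v. v c') ` set \<tau> = (\<lambda>v. v c') ` set \<sigma>" if "c' < D" for c'
    using *(3,4) that \<sigma>(2) by (cases \<sigma>) auto
  then have "width D \<tau> = width D \<sigma>" unfolding width_def by (intro sum.cong) auto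
  moreover have "product_simplex D j (Suc l) \<tau>"
    using *(1) by (auto simp: product_simplex_def monotone_simplex_def \<sigma>(2))
  ultimately show ?case using *(2) by simp
next
  case (Suc c)
  from Suc.prems(2) consider "\<tau> \<in> Poly_Mapping.keys (prism (zero_coord c) z)" | "\<tau> \<in> Poly_Mapping.keys (contraction c (push (zero_coord c) z))"
    using keys_add[of "prism (zero_coord c) z" "contraction c (push (zero_coord c) z)"] by auto
  then show ?case
  proof cases
    case 1
    then obtain a v b where avb: "a @ v # b \<in> Poly_Mapping.keys z" "\<tau> = map (zero_coord c) a @ zero_coord c v # v # b"
      using keys_prismD by metis
    with Suc.prems(1)[OF avb(1)] product_simplex_prism[of D j l a v b c] width_prism[of D c a v b]
    show ?thesis by simp
  next
    case 2
    show ?thesis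
    proof (rule Suc.IH[OF _ 2])
      fix \<rho> assume "\<rho> \<in> Poly_Mapping.keys (push (zero_coord c) z)"
      then obtain \<sigma> where \<sigma>: "\<sigma> \<in> Poly_Mapping.keys z" "\<rho> = map (zero_coord c) \<sigma>" using keys_pushD by metis
      note * = Suc.prems(1)[OF \<sigma>(1)]
      have "v c' = 0" if v: "v \<in> set \<rho>" and c': "c \<le> c'" "c' < D" for v c'
      proof -
        from v \<sigma>(2) obtain u where "u \<in> set \<sigma>" "v = zero_coord c u" by auto
        with * c' show ?thesis by (cases "c' = c") (auto simp: zero_coord_def)
      qed
      then show "product_simplex D j l \<rho> \<and> width D \<rho> \<le> w \<and> \<rho> \<noteq> [] \<and> (\<forall>v\<in>set \<rho>. \<forall>c'. c \<le> c' \<and> c' < D \<longrightarrow> v c' = 0)"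
        using * width_zero_coord[of D c \<sigma>] product_simplex_zero_coord[of D j l \<sigma> c] \<sigma>(2) by auto
    qed
  qed
qed

lemma shift_mono: "a \<le> b \<Longrightarrow> shift i a \<le> shift i b" by (auto simp: shift_def)

lemma shift_inj: "shift i a = shift i b \<longleftrightarrow> a = b" by (auto simp: shift_def split: if_splits)

lemma sorted_map_shift: "sorted as \<Longrightarrow> sorted (map (shift i) as)"
  by (induction as) (auto simp: shift_mono)

lemma monotone_simplex_shift: "monotone_simplex j l as \<Longrightarrow> monotone_simplex (Suc j) l (map (shift i) as)"
  by (auto simp: monotone_simplex_def sorted_map_shift) (auto simp: shift_def)

lemma product_simplex_shift: "product_simplex D j l \<sigma> \<Longrightarrow> product_simplex D (Suc j) l (map (shift_vertex i) \<sigma>)"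
proof -
  assume *: "product_simplex D j l \<sigma>"
  have "monotone_simplex (Suc j) l (map (\<lambda>v. v c') (map (shift_vertex i) \<sigma>))" if "c' < D" for c'
    using monotone_simplex_shift[of j l "map (\<lambda>v. v c') \<sigma>" i] * that
    by (simp add: product_simplex_def comp_def shift_vertex_def)
  with * show ?thesis by (auto simp: product_simplex_def)
qed

lemma width_shift: "width D (map (shift_vertex i) \<sigma>) = width D \<sigma>"
proof -
  have "(\<lambda>v. v c) ` set (map (shift_vertex i) \<sigma>) = shift i ` ((\<lambda>v. v c) ` set \<sigma>)" for c
    by (auto simp: shift_vertex_def image_iff)
  then have "card ((\<lambda>v. v c) ` set (map (shift_vertex i) \<sigma>)) = card ((\<lambda>v. v c) ` set \<sigma>)" for c
    by (simp only:) (rule card_image, simp add: inj_on_def shift_inj)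
  then show ?thesis by (simp only: width_def)
qed

definition diagonal_simplex :: "nat \<Rightarrow> (nat \<Rightarrow> nat) list" where
  "diagonal_simplex k = map (\<lambda>v c. v) [0..<Suc k]"

text \<open>Acyclic models: naturality prescribes the boundary of the chain in degree k + 1, and
  \<open>contraction\<close> fills it at the cost of one unit of width.\<close>

fun cellular_diagonal :: "nat \<Rightarrow> nat \<Rightarrow> ((nat \<Rightarrow> nat) list \<Rightarrow>\<^sub>0 int)" where
  "cellular_diagonal D 0 = frag_of [\<lambda>_. 0]"
| "cellular_diagonal D (Suc k) = contraction D (coboundary_sum shift_vertex (Suc k) (cellular_diagonal D k))"

text \<open>Acyclic models again, now joining two approximations of the diagonal. No width estimate
  is made here, so the plain cone at the origin serves as filling.\<close>

fun diagonal_homotopy :: "nat \<Rightarrow> nat \<Rightarrow> ((nat \<Rightarrow> nat) list \<Rightarrow>\<^sub>0 int)" where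
  "diagonal_homotopy D 0 = 0"
| "diagonal_homotopy D (Suc k) = prepend (\<lambda>_. 0) (frag_of (diagonal_simplex (Suc k))
     - cellular_diagonal D (Suc k) - coboundary_sum shift_vertex (Suc k) (diagonal_homotopy D k))"

lemma shift_vertex_shift_vertex:
  "i < j \<Longrightarrow> shift_vertex j (shift_vertex i v) = shift_vertex i (shift_vertex (j - 1) v)"
  by (auto simp: shift_vertex_def shift_shift)

lemma coboundary_sum_shift_vertex_twice:
  "coboundary_sum shift_vertex (Suc k) (coboundary_sum shift_vertex k z) = 0"
  by (rule coboundary_sum_twice) (rule shift_vertex_shift_vertex)

lemma contraction_0 [simp]: "contraction c 0 = 0"
  by (induction c) simp_all

lemma boundary_cellular_diagonal:
  "boundary (cellular_diagonal D (Suc k)) = coboundary_sum shift_vertex (Suc k) (cellular_diagonal D k)"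
proof -
  have "boundary (coboundary_sum shift_vertex (Suc k) (cellular_diagonal D k)) = 0"
  proof (induction k)
    case 0
    \<comment> \<open>The two cofaces of a point both have the empty simplex as boundary, with
      opposite signs.\<close>
    show ?case by (simp add: boundary_coboundary_sum) (simp add: coboundary_sum_def)
  next
    case (Suc k)
    have "boundary (cellular_diagonal D (Suc k)) = coboundary_sum shift_vertex (Suc k) (cellular_diagonal D k)"
      by (simp add: boundary_contraction Suc.IH)
    then show ?case
      by (simp add: boundary_coboundary_sum coboundary_sum_shift_vertex_twice
        del: cellular_diagonal.simps)
  qed
  then show ?thesis by (simp add: boundary_contraction)
qed

lemma boundary_diagonal_simplex:
  "boundary (frag_of (diagonal_simplex (Suc k))) = coboundary_sum shift_vertex (Suc k) (frag_of (diagonal_simplex k))"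
  unfolding diagonal_simplex_def by (rule boundary_diagonal) (simp add: shift_vertex_def)

text \<open>The chain that is coned off is a cycle: the two diagonals agree in degree 0, and above
  it the induction hypothesis leaves only a twofold coboundary sum.\<close>

lemma boundary_diagonal_homotopy:
  "boundary (diagonal_homotopy D (Suc k)) = frag_of (diagonal_simplex (Suc k))
     - cellular_diagonal D (Suc k) - coboundary_sum shift_vertex (Suc k) (diagonal_homotopy D k)"
proof -
  have "boundary (frag_of (diagonal_simplex (Suc k))
     - cellular_diagonal D (Suc k) - coboundary_sum shift_vertex (Suc k) (diagonal_homotopy D k)) = 0"
  proof (induction k)
    case 0
    show ?case
      by (simp only: boundary_simps(4) boundary_diagonal_simplex boundary_cellular_diagonal)
        (simp add: diagonal_simplex_def)
  next
    case (Suc k)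
    have "boundary (diagonal_homotopy D (Suc k)) = frag_of (diagonal_simplex (Suc k))
       - cellular_diagonal D (Suc k) - coboundary_sum shift_vertex (Suc k) (diagonal_homotopy D k)"
      using Suc.IH by (simp only: diagonal_homotopy.simps boundary_prepend) simp
    then show ?case
      by (simp only: boundary_simps(4) boundary_diagonal_simplex boundary_cellular_diagonal
        boundary_coboundary_sum coboundary_sum_simps coboundary_sum_shift_vertex_twice)
        simp
  qed
  then show ?thesis by (simp only: diagonal_homotopy.simps boundary_prepend) simp
qed

text \<open>In degree 0 each of the D coordinates has one value. Every further degree costs one
  contraction, hence one more value, while cofaces are injective on values.\<close>

lemma keys_cellular_diagonal:
  "\<sigma> \<in> Poly_Mapping.keys (cellular_diagonal D k) \<Longrightarrow> product_simplex D k (Suc k) \<sigma> \<and> width D \<sigma> \<le> k + D"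
proof (induction k arbitrary: \<sigma>)
  case 0
  then show ?case by (auto simp: product_simplex_def monotone_simplex_def width_def)
next
  case (Suc k)
  have "product_simplex D (Suc k) (Suc (Suc k)) \<sigma> \<and> width D \<sigma> \<le> Suc (k + D)"
  proof (rule keys_contraction)
    show "\<sigma> \<in> Poly_Mapping.keys (contraction D (coboundary_sum shift_vertex (Suc k) (cellular_diagonal D k)))"
      using Suc.prems by simp
    fix \<rho> assume "\<rho> \<in> Poly_Mapping.keys (coboundary_sum shift_vertex (Suc k) (cellular_diagonal D k))"
    then obtain i \<sigma>' where "\<sigma>' \<in> Poly_Mapping.keys (cellular_diagonal D k)" "\<rho> = map (shift_vertex i) \<sigma>'"
      using keys_coboundary_sumD by metis
    with Suc.IH show "product_simplex D (Suc k) (Suc k) \<rho> \<and> width D \<rho> \<le> k + D \<and> \<rho> \<noteq> [] \<and>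
       (\<forall>v\<in>set \<rho>. \<forall>c'. D \<le> c' \<and> c' < D \<longrightarrow> v c' = 0)"
      by (auto simp: product_simplex_shift width_shift) (force simp: product_simplex_def)
  qed
  then show ?case by simp
qed

lemma product_simplex_diagonal: "product_simplex D k (Suc k) (diagonal_simplex k)"
  by (auto simp: product_simplex_def monotone_simplex_def diagonal_simplex_def comp_def sorted_append)

lemma keys_diagonal_homotopy:
  "\<sigma> \<in> Poly_Mapping.keys (diagonal_homotopy D k) \<Longrightarrow> product_simplex D k (Suc (Suc k)) \<sigma>"
proof (induction k arbitrary: \<sigma>)
  case (Suc k)
  let ?q = "frag_of (diagonal_simplex (Suc k)) - cellular_diagonal D (Suc k)
      - coboundary_sum shift_vertex (Suc k) (diagonal_homotopy D k)"
  obtain \<rho> where \<rho>: "\<rho> \<in> Poly_Mapping.keys ?q" "\<sigma> = (\<lambda>_. 0) # \<rho>" using Suc.prems keys_prependD by (metis diagonal_homotopy.simps(2))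
  have "Poly_Mapping.keys ?q \<subseteq> {diagonal_simplex (Suc k)} \<union> Poly_Mapping.keys (cellular_diagonal D (Suc k)) \<union>
      Poly_Mapping.keys (coboundary_sum shift_vertex (Suc k) (diagonal_homotopy D k))"
    by (intro order_trans[OF keys_diff] Un_mono) auto
  with \<rho>(1) consider "\<rho> = diagonal_simplex (Suc k)" | "\<rho> \<in> Poly_Mapping.keys (cellular_diagonal D (Suc k))"
    | "\<rho> \<in> Poly_Mapping.keys (coboundary_sum shift_vertex (Suc k) (diagonal_homotopy D k))" by blast
  then have "product_simplex D (Suc k) (Suc (Suc k)) \<rho>"
  proof cases
    case 1 then show ?thesis by (simp add: product_simplex_diagonal)
  next
    case 2 then show ?thesis using keys_cellular_diagonal by blast
  next
    case 3
    then obtain i \<sigma>' where "\<sigma>' \<in> Poly_Mapping.keys (diagonal_homotopy D k)" "\<rho> = map (shift_vertex i) \<sigma>'"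
      using keys_coboundary_sumD by metis
    with Suc.IH show ?thesis by (auto simp: product_simplex_shift)
  qed
  then show ?case by (auto simp: \<rho>(2) product_simplex_def monotone_simplex_def)
qed simp

section \<open>Simplicial operators\<close>

lemma linear_map_closed: "linear_map R M N f \<Longrightarrow> x \<in> carrier M \<Longrightarrow> f x \<in> carrier N"
  by (auto simp: linear_map_def)

lemma linear_map_add:
  "linear_map R M N f \<Longrightarrow> x \<in> carrier M \<Longrightarrow> y \<in> carrier M \<Longrightarrow> f (x \<oplus>\<^bsub>M\<^esub> y) = f x \<oplus>\<^bsub>N\<^esub> f y"
  by (auto simp: linear_map_def)

lemma linear_map_smult:
  "linear_map R M N f \<Longrightarrow> r \<in> carrier R \<Longrightarrow> x \<in> carrier M \<Longrightarrow> f (r \<odot>\<^bsub>M\<^esub> x) = r \<odot>\<^bsub>N\<^esub> f x"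
  by (auto simp: linear_map_def)

lemma linear_map_zero:
  assumes "module R M" "module R N" "linear_map R M N f"
  shows "f \<zero>\<^bsub>M\<^esub> = \<zero>\<^bsub>N\<^esub>"
proof -
  interpret M: module R M by fact
  interpret N: module R N by fact
  have "f \<zero>\<^bsub>M\<^esub> \<oplus>\<^bsub>N\<^esub> f \<zero>\<^bsub>M\<^esub> = f \<zero>\<^bsub>M\<^esub>"
    using linear_map_add[OF assms(3), of "\<zero>\<^bsub>M\<^esub>" "\<zero>\<^bsub>M\<^esub>"] by simp
  then show ?thesis using linear_map_closed[OF assms(3), of "\<zero>\<^bsub>M\<^esub>"] N.add.l_cancel_one by simp
qed

lemma linear_map_a_inv:
  assumes "module R M" "module R N" "linear_map R M N f" "x \<in> carrier M"
  shows "f (\<ominus>\<^bsub>M\<^esub> x) = \<ominus>\<^bsub>N\<^esub> f x"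
proof -
  interpret M: module R M by fact
  interpret N: module R N by fact
  have "f (\<ominus>\<^bsub>M\<^esub> x) \<oplus>\<^bsub>N\<^esub> f x = \<zero>\<^bsub>N\<^esub>"
    using linear_map_add[OF assms(3), of "\<ominus>\<^bsub>M\<^esub> x" x] assms(4) linear_map_zero[OF assms(1-3)]
    by (simp add: M.l_neg)
  then show ?thesis using linear_map_closed[OF assms(3)] assms(4) N.minus_equality by (metis M.a_inv_closed)
qed

lemma linear_map_diff:
  assumes "module R M" "module R N" "linear_map R M N f" "x \<in> carrier M" "y \<in> carrier M"
  shows "f (x \<ominus>\<^bsub>M\<^esub> y) = f x \<ominus>\<^bsub>N\<^esub> f y"
proof -
  interpret M: module R M by fact
  show ?thesis using linear_map_add[OF assms(3,4), of "\<ominus>\<^bsub>M\<^esub> y"] linear_map_a_inv[OF assms(1-3,5)] assms(5)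
    by (simp add: a_minus_def)
qed

lemma linear_map_comp:
  "linear_map R L M f \<Longrightarrow> linear_map R M N g \<Longrightarrow> linear_map R L N (\<lambda>x. g (f x))"
  by (auto simp: linear_map_def Pi_def)

lemma linear_map_id: "linear_map R M M (\<lambda>x. x)"
  by (auto simp: linear_map_def)

lemma linear_map_zero_fun:
  assumes "module R N" shows "linear_map R M N (\<lambda>x. \<zero>\<^bsub>N\<^esub>)"
proof -
  interpret N: module R N by fact
  show ?thesis by (auto simp: linear_map_def)
qed

lemma linear_map_add_fun:
  assumes "module R M" "module R N" "linear_map R M N f" "linear_map R M N g"
  shows "linear_map R M N (\<lambda>x. f x \<oplus>\<^bsub>N\<^esub> g x)"
proof -
  interpret M: module R M by fact
  interpret N: module R N by fact
  note * = linear_map_closed[OF assms(3)] linear_map_closed[OF assms(4)]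
  show ?thesis unfolding linear_map_def
    using * by (auto simp: linear_map_add[OF assms(3)] linear_map_add[OF assms(4)]
      linear_map_smult[OF assms(3)] linear_map_smult[OF assms(4)] N.a_ac N.smult_r_distr)
qed

lemma linear_map_uminus_fun:
  assumes "module R M" "module R N" "linear_map R M N f"
  shows "linear_map R M N (\<lambda>x. \<ominus>\<^bsub>N\<^esub> f x)"
proof -
  interpret M: module R M by fact
  interpret N: module R N by fact
  note * = linear_map_closed[OF assms(3)]
  show ?thesis unfolding linear_map_def
    using * by (auto simp: linear_map_add[OF assms(3)] linear_map_smult[OF assms(3)] N.minus_add N.smult_r_minus)
qed

lemma linear_map_diff_fun:
  assumes "module R M" "module R N" "linear_map R M N f" "linear_map R M N g"
  shows "linear_map R M N (\<lambda>x. f x \<ominus>\<^bsub>N\<^esub> g x)"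
  unfolding a_minus_def by (intro linear_map_add_fun linear_map_uminus_fun assms)

lemma linear_map_cong:
  assumes "module R M" "\<And>x. x \<in> carrier M \<Longrightarrow> f x = g x" "linear_map R M N f"
  shows "linear_map R M N g"
proof -
  interpret M: module R M by fact
  show ?thesis using assms(2,3) unfolding linear_map_def by (auto simp: Pi_def)
qed

lemma lin_hom_linear_map: "f \<in> lin_hom R M N \<Longrightarrow> linear_map R M N f"
  by (simp add: lin_hom_def)

lemma restrict_lin_hom: "module R M \<Longrightarrow> linear_map R M N f \<Longrightarrow> restrict f (carrier M) \<in> lin_hom R M N"
  unfolding lin_hom_def by (auto intro: linear_map_cong[of R M f])

section \<open>Faces, degeneracies and words in them\<close>

context simplicial_module
begin

lemma face_linear: "i \<le> Suc k \<Longrightarrow> linear_map R (sobj Xs (Suc k)) (sobj Xs k) (face Xs k i)"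
  using face_hom lin_hom_linear_map by blast

lemma degen_linear: "i \<le> k \<Longrightarrow> linear_map R (sobj Xs k) (sobj Xs (Suc k)) (degen Xs k i)"
  using degen_hom lin_hom_linear_map by blast

lemma face_closed [simp]: "i \<le> Suc k \<Longrightarrow> x \<in> carrier (sobj Xs (Suc k)) \<Longrightarrow> face Xs k i x \<in> carrier (sobj Xs k)"
  using face_linear linear_map_closed by metis

lemma degen_closed [simp]: "i \<le> k \<Longrightarrow> x \<in> carrier (sobj Xs k) \<Longrightarrow> degen Xs k i x \<in> carrier (sobj Xs (Suc k))"
  using degen_linear linear_map_closed by metis

end

text \<open>
  A monotone map from \<open>[k]\<close> to \<open>[j]\<close> is coded by the word of a lattice path: \<open>False\<close> passes to the
  next vertex of \<open>[j]\<close> and \<open>True\<close> emits the current one. Read as an operator at position \<open>m\<close>,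
  \<open>True\<close> is the degeneracy $s_m$ followed by a step to position \<open>m + 1\<close>, and \<open>False\<close> is the
  face $d_m$.
\<close>

fun run_word :: "('r, 'a) simplicial_data \<Rightarrow> bool list \<Rightarrow> nat \<Rightarrow> nat \<Rightarrow> 'a \<Rightarrow> 'a" where
  "run_word Xs [] k m x = x"
| "run_word Xs (True # w) k m x = run_word Xs w (Suc k) (Suc m) (degen Xs k m x)"
| "run_word Xs (False # w) k m x = run_word Xs w (k - 1) m (face Xs (k - 1) m x)"

fun path_word :: "nat \<Rightarrow> nat \<Rightarrow> nat list \<Rightarrow> bool list" where
  "path_word j b [] = replicate (Suc j - b) False"
| "path_word j b (a # as) = replicate (a - b) False @ True # path_word j a as"

definition simplicial_op :: "('r, 'a) simplicial_data \<Rightarrow> nat \<Rightarrow> nat list \<Rightarrow> 'a \<Rightarrow> 'a" where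
  "simplicial_op Xs j as = run_word Xs (path_word j 0 as) j 0"

text \<open>The invariant of a run that has arrived at position m in X_k. The remaining
  \<open>False\<close> letters are exactly the faces that delete the vertices m, ..., k; a last
  letter \<open>False\<close> keeps every degeneracy at an index at most k; the third clause says
  that some vertex survives, so that no face is taken on X_0.\<close>

definition admissible :: "bool list \<Rightarrow> nat \<Rightarrow> nat \<Rightarrow> bool" where
  "admissible w k m \<longleftrightarrow> count_list w False + m = Suc k \<and> (w \<noteq> [] \<longrightarrow> \<not> last w) \<and> (0 < m \<or> True \<in> set w)"

lemma count_list_replicate: "count_list (replicate r a) b = (if a = b then r else 0)"
  by (induction r) auto

text \<open>The word ends with \<open>False\<close>, so a \<open>True\<close> is followed by at
  least one step; with the counting clause this gives m \<le> k.\<close>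

lemma admissible_True: "admissible (True # w) k m \<longleftrightarrow> m \<le> k \<and> w \<noteq> [] \<and> admissible w (Suc k) (Suc m)"
proof -
  have "w \<noteq> [] \<Longrightarrow> \<not> last w \<Longrightarrow> 0 < count_list w False"
    using count_list_0_iff[of w False] last_in_set[of w] by (metis (full_types) gr0I)
  then show ?thesis by (auto simp: admissible_def)
qed

lemma admissible_False:
  "admissible (False # w) k m \<Longrightarrow> \<exists>k'. k = Suc k' \<and> m \<le> k \<and> admissible w k' m"
proof -
  assume a: "admissible (False # w) k m"
  then have c: "Suc (count_list w False + m) = Suc k" by (simp add: admissible_def)
  have "k \<noteq> 0"
  proof
    assume "k = 0"
    with c have "count_list w False = 0" "m = 0" by auto
    moreover from this a have "True \<in> set w" by (auto simp: admissible_def)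
    moreover have "\<not> last w" using a \<open>True \<in> set w\<close> by (cases "w = []") (auto simp: admissible_def)
    ultimately show False using count_list_0_iff[of w False] last_in_set[of w] by (metis (full_types) empty_iff list.set(1))
  qed
  then obtain k' where "k = Suc k'" using not0_implies_Suc by blast
  with a c show ?thesis by (auto simp: admissible_def split: if_splits)
qed

lemma path_word_count: "sorted (b # as) \<Longrightarrow> \<forall>a\<in>set (b # as). a \<le> Suc j \<Longrightarrow>
   b + count_list (path_word j b as) False = Suc j"
  by (induction as arbitrary: b) (auto simp: count_list_replicate)

lemma path_word_last: "\<forall>a\<in>set (b # as). a \<le> j \<Longrightarrow> path_word j b as \<noteq> [] \<and> \<not> last (path_word j b as)"
  by (induction as arbitrary: b) auto

lemma path_word_count_True: "count_list (path_word j b as) True = length as"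
  by (induction as arbitrary: b) (auto simp: count_list_replicate)

lemma path_word_admissible:
  assumes "monotone_simplex j (Suc l) as"
  shows "admissible (path_word j 0 as) j 0"
proof -
  have "True \<in> set (path_word j 0 as)"
    using path_word_count_True[of j 0 as] assms count_list_0_iff[of "path_word j 0 as" True]
    by (auto simp: monotone_simplex_def)
  then show ?thesis
    using assms path_word_count[of 0 as j] path_word_last[of 0 as j]
    by (auto simp: admissible_def monotone_simplex_def le_SucI)
qed

context simplicial_module
begin

lemma run_word_linear:
  "admissible w k m \<Longrightarrow> m + count_list w True = Suc l \<Longrightarrow> linear_map R (sobj Xs k) (sobj Xs l) (run_word Xs w k m)"
proof (induction w arbitrary: k m)
  case Nil
  then have "k = l" by (simp add: admissible_def)
  then show ?case by (simp add: linear_map_id)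
next
  case (Cons t w)
  show ?case
  proof (cases t)
    case True
    with Cons.prems have "m \<le> k" "admissible w (Suc k) (Suc m)" by (auto simp: admissible_True)
    with Cons.IH[of "Suc k" "Suc m"] Cons.prems(2) True show ?thesis
      by (auto intro: linear_map_comp degen_linear)
  next
    case False
    with Cons.prems obtain k' where "k = Suc k'" "m \<le> k" "admissible w k' m" using admissible_False[of w k m] by auto
    with Cons.IH[of k' m] Cons.prems(2) False show ?thesis
      by (auto intro: linear_map_comp face_linear)
  qed
qed

text \<open>The added face travels to the front of the word. To pass a degeneracy it needs
  \<open>face_degen_greater\<close>, hence a strictly larger index. The condition on the end of
  \<open>w1\<close> provides it, because every \<open>True\<close> of \<open>w1\<close> is still
  followed by a \<open>False\<close> of \<open>w1\<close>.\<close>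

lemma run_word_insert_False:
  assumes "admissible (w1 @ False # w2) (Suc k) m" "w1 = [] \<or> \<not> last w1" "x \<in> carrier (sobj Xs (Suc k))"
  shows "run_word Xs (w1 @ False # w2) (Suc k) m x
    = run_word Xs (w1 @ w2) k m (face Xs k (m + count_list w1 False) x)"
  using assms
proof (induction w1 arbitrary: k m x)
  case (Cons t w1)
  show ?case
  proof (cases t)
    case True
    with Cons.prems have *: "m \<le> Suc k" "w1 \<noteq> []" "\<not> last w1" "admissible (w1 @ False # w2) (Suc (Suc k)) (Suc m)"
      by (auto simp: admissible_True split: if_splits)
    have pos: "0 < count_list w1 False"
      using *(2,3) count_list_0_iff[of w1 False] last_in_set[of w1] by (metis (full_types) gr0I)
    have le: "m + count_list w1 False \<le> Suc k" using *(4) by (auto simp: admissible_def)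
    have "run_word Xs ((t # w1) @ False # w2) (Suc k) m x
      = run_word Xs (w1 @ w2) (Suc k) (Suc m)
         (face Xs (Suc k) (Suc m + count_list w1 False) (degen Xs (Suc k) m x))"
      using True Cons.IH[OF *(4), of "degen Xs (Suc k) m x"] * Cons.prems(3) by simp
    also have "face Xs (Suc k) (Suc m + count_list w1 False) (degen Xs (Suc k) m x)
       = degen Xs k m (face Xs k (m + count_list w1 False) x)"
      using face_degen_greater[of m "Suc m + count_list w1 False" k x] pos le Cons.prems(3) by simp
    finally show ?thesis using True by simp
  next
    case False
    with Cons.prems(1) obtain k' where k': "k = k'" "m \<le> Suc k" "admissible (w1 @ False # w2) k' m"
      using admissible_False[of "w1 @ False # w2" "Suc k" m] by auto
    then have le: "m + count_list w1 False \<le> k" by (auto simp: admissible_def)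
    \<comment> \<open>The face just read must not land in X_0: there the inserted
      \<open>False\<close> would be the only step left, and no vertex could be emitted.\<close>
    from k'(3) have "k' \<noteq> 0"
    proof -
      have "admissible (w1 @ False # w2) k' m \<Longrightarrow> k' \<noteq> 0"
      proof
        assume a: "admissible (w1 @ False # w2) k' m" "k' = 0"
        then have "count_list w1 False = 0" "count_list w2 False = 0" "m = 0"
          by (auto simp: admissible_def)
        moreover from a(1) this(3) have "True \<in> set w1 \<or> True \<in> set w2" by (auto simp: admissible_def)
        moreover have "True \<notin> set w2"
          using a(1) calculation(2) count_list_0_iff[of w2 False]
          by (cases w2 rule: rev_cases) (auto simp: admissible_def)
        moreover have "True \<notin> set w1"
        proof
          assume "True \<in> set w1"
          then have "w1 \<noteq> []" "\<not> last w1" using Cons.prems(2) False by (cases "w1 = []"; auto)+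
          then show False using count_list_0_iff[of w1 False] calculation(1) last_in_set[of w1] by (metis (full_types))
        qed
        ultimately show False by blast
      qed
      then show ?thesis using k'(3) by blast
    qed
    then obtain k'' where k'': "k = Suc k''" using k'(1) not0_implies_Suc by blast
    have "run_word Xs ((t # w1) @ False # w2) (Suc k) m x
      = run_word Xs (w1 @ w2) k'' m (face Xs k'' (m + count_list w1 False) (face Xs k m x))"
      using False Cons.IH[of k'' m "face Xs k m x"] k' k'' Cons.prems(2,3) by (cases "w1 = []") auto
    also have "face Xs k'' (m + count_list w1 False) (face Xs k m x) =
        face Xs k'' m (face Xs k (Suc (m + count_list w1 False)) x)"
      using face_face[of m "Suc (m + count_list w1 False)" k'' x] le k'' Cons.prems(3) by simp
    finally show ?thesis using False k'' by simp
  qed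
qed simp

text \<open>A face at an index already passed commutes with every remaining letter, since each of
  these acts at a larger index; removing that vertex lowers the position by one.\<close>

lemma face_run_word:
  assumes "admissible w (Suc k) (Suc m)" "i \<le> m" "0 < m \<or> True \<in> set w" "x \<in> carrier (sobj Xs (Suc k))"
    "m + count_list w True = Suc l"
  shows "face Xs l i (run_word Xs w (Suc k) (Suc m) x) = run_word Xs w k m (face Xs k i x)"
  using assms
proof (induction w arbitrary: k m x)
  case Nil
  then show ?case by (simp add: admissible_def)
next
  case (Cons t w)
  show ?case
  proof (cases t)
    case True
    with Cons.prems have *: "m \<le> k" "admissible w (Suc (Suc k)) (Suc (Suc m))" by (auto simp: admissible_True)
    have "face Xs l i (run_word Xs (t # w) (Suc k) (Suc m) x)
      = run_word Xs w (Suc k) (Suc m) (face Xs (Suc k) i (degen Xs (Suc k) (Suc m) x))"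
      using True Cons.IH[OF *(2), of "degen Xs (Suc k) (Suc m) x"] * Cons.prems by simp
    also have "face Xs (Suc k) i (degen Xs (Suc k) (Suc m) x) = degen Xs k m (face Xs k i x)"
      using face_degen_less[of i "Suc m" k x] * Cons.prems by simp
    finally show ?thesis using True by simp
  next
    case False
    with Cons.prems(1) have *: "m \<le> k" "admissible w k (Suc m)"
      using admissible_False[of w "Suc k" "Suc m"] by auto
    have "k \<noteq> 0"
    proof
      assume "k = 0"
      then have "count_list w False = 0" "m = 0" using * by (auto simp: admissible_def)
      moreover have "True \<in> set w" using Cons.prems(3) calculation False by auto
      ultimately show False using *(2) count_list_0_iff[of w False]
        by (cases w rule: rev_cases) (auto simp: admissible_def)
    qed
    then obtain k' where k': "k = Suc k'" using not0_implies_Suc by blast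
    have "face Xs l i (run_word Xs (t # w) (Suc k) (Suc m) x)
       = run_word Xs w k' m (face Xs k' i (face Xs k (Suc m) x))"
      using False k' Cons.IH[of k' m "face Xs k (Suc m) x"] * Cons.prems by auto
    also have "face Xs k' i (face Xs k (Suc m) x) = face Xs k' m (face Xs k i x)"
      using face_face[of i "Suc m" k' x] * Cons.prems k' by simp
    finally show ?thesis using False k' by simp
  qed
qed

end

lemma path_word_shift_Suc: "path_word (Suc j) (Suc b) (map Suc as) = path_word j b as"
  by (induction as arbitrary: b) auto

text \<open>Leaving out the value i costs one extra step on reaching height i. The words agree up to
  that moment, which is \<open>w1\<close>; if \<open>w1\<close> is nonempty, its last letter is a
  step, as \<open>run_word_insert_False\<close> demands.\<close>

lemma path_word_shift:
  assumes "b \<le> i" "i \<le> Suc j" "sorted (b # as)"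
  shows "\<exists>w1 w2. path_word j b as = w1 @ w2 \<and> path_word (Suc j) b (map (shift i) as) = w1 @ False # w2 \<and>
     (w1 = [] \<or> \<not> last w1) \<and> count_list w1 False + b = i"
  using assms
proof (induction as arbitrary: b)
  case Nil
  have *: "replicate (Suc j - b) False = replicate (i - b) False @ replicate (Suc j - i) False"
    "replicate (Suc (Suc j) - b) False = replicate (i - b) False @ False # replicate (Suc j - i) False"
    using Nil by (simp_all flip: replicate_add replicate_Suc)
  show ?case
    by (rule exI[of _ "replicate (i - b) False"], rule exI[of _ "replicate (Suc j - i) False"])
      (use Nil * in \<open>auto simp: count_list_replicate\<close>)
next
  case (Cons a as)
  show ?case
  proof (cases "a < i")
    case True
    with Cons.IH[of a] Cons.prems obtain w1 w2 where w: "path_word j a as = w1 @ w2"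
      "path_word (Suc j) a (map (shift i) as) = w1 @ False # w2" "w1 = [] \<or> \<not> last w1" "count_list w1 False + a = i"
      by auto
    from w(4) True have "w1 \<noteq> []" by auto
    show ?thesis
      by (rule exI[of _ "replicate (a - b) False @ True # w1"], rule exI[of _ w2])
        (use w True Cons.prems \<open>w1 \<noteq> []\<close> in \<open>auto simp: count_list_replicate shift_def[of i a]\<close>)
  next
    case False
    have m: "map (shift i) as = map Suc as" using False Cons.prems by (intro map_cong) (auto simp: shift_def)
    have *: "replicate (a - b) False = replicate (i - b) False @ replicate (a - i) False"
      "replicate (Suc a - b) False = replicate (i - b) False @ False # replicate (a - i) False"
      using False Cons.prems by (simp_all flip: replicate_add replicate_Suc)
    show ?thesis
      by (rule exI[of _ "replicate (i - b) False"], rule exI[of _ "replicate (a - i) False @ True # path_word j a as"])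
        (use False Cons.prems * in \<open>auto simp: count_list_replicate shift_def path_word_shift_Suc
          m[unfolded shift_def]\<close>)
  qed
qed

text \<open>Forgetting entry i drops one \<open>True\<close>, namely the one preceded by i others;
  the steps on its two sides merge into one run.\<close>

lemma path_word_split:
  assumes "i < length as" "sorted (b # as)" "\<forall>a\<in>set as. a \<le> j"
  shows "\<exists>w1 w2. path_word j b as = w1 @ True # w2 \<and> path_word j b (delete_nth i as) = w1 @ w2 \<and>
     count_list w1 True = i"
  using assms
proof (induction as arbitrary: b i)
  case (Cons a as)
  show ?case
  proof (cases i)
    case 0
    have *: "path_word j b as = replicate (a - b) False @ path_word j a as"
    proof (cases as)
      case Nil
      then show ?thesis using Cons.prems by (simp flip: replicate_add)
    next
      case (Cons a' as')
      then show ?thesis using Cons.prems by (simp flip: append_assoc replicate_add)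
    qed
    show ?thesis
      by (rule exI[of _ "replicate (a - b) False"], rule exI[of _ "path_word j a as"])
        (use 0 * in \<open>auto simp: count_list_replicate\<close>)
  next
    case (Suc i')
    with Cons.IH[of i' a] Cons.prems obtain w1 w2 where w: "path_word j a as = w1 @ True # w2"
      "path_word j a (delete_nth i' as) = w1 @ w2" "count_list w1 True = i'" by auto
    show ?thesis
      by (rule exI[of _ "replicate (a - b) False @ True # w1"], rule exI[of _ w2])
        (use w Suc in \<open>auto simp: count_list_replicate\<close>)
  qed
qed simp

lemma monotone_simplex_delete:
  assumes "monotone_simplex j (Suc l) as" "i \<le> l"
  shows "monotone_simplex j l (delete_nth i as)"
proof -
  have "sorted (take i as @ drop (Suc i) as)"
    using assms(1) unfolding monotone_simplex_def
    by (metis Cons_nth_drop_Suc append_take_drop_id assms(2) le_imp_less_Suc sorted_append sorted_simps(2) set_ConsD list.set_intros(2))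
  moreover have "set (delete_nth i as) \<subseteq> set as"
    unfolding delete_nth_def using set_take_subset[of i as] set_drop_subset[of "Suc i" as] by auto
  ultimately show ?thesis using assms by (auto simp: monotone_simplex_def delete_nth_def)
qed

context simplicial_module
begin

lemma simplicial_op_linear:
  "monotone_simplex j (Suc l) as \<Longrightarrow> linear_map R (sobj Xs j) (sobj Xs l) (simplicial_op Xs j as)"
  unfolding simplicial_op_def
  by (rule run_word_linear[OF path_word_admissible]) (auto simp: path_word_count_True monotone_simplex_def)

text \<open>Functoriality along a coface of the target: the monotone map followed by the coface that
  skips i acts as d_i followed by its operator.\<close>

lemma simplicial_op_shift:
  assumes "monotone_simplex j (Suc l) as" "i \<le> Suc j" "x \<in> carrier (sobj Xs (Suc j))"
  shows "simplicial_op Xs (Suc j) (map (shift i) as) x = simplicial_op Xs j as (face Xs j i x)"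
proof -
  obtain w1 w2 where w: "path_word j 0 as = w1 @ w2" "path_word (Suc j) 0 (map (shift i) as) = w1 @ False # w2"
     "w1 = [] \<or> \<not> last w1" "count_list w1 False = i"
    using path_word_shift[of 0 i j as] assms by (auto simp: monotone_simplex_def)
  show ?thesis
    unfolding simplicial_op_def w(1,2)
    using run_word_insert_False[OF _ w(3), of w2 j 0 x] assms(3) w(4)
      path_word_admissible[OF monotone_simplex_shift[OF assms(1)], of i] by (simp add: w(2))
qed

text \<open>\<open>face_run_word\<close> brings the face back to the degeneracy that the extra
  \<open>True\<close> performs, and there d_m s_m = id.\<close>

lemma run_word_append_True:
  assumes "admissible (w1 @ True # w2) k m" "admissible (w1 @ w2) k m" "x \<in> carrier (sobj Xs k)"
    "m + count_list w1 True + count_list w2 True = Suc l"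
  shows "face Xs l (m + count_list w1 True) (run_word Xs (w1 @ True # w2) k m x) = run_word Xs (w1 @ w2) k m x"
  using assms
proof (induction w1 arbitrary: k m x)
  case Nil
  then have *: "m \<le> k" "admissible w2 (Suc k) (Suc m)" by (auto simp: admissible_True)
  have "0 < m \<or> True \<in> set w2" using Nil(2) by (auto simp: admissible_def)
  note * = * this
  have "face Xs l m (run_word Xs w2 (Suc k) (Suc m) (degen Xs k m x))
     = run_word Xs w2 k m (face Xs k m (degen Xs k m x))"
    using * Nil by (intro face_run_word) auto
  then show ?case using * Nil face_degen_same[of m m k x] by simp
next
  case (Cons t w1)
  show ?case
  proof (cases t)
    case True
    with Cons.IH[of "Suc k" "Suc m" "degen Xs k m x"] Cons.prems show ?thesis
      by (auto simp: admissible_True)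
  next
    case False
    with Cons.prems(1,2) obtain k' where k': "k = Suc k'" "m \<le> k" "admissible (w1 @ True # w2) k' m" "admissible (w1 @ w2) k' m"
      using admissible_False[of "w1 @ True # w2" k m] admissible_False[of "w1 @ w2" k m] by auto
    then show ?thesis using Cons.IH[of k' m "face Xs k' m x"] Cons.prems False by auto
  qed
qed

lemma face_simplicial_op:
  assumes "monotone_simplex j (Suc (Suc l)) as" "i \<le> Suc l" "x \<in> carrier (sobj Xs j)"
  shows "face Xs l i (simplicial_op Xs j as x) = simplicial_op Xs j (delete_nth i as) x"
proof -
  have m: "monotone_simplex j (Suc l) (delete_nth i as)"
    using monotone_simplex_delete[OF assms(1,2)] by simp
  obtain w1 w2 where w: "path_word j 0 as = w1 @ True # w2" "path_word j 0 (delete_nth i as) = w1 @ w2"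
     "count_list w1 True = i"
    using path_word_split[of i as 0 j] assms by (auto simp: monotone_simplex_def)
  have "count_list w1 True + count_list w2 True = Suc l"
    using path_word_count_True[of j 0 "delete_nth i as"] m by (simp add: w(2) monotone_simplex_def)
  then show ?thesis
    unfolding simplicial_op_def w(1,2)
    using run_word_append_True[of w1 w2 j 0 x l] w(3) assms(3) path_word_admissible[OF assms(1)] path_word_admissible[OF m]
    by (simp add: w(1,2))
qed

text \<open>The word of the identity alternates \<open>True\<close> and \<open>False\<close>, and
  each pair contributes d_(b+1) s_b = id.\<close>

lemma simplicial_op_id:
  assumes "x \<in> carrier (sobj Xs j)"
  shows "simplicial_op Xs j [0..<Suc j] x = x"
proof -
  have "run_word Xs (path_word j b [b..<Suc j]) j b x = x" if "b \<le> j" for b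
    using that
  proof (induction "j - b" arbitrary: b)
    case 0
    then show ?case using face_degen_same[of "Suc j" j j x] assms by simp
  next
    case (Suc d)
    then have b: "b < j" by simp
    then have "[b..<Suc j] = b # Suc b # [Suc (Suc b)..<Suc j]"
      by (metis Suc_leI Suc_lessI le_imp_less_Suc less_SucI upt_conv_Cons)
    moreover have "[Suc b..<Suc j] = Suc b # [Suc (Suc b)..<Suc j]"
      using b by (metis Suc_less_eq upt_conv_Cons)
    moreover have "run_word Xs (path_word j (Suc b) [Suc b..<Suc j]) j (Suc b) x = x"
      using Suc.hyps(1)[of "Suc b"] Suc.hyps(2) b by simp
    ultimately show ?case
      using face_degen_same[of "Suc b" b j x] b assms by (simp del: upt_Suc)
  qed
  from this[of 0] show ?thesis by (simp only: simplicial_op_def)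
qed

text \<open>A list with at most n values in [j], where j \<ge> n, misses a vertex, so its operator
  starts with a face, and the face can be exchanged with \<open>e\<close>. Descending in this way
  ends in some [j] with j < n, where \<open>e\<close> vanishes.\<close>

lemma simplicial_op_few_vertices:
  assumes e_lin: "\<And>k. linear_map R (sobj Xs k) (sobj Xs k) (e k)"
    and e_face: "\<And>k i x. i \<le> Suc k \<Longrightarrow> x \<in> carrier (sobj Xs (Suc k)) \<Longrightarrow> face Xs k i (e (Suc k) x) = e k (face Xs k i x)"
    and e_zero: "\<And>k x. k < n \<Longrightarrow> x \<in> carrier (sobj Xs k) \<Longrightarrow> e k x = \<zero>\<^bsub>sobj Xs k\<^esub>"
    and "monotone_simplex j (Suc l) as" "card (set as) \<le> n" "x \<in> carrier (sobj Xs j)"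
  shows "simplicial_op Xs j as (e j x) = \<zero>\<^bsub>sobj Xs l\<^esub>"
  using assms(4-6)
proof (induction j arbitrary: as x)
  have *: "simplicial_op Xs j as (e j x) = \<zero>\<^bsub>sobj Xs l\<^esub>"
    if "j < n" "monotone_simplex j (Suc l) as" "x \<in> carrier (sobj Xs j)" for j as x
    using e_zero[OF that(1,3)] linear_map_zero[OF sobj_module sobj_module simplicial_op_linear[OF that(2)]] by simp
  case 0
  then have "as \<noteq> []" by (auto simp: monotone_simplex_def)
  then have "0 < card (set as)" by (simp add: card_gt_0_iff)
  then show ?case using * 0 by simp
next
  case (Suc j)
  show ?case
  proof (cases "Suc j < n")
    case True
    then show ?thesis
      using e_zero[OF _ Suc.prems(3)] linear_map_zero[OF sobj_module sobj_module simplicial_op_linear[OF Suc.prems(1)]] by simp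
  next
    case False
    have "\<exists>v\<le>Suc j. v \<notin> set as"
    proof (rule ccontr)
      assume "\<not> ?thesis"
      then have "{..Suc j} \<subseteq> set as" by auto
      then have "card {..Suc j} \<le> card (set as)" by (intro card_mono) auto
      then show False using False Suc.prems(2) by simp
    qed
    then obtain v where v: "v \<le> Suc j" "v \<notin> set as" by blast
    define bs where "bs = map (\<lambda>a. if a < v then a else a - 1) as"
    have "shift v (if a < v then a else a - 1) = a" if "a \<in> set as" for a
    proof -
      have "a \<noteq> v" using that v(2) by blast
      then show ?thesis by (auto simp: shift_def)
    qed
    then have as: "as = map (shift v) bs"
      unfolding bs_def map_map by (intro map_idI[symmetric]) simp
    have "\<forall>b\<in>set bs. b \<le> j" using Suc.prems(1) v by (force simp: bs_def monotone_simplex_def)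
    moreover have "sorted bs"
    proof -
      have "sorted as" using Suc.prems(1) by (simp add: monotone_simplex_def)
      then show ?thesis unfolding bs_def by (induction as) auto
    qed
    moreover have "length bs = Suc l" using Suc.prems(1) by (simp add: bs_def monotone_simplex_def)
    ultimately have bs: "monotone_simplex j (Suc l) bs" by (simp add: monotone_simplex_def)
    have "card (set bs) \<le> n" using Suc.prems(2) card_image_le[of "set as" "\<lambda>a. if a < v then a else a - 1"]
      by (simp add: bs_def)
    have "simplicial_op Xs (Suc j) as (e (Suc j) x) = simplicial_op Xs j bs (face Xs j v (e (Suc j) x))"
      unfolding as using simplicial_op_shift[OF bs v(1)] linear_map_closed[OF e_lin Suc.prems(3)] by simp
    also have "\<dots> = simplicial_op Xs j bs (e j (face Xs j v x))" using e_face[OF v(1) Suc.prems(3)] by simp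
    also have "\<dots> = \<zero>\<^bsub>sobj Xs l\<^esub>"
      using Suc.IH[OF bs \<open>card (set bs) \<le> n\<close>] v(1) Suc.prems(3) by simp
    finally show ?thesis .
  qed
qed

end

section \<open>Lifting along surjections onto projective modules\<close>

lemma mk_module_simps [simp]:
  "carrier (mk_module A z pl sc) = A" "ring.zero (mk_module A z pl sc) = z"
  "ring.add (mk_module A z pl sc) = pl" "smult (mk_module A z pl sc) = sc"
  by (simp_all add: mk_module_def)

lemma mk_moduleI:
  assumes "cring R"
    and "\<And>x y. x \<in> A \<Longrightarrow> y \<in> A \<Longrightarrow> pl x y \<in> A" "z \<in> A"
    and "\<And>x y w. x \<in> A \<Longrightarrow> y \<in> A \<Longrightarrow> w \<in> A \<Longrightarrow> pl (pl x y) w = pl x (pl y w)"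
    and "\<And>x y. x \<in> A \<Longrightarrow> y \<in> A \<Longrightarrow> pl x y = pl y x"
    and "\<And>x. x \<in> A \<Longrightarrow> pl z x = x" "\<And>x. x \<in> A \<Longrightarrow> \<exists>y\<in>A. pl y x = z"
    and "\<And>r x. r \<in> carrier R \<Longrightarrow> x \<in> A \<Longrightarrow> sc r x \<in> A"
    and "\<And>r t x. r \<in> carrier R \<Longrightarrow> t \<in> carrier R \<Longrightarrow> x \<in> A \<Longrightarrow> sc (r \<oplus>\<^bsub>R\<^esub> t) x = pl (sc r x) (sc t x)"
    and "\<And>r x y. r \<in> carrier R \<Longrightarrow> x \<in> A \<Longrightarrow> y \<in> A \<Longrightarrow> sc r (pl x y) = pl (sc r x) (sc r y)"
    and "\<And>r t x. r \<in> carrier R \<Longrightarrow> t \<in> carrier R \<Longrightarrow> x \<in> A \<Longrightarrow> sc (r \<otimes>\<^bsub>R\<^esub> t) x = sc r (sc t x)"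
    and "\<And>x. x \<in> A \<Longrightarrow> sc \<one>\<^bsub>R\<^esub> x = x"
  shows "module R (mk_module A z pl sc)"
  by (rule moduleI[OF assms(1) abelian_groupI]; simp only: mk_module_simps; rule assms; assumption)

section \<open>Free modules and linear extension from a basis\<close>

context cring
begin

lemma free_module_simps [simp]:
  "\<zero>\<^bsub>free_module R B\<^esub> = (\<lambda>b. \<zero>)"
  "\<phi> \<oplus>\<^bsub>free_module R B\<^esub> \<psi> = (\<lambda>b. \<phi> b \<oplus> \<psi> b)"
  "r \<odot>\<^bsub>free_module R B\<^esub> \<phi> = (\<lambda>b. r \<otimes> \<phi> b)"
  by (simp_all add: free_module_def)

lemma carrier_free_module:
  "\<phi> \<in> carrier (free_module R B) \<longleftrightarrow>
    (\<forall>b\<in>B. \<phi> b \<in> carrier R) \<and> (\<forall>b. b \<notin> B \<longrightarrow> \<phi> b = \<zero>) \<and> finite {b. \<phi> b \<noteq> \<zero>}"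
  by (simp add: free_module_def)

lemma free_module_closed: "\<phi> \<in> carrier (free_module R B) \<Longrightarrow> \<phi> b \<in> carrier R"
  by (cases "b \<in> B") (auto simp: carrier_free_module)

lemma free_module_module: "module R (free_module R B)"
  unfolding free_module_def
proof (rule mk_moduleI[OF is_cring], goal_cases)
  case (1 x y)
  have "{b. x b \<oplus> y b \<noteq> \<zero>} \<subseteq> {b. x b \<noteq> \<zero>} \<union> {b. y b \<noteq> \<zero>}" by auto
  with 1 show ?case by (auto dest: finite_subset)
next
  case 2 then show ?case by simp
next
  case (3 x y w)
  then show ?case by (auto simp: fun_eq_iff) (metis a_assoc zero_closed)
next
  case (4 x y)
  then show ?case by (auto simp: fun_eq_iff) (metis a_comm zero_closed)
next
  case (5 x)
  then show ?case by (auto simp: fun_eq_iff) (metis l_zero zero_closed)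
next
  case (6 x)
  have "{b. \<ominus> x b \<noteq> \<zero>} \<subseteq> {b. x b \<noteq> \<zero>}" by auto
  with 6 have "(\<lambda>b. \<ominus> x b) \<in> {\<phi>. (\<forall>b\<in>B. \<phi> b \<in> carrier R) \<and> (\<forall>b. b \<notin> B \<longrightarrow> \<phi> b = \<zero>) \<and> finite {b. \<phi> b \<noteq> \<zero>}}"
    by (auto dest: finite_subset)
  moreover have "(\<lambda>b. \<ominus> x b \<oplus> x b) = (\<lambda>b. \<zero>)"
    using 6 by (auto simp: fun_eq_iff) (metis l_neg zero_closed)
  ultimately show ?case by (intro bexI[where x = "\<lambda>b. \<ominus> x b"])
next
  case (7 r x)
  then have "{b. r \<otimes> x b \<noteq> \<zero>} \<subseteq> {b. x b \<noteq> \<zero>}" by auto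
  with 7 show ?case by (auto dest: finite_subset)
next
  case (8 r t x)
  then show ?case by (auto simp: fun_eq_iff) (metis l_distr zero_closed)
next
  case (9 r x y)
  then show ?case by (auto simp: fun_eq_iff) (metis r_distr zero_closed)
next
  case (10 r t x)
  then show ?case by (auto simp: fun_eq_iff) (metis m_assoc zero_closed)
next
  case (11 x)
  then show ?case by (auto simp: fun_eq_iff) (metis l_one zero_closed)
qed

lemma free_basis_closed [simp]: "b \<in> B \<Longrightarrow> free_basis R b \<in> carrier (free_module R B)"
proof -
  have "{c. free_basis R b c \<noteq> \<zero>} \<subseteq> {b}" by (auto simp: free_basis_def)
  then show "b \<in> B \<Longrightarrow> ?thesis" by (auto simp: carrier_free_module free_basis_def dest: finite_subset)
qed

lemma free_module_induct [consumes 1, case_names zero add]: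
  assumes "\<phi> \<in> carrier (free_module R B)" "P (\<lambda>b. \<zero>)"
    and "\<And>\<psi> r b. \<psi> \<in> carrier (free_module R B) \<Longrightarrow> b \<in> B \<Longrightarrow> r \<in> carrier R \<Longrightarrow> P \<psi> \<Longrightarrow>
      P (\<psi> \<oplus>\<^bsub>free_module R B\<^esub> (r \<odot>\<^bsub>free_module R B\<^esub> free_basis R b))"
  shows "P \<phi>"
  using assms(1)
proof (induction "card {b. \<phi> b \<noteq> \<zero>}" arbitrary: \<phi>)
  case 0
  then have "\<phi> = (\<lambda>b. \<zero>)" by (auto simp: carrier_free_module)
  then show ?case using assms(2) by simp
next
  case (Suc d)
  then have "{b. \<phi> b \<noteq> \<zero>} \<noteq> {}" by (intro notI) simp
  then obtain b where b: "\<phi> b \<noteq> \<zero>" by blast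
  then have "b \<in> B" using Suc.prems by (auto simp: carrier_free_module)
  let ?\<psi> = "\<phi>(b := \<zero>)"
  have s: "{b. \<phi> b \<noteq> \<zero>} = insert b {c. ?\<psi> c \<noteq> \<zero>}" using b by auto
  have fin: "finite {c. ?\<psi> c \<noteq> \<zero>}" using Suc.prems by (auto simp: carrier_free_module intro: finite_subset[of _ "{b. \<phi> b \<noteq> \<zero>}"])
  then have "d = card {c. ?\<psi> c \<noteq> \<zero>}" using Suc.hyps(2) s by simp
  moreover have \<psi>: "?\<psi> \<in> carrier (free_module R B)" using Suc.prems fin by (auto simp: carrier_free_module)
  ultimately have "P ?\<psi>" using Suc.hyps(1) by blast
  then have "P (?\<psi> \<oplus>\<^bsub>free_module R B\<^esub> (\<phi> b \<odot>\<^bsub>free_module R B\<^esub> free_basis R b))"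
    by (rule assms(3)[OF \<psi> \<open>b \<in> B\<close> free_module_closed[OF Suc.prems]])
  also have "?\<psi> \<oplus>\<^bsub>free_module R B\<^esub> (\<phi> b \<odot>\<^bsub>free_module R B\<^esub> free_basis R b) = \<phi>"
    using free_module_closed[OF Suc.prems] by (auto simp: fun_eq_iff free_basis_def)
  finally show ?case .
qed

lemma free_module_linear_eq:
  assumes "module R N" "linear_map R (free_module R B) N f" "linear_map R (free_module R B) N g"
    and "\<And>b. b \<in> B \<Longrightarrow> f (free_basis R b) = g (free_basis R b)" "\<phi> \<in> carrier (free_module R B)"
  shows "f \<phi> = g \<phi>"
  using assms(5)
proof (induction rule: free_module_induct)
  case zero
  then show ?case
    using linear_map_zero[OF free_module_module assms(1,2)] linear_map_zero[OF free_module_module assms(1,3)] by simp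
next
  case (add \<psi> r b)
  interpret F: module R "free_module R B" by (rule free_module_module)
  show ?case
    using add assms(4) linear_map_add[OF assms(2)] linear_map_add[OF assms(3)] linear_map_smult[OF assms(2)]
      linear_map_smult[OF assms(3)] by (simp del: free_module_simps)
qed

definition free_extend :: "('a, 'c) module \<Rightarrow> ('d \<Rightarrow> 'c) \<Rightarrow> ('d \<Rightarrow> 'a) \<Rightarrow> 'c" where
  "free_extend N p \<phi> = (\<Oplus>\<^bsub>N\<^esub>b\<in>{b. \<phi> b \<noteq> \<zero>}. \<phi> b \<odot>\<^bsub>N\<^esub> p b)"

lemma free_extend_superset:
  assumes "module R N" "p \<in> B \<rightarrow> carrier N" "\<phi> \<in> carrier (free_module R B)"
    and "finite S" "{b. \<phi> b \<noteq> \<zero>} \<subseteq> S" "S \<subseteq> B"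
  shows "free_extend N p \<phi> = (\<Oplus>\<^bsub>N\<^esub>b\<in>S. \<phi> b \<odot>\<^bsub>N\<^esub> p b)"
proof -
  interpret N: module R N by fact
  have "p b \<in> carrier N" if "b \<in> S" for b using assms(2,6) that by auto
  then show ?thesis unfolding free_extend_def
    using assms(4,5) free_module_closed[OF assms(3)]
    by (intro N.add.finprod_mono_neutral_cong_left) auto
qed

lemma free_extend_linear:
  assumes "module R N" "p \<in> B \<rightarrow> carrier N"
  shows "linear_map R (free_module R B) N (free_extend N p)"
proof -
  interpret N: module R N by fact
  interpret F: module R "free_module R B" by (rule free_module_module)
  have supp: "finite {b. \<phi> b \<noteq> \<zero>}" "{b. \<phi> b \<noteq> \<zero>} \<subseteq> B" if "\<phi> \<in> carrier (free_module R B)" for \<phi>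
    using that by (auto simp: carrier_free_module)
  have p: "p b \<in> carrier N" if "b \<in> B" for b using assms(2) that by auto
  show ?thesis
    unfolding linear_map_def
  proof (intro conjI ballI)
    show "free_extend N p \<in> carrier (free_module R B) \<rightarrow> carrier N"
    proof
      fix \<phi> assume *: "\<phi> \<in> carrier (free_module R B)"
      have "p b \<in> carrier N" if "\<phi> b \<noteq> \<zero>" for b using supp(2)[OF *] p that by blast
      then show "free_extend N p \<phi> \<in> carrier N" unfolding free_extend_def
        using free_module_closed[OF *] by (intro N.finsum_closed) auto
    qed
    fix \<phi> \<psi> assume *: "\<phi> \<in> carrier (free_module R B)" "\<psi> \<in> carrier (free_module R B)"
    let ?S = "{b. \<phi> b \<noteq> \<zero>} \<union> {b. \<psi> b \<noteq> \<zero>}"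
    have S: "finite ?S" "?S \<subseteq> B" using supp[OF *(1)] supp[OF *(2)] by auto
    have pS: "p b \<in> carrier N" if "b \<in> ?S" for b using S(2) p that by blast
    have sub: "{b. (\<phi> \<oplus>\<^bsub>free_module R B\<^esub> \<psi>) b \<noteq> \<zero>} \<subseteq> ?S" by auto
    have "free_extend N p (\<phi> \<oplus>\<^bsub>free_module R B\<^esub> \<psi>) = (\<Oplus>\<^bsub>N\<^esub>b\<in>?S. (\<phi> \<oplus>\<^bsub>free_module R B\<^esub> \<psi>) b \<odot>\<^bsub>N\<^esub> p b)"
      by (rule free_extend_superset[OF assms F.a_closed[OF *] S(1) sub S(2)])
    also have "\<dots> = (\<Oplus>\<^bsub>N\<^esub>b\<in>?S. \<phi> b \<odot>\<^bsub>N\<^esub> p b \<oplus>\<^bsub>N\<^esub> \<psi> b \<odot>\<^bsub>N\<^esub> p b)"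
      using pS free_module_closed[OF *(1)] free_module_closed[OF *(2)]
      by (intro N.finsum_cong') (auto simp: N.smult_l_distr)
    also have "\<dots> = (\<Oplus>\<^bsub>N\<^esub>b\<in>?S. \<phi> b \<odot>\<^bsub>N\<^esub> p b) \<oplus>\<^bsub>N\<^esub> (\<Oplus>\<^bsub>N\<^esub>b\<in>?S. \<psi> b \<odot>\<^bsub>N\<^esub> p b)"
      using pS free_module_closed[OF *(1)] free_module_closed[OF *(2)] by (intro N.finsum_addf) auto
    also have "(\<Oplus>\<^bsub>N\<^esub>b\<in>?S. \<phi> b \<odot>\<^bsub>N\<^esub> p b) = free_extend N p \<phi>"
      by (rule free_extend_superset[OF assms *(1) S(1) _ S(2), symmetric]) auto
    also have "(\<Oplus>\<^bsub>N\<^esub>b\<in>?S. \<psi> b \<odot>\<^bsub>N\<^esub> p b) = free_extend N p \<psi>"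
      by (rule free_extend_superset[OF assms *(2) S(1) _ S(2), symmetric]) auto
    finally show "free_extend N p (\<phi> \<oplus>\<^bsub>free_module R B\<^esub> \<psi>) = free_extend N p \<phi> \<oplus>\<^bsub>N\<^esub> free_extend N p \<psi>" .
  next
    fix r \<phi> assume *: "r \<in> carrier R" "\<phi> \<in> carrier (free_module R B)"
    let ?S = "{b. \<phi> b \<noteq> \<zero>}"
    have pS: "p b \<in> carrier N" if "b \<in> ?S" for b using supp(2)[OF *(2)] p that by blast
    have sub: "{b. (r \<odot>\<^bsub>free_module R B\<^esub> \<phi>) b \<noteq> \<zero>} \<subseteq> ?S" using * by auto
    have "free_extend N p (r \<odot>\<^bsub>free_module R B\<^esub> \<phi>) = (\<Oplus>\<^bsub>N\<^esub>b\<in>?S. (r \<odot>\<^bsub>free_module R B\<^esub> \<phi>) b \<odot>\<^bsub>N\<^esub> p b)"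
      by (rule free_extend_superset[OF assms F.smult_closed[OF *] supp(1)[OF *(2)] sub supp(2)[OF *(2)]])
    also have "\<dots> = (\<Oplus>\<^bsub>N\<^esub>b\<in>?S. r \<odot>\<^bsub>N\<^esub> (\<phi> b \<odot>\<^bsub>N\<^esub> p b))"
      using pS free_module_closed[OF *(2)] *(1)
      by (intro N.finsum_cong') (auto simp: N.smult_assoc1)
    also have "\<dots> = r \<odot>\<^bsub>N\<^esub> (\<Oplus>\<^bsub>N\<^esub>b\<in>?S. \<phi> b \<odot>\<^bsub>N\<^esub> p b)"
      using pS free_module_closed[OF *(2)] *(1) supp(1)[OF *(2)]
      by (intro N.finsum_smult_ldistr[symmetric]) auto
    finally show "free_extend N p (r \<odot>\<^bsub>free_module R B\<^esub> \<phi>) = r \<odot>\<^bsub>N\<^esub> free_extend N p \<phi>"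
      by (simp only: free_extend_def)
  qed
qed

lemma free_extend_basis:
  assumes "module R N" "p \<in> B \<rightarrow> carrier N" "b \<in> B"
  shows "free_extend N p (free_basis R b) = p b"
proof -
  interpret N: module R N by fact
  have pb: "p b \<in> carrier N" using assms by auto
  have "{c. free_basis R b c \<noteq> \<zero>} \<subseteq> {b}" by (auto simp: free_basis_def)
  then have "free_extend N p (free_basis R b) = (\<Oplus>\<^bsub>N\<^esub>c\<in>{b}. free_basis R b c \<odot>\<^bsub>N\<^esub> p c)"
    using assms by (intro free_extend_superset[of N p B]) auto
  also have "\<dots> = free_basis R b b \<odot>\<^bsub>N\<^esub> p b"
    using pb by (subst N.finsum_insert) (auto simp: free_basis_def)
  also have "\<dots> = p b" using pb by (auto simp: free_basis_def)
  finally show ?thesis .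
qed

lemma free_map_superset:
  assumes "\<phi> \<in> carrier (free_module R B)" "finite S" "{b. \<phi> b \<noteq> \<zero>} \<subseteq> S"
  shows "free_map R h \<phi> c = (\<Oplus>b\<in>{b\<in>S. h b = c}. \<phi> b)"
  unfolding free_map_def using assms free_module_closed[OF assms(1)]
  by (intro add.finprod_mono_neutral_cong_left) auto

lemma free_map_linear:
  assumes "h \<in> B \<rightarrow> C"
  shows "linear_map R (free_module R B) (free_module R C) (free_map R h)"
proof -
  interpret F: module R "free_module R B" by (rule free_module_module)
  have supp: "finite {b. \<phi> b \<noteq> \<zero>}" "{b. \<phi> b \<noteq> \<zero>} \<subseteq> B" if "\<phi> \<in> carrier (free_module R B)" for \<phi>
    using that by (auto simp: carrier_free_module)
  show ?thesis
    unfolding linear_map_def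
  proof (intro conjI ballI)
    show "free_map R h \<in> carrier (free_module R B) \<rightarrow> carrier (free_module R C)"
    proof
      fix \<phi> assume *: "\<phi> \<in> carrier (free_module R B)"
      have zero: "free_map R h \<phi> c = \<zero>" if "c \<notin> h ` {b. \<phi> b \<noteq> \<zero>}" for c
      proof -
        have "{b. \<phi> b \<noteq> \<zero> \<and> h b = c} = {}" using that by auto
        then show ?thesis by (simp only: free_map_def finsum_empty)
      qed
      have "{c. free_map R h \<phi> c \<noteq> \<zero>} \<subseteq> h ` {b. \<phi> b \<noteq> \<zero>}" using zero by blast
      then have "finite {c. free_map R h \<phi> c \<noteq> \<zero>}" using supp(1)[OF *] finite_subset by blast
      moreover have "free_map R h \<phi> c \<in> carrier R" for c
        unfolding free_map_def using free_module_closed[OF *] by (intro finsum_closed) auto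
      moreover have "free_map R h \<phi> c = \<zero>" if "c \<notin> C" for c
        using zero[of c] supp(2)[OF *] assms that by blast
      ultimately show "free_map R h \<phi> \<in> carrier (free_module R C)" by (auto simp: carrier_free_module)
    qed
    fix \<phi> \<psi> assume *: "\<phi> \<in> carrier (free_module R B)" "\<psi> \<in> carrier (free_module R B)"
    let ?S = "{b. \<phi> b \<noteq> \<zero>} \<union> {b. \<psi> b \<noteq> \<zero>}"
    have S: "finite ?S" using supp[OF *(1)] supp[OF *(2)] by auto
    have sub: "{b. (\<phi> \<oplus>\<^bsub>free_module R B\<^esub> \<psi>) b \<noteq> \<zero>} \<subseteq> ?S" by auto
    show "free_map R h (\<phi> \<oplus>\<^bsub>free_module R B\<^esub> \<psi>) = free_map R h \<phi> \<oplus>\<^bsub>free_module R C\<^esub> free_map R h \<psi>"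
    proof
      fix c
      have "free_map R h (\<phi> \<oplus>\<^bsub>free_module R B\<^esub> \<psi>) c = (\<Oplus>b\<in>{b\<in>?S. h b = c}. (\<phi> \<oplus>\<^bsub>free_module R B\<^esub> \<psi>) b)"
        by (rule free_map_superset[OF F.a_closed[OF *] S sub])
      also have "\<dots> = (\<Oplus>b\<in>{b\<in>?S. h b = c}. \<phi> b) \<oplus> (\<Oplus>b\<in>{b\<in>?S. h b = c}. \<psi> b)"
        using free_module_closed[OF *(1)] free_module_closed[OF *(2)]
        by (simp only: free_module_simps) (intro finsum_addf, auto)
      also have "(\<Oplus>b\<in>{b\<in>?S. h b = c}. \<phi> b) = free_map R h \<phi> c"
        by (rule free_map_superset[OF *(1) S, symmetric]) auto
      also have "(\<Oplus>b\<in>{b\<in>?S. h b = c}. \<psi> b) = free_map R h \<psi> c"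
        by (rule free_map_superset[OF *(2) S, symmetric]) auto
      finally show "free_map R h (\<phi> \<oplus>\<^bsub>free_module R B\<^esub> \<psi>) c =
          (free_map R h \<phi> \<oplus>\<^bsub>free_module R C\<^esub> free_map R h \<psi>) c" by simp
    qed
  next
    fix r \<phi> assume *: "r \<in> carrier R" "\<phi> \<in> carrier (free_module R B)"
    let ?S = "{b. \<phi> b \<noteq> \<zero>}"
    have sub: "{b. (r \<odot>\<^bsub>free_module R B\<^esub> \<phi>) b \<noteq> \<zero>} \<subseteq> ?S" using * by auto
    show "free_map R h (r \<odot>\<^bsub>free_module R B\<^esub> \<phi>) = r \<odot>\<^bsub>free_module R C\<^esub> free_map R h \<phi>"
    proof
      fix c
      have "free_map R h (r \<odot>\<^bsub>free_module R B\<^esub> \<phi>) c = (\<Oplus>b\<in>{b\<in>?S. h b = c}. (r \<odot>\<^bsub>free_module R B\<^esub> \<phi>) b)"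
        by (rule free_map_superset[OF F.smult_closed[OF *] supp(1)[OF *(2)] sub])
      also have "\<dots> = r \<otimes> (\<Oplus>b\<in>{b\<in>?S. h b = c}. \<phi> b)"
        using free_module_closed[OF *(2)] *(1) supp(1)[OF *(2)]
        by (simp only: free_module_simps) (intro finsum_rdistr[symmetric], auto)
      also have "(\<Oplus>b\<in>{b\<in>?S. h b = c}. \<phi> b) = free_map R h \<phi> c"
        by (rule free_map_superset[OF *(2) supp(1)[OF *(2)], symmetric]) auto
      finally show "free_map R h (r \<odot>\<^bsub>free_module R B\<^esub> \<phi>) c =
          (r \<odot>\<^bsub>free_module R C\<^esub> free_map R h \<phi>) c" by simp
    qed
  qed
qed

lemma free_map_basis: "free_map R h (free_basis R b) = free_basis R (h b)"
proof
  fix c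
  have "free_basis R b \<in> carrier (free_module R {b})" by simp
  then have "free_map R h (free_basis R b) c = (\<Oplus>b'\<in>{b'\<in>{b}. h b' = c}. free_basis R b b')"
    by (rule free_map_superset) (auto simp: free_basis_def)
  also have "{b'\<in>{b}. h b' = c} = (if h b = c then {b} else {})" by auto
  also have "(\<Oplus>b'\<in>(if h b = c then {b} else {}). free_basis R b b') = free_basis R (h b) c"
    by (auto simp: free_basis_def)
  finally show "free_map R h (free_basis R b) c = free_basis R (h b) c" .
qed

text \<open>The definition of \<open>projective\<close> tests only modules on two fixed types. It
  does split the free module on the carrier of M over M, and this section is enough: choose
  preimages of the values of h on the basis, extend linearly, and compose with the section. An
  inclusion of images takes the place of surjectivity of q.\<close>

lemma projective_lift:
  assumes "module R M" "projective R M" "module R P" "module R N"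
    and "linear_map R P N q" "linear_map R M N h" "h ` carrier M \<subseteq> q ` carrier P"
  shows "\<exists>k\<in>lin_hom R M P. \<forall>x\<in>carrier M. q (k x) = h x"
proof -
  interpret M: module R M by fact
  let ?F = "free_module R (carrier M)"
  interpret F: module R ?F by (rule free_module_module)
  let ?g = "restrict (free_extend M (\<lambda>b. b)) (carrier ?F)"
  have g: "linear_map R ?F M (free_extend M (\<lambda>b. b))" by (rule free_extend_linear[OF assms(1)]) simp
  have g_basis: "free_extend M (\<lambda>b. b) (free_basis R x) = x" if "x \<in> carrier M" for x
    using free_extend_basis[OF assms(1), of "\<lambda>b. b" "carrier M" x] that by simp
  have "?g ` carrier ?F = carrier M"
  proof
    show "?g ` carrier ?F \<subseteq> carrier M" using linear_map_closed[OF g] by auto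
    show "carrier M \<subseteq> ?g ` carrier ?F"
    proof
      fix x assume "x \<in> carrier M"
      then show "x \<in> ?g ` carrier ?F"
        using g_basis[of x] free_basis_closed[of x "carrier M"] by (intro image_eqI[of _ _ "free_basis R x"]) auto
    qed
  qed
  moreover have "(\<lambda>x\<in>carrier M. x) \<in> lin_hom R M M"
    by (rule restrict_lin_hom[OF assms(1) linear_map_id])
  ultimately obtain k where k: "k \<in> lin_hom R M ?F" "\<And>x. x \<in> carrier M \<Longrightarrow> ?g (k x) = (\<lambda>x\<in>carrier M. x) x"
    using assms(1,2) free_module_module[of "carrier M"] restrict_lin_hom[OF free_module_module g]
    unfolding projective_def by blast
  have k_closed: "k x \<in> carrier ?F" if "x \<in> carrier M" for x
    using linear_map_closed[OF lin_hom_linear_map[OF k(1)] that] .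
  define p where "p x = (SOME y. y \<in> carrier P \<and> q y = h x)" for x
  have p: "p x \<in> carrier P \<and> q (p x) = h x" if "x \<in> carrier M" for x
  proof -
    have "h x \<in> q ` carrier P" using assms(7) that by blast
    then have "\<exists>y. y \<in> carrier P \<and> q y = h x" by auto
    then show ?thesis unfolding p_def by (rule someI_ex)
  qed
  have pP: "p \<in> carrier M \<rightarrow> carrier P" using p by auto
  have lift: "q (free_extend P p \<phi>) = h (free_extend M (\<lambda>b. b) \<phi>)" if "\<phi> \<in> carrier ?F" for \<phi>
  proof (rule free_module_linear_eq[OF assms(4) _ _ _ that])
    show "linear_map R ?F N (\<lambda>\<phi>. q (free_extend P p \<phi>))"
      by (rule linear_map_comp[OF free_extend_linear[OF assms(3) pP] assms(5)])
    show "linear_map R ?F N (\<lambda>\<phi>. h (free_extend M (\<lambda>b. b) \<phi>))" by (rule linear_map_comp[OF g assms(6)])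
    show "q (free_extend P p (free_basis R b)) = h (free_extend M (\<lambda>b. b) (free_basis R b))"
      if "b \<in> carrier M" for b
      using free_extend_basis[OF assms(3) pP that] g_basis[OF that] p[OF that] by simp
  qed
  show ?thesis
  proof (rule bexI)
    show "restrict (\<lambda>x. free_extend P p (k x)) (carrier M) \<in> lin_hom R M P"
      by (rule restrict_lin_hom[OF assms(1) linear_map_comp[OF lin_hom_linear_map[OF k(1)] free_extend_linear[OF assms(3) pP]]])
    show "\<forall>x\<in>carrier M. q (restrict (\<lambda>x. free_extend P p (k x)) (carrier M) x) = h x"
      using lift k_closed k(2) by auto
  qed
qed

end

section \<open>The cone of a connected simplicial module\<close>

lemma quot_module_trivialD:
  assumes "trivial_module (quot_module M H)" "module R M" "\<zero>\<^bsub>M\<^esub> \<in> H" "x \<in> carrier M"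
  shows "x \<in> H"
proof -
  interpret M: module R M by fact
  have "H +>\<^bsub>M\<^esub> x \<in> a_rcosets\<^bsub>M\<^esub> H" using assms(4) by (auto simp: A_RCOSETS_def' a_r_coset_def')
  then have "H +>\<^bsub>M\<^esub> x = H" using assms(1) by (simp add: trivial_module_def quot_module_def)
  moreover have "\<zero>\<^bsub>M\<^esub> \<oplus>\<^bsub>M\<^esub> x \<in> H +>\<^bsub>M\<^esub> x" using assms(3) by (auto simp: a_r_coset_def')
  ultimately show ?thesis using assms(4) by simp
qed

context simplicial_module
begin

definition moore_chains :: "nat \<Rightarrow> 'a set" where
  "moore_chains j = {x \<in> carrier (sobj Xs j).
     \<forall>k. j = Suc k \<longrightarrow> (\<forall>i\<in>{1..Suc k}. face Xs k i x = \<zero>\<^bsub>sobj Xs k\<^esub>)}"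

lemma moore_chains_submodule: "submodule (moore_chains j) R (sobj Xs j)"
proof -
  interpret X: module R "sobj Xs j" by (rule sobj_module)
  show ?thesis
  proof (cases j)
    case 0
    then have "moore_chains j = carrier (sobj Xs j)" by (auto simp: moore_chains_def)
    then show ?thesis by (simp add: X.carrier_is_submodule)
  next
    case (Suc k)
    interpret Y: module R "sobj Xs k" by (rule sobj_module)
    have lin: "linear_map R (sobj Xs j) (sobj Xs k) (face Xs k i)" if "i \<in> {1..Suc k}" for i
      using face_linear[of i k] that Suc by simp
    have eq: "moore_chains j = {x \<in> carrier (sobj Xs j). \<forall>i\<in>{1..Suc k}. face Xs k i x = \<zero>\<^bsub>sobj Xs k\<^esub>}"
      by (simp add: moore_chains_def Suc)
    show ?thesis unfolding eq
    proof (rule X.submoduleI, goal_cases)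
      case 1 then show ?case by auto
    next
      case 2 then show ?case using linear_map_zero[OF sobj_module sobj_module lin] by simp
    next
      case (3 a) then show ?case using linear_map_a_inv[OF sobj_module sobj_module lin] by simp
    next
      case (4 a b) then show ?case using linear_map_add[OF lin] by simp
    next
      case (5 a x) then show ?case using linear_map_smult[OF lin] by simp
    qed
  qed
qed

lemma moore_chains_module: "module R ((sobj Xs j)\<lparr>carrier := moore_chains j\<rparr>)"
  using submodule.submodule_is_module[OF moore_chains_submodule sobj_module] .

text \<open>Moore's proof that simplicial groups are Kan, for the horn without its 0-th face and
  with a linear parameter in M. Faces are corrected from the top downwards: the defect u at face r
  is removed by adding s_(r-1) u, and compatibility gives d_(l-1) u = 0 for l > r, so the faces
  above stay right.\<close>

lemma horn_filler:
  assumes "module R M" and y: "\<And>i. i \<in> {1..Suc k} \<Longrightarrow> linear_map R M (sobj Xs k) (y i)"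
    and compat: "\<And>i l k' x. k = Suc k' \<Longrightarrow> 1 \<le> i \<Longrightarrow> i < l \<Longrightarrow> l \<le> Suc k \<Longrightarrow> x \<in> carrier M \<Longrightarrow>
       face Xs k' i (y l x) = face Xs k' (l - 1) (y i x)"
  shows "\<exists>z. linear_map R M (sobj Xs (Suc k)) z \<and> (\<forall>i\<in>{1..Suc k}. \<forall>x\<in>carrier M. face Xs k i (z x) = y i x)"
proof -
  interpret X: module R "sobj Xs k" by (rule sobj_module)
  interpret X': module R "sobj Xs (Suc k)" by (rule sobj_module)
  have "\<exists>z. linear_map R M (sobj Xs (Suc k)) z \<and>
      (\<forall>i\<in>{Suc (Suc k) - t..Suc k}. \<forall>x\<in>carrier M. face Xs k i (z x) = y i x)" if "t \<le> Suc k" for t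
    using that
  proof (induction t)
    case 0
    then show ?case using linear_map_zero_fun[OF sobj_module[of "Suc k"], of M] by auto
  next
    case (Suc t)
    then obtain w where w: "linear_map R M (sobj Xs (Suc k)) w"
      "\<And>i x. i \<in> {Suc (Suc k) - t..Suc k} \<Longrightarrow> x \<in> carrier M \<Longrightarrow> face Xs k i (w x) = y i x" by auto
    define r where "r = Suc k - t"
    have r: "1 \<le> r" "r \<le> Suc k" "Suc (Suc k) - t = Suc r" "Suc (Suc k) - Suc t = r" using Suc.prems by (auto simp: r_def)
    let ?u = "\<lambda>x. y r x \<ominus>\<^bsub>sobj Xs k\<^esub> face Xs k r (w x)"
    let ?z = "\<lambda>x. w x \<oplus>\<^bsub>sobj Xs (Suc k)\<^esub> degen Xs k (r - 1) (?u x)"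
    have u: "linear_map R M (sobj Xs k) ?u"
      using r y by (intro linear_map_diff_fun[OF assms(1) sobj_module] linear_map_comp[OF w(1)] face_linear) auto
    have d: "linear_map R M (sobj Xs (Suc k)) (\<lambda>x. degen Xs k (r - 1) (?u x))"
      using r by (intro linear_map_comp[OF u] degen_linear) auto
    have z: "linear_map R M (sobj Xs (Suc k)) ?z"
      by (rule linear_map_add_fun[OF assms(1) sobj_module w(1) d])
    have "face Xs k l (?z x) = y l x" if l: "l \<in> {r..Suc k}" and x: "x \<in> carrier M" for l x
    proof -
      note cl = linear_map_closed[OF w(1) x] linear_map_closed[OF u x] linear_map_closed[OF d x]
      have yl: "y l x \<in> carrier (sobj Xs k)" using linear_map_closed[OF y x] l r by auto
      have split: "face Xs k l (?z x) = face Xs k l (w x) \<oplus>\<^bsub>sobj Xs k\<^esub> face Xs k l (degen Xs k (r - 1) (?u x))"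
        using linear_map_add[OF face_linear cl(1,3)] l by simp
      show ?thesis
      proof (cases "l = r")
        case True
        have "face Xs k r (degen Xs k (r - 1) (?u x)) = ?u x"
          using face_degen_same[of r "r - 1" k "?u x"] cl(2) r by simp
        then show ?thesis using split True cl yl r by (simp add: a_minus_def X.a_ac X.r_neg)
      next
        case False
        then obtain k' where k': "k = Suc k'" using l r by (cases k) auto
        have 1: "face Xs k l (degen Xs k (r - 1) (?u x)) = degen Xs k' (r - 1) (face Xs k' (l - 1) (?u x))"
          using face_degen_greater[of "r - 1" l k' "?u x"] False l r cl(2) k' by simp
        have "face Xs k' (l - 1) (?u x) = face Xs k' (l - 1) (y r x) \<ominus>\<^bsub>sobj Xs k'\<^esub> face Xs k' (l - 1) (face Xs k r (w x))"
          using linear_map_diff[OF sobj_module sobj_module face_linear, of "l - 1" k' "y r x" "face Xs k r (w x)"]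
            linear_map_closed[OF y x, of r] cl l r k' by auto
        also have "face Xs k' (l - 1) (y r x) = face Xs k' r (y l x)"
          using compat[OF k' r(1) _ _ x, of l] False l by simp
        also have "face Xs k' (l - 1) (face Xs k r (w x)) = face Xs k' r (face Xs k l (w x))"
          using face_face[of r l k' "w x"] cl k' False l by simp
        also have "face Xs k l (w x) = y l x" using w(2)[OF _ x] False l r by simp
        finally have "face Xs k' (l - 1) (?u x) = \<zero>\<^bsub>sobj Xs k'\<^esub>"
        proof -
          assume *: "face Xs k' (l - 1) (?u x) = face Xs k' r (y l x) \<ominus>\<^bsub>sobj Xs k'\<^esub> face Xs k' r (y l x)"
          interpret X'': module R "sobj Xs k'" by (rule sobj_module)
          have "face Xs k' r (y l x) \<in> carrier (sobj Xs k')" using yl k' l r False by simp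
          then show ?thesis unfolding * by (simp add: a_minus_def X''.r_neg)
        qed
        then have "face Xs k l (degen Xs k (r - 1) (?u x)) = \<zero>\<^bsub>sobj Xs k\<^esub>"
          unfolding 1 using linear_map_zero[OF sobj_module sobj_module degen_linear[of "r - 1" k']] k' r l False by auto
        then show ?thesis using split w(2)[OF _ x, of l] False l r yl by simp
      qed
    qed
    then show ?case unfolding r(4) using z by blast
  qed
  from this[of "Suc k"] show ?thesis by simp
qed

end

locale connected_simplicial_module = simplicial_module R Xs
  for R :: "('r, 'x) ring_scheme" and Xs :: "('r, 'a) simplicial_data" +
  fixes n :: nat
  assumes sobj_projective: "projective R (sobj Xs j)"
    and connected: "i < n \<Longrightarrow> trivial_module (homotopy_group Xs i)"
begin

sublocale R: cring R
  using sobj_module[of 0] by (simp add: module_def)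

lemma sphere_filler:
  assumes "k < n" "x \<in> carrier (sobj Xs k)"
    and "\<And>k' i. k = Suc k' \<Longrightarrow> i \<le> k \<Longrightarrow> face Xs k' i x = \<zero>\<^bsub>sobj Xs k'\<^esub>"
  shows "x \<in> face Xs k 0 ` moore_chains (Suc k)"
proof -
  let ?N = "normalized_chains Xs"
  have cobj: "cobj ?N j = (sobj Xs j)\<lparr>carrier := moore_chains j\<rparr>" for j
    by (simp add: normalized_chains_def moore_chains_def)
  have all_le: "(\<forall>i\<le>Suc m. Q i) \<longleftrightarrow> Q 0 \<and> (\<forall>i\<in>{1..Suc m}. Q i)" for m and Q :: "nat \<Rightarrow> bool"
  proof -
    have "{..Suc m} = insert 0 {1..Suc m}" by auto
    then show ?thesis by (metis (no_types, lifting) atMost_iff insert_iff)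
  qed
  have cyc: "cycles ?N k = {x \<in> carrier (sobj Xs k). \<forall>k'. k = Suc k' \<longrightarrow> (\<forall>i\<le>k. face Xs k' i x = \<zero>\<^bsub>sobj Xs k'\<^esub>)}"
    unfolding cycles_def cobj
    by (auto simp: normalized_chains_def moore_chains_def all_le)
  have sub: "submodule (cycles ?N k) R (sobj Xs k)"
  proof -
    interpret X: module R "sobj Xs k" by (rule sobj_module)
    show ?thesis
    proof (cases k)
      case 0
      then have "cycles ?N k = carrier (sobj Xs k)" using cyc by auto
      then show ?thesis by (simp add: X.carrier_is_submodule)
    next
      case (Suc k')
      interpret Y: module R "sobj Xs k'" by (rule sobj_module)
      have lin: "linear_map R (sobj Xs k) (sobj Xs k') (face Xs k' i)" if "i \<le> k" for i
        using face_linear[of i k'] that Suc by simp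
      have eq: "cycles ?N k = {x \<in> carrier (sobj Xs k). \<forall>i\<le>k. face Xs k' i x = \<zero>\<^bsub>sobj Xs k'\<^esub>}"
        using cyc Suc by auto
      show ?thesis unfolding eq
      proof (rule X.submoduleI, goal_cases)
        case 1 then show ?case by auto
      next
        case 2 then show ?case using linear_map_zero[OF sobj_module sobj_module lin] by simp
      next
        case (3 a) then show ?case using linear_map_a_inv[OF sobj_module sobj_module lin] by simp
      next
        case (4 a b) then show ?case using linear_map_add[OF lin] by simp
      next
        case (5 a x) then show ?case using linear_map_smult[OF lin] by simp
      qed
    qed
  qed
  have mod: "module R ((cobj ?N k)\<lparr>carrier := cycles ?N k\<rparr>)"
    using submodule.submodule_is_module[OF sub sobj_module] by (simp add: cobj)
  have bd: "boundaries ?N k = face Xs k 0 ` moore_chains (Suc k)"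
    by (simp add: boundaries_def cobj) (simp add: normalized_chains_def)
  have "\<zero>\<^bsub>sobj Xs (Suc k)\<^esub> \<in> moore_chains (Suc k)"
    using moore_chains_submodule module.submoduleE(2)[OF sobj_module moore_chains_submodule]
    by (metis submodule.axioms(1) subgroup.one_closed monoid.simps(2) )
  then have "\<zero>\<^bsub>sobj Xs k\<^esub> \<in> boundaries ?N k"
    unfolding bd using linear_map_zero[OF sobj_module sobj_module face_linear[of 0 k]] by (metis image_eqI le0)
  moreover have "x \<in> cycles ?N k" using assms(2,3) by (auto simp: cyc)
  ultimately have "x \<in> boundaries ?N k"
    using quot_module_trivialD[OF connected[OF assms(1), unfolded homotopy_group_def homology_def] mod]
    by (simp add: cobj)
  then show ?thesis by (simp add: bd)
qed

text \<open>A horn filler z has all prescribed faces but possibly the wrong 0-th one. By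
  \<open>base\<close> all faces of x - d_0 z(x) vanish, so for k < n it is d_0 of a Moore chain, and
  projectivity of X_k makes that chain linear in x. Adding it corrects d_0 and touches no other
  face.\<close>

lemma cone_step:
  assumes y: "\<And>i. i \<in> {1..Suc k} \<Longrightarrow> linear_map R (sobj Xs k) (sobj Xs k) (y i)"
    and compat: "\<And>i l k' x. k = Suc k' \<Longrightarrow> 1 \<le> i \<Longrightarrow> i < l \<Longrightarrow> l \<le> Suc k \<Longrightarrow> x \<in> carrier (sobj Xs k) \<Longrightarrow>
       face Xs k' i (y l x) = face Xs k' (l - 1) (y i x)"
    and base: "\<And>i k' x. k = Suc k' \<Longrightarrow> k < n \<Longrightarrow> i \<le> k \<Longrightarrow> x \<in> carrier (sobj Xs k) \<Longrightarrow>
       face Xs k' 0 (y (Suc i) x) = face Xs k' i x"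
  shows "\<exists>c. linear_map R (sobj Xs k) (sobj Xs (Suc k)) c \<and>
     (\<forall>i\<in>{1..Suc k}. \<forall>x\<in>carrier (sobj Xs k). face Xs k i (c x) = y i x) \<and>
     (k < n \<longrightarrow> (\<forall>x\<in>carrier (sobj Xs k). face Xs k 0 (c x) = x))"
proof -
  interpret X: module R "sobj Xs k" by (rule sobj_module)
  interpret X': module R "sobj Xs (Suc k)" by (rule sobj_module)
  obtain z where z: "linear_map R (sobj Xs k) (sobj Xs (Suc k)) z"
    "\<And>i x. i \<in> {1..Suc k} \<Longrightarrow> x \<in> carrier (sobj Xs k) \<Longrightarrow> face Xs k i (z x) = y i x"
    using horn_filler[OF sobj_module y compat] by blast
  show ?thesis
  proof (cases "k < n")
    case False
    then show ?thesis using z by blast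
  next
    case True
    let ?h = "\<lambda>x. x \<ominus>\<^bsub>sobj Xs k\<^esub> face Xs k 0 (z x)"
    have h: "linear_map R (sobj Xs k) (sobj Xs k) ?h"
      by (intro linear_map_diff_fun sobj_module linear_map_id linear_map_comp[OF z(1)] face_linear) simp
    have im: "?h ` carrier (sobj Xs k) \<subseteq> face Xs k 0 ` moore_chains (Suc k)"
    proof (rule image_subsetI, rule sphere_filler[OF True])
      fix x assume x: "x \<in> carrier (sobj Xs k)"
      show "?h x \<in> carrier (sobj Xs k)" using linear_map_closed[OF h x] .
      fix k' i assume k': "k = Suc k'" and i: "i \<le> k"
      interpret X'': module R "sobj Xs k'" by (rule sobj_module)
      have zx: "z x \<in> carrier (sobj Xs (Suc k))" using linear_map_closed[OF z(1) x] .
      have "face Xs k' i (?h x) = face Xs k' i x \<ominus>\<^bsub>sobj Xs k'\<^esub> face Xs k' i (face Xs k 0 (z x))"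
        using linear_map_diff[OF sobj_module sobj_module face_linear, of i k' x "face Xs k 0 (z x)"] x zx k' i by simp
      also have "face Xs k' i (face Xs k 0 (z x)) = face Xs k' 0 (face Xs k (Suc i) (z x))"
        using face_face[of 0 "Suc i" k' "z x"] zx k' i by simp
      also have "\<dots> = face Xs k' i x" using z(2)[OF _ x, of "Suc i"] base[OF k' True i x] i by simp
      finally show "face Xs k' i (?h x) = \<zero>\<^bsub>sobj Xs k'\<^esub>"
        using x i k' by (simp add: a_minus_def X''.r_neg)
    qed
    let ?P = "(sobj Xs (Suc k))\<lparr>carrier := moore_chains (Suc k)\<rparr>"
    have sub: "moore_chains (Suc k) \<subseteq> carrier (sobj Xs (Suc k))" by (auto simp: moore_chains_def)
    have q: "linear_map R ?P (sobj Xs k) (face Xs k 0)"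
      using face_linear[of 0 k] sub by (auto simp: linear_map_def Pi_def subset_iff)
    obtain w where w: "w \<in> lin_hom R (sobj Xs k) ?P" "\<And>x. x \<in> carrier (sobj Xs k) \<Longrightarrow> face Xs k 0 (w x) = ?h x"
      using R.projective_lift[OF sobj_module sobj_projective moore_chains_module sobj_module q h] im by auto
    have wN: "w x \<in> moore_chains (Suc k)" if "x \<in> carrier (sobj Xs k)" for x
      using linear_map_closed[OF lin_hom_linear_map[OF w(1)] that] by simp
    have wl: "linear_map R (sobj Xs k) (sobj Xs (Suc k)) w"
      using lin_hom_linear_map[OF w(1)] sub by (auto simp: linear_map_def Pi_def subset_iff)
    let ?c = "\<lambda>x. z x \<oplus>\<^bsub>sobj Xs (Suc k)\<^esub> w x"
    have c: "linear_map R (sobj Xs k) (sobj Xs (Suc k)) ?c"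
      by (rule linear_map_add_fun[OF sobj_module sobj_module z(1) wl])
    have split: "face Xs k i (?c x) = face Xs k i (z x) \<oplus>\<^bsub>sobj Xs k\<^esub> face Xs k i (w x)"
      if "i \<le> Suc k" "x \<in> carrier (sobj Xs k)" for i x
      using linear_map_add[OF face_linear] linear_map_closed[OF z(1)] linear_map_closed[OF wl] that by simp
    have "face Xs k i (?c x) = y i x" if i: "i \<in> {1..Suc k}" and x: "x \<in> carrier (sobj Xs k)" for i x
      using split[of i x] z(2)[OF that] wN[OF x] i x linear_map_closed[OF y[OF i] x]
      by (simp add: moore_chains_def)
    moreover have "face Xs k 0 (?c x) = x" if x: "x \<in> carrier (sobj Xs k)" for x
      using split[of 0 x] w(2)[OF x] x linear_map_closed[OF z(1) x]
      by (simp add: a_minus_def X.a_ac X.r_neg)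
    ultimately show ?thesis using c by blast
  qed
qed

text \<open>The apex is the zero vertex and comes first, so the faces of index i > 0 are cones on
  faces of x, and each stage prescribes the horn for the next.\<close>

lemma ex_cone:
  "\<exists>c. (\<forall>k. linear_map R (sobj Xs k) (sobj Xs (Suc k)) (c k)) \<and>
     (\<forall>k. k < n \<longrightarrow> (\<forall>x\<in>carrier (sobj Xs k). face Xs k 0 (c k x) = x)) \<and>
     (\<forall>x\<in>carrier (sobj Xs 0). face Xs 0 1 (c 0 x) = \<zero>\<^bsub>sobj Xs 0\<^esub>) \<and>
     (\<forall>k. \<forall>i\<in>{1..Suc (Suc k)}. \<forall>x\<in>carrier (sobj Xs (Suc k)).
         face Xs (Suc k) i (c (Suc k) x) = c k (face Xs k (i - 1) x))"
proof -
  \<comment> \<open>\<open>dependent_nat_choice\<close> passes on only the current term. The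
    existential \<open>g\<close> stands for the preceding stage and keeps the fact that the faces of
    \<open>c\<close> are again cones, which the compatibility of the next horn needs.\<close>
  define P where "P k c \<longleftrightarrow> linear_map R (sobj Xs k) (sobj Xs (Suc k)) c \<and>
     (k < n \<longrightarrow> (\<forall>x\<in>carrier (sobj Xs k). face Xs k 0 (c x) = x)) \<and>
     (case k of 0 \<Rightarrow> \<forall>x\<in>carrier (sobj Xs 0). face Xs 0 1 (c x) = \<zero>\<^bsub>sobj Xs 0\<^esub>
      | Suc k' \<Rightarrow> \<exists>g. \<forall>i\<in>{1..Suc k}. \<forall>x\<in>carrier (sobj Xs k). face Xs k i (c x) = g (face Xs k' (i - 1) x))" for k c
  define Q where "Q k c c' \<longleftrightarrow> (\<forall>i\<in>{1..Suc (Suc k)}. \<forall>x\<in>carrier (sobj Xs (Suc k)).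
         face Xs (Suc k) i (c' x) = c (face Xs k (i - 1) x))" for k and c c' :: "'a \<Rightarrow> 'a"
  have "\<exists>f. \<forall>k. P k (f k) \<and> Q k (f k) (f (Suc k))"
  proof (rule dependent_nat_choice)
    show "\<exists>c. P 0 c"
      using cone_step[of 0 "\<lambda>i x. \<zero>\<^bsub>sobj Xs 0\<^esub>"] linear_map_zero_fun[OF sobj_module] by (auto simp: P_def)
  next
    fix c k assume c: "P k c"
    then have lin: "linear_map R (sobj Xs k) (sobj Xs (Suc k)) c" by (simp add: P_def)
    have "\<exists>c'. linear_map R (sobj Xs (Suc k)) (sobj Xs (Suc (Suc k))) c' \<and>
      (\<forall>i\<in>{1..Suc (Suc k)}. \<forall>x\<in>carrier (sobj Xs (Suc k)). face Xs (Suc k) i (c' x) = c (face Xs k (i - 1) x)) \<and>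
      (Suc k < n \<longrightarrow> (\<forall>x\<in>carrier (sobj Xs (Suc k)). face Xs (Suc k) 0 (c' x) = x))"
    proof (rule cone_step)
      show "linear_map R (sobj Xs (Suc k)) (sobj Xs (Suc k)) (\<lambda>x. c (face Xs k (i - 1) x))"
        if "i \<in> {1..Suc (Suc k)}" for i
        using that by (intro linear_map_comp[OF _ lin] face_linear) auto
    next
      fix i l k' x assume *: "Suc k = Suc k'" "1 \<le> i" "i < l" "l \<le> Suc (Suc k)" "x \<in> carrier (sobj Xs (Suc k))"
      show "face Xs k' i (c (face Xs k (l - 1) x)) = face Xs k' (l - 1) (c (face Xs k (i - 1) x))"
      proof (cases k)
        \<comment> \<open>Only i = 1 and l = 2 occur; both sides are the apex of a cone on a vertex,
          hence zero.\<close>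
        case 0
        then have il: "i = 1" "l = 2" "k' = 0" using * by auto
        have x: "x \<in> carrier (sobj Xs (Suc 0))" using * 0 by simp
        have z: "face Xs 0 1 (c v) = \<zero>\<^bsub>sobj Xs 0\<^esub>" if "v \<in> carrier (sobj Xs 0)" for v
          using c that 0 by (auto simp: P_def)
        show ?thesis unfolding il 0 using z[of "face Xs 0 1 x"] z[of "face Xs 0 0 x"] x by simp
      next
        case (Suc k'')
        then obtain g where g: "\<And>i x. i \<in> {1..Suc k} \<Longrightarrow> x \<in> carrier (sobj Xs k) \<Longrightarrow> face Xs k i (c x) = g (face Xs k'' (i - 1) x)"
          using c by (auto simp: P_def)
        have "face Xs k' i (c (face Xs k (l - 1) x)) = g (face Xs k'' (i - 1) (face Xs k (l - 1) x))"
          using g[of i "face Xs k (l - 1) x"] * by simp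
        also have "face Xs k'' (i - 1) (face Xs k (l - 1) x) = face Xs k'' (l - 1 - 1) (face Xs k (i - 1) x)"
          using face_face[of "i - 1" "l - 1" k'' x] * Suc by simp
        also have "g \<dots> = face Xs k' (l - 1) (c (face Xs k (i - 1) x))"
        proof -
          have "l - 1 \<in> {1..Suc k}" "i - 1 \<le> Suc k" using * by auto
          with g[of "l - 1" "face Xs k (i - 1) x"] *(1,5) show ?thesis by simp
        qed
        finally show ?thesis .
      qed
    next
      fix i k' x assume *: "Suc k = Suc k'" "Suc k < n" "i \<le> Suc k" "x \<in> carrier (sobj Xs (Suc k))"
      then show "face Xs k' 0 (c (face Xs k (Suc i - 1) x)) = face Xs k' i x"
        using c by (auto simp: P_def)
    qed
    then show "\<exists>c'. P (Suc k) c' \<and> Q k c c'" by (auto simp: P_def Q_def)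
  qed
  then obtain f where f: "\<And>k. P k (f k)" "\<And>k. Q k (f k) (f (Suc k))" by blast
  show ?thesis
  proof (intro exI[of _ f] conjI allI)
    show "linear_map R (sobj Xs k) (sobj Xs (Suc k)) (f k)" for k using f(1)[of k] by (simp add: P_def)
    show "k < n \<longrightarrow> (\<forall>x\<in>carrier (sobj Xs k). face Xs k 0 (f k x) = x)" for k
      using f(1)[of k] by (simp add: P_def)
    show "\<forall>x\<in>carrier (sobj Xs 0). face Xs 0 1 (f 0 x) = \<zero>\<^bsub>sobj Xs 0\<^esub>" using f(1)[of 0] by (simp add: P_def)
    show "\<forall>i\<in>{1..Suc (Suc k)}. \<forall>x\<in>carrier (sobj Xs (Suc k)).
         face Xs (Suc k) i (f (Suc k) x) = f k (face Xs k (i - 1) x)" for k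
      using f(2)[of k] by (simp add: Q_def)
  qed
qed

end

section \<open>Truncation\<close>

text \<open>Repeats the first vertex r more times; on a cone this repeats the apex.\<close>

fun degen_zero_power :: "('r, 'a) simplicial_data \<Rightarrow> nat \<Rightarrow> nat \<Rightarrow> 'a \<Rightarrow> 'a" where
  "degen_zero_power Xs k 0 y = y"
| "degen_zero_power Xs k (Suc r) y = degen Xs (k + r) 0 (degen_zero_power Xs k r y)"

context simplicial_module
begin

lemma degen_zero_power_linear:
  "linear_map R (sobj Xs k) (sobj Xs (k + r)) (degen_zero_power Xs k r)"
proof (induction r)
  case 0
  then show ?case by (auto simp: linear_map_def)
next
  case (Suc r)
  then show ?case using linear_map_comp[OF Suc degen_linear[of 0 "k + r"]] by (simp add: linear_map_def)
qed

text \<open>The first r + 2 vertices coincide, so deleting any one of them leaves one copy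
  fewer.\<close>

lemma face_degen_zero_power_less:
  "i \<le> Suc r \<Longrightarrow> y \<in> carrier (sobj Xs k) \<Longrightarrow>
   face Xs (k + r) i (degen_zero_power Xs k (Suc r) y) = degen_zero_power Xs k r y"
proof (induction r arbitrary: i)
  case 0
  then show ?case using face_degen_same[of i 0 k y] by (auto simp: le_Suc_eq)
next
  case (Suc r)
  let ?z = "degen_zero_power Xs k (Suc r) y"
  have z: "?z \<in> carrier (sobj Xs (Suc (k + r)))"
    using linear_map_closed[OF degen_zero_power_linear[of k "Suc r"] Suc.prems(2)] by simp
  show ?case
  proof (cases "i \<le> 1")
    case True
    then show ?thesis using face_degen_same[of i 0 "Suc (k + r)" ?z] z by (auto simp: le_Suc_eq)
  next
    case False
    then have "face Xs (Suc (k + r)) i (degen Xs (Suc (k + r)) 0 ?z) = degen Xs (k + r) 0 (face Xs (k + r) (i - 1) ?z)"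
      using Suc.prems z by (intro face_degen_greater) auto
    also have "face Xs (k + r) (i - 1) ?z = degen_zero_power Xs k r y"
      using Suc.prems False by (intro Suc.IH) auto
    finally show ?thesis by simp
  qed
qed

lemma face_degen_zero_power_greater:
  "r < i \<Longrightarrow> i \<le> Suc (k + r) \<Longrightarrow> y \<in> carrier (sobj Xs (Suc k)) \<Longrightarrow>
   face Xs (k + r) i (degen_zero_power Xs (Suc k) r y) = degen_zero_power Xs k r (face Xs k (i - r) y)"
proof (induction r arbitrary: i)
  case (Suc r)
  let ?z = "degen_zero_power Xs (Suc k) r y"
  have z: "?z \<in> carrier (sobj Xs (Suc (k + r)))"
    using linear_map_closed[OF degen_zero_power_linear[of "Suc k" r] Suc.prems(3)] by simp
  have "face Xs (Suc (k + r)) i (degen Xs (Suc (k + r)) 0 ?z) = degen Xs (k + r) 0 (face Xs (k + r) (i - 1) ?z)"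
    using Suc.prems z by (intro face_degen_greater) auto
  also have "face Xs (k + r) (i - 1) ?z = degen_zero_power Xs k r (face Xs k (i - 1 - r) y)"
    using Suc.prems by (intro Suc.IH) auto
  finally show ?case by simp
qed simp

end

section \<open>The prism between the identity and the truncation\<close>

lemma monotone_simplex_append:
  "monotone_simplex j l (p @ u) \<Longrightarrow> monotone_simplex j (length u) u"
  by (auto simp: monotone_simplex_def sorted_append)

text \<open>A simplex of [j] x [1] for the order in which the end \<open>True\<close> precedes the
  end \<open>False\<close>; \<open>p\<close> and \<open>u\<close> are its parts over the two
  ends.\<close>

definition prism_simplex :: "nat \<Rightarrow> nat \<Rightarrow> (nat \<times> bool) list \<Rightarrow> bool" where
  "prism_simplex j l \<sigma> \<longleftrightarrow> (\<exists>p u. \<sigma> = map (\<lambda>v. (v, True)) p @ map (\<lambda>v. (v, False)) u \<and> monotone_simplex j l (p @ u))"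

definition true_part :: "(nat \<times> bool) list \<Rightarrow> nat list" where
  "true_part \<sigma> = map fst (filter snd \<sigma>)"

definition false_part :: "(nat \<times> bool) list \<Rightarrow> nat list" where
  "false_part \<sigma> = map fst (filter (Not \<circ> snd) \<sigma>)"

lemma prism_parts [simp]:
  "true_part (map (\<lambda>v. (v, True)) p @ map (\<lambda>v. (v, False)) u) = p"
  "false_part (map (\<lambda>v. (v, True)) p @ map (\<lambda>v. (v, False)) u) = u"
  by (simp_all add: true_part_def false_part_def filter_map comp_def)

text \<open>One fixed choice of cone, shared by all functors applied to X; naturality of the
  homotopies in the functor rests on this.\<close>

locale coned_simplicial_module = simplicial_module R Xs
  for R :: "('r, 'x) ring_scheme" and Xs :: "('r, 'a) simplicial_data" +
  fixes n :: nat and cone :: "nat \<Rightarrow> 'a \<Rightarrow> 'a"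
  assumes cone_linear: "linear_map R (sobj Xs k) (sobj Xs (Suc k)) (cone k)"
    and face_0_cone: "k < n \<Longrightarrow> x \<in> carrier (sobj Xs k) \<Longrightarrow> face Xs k 0 (cone k x) = x"
    and face_1_cone: "x \<in> carrier (sobj Xs 0) \<Longrightarrow> face Xs 0 1 (cone 0 x) = \<zero>\<^bsub>sobj Xs 0\<^esub>"
    and face_cone: "1 \<le> i \<Longrightarrow> i \<le> Suc (Suc k) \<Longrightarrow> x \<in> carrier (sobj Xs (Suc k)) \<Longrightarrow>
       face Xs (Suc k) i (cone (Suc k) x) = cone k (face Xs k (i - 1) x)"
begin

definition trunc :: "nat \<Rightarrow> 'a \<Rightarrow> 'a" where
  "trunc k x = x \<ominus>\<^bsub>sobj Xs k\<^esub> face Xs k 0 (cone k x)"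

lemma trunc_linear: "linear_map R (sobj Xs k) (sobj Xs k) (trunc k)"
  unfolding trunc_def
  by (intro linear_map_diff_fun sobj_module linear_map_id linear_map_comp[OF cone_linear] face_linear) simp

lemma trunc_zero: "k < n \<Longrightarrow> x \<in> carrier (sobj Xs k) \<Longrightarrow> trunc k x = \<zero>\<^bsub>sobj Xs k\<^esub>"
proof -
  interpret X: module R "sobj Xs k" by (rule sobj_module)
  show "k < n \<Longrightarrow> x \<in> carrier (sobj Xs k) \<Longrightarrow> ?thesis"
    by (simp add: trunc_def face_0_cone a_minus_def X.r_neg)
qed

text \<open>d_i d_0 = d_0 d_(i+1), and d_(i+1) of a cone is the cone on d_i.\<close>

lemma face_trunc:
  assumes "i \<le> Suc k" "x \<in> carrier (sobj Xs (Suc k))"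
  shows "face Xs k i (trunc (Suc k) x) = trunc k (face Xs k i x)"
proof -
  have c: "cone (Suc k) x \<in> carrier (sobj Xs (Suc (Suc k)))" using linear_map_closed[OF cone_linear assms(2)] .
  have "face Xs k i (trunc (Suc k) x) = face Xs k i x \<ominus>\<^bsub>sobj Xs k\<^esub> face Xs k i (face Xs (Suc k) 0 (cone (Suc k) x))"
    unfolding trunc_def using linear_map_diff[OF sobj_module sobj_module face_linear] assms c by simp
  also have "face Xs k i (face Xs (Suc k) 0 (cone (Suc k) x)) = face Xs k 0 (face Xs (Suc k) (Suc i) (cone (Suc k) x))"
    using face_face[of 0 "Suc i" k] assms c by simp
  also have "\<dots> = face Xs k 0 (cone k (face Xs k i x))" using face_cone[of "Suc i" k x] assms by simp
  finally show ?thesis by (simp add: trunc_def)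
qed

text \<open>The vertices over \<open>True\<close> go to the apex and those over \<open>False\<close>
  span the base. So u = [] gives the zero vertex and p = [] the base of the cone; otherwise the apex
  occurs as often as p is long, which takes length p - 1 degeneracies.\<close>

definition cone_part :: "nat \<Rightarrow> nat list \<Rightarrow> nat list \<Rightarrow> 'a \<Rightarrow> 'a" where
  "cone_part j p u x = (let y = cone (length u - 1) (simplicial_op Xs j u x) in
     if u = [] then \<zero>\<^bsub>sobj Xs (length p - 1)\<^esub>
     else if p = [] then face Xs (length u - 1) 0 y
     else degen_zero_power Xs (length u) (length p - 1) y)"

text \<open>
  On $[j] \times [1]$ this interpolates between the identity, at the end marked \<open>True\<close>, and
  \<open>trunc\<close>, at the end marked \<open>False\<close>.
\<close>

definition prism_op :: "nat \<Rightarrow> (nat \<times> bool) list \<Rightarrow> 'a \<Rightarrow> 'a" where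
  "prism_op j \<sigma> x = simplicial_op Xs j (map fst \<sigma>) x \<ominus>\<^bsub>sobj Xs (length \<sigma> - 1)\<^esub>
     cone_part j (true_part \<sigma>) (false_part \<sigma>) x"

lemma cone_part_linear:
  assumes "monotone_simplex j (Suc l) (p @ u)"
  shows "linear_map R (sobj Xs j) (sobj Xs l) (cone_part j p u)"
proof (cases "u = []")
  case True
  then have "l = length p - 1" using assms by (auto simp: monotone_simplex_def)
  with True show ?thesis
    using linear_map_zero_fun[OF sobj_module] by (simp add: cone_part_def[abs_def])
next
  case False
  then obtain l' where l': "length u = Suc l'" by (cases u) auto
  have y: "linear_map R (sobj Xs j) (sobj Xs (Suc l')) (\<lambda>x. cone l' (simplicial_op Xs j u x))"
    using monotone_simplex_append[OF assms] l'
    by (intro linear_map_comp[OF simplicial_op_linear cone_linear]) simp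
  show ?thesis
  proof (cases "p = []")
    case True
    then have "l = l'" using l' assms by (simp add: monotone_simplex_def)
    then show ?thesis using True False l' linear_map_comp[OF y face_linear[of 0 l']]
      by (simp add: cone_part_def[abs_def])
  next
    case False
    then have "l = Suc l' + (length p - 1)" using l' assms by (cases p) (auto simp: monotone_simplex_def)
    then show ?thesis using False \<open>u \<noteq> []\<close> l' linear_map_comp[OF y degen_zero_power_linear[of "Suc l'" "length p - 1"]]
      by (simp add: cone_part_def[abs_def])
  qed
qed

lemma prism_op_linear:
  assumes "prism_simplex j (Suc l) \<sigma>"
  shows "linear_map R (sobj Xs j) (sobj Xs l) (prism_op j \<sigma>)"
proof -
  obtain p u where *: "\<sigma> = map (\<lambda>v. (v, True)) p @ map (\<lambda>v. (v, False)) u" "monotone_simplex j (Suc l) (p @ u)"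
    using assms by (auto simp: prism_simplex_def)
  then have "length \<sigma> - 1 = l" "map fst \<sigma> = p @ u" by (auto simp: monotone_simplex_def comp_def)
  then show ?thesis unfolding prism_op_def using *
    by (auto intro!: linear_map_diff_fun sobj_module simplicial_op_linear cone_part_linear)
qed

lemma prism_op_shift:
  assumes "prism_simplex j (Suc l) \<sigma>" "i \<le> Suc j" "x \<in> carrier (sobj Xs (Suc j))"
  shows "prism_op (Suc j) (map (map_prod (shift i) id) \<sigma>) x = prism_op j \<sigma> (face Xs j i x)"
proof -
  obtain p u where *: "\<sigma> = map (\<lambda>v. (v, True)) p @ map (\<lambda>v. (v, False)) u" "monotone_simplex j (Suc l) (p @ u)"
    using assms by (auto simp: prism_simplex_def)
  have \<sigma>': "map (map_prod (shift i) id) \<sigma> = map (\<lambda>v. (v, True)) (map (shift i) p) @ map (\<lambda>v. (v, False)) (map (shift i) u)"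
    by (simp add: *(1))
  have 1: "simplicial_op Xs (Suc j) (map (shift i) (p @ u)) x = simplicial_op Xs j (p @ u) (face Xs j i x)"
    by (rule simplicial_op_shift[OF *(2) assms(2,3)])
  have 2: "cone_part (Suc j) (map (shift i) p) (map (shift i) u) x = cone_part j p u (face Xs j i x)"
  proof (cases u)
    case Nil
    then show ?thesis by (simp add: cone_part_def)
  next
    case (Cons a u')
    then have "simplicial_op Xs (Suc j) (map (shift i) u) x = simplicial_op Xs j u (face Xs j i x)"
      using monotone_simplex_append[OF *(2)] by (intro simplicial_op_shift[OF _ assms(2,3)]) simp
    then show ?thesis by (auto simp: cone_part_def Let_def)
  qed
  have f: "map fst (map (map_prod (shift i) id) \<sigma>) = map (shift i) (p @ u)" "map fst \<sigma> = p @ u"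
    by (simp_all add: *(1) comp_def)
  show ?thesis unfolding prism_op_def f 1 unfolding \<sigma>' prism_parts 2 by (simp add: *(1))
qed

text \<open>Deleting a copy of the apex undoes one s_0, and deleting the only copy leaves the base,
  d_0 of the cone. Deleting a base vertex gives the cone on a face, and deleting the only base
  vertex leaves the apex, which is zero by \<open>face_1_cone\<close>.\<close>

lemma face_cone_part:
  assumes m: "monotone_simplex j (Suc (Suc l)) (p @ u)" and i: "i \<le> Suc l" and x: "x \<in> carrier (sobj Xs j)"
  shows "face Xs l i (cone_part j p u x) =
    (if i < length p then cone_part j (delete_nth i p) u x else cone_part j p (delete_nth (i - length p) u) x)"
proof (cases "u = []")
  case True
  then have "face Xs l i (cone_part j p u x) = \<zero>\<^bsub>sobj Xs l\<^esub>" "i < length p" "length p = Suc (Suc l)"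
    using m i linear_map_zero[OF sobj_module sobj_module face_linear[OF i]] by (auto simp: cone_part_def monotone_simplex_def)
  with True i show ?thesis by (auto simp: cone_part_def)
next
  case False
  then obtain q where q: "length u = Suc q" by (cases u) auto
  have len: "length p + q = Suc l" using m q by (simp add: monotone_simplex_def)
  have mu: "monotone_simplex j (Suc q) u" using monotone_simplex_append[OF m] q by simp
  let ?v = "simplicial_op Xs j u x"
  have v: "?v \<in> carrier (sobj Xs q)" using linear_map_closed[OF simplicial_op_linear[OF mu] x] .
  have cv: "cone q ?v \<in> carrier (sobj Xs (Suc q))" using linear_map_closed[OF cone_linear v] .
  show ?thesis
  proof (cases "i < length p")
    case True
    then obtain r where r: "length p = Suc r" by (cases p) auto
    show ?thesis
    proof (cases r)
      case 0
      then have "p \<noteq> []" "i = 0" "delete_nth i p = []" "q = l" using True r len by (auto simp: delete_nth_def)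
      then show ?thesis using False q 0 r by (simp add: cone_part_def)
    next
      case (Suc r')
      have ne: "p \<noteq> []" "delete_nth i p \<noteq> []" "length (delete_nth i p) = r"
        using True r Suc by (auto simp: delete_nth_def)
      have "l = Suc q + r'" using len r Suc by simp
      then have "face Xs l i (degen_zero_power Xs (Suc q) r (cone q ?v)) = degen_zero_power Xs (Suc q) r' (cone q ?v)"
        unfolding Suc using face_degen_zero_power_less[of i r' "cone q ?v" "Suc q"] cv True r Suc by simp
      then show ?thesis using True False q r Suc ne by (simp add: cone_part_def)
    qed
  next
    case i_ge: False
    define t where "t = i - length p"
    have t: "t \<le> q" "i = length p + t" using i_ge i len by (auto simp: t_def)
    show ?thesis
    proof (cases q)
      case 0
      then have t0: "t = 0" "delete_nth t u = []" using t q by (auto simp: delete_nth_def)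
      from len 0 obtain r where r: "length p = Suc r" "l = r" by (cases p) auto
      then have "p \<noteq> []" by auto
      have "face Xs l i (degen_zero_power Xs (Suc 0) r (cone 0 ?v)) = degen_zero_power Xs 0 r (face Xs 0 1 (cone 0 ?v))"
        using face_degen_zero_power_greater[of r i 0 "cone 0 ?v"] cv 0 r t t0 by simp
      also have "\<dots> = \<zero>\<^bsub>sobj Xs l\<^esub>"
        using face_1_cone[of ?v] v 0 r linear_map_zero[OF sobj_module sobj_module degen_zero_power_linear[of 0 r]] by simp
      finally show ?thesis using i_ge False q 0 r \<open>p \<noteq> []\<close> t0 by (simp add: cone_part_def t_def)
    next
      case (Suc q')
      have d: "length (delete_nth t u) = q" "delete_nth t u \<noteq> []" using t q Suc by (auto simp: delete_nth_def)
      have "face Xs q (Suc t) (cone q ?v) = cone q' (face Xs q' t ?v)"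
        using face_cone[of "Suc t" q' ?v] v t Suc by simp
      also have "face Xs q' t ?v = simplicial_op Xs j (delete_nth t u) x"
        using face_simplicial_op[of j q' u t x] mu t x Suc by simp
      finally have fc: "face Xs q (Suc t) (cone q ?v) = cone q' (simplicial_op Xs j (delete_nth t u) x)" .
      show ?thesis
      proof (cases p)
        case Nil
        then have "l = q'" "i = t" using len Suc t by auto
        then have "face Xs l i (face Xs q 0 (cone q ?v)) = face Xs q' 0 (face Xs q (Suc t) (cone q ?v))"
          using face_face[of 0 "Suc t" q' "cone q ?v"] cv t Suc by simp
        then show ?thesis using fc Nil False q d Suc i_ge \<open>i = t\<close> by (simp add: cone_part_def)
      next
        case (Cons a p')
        define r where "r = length p'"
        have r: "length p = Suc r" "p \<noteq> []" by (auto simp: Cons r_def)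
        have "l = q + r" "i = Suc t + r" using len r t by auto
        then have "face Xs l i (degen_zero_power Xs (Suc q) r (cone q ?v)) = degen_zero_power Xs q r (face Xs q (Suc t) (cone q ?v))"
          using face_degen_zero_power_greater[of r i q "cone q ?v"] cv t by simp
        then show ?thesis using fc False q d Suc i_ge r t_def by (simp add: cone_part_def)
      qed
    qed
  qed
qed

lemma face_prism_op:
  assumes "prism_simplex j (Suc (Suc l)) \<sigma>" and i: "i \<le> Suc l" and x: "x \<in> carrier (sobj Xs j)"
  shows "face Xs l i (prism_op j \<sigma> x) = prism_op j (delete_nth i \<sigma>) x"
proof -
  obtain p u where *: "\<sigma> = map (\<lambda>v. (v, True)) p @ map (\<lambda>v. (v, False)) u" "monotone_simplex j (Suc (Suc l)) (p @ u)"
    using assms by (auto simp: prism_simplex_def)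
  have f: "map fst \<sigma> = p @ u" by (simp add: *(1) comp_def)
  have len: "length \<sigma> = Suc (Suc l)" using * by (simp add: monotone_simplex_def)
  have d: "true_part (delete_nth i \<sigma>) = (if i < length p then delete_nth i p else p)"
    "false_part (delete_nth i \<sigma>) = (if i < length p then u else delete_nth (i - length p) u)"
  proof -
    have "delete_nth i \<sigma> = (if i < length p then map (\<lambda>v. (v, True)) (delete_nth i p) @ map (\<lambda>v. (v, False)) u
       else map (\<lambda>v. (v, True)) p @ map (\<lambda>v. (v, False)) (delete_nth (i - length p) u))"
      by (auto simp: *(1) delete_nth_def take_map drop_map Suc_diff_le)
    then show "true_part (delete_nth i \<sigma>) = (if i < length p then delete_nth i p else p)"
      "false_part (delete_nth i \<sigma>) = (if i < length p then u else delete_nth (i - length p) u)" by auto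
  qed
  have "face Xs l i (prism_op j \<sigma> x) = face Xs l i (simplicial_op Xs j (p @ u) x) \<ominus>\<^bsub>sobj Xs l\<^esub>
     face Xs l i (cone_part j p u x)"
    unfolding prism_op_def f using len linear_map_closed[OF cone_part_linear[OF *(2)] x]
      linear_map_closed[OF simplicial_op_linear[OF *(2)] x]
    by (simp add: *(1) linear_map_diff[OF sobj_module sobj_module face_linear[OF i]])
  also have "face Xs l i (simplicial_op Xs j (p @ u) x) = simplicial_op Xs j (map fst (delete_nth i \<sigma>)) x"
    using face_simplicial_op[OF *(2) i x] by (simp add: map_delete_nth f)
  also have "face Xs l i (cone_part j p u x) = cone_part j (true_part (delete_nth i \<sigma>)) (false_part (delete_nth i \<sigma>)) x"
    unfolding face_cone_part[OF *(2) i x] d by simp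
  finally show ?thesis using len i by (simp add: prism_op_def)
qed

lemma prism_op_ends:
  assumes "x \<in> carrier (sobj Xs k)"
  shows "prism_op k (map (\<lambda>v. (v, True)) [0..<Suc k]) x = x"
    and "prism_op k (map (\<lambda>v. (v, False)) [0..<Suc k]) x = trunc k x"
proof -
  interpret X: module R "sobj Xs k" by (rule sobj_module)
  note parts = prism_parts[of _ "[]", simplified] prism_parts[of "[]", simplified]
  have "map fst (map (\<lambda>v. (v, b)) [0..<Suc k]) = [0..<Suc k]" for b :: bool
    by (simp add: comp_def del: upt_Suc)
  then show "prism_op k (map (\<lambda>v. (v, True)) [0..<Suc k]) x = x"
    "prism_op k (map (\<lambda>v. (v, False)) [0..<Suc k]) x = trunc k x"
    using assms simplicial_op_id[OF assms]
    by (simp_all add: prism_op_def parts cone_part_def trunc_def a_minus_def X.add.inv_one[simplified a_inv_def[symmetric]]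
      del: upt_Suc map_map)
qed

end

section \<open>Tensor powers and polarization\<close>

lemma linear_map_finsum:
  assumes "module R M" "module R N" "linear_map R M N f" "\<And>i. i \<in> I \<Longrightarrow> a i \<in> carrier M"
  shows "f (\<Oplus>\<^bsub>M\<^esub>i\<in>I. a i) = (\<Oplus>\<^bsub>N\<^esub>i\<in>I. f (a i))"
proof -
  interpret M: module R M by fact
  interpret N: module R N by fact
  show ?thesis
    using assms(4)
  proof (induction I rule: infinite_finite_induct)
    case (infinite I)
    then show ?case by (simp add: linear_map_zero[OF assms(1-3)])
  next
    case empty
    then show ?case by (simp add: linear_map_zero[OF assms(1-3)])
  next
    case (insert i I)
    have fa: "(\<lambda>i. f (a i)) \<in> I \<rightarrow> carrier N" "f (a i) \<in> carrier N"
      using linear_map_closed[OF assms(3)] insert.prems by auto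
    have a: "a \<in> I \<rightarrow> carrier M" "a i \<in> carrier M" using insert.prems by auto
    show ?case
      using insert fa a linear_map_add[OF assms(3) a(2) M.finsum_closed[OF a(1)]] by simp
  qed
qed

lemma linear_map_finsum_fun:
  assumes "module R M" "module R N" "\<And>i. i \<in> I \<Longrightarrow> linear_map R M N (f i)"
  shows "linear_map R M N (\<lambda>x. \<Oplus>\<^bsub>N\<^esub>i\<in>I. f i x)"
proof -
  interpret M: module R M by fact
  interpret N: module R N by fact
  show ?thesis
    using assms(3)
  proof (induction I rule: infinite_finite_induct)
    case (infinite I)
    then show ?case by (simp add: linear_map_zero_fun[OF assms(2)])
  next
    case empty
    then show ?case by (simp add: linear_map_zero_fun[OF assms(2)])
  next
    case (insert i I)
    have "linear_map R M N (\<lambda>x. f i x \<oplus>\<^bsub>N\<^esub> (\<Oplus>\<^bsub>N\<^esub>i\<in>I. f i x))"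
      using insert by (intro linear_map_add_fun assms(1,2)) auto
    then show ?case
    proof (rule linear_map_cong[OF assms(1), rotated])
      fix x assume "x \<in> carrier M"
      then have "f j x \<in> carrier N" if "j \<in> insert i I" for j
        using linear_map_closed[OF insert.prems[OF that]] by blast
      then show "f i x \<oplus>\<^bsub>N\<^esub> (\<Oplus>\<^bsub>N\<^esub>i\<in>I. f i x) = (\<Oplus>\<^bsub>N\<^esub>i\<in>insert i I. f i x)"
        using insert.hyps by simp
    qed
  qed
qed

lemma smult_add_pow_one:
  assumes "module R M" "x \<in> carrier M"
  shows "([k] \<cdot>\<^bsub>R\<^esub> \<one>\<^bsub>R\<^esub>) \<odot>\<^bsub>M\<^esub> x = [(k::nat)] \<cdot>\<^bsub>M\<^esub> x"
proof -
  interpret M: module R M by fact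
  show ?thesis
  proof (induction k)
    case 0
    then show ?case using assms(2) by simp
  next
    case (Suc k)
    then show ?case using assms(2) by (simp add: M.smult_l_distr)
  qed
qed

section \<open>Quotients and spans of submodules\<close>

locale quotient_module = module R M for R :: "('r, 'x) ring_scheme" and M :: "('r, 'a) module" (structure) +
  fixes H :: "'a set"
  assumes submodule: "submodule H R M"
begin

sublocale H: abelian_subgroup H M
proof (rule abelian_subgroupI3)
  show "additive_subgroup H M" using submodule.axioms(1)[OF submodule] by (simp add: additive_subgroup_def)
qed (rule M.abelian_group_axioms)

lemma H_subset: "H \<subseteq> carrier M" by (rule H.a_subset)

lemma carrier_quot_module: "carrier (quot_module M H) = (\<lambda>x. H +> x) ` carrier M"
  by (auto simp: quot_module_def A_RCOSETS_def')

lemma zero_quot_module: "\<zero>\<^bsub>quot_module M H\<^esub> = H"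
  by (simp add: quot_module_def)

lemma coset_zero: "x \<in> H \<Longrightarrow> H +> x = H"
  using a_coset_join2 H.a_subgroup H_subset by blast

lemma add_quot_module:
  "x \<in> carrier M \<Longrightarrow> y \<in> carrier M \<Longrightarrow> (H +> x) \<oplus>\<^bsub>quot_module M H\<^esub> (H +> y) = H +> (x \<oplus> y)"
  by (simp add: quot_module_def H.a_rcos_sum)

lemma coset_add_left: "h \<in> H \<Longrightarrow> x \<in> carrier M \<Longrightarrow> H +> (h \<oplus> x) = H +> x"
  by (rule a_repr_independence[symmetric, OF _ _ H.a_subgroup]) (auto simp: a_r_coset_def')

text \<open>Operations on cosets are defined as unions over representatives; such a union collapses
  to one coset as soon as the operation is constant on representatives.\<close>

lemma Union_coset:
  assumes "x \<in> carrier M" "\<And>h. h \<in> H \<Longrightarrow> f (h \<oplus> x) = f x"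
  shows "(\<Union>y\<in>H +> x. f y) = f x"
proof -
  have "H +> x = (\<lambda>h. h \<oplus> x) ` H" by (auto simp: a_r_coset_def')
  moreover have "H \<noteq> {}" using H.zero_closed by blast
  ultimately show ?thesis using assms(2) by auto
qed

lemma smult_quot_module:
  assumes "r \<in> carrier R" "x \<in> carrier M"
  shows "r \<odot>\<^bsub>quot_module M H\<^esub> (H +> x) = H +> (r \<odot> x)"
proof -
  have "H +> (r \<odot> (h \<oplus> x)) = H +> (r \<odot> x)" if "h \<in> H" for h
    using coset_add_left[of "r \<odot> h" "r \<odot> x"] submodule.smult_closed[OF submodule] that assms H_subset
    by (simp add: smult_r_distr subset_iff)
  then show ?thesis
    using Union_coset[OF assms(2), of "\<lambda>y. H +> (r \<odot> y)"] by (simp add: quot_module_def)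
qed

lemma quot_module_module: "module R (quot_module M H)"
proof -
  have zero: "H = H +> \<zero>" using coset_zero[OF H.zero_closed] by simp
  note q = carrier_quot_module add_quot_module smult_quot_module
  have "module R (mk_module (carrier (quot_module M H)) (H +> \<zero>) (ring.add (quot_module M H)) (smult (quot_module M H)))"
  proof (rule mk_moduleI[OF R.is_cring], goal_cases)
    case (6 x)
    then obtain y where "y \<in> carrier M" "x = H +> y" by (auto simp: q)
    then show ?case by (intro bexI[of _ "H +> (\<ominus> y)"]) (auto simp: q l_neg)
  qed (auto simp: q M.a_ac smult_l_distr smult_r_distr smult_assoc1)
  also have "mk_module (carrier (quot_module M H)) (H +> \<zero>) (ring.add (quot_module M H)) (smult (quot_module M H)) = quot_module M H"
    by (simp add: zero[symmetric]) (simp add: quot_module_def mk_module_def)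
  finally show ?thesis .
qed

lemma coset_linear: "linear_map R M (quot_module M H) (\<lambda>x. H +> x)"
  by (auto simp: linear_map_def add_quot_module smult_quot_module carrier_quot_module)

end

lemma submodule_span_submodule:
  assumes "module R M" "S \<subseteq> carrier M" shows "submodule (submodule_span R M S) R M"
proof -
  interpret module R M by fact
  have *: "carrier M \<in> {H. submodule H R M \<and> S \<subseteq> H}" using assms carrier_is_submodule by auto
  show ?thesis unfolding submodule_span_def
  proof (rule submoduleI, goal_cases)
    case 1 then show ?case using * by blast
  next
    case 2 then show ?case
      by (auto simp: submodule_def subgroup_def)
  next
    case (3 a) then show ?case using submoduleE(3) by auto
  next
    case (4 a b) then show ?case using submoduleE(5) by auto
  next
    case (5 a x) then show ?case using submoduleE(4) by auto
  qed
qed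

lemma submodule_span_superset: "S \<subseteq> submodule_span R M S"
  by (auto simp: submodule_span_def)

lemma submodule_span_least: "submodule H R M \<Longrightarrow> S \<subseteq> H \<Longrightarrow> submodule_span R M S \<subseteq> H"
  by (auto simp: submodule_span_def)

lemma linear_map_vimage_submodule:
  assumes "module R M" "module R N" "linear_map R M N f" "submodule H R N"
  shows "submodule {x \<in> carrier M. f x \<in> H} R M"
proof -
  interpret M: module R M by fact
  interpret N: module R N by fact
  show ?thesis
  proof (rule M.submoduleI, goal_cases)
    case 1 then show ?case by auto
  next
    case 2 then show ?case
      using linear_map_zero[OF assms(1-3)] submodule.axioms(1)[OF assms(4)] by (auto simp: subgroup_def)
  next
    case (3 a) then show ?case using linear_map_a_inv[OF assms(1-3)] N.submoduleE(3)[OF assms(4)] by simp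
  next
    case (4 a b) then show ?case using linear_map_add[OF assms(3)] N.submoduleE(5)[OF assms(4)] by simp
  next
    case (5 a x) then show ?case using linear_map_smult[OF assms(3)] N.submoduleE(4)[OF assms(4)] by simp
  qed
qed

section \<open>Pure tensors and maps induced on tensor powers\<close>

definition pure_tensor :: "('r, 'x) ring_scheme \<Rightarrow> nat \<Rightarrow> ('r, 'm) module \<Rightarrow> 'm list \<Rightarrow> ('m list \<Rightarrow> 'r) set" where
  "pure_tensor R s M xs = tensor_kernel R s M +>\<^bsub>free_module R (tuples s M)\<^esub> free_basis R xs"

text \<open>What makes an operation on tuples descend to tensor powers: changing slot k changes a
  single slot l, linearly. Slot and map may depend on k and on the tuple, so the notion covers one
  map applied everywhere, different maps in different slots, and permutations of slots.\<close>

definition slotwise_linear :: "('r, 'x) ring_scheme \<Rightarrow> nat \<Rightarrow> ('r, 'm) module \<Rightarrow> ('r, 'm) module \<Rightarrow> ('m list \<Rightarrow> 'm list) \<Rightarrow> bool" where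
  "slotwise_linear R s M N h \<longleftrightarrow> (\<forall>xs\<in>tuples s M. h xs \<in> tuples s N \<and>
     (\<forall>k<s. \<exists>l<s. \<exists>g. linear_map R M N g \<and> (\<forall>x\<in>carrier M. h (xs[k := x]) = (h xs)[l := g x])))"

lemma tuples_update: "xs \<in> tuples s M \<Longrightarrow> x \<in> carrier M \<Longrightarrow> xs[k := x] \<in> tuples s M"
  using set_update_subset_insert[of xs k x] by (auto simp: tuples_def)

context cring
begin

lemma multilinear_relations_subset:
  assumes "module R M" shows "multilinear_relations R s M \<subseteq> carrier (free_module R (tuples s M))"
proof -
  interpret M: module R M by fact
  interpret F: module R "free_module R (tuples s M)" by (rule free_module_module)
  show ?thesis unfolding multilinear_relations_def Let_def
    by (auto simp: tuples_update simp del: free_module_simps intro!: F.minus_closed F.a_closed F.smult_closed)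
qed

lemma tensor_kernel_quotient:
  "module R M \<Longrightarrow> quotient_module R (free_module R (tuples s M)) (tensor_kernel R s M)"
  unfolding quotient_module_def quotient_module_axioms_def tensor_kernel_def
  using free_module_module submodule_span_submodule[OF free_module_module multilinear_relations_subset] by blast

lemma tensor_power_module: "module R M \<Longrightarrow> module R (tensor_power R s M)"
  unfolding tensor_power_def by (rule quotient_module.quot_module_module[OF tensor_kernel_quotient])

lemma pure_tensor_closed: "module R M \<Longrightarrow> xs \<in> tuples s M \<Longrightarrow> pure_tensor R s M xs \<in> carrier (tensor_power R s M)"
  unfolding tensor_power_def pure_tensor_def
  by (simp add: quotient_module.carrier_quot_module[OF tensor_kernel_quotient])

text \<open>The cosets of the basis elements generate; from here on, equalities of maps on tensor
  powers are checked on pure tensors.\<close>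

lemma tensor_linear_eq:
  assumes "module R M" "module R N" "linear_map R (tensor_power R s M) N f" "linear_map R (tensor_power R s M) N g"
    and "\<And>xs. xs \<in> tuples s M \<Longrightarrow> f (pure_tensor R s M xs) = g (pure_tensor R s M xs)"
    and "t \<in> carrier (tensor_power R s M)"
  shows "f t = g t"
proof -
  interpret Q: quotient_module R "free_module R (tuples s M)" "tensor_kernel R s M"
    by (rule tensor_kernel_quotient[OF assms(1)])
  obtain \<phi> where \<phi>: "\<phi> \<in> carrier (free_module R (tuples s M))" "t = tensor_kernel R s M +>\<^bsub>free_module R (tuples s M)\<^esub> \<phi>"
    using assms(6) by (auto simp: tensor_power_def Q.carrier_quot_module)
  note lin = Q.coset_linear[folded tensor_power_def]
  have "f (tensor_kernel R s M +>\<^bsub>free_module R (tuples s M)\<^esub> \<phi>) = g (tensor_kernel R s M +>\<^bsub>free_module R (tuples s M)\<^esub> \<phi>)"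
    by (rule free_module_linear_eq[OF assms(2) linear_map_comp[OF lin assms(3)] linear_map_comp[OF lin assms(4)] _ \<phi>(1)])
      (use assms(5) in \<open>simp add: pure_tensor_def\<close>)
  then show ?thesis by (simp add: \<phi>(2))
qed

text \<open>A relation in slot k is sent to a relation of the same type in slot l, so the preimage
  of the kernel is a submodule containing all relations.\<close>

lemma free_map_tensor_kernel:
  assumes "module R M" "module R N" "slotwise_linear R s M N h"
  shows "\<phi> \<in> tensor_kernel R s M \<Longrightarrow> free_map R h \<phi> \<in> tensor_kernel R s N"
proof -
  interpret M: module R M by fact
  interpret N: module R N by fact
  let ?F = "free_module R (tuples s M)" and ?G = "free_module R (tuples s N)"
  interpret F: module R ?F by (rule free_module_module)
  interpret G: module R ?G by (rule free_module_module)
  have h: "h \<in> tuples s M \<rightarrow> tuples s N" using assms(3) by (auto simp: slotwise_linear_def)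
  note lin = free_map_linear[OF h]
  have sub: "submodule (tensor_kernel R s N) R ?G"
    using quotient_module.submodule[OF tensor_kernel_quotient[OF assms(2)]] .
  have ker: "multilinear_relations R s N \<subseteq> tensor_kernel R s N"
    unfolding tensor_kernel_def by (rule submodule_span_superset)
  have "multilinear_relations R s M \<subseteq> {\<phi> \<in> carrier ?F. free_map R h \<phi> \<in> tensor_kernel R s N}"
  proof
    fix \<phi> assume \<phi>: "\<phi> \<in> multilinear_relations R s M"
    have "free_map R h \<phi> \<in> multilinear_relations R s N"
    proof -
      from \<phi> consider
        xs k x y where "\<phi> = free_basis R (xs[k := x \<oplus>\<^bsub>M\<^esub> y]) \<ominus>\<^bsub>?F\<^esub> (free_basis R (xs[k := x]) \<oplus>\<^bsub>?F\<^esub> free_basis R (xs[k := y]))"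
          "xs \<in> tuples s M" "k < s" "x \<in> carrier M" "y \<in> carrier M"
        | xs k r x where "\<phi> = free_basis R (xs[k := r \<odot>\<^bsub>M\<^esub> x]) \<ominus>\<^bsub>?F\<^esub> (r \<odot>\<^bsub>?F\<^esub> free_basis R (xs[k := x]))"
          "xs \<in> tuples s M" "k < s" "r \<in> carrier R" "x \<in> carrier M"
        unfolding multilinear_relations_def Let_def by blast
      then show ?thesis
      proof cases
        case 1
        obtain l g where lg: "l < s" "linear_map R M N g" "\<And>x. x \<in> carrier M \<Longrightarrow> h (xs[k := x]) = (h xs)[l := g x]"
          using assms(3) 1(2,3) unfolding slotwise_linear_def by meson
        have "free_map R h \<phi> = free_basis R ((h xs)[l := g x \<oplus>\<^bsub>N\<^esub> g y]) \<ominus>\<^bsub>?G\<^esub>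
            (free_basis R ((h xs)[l := g x]) \<oplus>\<^bsub>?G\<^esub> free_basis R ((h xs)[l := g y]))"
          unfolding 1(1) using 1(2-5) lg
          by (simp add: linear_map_diff[OF free_module_module free_module_module lin] linear_map_add[OF lin]
            tuples_update free_map_basis linear_map_add[OF lg(2)] del: free_module_simps)
        then show ?thesis unfolding multilinear_relations_def Let_def
          using h 1 lg(1) linear_map_closed[OF lg(2)] by blast
      next
        case 2
        obtain l g where lg: "l < s" "linear_map R M N g" "\<And>x. x \<in> carrier M \<Longrightarrow> h (xs[k := x]) = (h xs)[l := g x]"
          using assms(3) 2(2,3) unfolding slotwise_linear_def by meson
        have "free_map R h \<phi> = free_basis R ((h xs)[l := r \<odot>\<^bsub>N\<^esub> g x]) \<ominus>\<^bsub>?G\<^esub> (r \<odot>\<^bsub>?G\<^esub> free_basis R ((h xs)[l := g x]))"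
          unfolding 2(1) using 2(2-5) lg
          by (simp add: linear_map_diff[OF free_module_module free_module_module lin] linear_map_smult[OF lin]
            tuples_update free_map_basis linear_map_smult[OF lg(2)] del: free_module_simps)
        then show ?thesis unfolding multilinear_relations_def Let_def
          using h 2 lg(1) linear_map_closed[OF lg(2)] by blast
      qed
    qed
    then show "\<phi> \<in> {\<phi> \<in> carrier ?F. free_map R h \<phi> \<in> tensor_kernel R s N}"
      using \<phi> ker multilinear_relations_subset[OF assms(1)] by blast
  qed
  then have "tensor_kernel R s M \<subseteq> {\<phi> \<in> carrier ?F. free_map R h \<phi> \<in> tensor_kernel R s N}"
    unfolding tensor_kernel_def[of R s M]
    by (rule submodule_span_least[OF linear_map_vimage_submodule[OF free_module_module free_module_module lin sub]])
  then show "\<phi> \<in> tensor_kernel R s M \<Longrightarrow> free_map R h \<phi> \<in> tensor_kernel R s N" by blast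
qed

lemma tensor_map_coset:
  assumes "module R M" "module R N" "slotwise_linear R s M N h" "\<phi> \<in> carrier (free_module R (tuples s M))"
  shows "tensor_map R s M N h (tensor_kernel R s M +>\<^bsub>free_module R (tuples s M)\<^esub> \<phi>) =
    tensor_kernel R s N +>\<^bsub>free_module R (tuples s N)\<^esub> free_map R h \<phi>"
proof -
  interpret Q: quotient_module R "free_module R (tuples s M)" "tensor_kernel R s M"
    by (rule tensor_kernel_quotient[OF assms(1)])
  interpret Q': quotient_module R "free_module R (tuples s N)" "tensor_kernel R s N"
    by (rule tensor_kernel_quotient[OF assms(2)])
  have h: "h \<in> tuples s M \<rightarrow> tuples s N" using assms(3) by (auto simp: slotwise_linear_def)
  note lin = free_map_linear[OF h]
  have "tensor_kernel R s N +>\<^bsub>free_module R (tuples s N)\<^esub> free_map R h (\<kappa> \<oplus>\<^bsub>free_module R (tuples s M)\<^esub> \<phi>) =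
     tensor_kernel R s N +>\<^bsub>free_module R (tuples s N)\<^esub> free_map R h \<phi>" if \<kappa>: "\<kappa> \<in> tensor_kernel R s M" for \<kappa>
  proof -
    have "\<kappa> \<in> carrier (free_module R (tuples s M))" using \<kappa> Q.H_subset by blast
    then show ?thesis
      using linear_map_add[OF lin _ assms(4)] Q'.coset_add_left free_map_tensor_kernel[OF assms(1-3) \<kappa>]
        linear_map_closed[OF lin assms(4)] by simp
  qed
  from Q.Union_coset[OF assms(4), of "\<lambda>\<psi>. tensor_kernel R s N +>\<^bsub>free_module R (tuples s N)\<^esub> free_map R h \<psi>", OF this]
  show ?thesis using assms(4) by (simp add: tensor_map_def tensor_power_def Q.carrier_quot_module)
qed

lemma tensor_map_lin_hom:
  assumes "module R M" "module R N" "slotwise_linear R s M N h"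
  shows "tensor_map R s M N h \<in> lin_hom R (tensor_power R s M) (tensor_power R s N)"
proof -
  interpret Q: quotient_module R "free_module R (tuples s M)" "tensor_kernel R s M"
    by (rule tensor_kernel_quotient[OF assms(1)])
  interpret Q': quotient_module R "free_module R (tuples s N)" "tensor_kernel R s N"
    by (rule tensor_kernel_quotient[OF assms(2)])
  have h: "h \<in> tuples s M \<rightarrow> tuples s N" using assms(3) by (auto simp: slotwise_linear_def)
  note lin = free_map_linear[OF h]
  have "linear_map R (tensor_power R s M) (tensor_power R s N) (tensor_map R s M N h)"
    unfolding linear_map_def
  proof (intro conjI ballI)
    show "tensor_map R s M N h \<in> carrier (tensor_power R s M) \<rightarrow> carrier (tensor_power R s N)"
      using linear_map_closed[OF lin]
      by (auto simp: tensor_power_def Q.carrier_quot_module Q'.carrier_quot_module tensor_map_coset[OF assms])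
    fix t u assume "t \<in> carrier (tensor_power R s M)" "u \<in> carrier (tensor_power R s M)"
    then show "tensor_map R s M N h (t \<oplus>\<^bsub>tensor_power R s M\<^esub> u) = tensor_map R s M N h t \<oplus>\<^bsub>tensor_power R s N\<^esub> tensor_map R s M N h u"
      using linear_map_closed[OF lin]
      by (auto simp: tensor_power_def Q.carrier_quot_module tensor_map_coset[OF assms] linear_map_add[OF lin]
        Q.add_quot_module Q'.add_quot_module simp del: free_module_simps)
  next
    fix r t assume "r \<in> carrier R" "t \<in> carrier (tensor_power R s M)"
    then show "tensor_map R s M N h (r \<odot>\<^bsub>tensor_power R s M\<^esub> t) = r \<odot>\<^bsub>tensor_power R s N\<^esub> tensor_map R s M N h t"
      using linear_map_closed[OF lin]
      by (auto simp: tensor_power_def Q.carrier_quot_module tensor_map_coset[OF assms] linear_map_smult[OF lin]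
        Q.smult_quot_module Q'.smult_quot_module simp del: free_module_simps)
  qed
  then show ?thesis by (simp add: lin_hom_def tensor_map_def)
qed

lemma tensor_map_pure:
  assumes "module R M" "module R N" "slotwise_linear R s M N h" "xs \<in> tuples s M"
  shows "tensor_map R s M N h (pure_tensor R s M xs) = pure_tensor R s N (h xs)"
  unfolding pure_tensor_def using tensor_map_coset[OF assms(1-3)] assms(4) by (simp add: free_map_basis)

lemma pure_tensor_zero:
  assumes "module R M" "xs \<in> tuples s M" "\<zero>\<^bsub>M\<^esub> \<in> set xs"
  shows "pure_tensor R s M xs = \<zero>\<^bsub>tensor_power R s M\<^esub>"
proof -
  interpret M: module R M by fact
  interpret Q: quotient_module R "free_module R (tuples s M)" "tensor_kernel R s M"
    by (rule tensor_kernel_quotient[OF assms(1)])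
  obtain k where k: "k < s" "xs ! k = \<zero>\<^bsub>M\<^esub>" using assms(2,3) by (auto simp: tuples_def in_set_conv_nth)
  \<comment> \<open>Rewriting the zero entry as a zero multiple makes the tuple an instance of the
    scalar relation with r = 0.\<close>
  have xs: "xs = xs[k := \<zero> \<odot>\<^bsub>M\<^esub> \<zero>\<^bsub>M\<^esub>]" using k by (metis M.zero_closed M.smult_l_null list_update_id)
  let ?F = "free_module R (tuples s M)"
  have 1: "free_basis R (xs[k := \<zero> \<odot>\<^bsub>M\<^esub> \<zero>\<^bsub>M\<^esub>]) \<ominus>\<^bsub>?F\<^esub> (\<zero> \<odot>\<^bsub>?F\<^esub> free_basis R (xs[k := \<zero>\<^bsub>M\<^esub>])) \<in> multilinear_relations R s M"
    unfolding multilinear_relations_def Let_def using assms(2) k(1) by blast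
  have 2: "\<zero> \<odot>\<^bsub>?F\<^esub> free_basis R (xs[k := \<zero>\<^bsub>M\<^esub>]) = \<zero>\<^bsub>?F\<^esub>"
    using assms(2) by (simp add: tuples_update del: free_module_simps)
  have 3: "free_basis R (xs[k := \<zero> \<odot>\<^bsub>M\<^esub> \<zero>\<^bsub>M\<^esub>]) \<ominus>\<^bsub>?F\<^esub> \<zero>\<^bsub>?F\<^esub> = free_basis R xs"
    unfolding xs[symmetric] using assms(2)
    by (simp only: a_minus_def Q.M.add.inv_one[folded a_inv_def] Q.M.r_zero free_basis_closed)
  have "free_basis R xs \<in> tensor_kernel R s M"
    unfolding tensor_kernel_def by (rule subsetD[OF submodule_span_superset 1[unfolded 2 3]])
  then show ?thesis by (simp add: pure_tensor_def tensor_power_def Q.coset_zero Q.zero_quot_module)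
qed

end

section \<open>Polarized tensor powers\<close>

definition apply_list :: "('m \<Rightarrow> 'm) list \<Rightarrow> 'm list \<Rightarrow> 'm list" where
  "apply_list gs xs = map2 (\<lambda>g x. g x) gs xs"

lemma apply_list_slotwise_linear:
  assumes "length gs = s" "\<And>g. g \<in> set gs \<Longrightarrow> linear_map R M N g"
  shows "slotwise_linear R s M N (apply_list gs)"
  unfolding slotwise_linear_def
proof (intro ballI conjI allI impI)
  fix xs assume xs: "xs \<in> tuples s M"
  then have len: "length xs = s" by (simp add: tuples_def)
  have "g x \<in> carrier N" if "(g, x) \<in> set (zip gs xs)" for g x
    using set_zip_leftD[OF that] set_zip_rightD[OF that] xs assms(2) linear_map_closed by (fastforce simp: tuples_def)
  then show "apply_list gs xs \<in> tuples s N" using len assms(1) by (auto simp: tuples_def apply_list_def)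
  fix k assume k: "k < s"
  show "\<exists>l<s. \<exists>g. linear_map R M N g \<and> (\<forall>x\<in>carrier M. apply_list gs (xs[k := x]) = (apply_list gs xs)[l := g x])"
    using k len assms by (intro exI[of _ k] conjI exI[of _ "gs ! k"] ballI nth_equalityI)
      (auto simp: apply_list_def nth_list_update)
qed

lemma permute_list_slotwise_linear:
  assumes "\<sigma> permutes {..<s}"
  shows "slotwise_linear R s M M (permute_list \<sigma>)"
  unfolding slotwise_linear_def
proof (intro ballI conjI allI impI)
  fix xs assume xs: "xs \<in> tuples s M"
  then have len: "length xs = s" by (simp add: tuples_def)
  then show "permute_list \<sigma> xs \<in> tuples s M" using xs assms by (simp add: tuples_def)
  fix k assume k: "k < s"
  define l where "l = inv_into UNIV \<sigma> k"
  have l: "l < s" unfolding l_def using permutes_in_image[OF permutes_inv[OF assms], of k] k by simp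
  have *: "\<sigma> i = k \<longleftrightarrow> i = l" for i unfolding l_def using permutes_inverses[OF assms] by metis
  have **: "\<sigma> i < s" if "i < s" for i using permutes_in_image[OF assms, of i] that by simp
  have "permute_list \<sigma> (xs[k := x]) = (permute_list \<sigma> xs)[l := x]" for x
  proof (rule nth_equalityI)
    fix i assume "i < length (permute_list \<sigma> (xs[k := x]))"
    then have i: "i < s" using len by simp
    then show "permute_list \<sigma> (xs[k := x]) ! i = (permute_list \<sigma> xs)[l := x] ! i"
      using len k l *[of i] **[OF i] by (cases "i = l") (simp_all add: permute_list_def)
  qed (simp add: len)
  then show "\<exists>l<s. \<exists>g. linear_map R M M g \<and> (\<forall>x\<in>carrier M. permute_list \<sigma> (xs[k := x]) = (permute_list \<sigma> xs)[l := g x])"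
    using l linear_map_id by blast
qed

lemma map_slotwise_linear: "linear_map R M N g \<Longrightarrow> slotwise_linear R s M N (map g)"
  unfolding slotwise_linear_def
  by (auto simp: tuples_def map_update image_subset_iff intro: linear_map_closed)

text \<open>In Gamma^s Hom(M, N) this is the product, over the letters c of A, of the divided powers
  of degree \<open>count A c\<close> of \<open>fs c\<close>: the multiset codes the partition of s,
  and the words are its arrangements.\<close>

definition polarized_power ::
    "('r, 'x) ring_scheme \<Rightarrow> nat \<Rightarrow> ('r, 'm) module \<Rightarrow> ('r, 'm) module \<Rightarrow> nat multiset \<Rightarrow>
     (nat \<Rightarrow> 'm \<Rightarrow> 'm) \<Rightarrow> ('m list \<Rightarrow> 'r) set \<Rightarrow> ('m list \<Rightarrow> 'r) set" where
  "polarized_power R s M N A fs = (\<lambda>t\<in>carrier (tensor_power R s M).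
     \<Oplus>\<^bsub>tensor_power R s N\<^esub>w\<in>permutations_of_multiset A. tensor_map R s M N (apply_list (map fs w)) t)"

lemma permutations_of_multiset_length: "w \<in> permutations_of_multiset A \<Longrightarrow> length w = size A"
  by (auto simp: permutations_of_multiset_def)

lemma permutations_of_multiset_set: "w \<in> permutations_of_multiset A \<Longrightarrow> set w = set_mset A"
  by (auto simp: permutations_of_multiset_def)

context cring
begin

context
  fixes M N :: "('a, 'm) module" and s :: nat and A :: "nat multiset" and fs :: "nat \<Rightarrow> 'm \<Rightarrow> 'm"
  assumes modules: "module R M" "module R N" and size_A: "size A = s"
    and fs_linear: "\<And>i. i \<in># A \<Longrightarrow> linear_map R M N (fs i)"
begin

lemma word_slotwise_linear:
  "w \<in> permutations_of_multiset A \<Longrightarrow> slotwise_linear R s M N (apply_list (map fs w))"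
  using fs_linear permutations_of_multiset_length[of w A] permutations_of_multiset_set[of w A] size_A
  by (intro apply_list_slotwise_linear) auto

lemma word_map_linear:
  "w \<in> permutations_of_multiset A \<Longrightarrow>
   linear_map R (tensor_power R s M) (tensor_power R s N) (tensor_map R s M N (apply_list (map fs w)))"
  using tensor_map_lin_hom[OF modules word_slotwise_linear] lin_hom_linear_map by blast

lemma polarized_power_lin_hom:
  "polarized_power R s M N A fs \<in> lin_hom R (tensor_power R s M) (tensor_power R s N)"
  unfolding polarized_power_def
  by (intro restrict_lin_hom tensor_power_module linear_map_finsum_fun modules word_map_linear)

lemma polarized_power_pure:
  assumes "xs \<in> tuples s M"
  shows "polarized_power R s M N A fs (pure_tensor R s M xs) =
    (\<Oplus>\<^bsub>tensor_power R s N\<^esub>w\<in>permutations_of_multiset A. pure_tensor R s N (apply_list (map fs w) xs))"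
proof -
  interpret T: module R "tensor_power R s N" by (rule tensor_power_module[OF modules(2)])
  have "apply_list (map fs w) xs \<in> tuples s N" if "w \<in> permutations_of_multiset A" for w
    using word_slotwise_linear[OF that] assms by (auto simp: slotwise_linear_def)
  then show ?thesis unfolding polarized_power_def restrict_apply'[OF pure_tensor_closed[OF modules(1) assms]]
    using pure_tensor_closed[OF modules(2)]
    by (intro T.finsum_cong') (auto simp: tensor_map_pure[OF modules word_slotwise_linear assms])
qed

text \<open>Permuting the slots of a summand permutes its word, and this only permutes the set of
  all words.\<close>

lemma polarized_power_schur: "polarized_power R s M N A fs \<in> carrier (schur_hom R s M N)"
proof -
  interpret T: module R "tensor_power R s N" by (rule tensor_power_module[OF modules(2)])
  note lin = lin_hom_linear_map[OF polarized_power_lin_hom]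
  have "polarized_power R s M N A fs (tensor_perm R s M \<sigma> t) = tensor_perm R s N \<sigma> (polarized_power R s M N A fs t)"
    if \<sigma>: "\<sigma> permutes {..<s}" and t: "t \<in> carrier (tensor_power R s M)" for \<sigma> t
  proof -
    have perm: "linear_map R (tensor_power R s L) (tensor_power R s L) (tensor_perm R s L \<sigma>)" if "module R L" for L :: "('a, 'm) module"
      unfolding tensor_perm_def
      by (rule lin_hom_linear_map[OF tensor_map_lin_hom[OF that that permute_list_slotwise_linear[OF \<sigma>]]])
    show ?thesis
    proof (rule tensor_linear_eq[OF modules(1) T.module_axioms _ _ _ t])
      show "linear_map R (tensor_power R s M) (tensor_power R s N) (\<lambda>t. polarized_power R s M N A fs (tensor_perm R s M \<sigma> t))"
        by (rule linear_map_comp[OF perm[OF modules(1)] lin])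
      show "linear_map R (tensor_power R s M) (tensor_power R s N) (\<lambda>t. tensor_perm R s N \<sigma> (polarized_power R s M N A fs t))"
        by (rule linear_map_comp[OF lin perm[OF modules(2)]])
      fix xs assume xs: "xs \<in> tuples s M"
      then have len: "length xs = s" by (simp add: tuples_def)
      have pxs: "permute_list \<sigma> xs \<in> tuples s M"
        using permute_list_slotwise_linear[OF \<sigma>, of R M] xs by (auto simp: slotwise_linear_def)
      have tup: "apply_list (map fs w) ys \<in> tuples s N" if "w \<in> permutations_of_multiset A" "ys \<in> tuples s M" for w ys
        using word_slotwise_linear[OF that(1)] that(2) by (auto simp: slotwise_linear_def)
      have ptup: "permute_list \<sigma> ys \<in> tuples s N" if "ys \<in> tuples s N" for ys
        using permute_list_slotwise_linear[OF \<sigma>, of R N] that by (auto simp: slotwise_linear_def)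
      have lenw: "length w = s" if "w \<in> permutations_of_multiset A" for w
        using permutations_of_multiset_length[OF that] size_A by simp
      have perm_app: "permute_list \<sigma> (apply_list (map fs w) xs) = apply_list (map fs (permute_list \<sigma> w)) (permute_list \<sigma> xs)"
        if "w \<in> permutations_of_multiset A" for w
      proof -
        have s: "\<sigma> permutes {..<length w}" "\<sigma> permutes {..<length (zip (map fs w) xs)}" using \<sigma> lenw[OF that] len by simp_all
        show ?thesis unfolding apply_list_def
          using lenw[OF that] len \<sigma>
          by (simp add: permute_list_map[OF s(2)] permute_list_zip[of \<sigma> "{..<s}"] permute_list_map[OF s(1)])
      qed
      have inj: "inj_on (permute_list \<sigma>) (permutations_of_multiset A)"
      proof (rule inj_onI)
        fix w w' assume w: "w \<in> permutations_of_multiset A" "w' \<in> permutations_of_multiset A"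
          and eq: "permute_list \<sigma> w = permute_list \<sigma> w'"
        have "w ! i = w' ! i" if "i < s" for i
        proof -
          have "i \<in> \<sigma> ` {..<s}" using permutes_image[OF \<sigma>] that by simp
          then obtain k where k: "k < s" "i = \<sigma> k" by auto
          then show ?thesis using arg_cong[OF eq, of "\<lambda>v. v ! k"] lenw[OF w(1)] lenw[OF w(2)]
            by (simp add: permute_list_def)
        qed
        then show "w = w'" using lenw[OF w(1)] lenw[OF w(2)] by (intro nth_equalityI) auto
      qed
      have img: "permute_list \<sigma> ` permutations_of_multiset A = permutations_of_multiset A"
      proof (rule card_subset_eq)
        show "permute_list \<sigma> ` permutations_of_multiset A \<subseteq> permutations_of_multiset A"
          using lenw \<sigma> by (auto simp: permutations_of_multiset_def)
        show "card (permute_list \<sigma> ` permutations_of_multiset A) = card (permutations_of_multiset A)"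
          by (rule card_image[OF inj])
      qed simp
      have "tensor_perm R s N \<sigma> (polarized_power R s M N A fs (pure_tensor R s M xs)) =
        (\<Oplus>\<^bsub>tensor_power R s N\<^esub>w\<in>permutations_of_multiset A. tensor_perm R s N \<sigma> (pure_tensor R s N (apply_list (map fs w) xs)))"
        unfolding polarized_power_pure[OF xs]
        by (rule linear_map_finsum[OF T.module_axioms T.module_axioms perm[OF modules(2)]])
          (use tup[OF _ xs] pure_tensor_closed[OF modules(2)] in blast)
      also have "\<dots> = (\<Oplus>\<^bsub>tensor_power R s N\<^esub>w\<in>permutations_of_multiset A.
          pure_tensor R s N (apply_list (map fs (permute_list \<sigma> w)) (permute_list \<sigma> xs)))"
      proof (rule T.finsum_cong', goal_cases)
        case 2
        show ?case
          using tup[OF _ xs] ptup pure_tensor_closed[OF modules(2)] by (auto simp flip: perm_app)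
      next
        case (3 w)
        then show ?case
          using tup[OF 3 xs] by (simp add: tensor_perm_def perm_app
            tensor_map_pure[OF modules(2) modules(2) permute_list_slotwise_linear[OF \<sigma>]])
      qed simp
      also have "\<dots> = (\<Oplus>\<^bsub>tensor_power R s N\<^esub>w\<in>permute_list \<sigma> ` permutations_of_multiset A.
          pure_tensor R s N (apply_list (map fs w) (permute_list \<sigma> xs)))"
        using tup[OF _ pxs] pure_tensor_closed[OF modules(2)]
        by (intro T.finsum_reindex[symmetric] inj) (auto simp: img)
      also have "\<dots> = polarized_power R s M N A fs (pure_tensor R s M (permute_list \<sigma> xs))"
        by (simp add: img polarized_power_pure[OF pxs])
      also have "pure_tensor R s M (permute_list \<sigma> xs) = tensor_perm R s M \<sigma> (pure_tensor R s M xs)"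
        unfolding tensor_perm_def
        by (rule tensor_map_pure[OF modules(1) modules(1) permute_list_slotwise_linear[OF \<sigma>] xs, symmetric])
      finally show "polarized_power R s M N A fs (tensor_perm R s M \<sigma> (pure_tensor R s M xs)) =
        tensor_perm R s N \<sigma> (polarized_power R s M N A fs (pure_tensor R s M xs))" by simp
    qed
  qed
  then show ?thesis using polarized_power_lin_hom by (simp add: schur_hom_def)
qed

text \<open>Every word contains the letter i, so every summand has a zero slot.\<close>

lemma polarized_power_zero:
  assumes "i \<in># A" "\<And>x. x \<in> carrier M \<Longrightarrow> fs i x = \<zero>\<^bsub>N\<^esub>" "t \<in> carrier (tensor_power R s M)"
  shows "polarized_power R s M N A fs t = \<zero>\<^bsub>tensor_power R s N\<^esub>"
proof -
  interpret T: module R "tensor_power R s N" by (rule tensor_power_module[OF modules(2)])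
  show ?thesis
  proof (rule tensor_linear_eq[OF modules(1) T.module_axioms lin_hom_linear_map[OF polarized_power_lin_hom]
        linear_map_zero_fun[OF T.module_axioms] _ assms(3)])
    fix xs assume xs: "xs \<in> tuples s M"
    have "pure_tensor R s N (apply_list (map fs w) xs) = \<zero>\<^bsub>tensor_power R s N\<^esub>" if w: "w \<in> permutations_of_multiset A" for w
    proof (rule pure_tensor_zero[OF modules(2)])
      show "apply_list (map fs w) xs \<in> tuples s N"
        using word_slotwise_linear[OF w] xs by (auto simp: slotwise_linear_def)
      obtain k where k: "k < length w" "w ! k = i"
        using permutations_of_multiset_set[OF w] assms(1) by (metis in_set_conv_nth)
      have len: "length xs = s" "length w = s" using xs permutations_of_multiset_length[OF w] size_A by (auto simp: tuples_def)
      then have "xs ! k \<in> carrier M" using xs k by (auto simp: tuples_def)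
      then have "apply_list (map fs w) xs ! k = \<zero>\<^bsub>N\<^esub>"
        using k len assms(2) by (simp add: apply_list_def)
      moreover have "k < length (apply_list (map fs w) xs)" using k len by (simp add: apply_list_def)
      ultimately show "\<zero>\<^bsub>N\<^esub> \<in> set (apply_list (map fs w) xs)" by (metis nth_mem)
    qed
    then show "polarized_power R s M N A fs (pure_tensor R s M xs) = \<zero>\<^bsub>tensor_power R s N\<^esub>"
      unfolding polarized_power_pure[OF xs] by (simp cong: T.finsum_cong)
  qed
qed

end

lemma tensor_power_map_lin_hom:
  "module R M \<Longrightarrow> module R N \<Longrightarrow> linear_map R M N f \<Longrightarrow>
   tensor_power_map R s M N f \<in> lin_hom R (tensor_power R s M) (tensor_power R s N)"
  unfolding tensor_power_map_def by (rule tensor_map_lin_hom[OF _ _ map_slotwise_linear])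

lemma tensor_power_map_pure:
  "module R M \<Longrightarrow> module R N \<Longrightarrow> linear_map R M N f \<Longrightarrow> xs \<in> tuples s M \<Longrightarrow>
   tensor_power_map R s M N f (pure_tensor R s M xs) = pure_tensor R s N (map f xs)"
  unfolding tensor_power_map_def by (rule tensor_map_pure[OF _ _ map_slotwise_linear])

lemma lin_hom_eqI:
  assumes "f \<in> lin_hom R M N" "g \<in> lin_hom R M N" "\<And>x. x \<in> carrier M \<Longrightarrow> f x = g x"
  shows "f = g"
  using assms unfolding lin_hom_def by (auto intro: extensionalityI)

lemma tensor_lin_hom_eqI:
  assumes "module R M" "module R N" "f \<in> lin_hom R (tensor_power R s M) N" "g \<in> lin_hom R (tensor_power R s M) N"
    and "\<And>xs. xs \<in> tuples s M \<Longrightarrow> f (pure_tensor R s M xs) = g (pure_tensor R s M xs)"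
  shows "f = g"
  by (rule lin_hom_eqI[OF assms(3,4)], rule tensor_linear_eq[OF assms(1,2)])
    (use assms lin_hom_linear_map in blast)+

lemma compose_lin_hom:
  "module R L \<Longrightarrow> f \<in> lin_hom R L M \<Longrightarrow> g \<in> lin_hom R M N \<Longrightarrow> compose (carrier L) g f \<in> lin_hom R L N"
  unfolding compose_def by (intro restrict_lin_hom linear_map_comp[OF lin_hom_linear_map lin_hom_linear_map])

lemma polarized_power_const:
  assumes "module R M" "module R N" "size A = s" "linear_map R M N f" "t \<in> carrier (tensor_power R s M)"
  shows "polarized_power R s M N A (\<lambda>_. f) t =
    ([card (permutations_of_multiset A)] \<cdot>\<^bsub>R\<^esub> \<one>) \<odot>\<^bsub>tensor_power R s N\<^esub> tensor_power_map R s M N f t"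
proof -
  interpret T: module R "tensor_power R s N" by (rule tensor_power_module[OF assms(2)])
  let ?r = "[card (permutations_of_multiset A)] \<cdot> \<one>"
  have r: "?r \<in> carrier R" by simp
  have tl: "linear_map R (tensor_power R s M) (tensor_power R s N) (tensor_power_map R s M N f)"
    by (rule lin_hom_linear_map[OF tensor_power_map_lin_hom[OF assms(1,2,4)]])
  have smult: "linear_map R (tensor_power R s M) (tensor_power R s N) (\<lambda>t. ?r \<odot>\<^bsub>tensor_power R s N\<^esub> tensor_power_map R s M N f t)"
    using r linear_map_closed[OF tl]
    by (auto simp: linear_map_def linear_map_add[OF tl] linear_map_smult[OF tl] T.smult_r_distr
      T.smult_assoc1[symmetric] m_comm)
  show ?thesis
  proof (rule tensor_linear_eq[OF assms(1) T.module_axioms _ smult _ assms(5)])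
    show "linear_map R (tensor_power R s M) (tensor_power R s N) (polarized_power R s M N A (\<lambda>_. f))"
      by (rule lin_hom_linear_map[OF polarized_power_lin_hom[OF assms(1-3)]]) (rule assms(4))
    fix xs assume xs: "xs \<in> tuples s M"
    then have len: "length xs = s" by (simp add: tuples_def)
    have app: "apply_list (map (\<lambda>_. f) w) xs = map f xs" if "w \<in> permutations_of_multiset A" for w
      using permutations_of_multiset_length[OF that] len assms(3)
      by (intro nth_equalityI) (simp_all add: apply_list_def)
    have fxs: "pure_tensor R s N (map f xs) \<in> carrier (tensor_power R s N)"
      using map_slotwise_linear[OF assms(4), of s] xs by (intro pure_tensor_closed[OF assms(2)]) (auto simp: slotwise_linear_def)
    have "polarized_power R s M N A (\<lambda>_. f) (pure_tensor R s M xs) =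
       (\<Oplus>\<^bsub>tensor_power R s N\<^esub>w\<in>permutations_of_multiset A. pure_tensor R s N (map f xs))"
      unfolding polarized_power_pure[OF assms(1-4) xs]
      using fxs by (intro T.finsum_cong') (auto simp: app)
    also have "\<dots> = [card (permutations_of_multiset A)] \<cdot>\<^bsub>tensor_power R s N\<^esub> pure_tensor R s N (map f xs)"
      by (rule T.add.finprod_const[OF fxs])
    also have "\<dots> = ?r \<odot>\<^bsub>tensor_power R s N\<^esub> pure_tensor R s N (map f xs)"
      by (rule smult_add_pow_one[OF T.module_axioms fxs, symmetric])
    finally show "polarized_power R s M N A (\<lambda>_. f) (pure_tensor R s M xs) =
        ?r \<odot>\<^bsub>tensor_power R s N\<^esub> tensor_power_map R s M N f (pure_tensor R s M xs)"
      by (simp add: tensor_power_map_pure[OF assms(1,2,4) xs])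
  qed
qed

lemma polarized_power_cong:
  assumes "module R M" "module R N" "size A = s" "\<And>i. i \<in># A \<Longrightarrow> linear_map R M N (fs i)"
    and "\<And>i x. i \<in># A \<Longrightarrow> x \<in> carrier M \<Longrightarrow> gs i x = fs i x"
  shows "polarized_power R s M N A gs = polarized_power R s M N A fs"
proof -
  have gs: "linear_map R M N (gs i)" if "i \<in># A" for i
    by (rule linear_map_cong[OF assms(1) _ assms(4)[OF that]]) (simp add: assms(5)[OF that])
  have app: "apply_list (map gs w) xs = apply_list (map fs w) xs" if w: "w \<in> permutations_of_multiset A" and xs: "xs \<in> tuples s M" for w xs
  proof (rule nth_equalityI)
    show "length (apply_list (map gs w) xs) = length (apply_list (map fs w) xs)" by (simp add: apply_list_def)
    fix k assume "k < length (apply_list (map gs w) xs)"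
    then have k: "k < length w" "k < length xs" by (auto simp: apply_list_def)
    then have "w ! k \<in># A" "xs ! k \<in> carrier M"
      using permutations_of_multiset_set[OF w] nth_mem[OF k(1)] nth_mem[OF k(2)] xs by (auto simp: tuples_def)
    then show "apply_list (map gs w) xs ! k = apply_list (map fs w) xs ! k"
      using k assms(5) by (simp add: apply_list_def)
  qed
  show ?thesis
  proof (rule tensor_lin_hom_eqI[OF assms(1) tensor_power_module[OF assms(2)]
       polarized_power_lin_hom[OF assms(1-3) gs] polarized_power_lin_hom[OF assms(1-4)]])
    fix xs assume xs: "xs \<in> tuples s M"
    interpret T: module R "tensor_power R s N" by (rule tensor_power_module[OF assms(2)])
    have "apply_list (map fs w) xs \<in> tuples s N" if "w \<in> permutations_of_multiset A" for w
      using word_slotwise_linear[OF assms(1-4) that] xs by (auto simp: slotwise_linear_def)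
    then have "(\<Oplus>\<^bsub>tensor_power R s N\<^esub>w\<in>permutations_of_multiset A. pure_tensor R s N (apply_list (map gs w) xs)) =
        (\<Oplus>\<^bsub>tensor_power R s N\<^esub>w\<in>permutations_of_multiset A. pure_tensor R s N (apply_list (map fs w) xs))"
      using pure_tensor_closed[OF assms(2)] by (intro T.finsum_cong') (auto simp: app[OF _ xs])
    then show "polarized_power R s M N A gs (pure_tensor R s M xs) = polarized_power R s M N A fs (pure_tensor R s M xs)"
      using polarized_power_pure[OF assms(1-3) gs xs] polarized_power_pure[OF assms(1-4) xs] by simp
  qed
qed

text \<open>Composition with the tensor power of one map acts on the letters one by one. Together
  with \<open>polarized_power_compose_right\<close> this moves a face on either side of a polarized
  operator into its entries.\<close>

lemma polarized_power_compose_left: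
  assumes "module R L" "module R M" "module R N" "size A = s" "\<And>i. i \<in># A \<Longrightarrow> linear_map R L M (fs i)"
    and "linear_map R M N g"
  shows "polarized_power R s L N A (\<lambda>i x. g (fs i x)) =
    compose (carrier (tensor_power R s L)) (tensor_power_map R s M N g) (polarized_power R s L M A fs)"
proof -
  have gfs: "linear_map R L N (\<lambda>x. g (fs i x))" if "i \<in># A" for i
    by (rule linear_map_comp[OF assms(5)[OF that] assms(6)])
  interpret TM: module R "tensor_power R s M" by (rule tensor_power_module[OF assms(2)])
  interpret TN: module R "tensor_power R s N" by (rule tensor_power_module[OF assms(3)])
  note tg = tensor_power_map_lin_hom[OF assms(2,3,6)]
  show ?thesis
  proof (rule tensor_lin_hom_eqI[OF assms(1) TN.module_axioms polarized_power_lin_hom[OF assms(1,3,4) gfs]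
      compose_lin_hom[OF tensor_power_module[OF assms(1)] polarized_power_lin_hom[OF assms(1,2,4,5)] tg]])
    fix xs assume xs: "xs \<in> tuples s L"
    have tup: "apply_list (map fs w) xs \<in> tuples s M" if "w \<in> permutations_of_multiset A" for w
      using word_slotwise_linear[OF assms(1,2,4,5) that] xs by (auto simp: slotwise_linear_def)
    have app: "apply_list (map (\<lambda>i x. g (fs i x)) w) xs = map g (apply_list (map fs w) xs)" for w
      by (rule nth_equalityI) (simp_all add: apply_list_def)
    have gtup: "map g ys \<in> tuples s N" if "ys \<in> tuples s M" for ys
      using map_slotwise_linear[OF assms(6), of s] that by (auto simp: slotwise_linear_def)
    have "compose (carrier (tensor_power R s L)) (tensor_power_map R s M N g) (polarized_power R s L M A fs) (pure_tensor R s L xs) =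
       tensor_power_map R s M N g (\<Oplus>\<^bsub>tensor_power R s M\<^esub>w\<in>permutations_of_multiset A. pure_tensor R s M (apply_list (map fs w) xs))"
      using pure_tensor_closed[OF assms(1) xs] by (simp add: compose_eq polarized_power_pure[OF assms(1,2,4,5) xs])
    also have "\<dots> = (\<Oplus>\<^bsub>tensor_power R s N\<^esub>w\<in>permutations_of_multiset A. tensor_power_map R s M N g (pure_tensor R s M (apply_list (map fs w) xs)))"
      by (rule linear_map_finsum[OF TM.module_axioms TN.module_axioms lin_hom_linear_map[OF tg]])
        (use tup pure_tensor_closed[OF assms(2)] in blast)
    also have "\<dots> = (\<Oplus>\<^bsub>tensor_power R s N\<^esub>w\<in>permutations_of_multiset A. pure_tensor R s N (apply_list (map (\<lambda>i x. g (fs i x)) w) xs))"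
      using tup gtup pure_tensor_closed[OF assms(3)]
      by (intro TN.finsum_cong') (auto simp: app tensor_power_map_pure[OF assms(2,3,6)])
    finally show "polarized_power R s L N A (\<lambda>i x. g (fs i x)) (pure_tensor R s L xs) =
      compose (carrier (tensor_power R s L)) (tensor_power_map R s M N g) (polarized_power R s L M A fs) (pure_tensor R s L xs)"
      by (simp add: polarized_power_pure[OF assms(1,3,4) gfs xs])
  qed
qed

lemma polarized_power_compose_right:
  assumes "module R L" "module R M" "module R N" "size A = s" "linear_map R L M g"
    and "\<And>i. i \<in># A \<Longrightarrow> linear_map R M N (fs i)"
  shows "polarized_power R s L N A (\<lambda>i x. fs i (g x)) =
    compose (carrier (tensor_power R s L)) (polarized_power R s M N A fs) (tensor_power_map R s L M g)"
proof -
  have fsg: "linear_map R L N (\<lambda>x. fs i (g x))" if "i \<in># A" for i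
    by (rule linear_map_comp[OF assms(5) assms(6)[OF that]])
  note tg = tensor_power_map_lin_hom[OF assms(1,2,5)]
  show ?thesis
  proof (rule tensor_lin_hom_eqI[OF assms(1) tensor_power_module[OF assms(3)] polarized_power_lin_hom[OF assms(1,3,4) fsg]
      compose_lin_hom[OF tensor_power_module[OF assms(1)] tg polarized_power_lin_hom[OF assms(2,3,4,6)]]])
    fix xs assume xs: "xs \<in> tuples s L"
    have gxs: "map g xs \<in> tuples s M"
      using map_slotwise_linear[OF assms(5), of s] xs by (auto simp: slotwise_linear_def)
    have app: "apply_list (map (\<lambda>i x. fs i (g x)) w) xs = apply_list (map fs w) (map g xs)" for w
      by (rule nth_equalityI) (simp_all add: apply_list_def)
    show "polarized_power R s L N A (\<lambda>i x. fs i (g x)) (pure_tensor R s L xs) =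
      compose (carrier (tensor_power R s L)) (polarized_power R s M N A fs) (tensor_power_map R s L M g) (pure_tensor R s L xs)"
      using pure_tensor_closed[OF assms(1) xs]
      by (simp add: compose_eq polarized_power_pure[OF assms(1,3,4) fsg xs] polarized_power_pure[OF assms(2,3,4,6) gxs]
        tensor_power_map_pure[OF assms(1,2,5) xs] app)
  qed
qed

end

context cring
begin

lemma tensor_power_map_schur:
  fixes M N :: "('a, 'm) module"
  assumes "module R M" "module R N" "linear_map R M N f"
  shows "tensor_power_map R s M N f \<in> carrier (schur_hom R s M N)"
proof -
  note tf = tensor_power_map_lin_hom[OF assms, of s]
  have "tensor_power_map R s M N f (tensor_perm R s M \<sigma> t) = tensor_perm R s N \<sigma> (tensor_power_map R s M N f t)"
    if \<sigma>: "\<sigma> permutes {..<s}" and t: "t \<in> carrier (tensor_power R s M)" for \<sigma> t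
  proof -
    have perm: "linear_map R (tensor_power R s L) (tensor_power R s L) (tensor_perm R s L \<sigma>)" if "module R L" for L :: "('a, 'm) module"
      unfolding tensor_perm_def
      by (rule lin_hom_linear_map[OF tensor_map_lin_hom[OF that that permute_list_slotwise_linear[OF \<sigma>]]])
    show ?thesis
    proof (rule tensor_linear_eq[OF assms(1) tensor_power_module[OF assms(2)] linear_map_comp[OF perm[OF assms(1)] lin_hom_linear_map[OF tf]]
        linear_map_comp[OF lin_hom_linear_map[OF tf] perm[OF assms(2)]] _ t])
      fix xs assume xs: "xs \<in> tuples s M"
      have "permute_list \<sigma> xs \<in> tuples s M" "map f xs \<in> tuples s N"
        using permute_list_slotwise_linear[OF \<sigma>, of R M] map_slotwise_linear[OF assms(3), of s] xs
        by (auto simp: slotwise_linear_def)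
      moreover have "permute_list \<sigma> (map f xs) = map f (permute_list \<sigma> xs)"
        using permute_list_map[of \<sigma> xs f] \<sigma> xs by (simp add: tuples_def)
      ultimately show "tensor_power_map R s M N f (tensor_perm R s M \<sigma> (pure_tensor R s M xs)) =
         tensor_perm R s N \<sigma> (tensor_power_map R s M N f (pure_tensor R s M xs))"
        by (simp add: tensor_perm_def xs tensor_power_map_pure[OF assms] tensor_map_pure[OF assms(1,1) permute_list_slotwise_linear[OF \<sigma>]]
          tensor_map_pure[OF assms(2,2) permute_list_slotwise_linear[OF \<sigma>]])
    qed
  qed
  then show ?thesis using tf by (simp add: schur_hom_def)
qed

lemma tensor_power_map_cong:
  assumes "module R M" "module R N" "linear_map R M N f" "\<And>x. x \<in> carrier M \<Longrightarrow> g x = f x"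
  shows "tensor_power_map R s M N g = tensor_power_map R s M N f"
proof -
  have g: "linear_map R M N g" by (rule linear_map_cong[OF assms(1) _ assms(3)]) (simp add: assms(4))
  show ?thesis
  proof (rule tensor_lin_hom_eqI[OF assms(1) tensor_power_module[OF assms(2)]
      tensor_power_map_lin_hom[OF assms(1,2) g] tensor_power_map_lin_hom[OF assms(1-3)]])
    fix xs assume xs: "xs \<in> tuples s M"
    then have "map g xs = map f xs" using assms(4) by (auto simp: tuples_def)
    then show "tensor_power_map R s M N g (pure_tensor R s M xs) = tensor_power_map R s M N f (pure_tensor R s M xs)"
      by (simp only: tensor_power_map_pure[OF assms(1,2) g xs] tensor_power_map_pure[OF assms(1-3) xs])
  qed
qed

lemma tensor_power_map_compose:
  assumes "module R L" "module R M" "module R N" "linear_map R L M f" "linear_map R M N g"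
  shows "tensor_power_map R s L N (\<lambda>x. g (f x)) =
    compose (carrier (tensor_power R s L)) (tensor_power_map R s M N g) (tensor_power_map R s L M f)"
proof (rule tensor_lin_hom_eqI[OF assms(1) tensor_power_module[OF assms(3)]
     tensor_power_map_lin_hom[OF assms(1,3) linear_map_comp[OF assms(4,5)]]
     compose_lin_hom[OF tensor_power_module[OF assms(1)] tensor_power_map_lin_hom[OF assms(1,2,4)] tensor_power_map_lin_hom[OF assms(2,3,5)]]])
  fix xs assume xs: "xs \<in> tuples s L"
  have "map f xs \<in> tuples s M" using map_slotwise_linear[OF assms(4), of s] xs by (auto simp: slotwise_linear_def)
  then show "tensor_power_map R s L N (\<lambda>x. g (f x)) (pure_tensor R s L xs) =
    compose (carrier (tensor_power R s L)) (tensor_power_map R s M N g) (tensor_power_map R s L M f) (pure_tensor R s L xs)"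
    using pure_tensor_closed[OF assms(1) xs] xs
    by (simp add: compose_eq tensor_power_map_pure[OF assms(1,3) linear_map_comp[OF assms(4,5)]]
      tensor_power_map_pure[OF assms(1,2,4)] tensor_power_map_pure[OF assms(2,3,5)] comp_def)
qed

lemma tensor_power_map_id:
  assumes "module R M"
  shows "tensor_power_map R s M M (\<lambda>x. x) = (\<lambda>t\<in>carrier (tensor_power R s M). t)"
  by (rule tensor_lin_hom_eqI[OF assms tensor_power_module[OF assms] tensor_power_map_lin_hom[OF assms assms linear_map_id]
      restrict_lin_hom[OF tensor_power_module[OF assms] linear_map_id]])
    (simp add: tensor_power_map_pure[OF assms assms linear_map_id] pure_tensor_closed[OF assms])

end

section \<open>Strict polynomial functors on maps and on simplicial modules\<close>

lemma proj_objects_module: "M \<in> proj_objects R \<Longrightarrow> module R M"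
  by (simp add: proj_objects_def)

context strict_poly_functor
begin

definition ordinary_arr :: "('r, 'm) module \<Rightarrow> ('r, 'm) module \<Rightarrow> ('m \<Rightarrow> 'm) \<Rightarrow> 'n \<Rightarrow> 'n" where
  "ordinary_arr M N f = farr F M N (tensor_power_map R s M N f)"

definition polarized_arr ::
    "nat multiset \<Rightarrow> ('r, 'm) module \<Rightarrow> ('r, 'm) module \<Rightarrow> (nat \<Rightarrow> 'm \<Rightarrow> 'm) \<Rightarrow> 'n \<Rightarrow> 'n" where
  "polarized_arr A M N fs = farr F M N (polarized_power R s M N A fs)"

lemma cring_R: "M \<in> proj_objects R \<Longrightarrow> cring R"
  using proj_objects_module[of M R] by (simp add: module_def)

lemma farr_lin_hom:
  "M \<in> proj_objects R \<Longrightarrow> N \<in> proj_objects R \<Longrightarrow> f \<in> carrier (schur_hom R s M N) \<Longrightarrow>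
   farr F M N f \<in> lin_hom R (fobj F M) (fobj F N)"
  using linear_map_closed[OF farr_linear] by (simp add: hom_module_def)

lemma farr_smult:
  assumes "M \<in> proj_objects R" "N \<in> proj_objects R" "f \<in> carrier (schur_hom R s M N)" "r \<in> carrier R"
    and "x \<in> carrier (fobj F M)"
  shows "farr F M N (\<lambda>t\<in>carrier (tensor_power R s M). r \<odot>\<^bsub>tensor_power R s N\<^esub> f t) x = r \<odot>\<^bsub>fobj F N\<^esub> farr F M N f x"
  using linear_map_smult[OF farr_linear[OF assms(1,2)] assms(4,3)] assms(5)
  by (simp add: schur_hom_def hom_module_def)

lemma ordinary_arr_linear:
  assumes "M \<in> proj_objects R" "N \<in> proj_objects R" "linear_map R M N f"
  shows "linear_map R (fobj F M) (fobj F N) (ordinary_arr M N f)"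
  unfolding ordinary_arr_def
  by (rule lin_hom_linear_map[OF farr_lin_hom[OF assms(1,2)
     cring.tensor_power_map_schur[OF cring_R[OF assms(1)] proj_objects_module[OF assms(1)] proj_objects_module[OF assms(2)] assms(3)]]])

lemma ordinary_arr_cong:
  assumes "M \<in> proj_objects R" "N \<in> proj_objects R" "linear_map R M N f" "\<And>x. x \<in> carrier M \<Longrightarrow> g x = f x"
  shows "ordinary_arr M N g = ordinary_arr M N f"
  unfolding ordinary_arr_def
  using cring.tensor_power_map_cong[OF cring_R[OF assms(1)] proj_objects_module[OF assms(1)] proj_objects_module[OF assms(2)] assms(3,4)]
  by simp

lemma ordinary_arr_comp:
  assumes "L \<in> proj_objects R" "M \<in> proj_objects R" "N \<in> proj_objects R" "linear_map R L M f" "linear_map R M N g"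
    and "x \<in> carrier (fobj F L)"
  shows "ordinary_arr L N (\<lambda>x. g (f x)) x = ordinary_arr M N g (ordinary_arr L M f x)"
proof -
  interpret cring R by (rule cring_R[OF assms(1)])
  note m = assms(1-3)[THEN proj_objects_module]
  show ?thesis unfolding ordinary_arr_def tensor_power_map_compose[OF m assms(4,5)]
    using farr_comp[OF assms(1-3) tensor_power_map_schur[OF m(1,2) assms(4)] tensor_power_map_schur[OF m(2,3) assms(5)]]
      assms(6) by (simp add: compose_eq)
qed

lemma ordinary_arr_id:
  assumes "M \<in> proj_objects R" "x \<in> carrier (fobj F M)"
  shows "ordinary_arr M M (\<lambda>x. x) x = x"
  unfolding ordinary_arr_def
  using cring.tensor_power_map_id[OF cring_R[OF assms(1)] proj_objects_module[OF assms(1)]] farr_id[OF assms(1)] assms(2)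
  by simp

lemma polarized_arr_linear:
  assumes "M \<in> proj_objects R" "N \<in> proj_objects R" "size A = s" "\<And>i. i \<in># A \<Longrightarrow> linear_map R M N (fs i)"
  shows "linear_map R (fobj F M) (fobj F N) (polarized_arr A M N fs)"
  unfolding polarized_arr_def
  by (rule lin_hom_linear_map[OF farr_lin_hom[OF assms(1,2) cring.polarized_power_schur[where fs = fs, OF cring_R[OF assms(1)]
     proj_objects_module[OF assms(1)] proj_objects_module[OF assms(2)] assms(3,4)]]])

lemma polarized_arr_cong:
  assumes "M \<in> proj_objects R" "N \<in> proj_objects R" "size A = s" "\<And>i. i \<in># A \<Longrightarrow> linear_map R M N (fs i)"
    and "\<And>i x. i \<in># A \<Longrightarrow> x \<in> carrier M \<Longrightarrow> gs i x = fs i x"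
  shows "polarized_arr A M N gs = polarized_arr A M N fs"
  unfolding polarized_arr_def
  using cring.polarized_power_cong[where fs = fs, OF cring_R[OF assms(1)] proj_objects_module[OF assms(1)] proj_objects_module[OF assms(2)] assms(3,4,5)]
  by simp

lemma polarized_arr_const:
  assumes "M \<in> proj_objects R" "N \<in> proj_objects R" "size A = s" "linear_map R M N f" "x \<in> carrier (fobj F M)"
  shows "polarized_arr A M N (\<lambda>_. f) x = [card (permutations_of_multiset A)] \<cdot>\<^bsub>fobj F N\<^esub> ordinary_arr M N f x"
proof -
  interpret cring R by (rule cring_R[OF assms(1)])
  note m = assms(1,2)[THEN proj_objects_module]
  let ?r = "[card (permutations_of_multiset A)] \<cdot>\<^bsub>R\<^esub> \<one>\<^bsub>R\<^esub>"
  have "polarized_power R s M N A (\<lambda>_. f) =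
     (\<lambda>t\<in>carrier (tensor_power R s M). ?r \<odot>\<^bsub>tensor_power R s N\<^esub> tensor_power_map R s M N f t)"
    using polarized_power_const[OF m assms(3,4)] lin_hom_def[of R "tensor_power R s M" "tensor_power R s N"]
      polarized_power_lin_hom[OF m assms(3), of "\<lambda>_. f"] assms(4)
    by (intro extensionalityI[of _ "carrier (tensor_power R s M)"]) auto
  then have "polarized_arr A M N (\<lambda>_. f) x = ?r \<odot>\<^bsub>fobj F N\<^esub> ordinary_arr M N f x"
    unfolding polarized_arr_def ordinary_arr_def
    using farr_smult[OF assms(1,2) tensor_power_map_schur[OF m assms(4)] _ assms(5), of ?r] by simp
  also have "\<dots> = [card (permutations_of_multiset A)] \<cdot>\<^bsub>fobj F N\<^esub> ordinary_arr M N f x"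
    by (rule smult_add_pow_one[OF fobj_module[OF assms(2)] linear_map_closed[OF ordinary_arr_linear[OF assms(1,2,4)] assms(5)]])
  finally show ?thesis .
qed

lemma polarized_arr_zero:
  assumes "M \<in> proj_objects R" "N \<in> proj_objects R" "size A = s" "\<And>i. i \<in># A \<Longrightarrow> linear_map R M N (fs i)"
    and "i \<in># A" "\<And>x. x \<in> carrier M \<Longrightarrow> fs i x = \<zero>\<^bsub>N\<^esub>" "x \<in> carrier (fobj F M)"
  shows "polarized_arr A M N fs x = \<zero>\<^bsub>fobj F N\<^esub>"
proof -
  interpret cring R by (rule cring_R[OF assms(1)])
  note m = assms(1,2)[THEN proj_objects_module]
  interpret T: module R "tensor_power R s N" by (rule tensor_power_module[OF m(2)])
  interpret FN: module R "fobj F N" by (rule fobj_module[OF assms(2)])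
  note pl = polarized_power_lin_hom[where fs = fs, OF m assms(3,4)]
  let ?p = "polarized_power R s M N A fs"
  \<comment> \<open>Writing the zero morphism as a zero multiple of itself lets linearity of
    \<open>farr\<close> in the scalar give the value 0.\<close>
  have "?p = (\<lambda>t\<in>carrier (tensor_power R s M). \<zero>\<^bsub>R\<^esub> \<odot>\<^bsub>tensor_power R s N\<^esub> ?p t)"
    using polarized_power_zero[where fs = fs, OF m assms(3,4,5,6)] pl
    by (intro extensionalityI[of _ "carrier (tensor_power R s M)"]) (auto simp: lin_hom_def)
  then have "polarized_arr A M N fs x = \<zero>\<^bsub>R\<^esub> \<odot>\<^bsub>fobj F N\<^esub> farr F M N ?p x"
    unfolding polarized_arr_def
    using farr_smult[OF assms(1,2) polarized_power_schur[where fs = fs, OF m assms(3,4)] _ assms(7), of "\<zero>\<^bsub>R\<^esub>"] by simp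
  then show ?thesis
    using linear_map_closed[OF polarized_arr_linear[OF assms(1-4)] assms(7)] by (simp add: polarized_arr_def)
qed

lemma polarized_arr_comp_left:
  assumes "L \<in> proj_objects R" "M \<in> proj_objects R" "N \<in> proj_objects R" "size A = s"
    and "\<And>i. i \<in># A \<Longrightarrow> linear_map R L M (fs i)" "linear_map R M N g" "x \<in> carrier (fobj F L)"
  shows "ordinary_arr M N g (polarized_arr A L M fs x) = polarized_arr A L N (\<lambda>i x. g (fs i x)) x"
proof -
  interpret cring R by (rule cring_R[OF assms(1)])
  note m = assms(1-3)[THEN proj_objects_module]
  have eq: "polarized_power R s L N A (\<lambda>i x. g (fs i x)) =
    compose (carrier (tensor_power R s L)) (tensor_power_map R s M N g) (polarized_power R s L M A fs)"
    by (intro polarized_power_compose_left m assms)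
  show ?thesis unfolding ordinary_arr_def polarized_arr_def eq
    using farr_comp[OF assms(1-3) polarized_power_schur[where fs = fs, OF m(1,2) assms(4,5)] tensor_power_map_schur[OF m(2,3) assms(6)]]
      assms(7) by (simp add: compose_eq)
qed

lemma polarized_arr_comp_right:
  assumes "L \<in> proj_objects R" "M \<in> proj_objects R" "N \<in> proj_objects R" "size A = s"
    and "linear_map R L M g" "\<And>i. i \<in># A \<Longrightarrow> linear_map R M N (fs i)" "x \<in> carrier (fobj F L)"
  shows "polarized_arr A M N fs (ordinary_arr L M g x) = polarized_arr A L N (\<lambda>i x. fs i (g x)) x"
proof -
  interpret cring R by (rule cring_R[OF assms(1)])
  note m = assms(1-3)[THEN proj_objects_module]
  have eq: "polarized_power R s L N A (\<lambda>i x. fs i (g x)) =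
    compose (carrier (tensor_power R s L)) (polarized_power R s M N A fs) (tensor_power_map R s L M g)"
    by (intro polarized_power_compose_right m assms)
  show ?thesis unfolding ordinary_arr_def polarized_arr_def eq
    using farr_comp[OF assms(1-3) tensor_power_map_schur[OF m(1,2) assms(5)] polarized_power_schur[where fs = fs, OF m(2,3) assms(4,6)]]
      assms(7) by (simp add: compose_eq)
qed

lemma apply_functor_simps:
  "sobj (apply_functor (underlying_functor R s F) Xs) k = fobj F (sobj Xs k)"
  "face (apply_functor (underlying_functor R s F) Xs) k i = ordinary_arr (sobj Xs (Suc k)) (sobj Xs k) (face Xs k i)"
  "degen (apply_functor (underlying_functor R s F) Xs) k i = ordinary_arr (sobj Xs k) (sobj Xs (Suc k)) (degen Xs k i)"
  by (simp_all add: apply_functor_def underlying_functor_def ordinary_arr_def)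

lemma ordinary_arr_extensional:
  assumes "M \<in> proj_objects R" "N \<in> proj_objects R" "linear_map R M N f"
  shows "ordinary_arr M N f \<in> lin_hom R (fobj F M) (fobj F N)"
  unfolding ordinary_arr_def
  by (rule farr_lin_hom[OF assms(1,2)
     cring.tensor_power_map_schur[OF cring_R[OF assms(1)] proj_objects_module[OF assms(1)] proj_objects_module[OF assms(2)] assms(3)]])

lemma apply_functor_simplicial:
  assumes "simplicial_module R Xs" and proj: "\<And>k. sobj Xs k \<in> proj_objects R"
  shows "simplicial_module R (apply_functor (underlying_functor R s F) Xs)"
proof -
  interpret simplicial_module R Xs by fact
  \<comment> \<open>Two composites that agree on the carrier may differ as functions off it, so
    functoriality has to be combined with \<open>ordinary_arr_cong\<close>; the simplicial
    identities between two composites are all transferred in this form.\<close>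
  have comp_eq: "ordinary_arr (sobj Xs m) (sobj Xs b) g (ordinary_arr (sobj Xs a) (sobj Xs m) f x) =
      ordinary_arr (sobj Xs m') (sobj Xs b) g' (ordinary_arr (sobj Xs a) (sobj Xs m') f' x)"
    if "linear_map R (sobj Xs a) (sobj Xs m) f" "linear_map R (sobj Xs m) (sobj Xs b) g"
      "linear_map R (sobj Xs a) (sobj Xs m') f'" "linear_map R (sobj Xs m') (sobj Xs b) g'"
      "\<And>x. x \<in> carrier (sobj Xs a) \<Longrightarrow> g (f x) = g' (f' x)" "x \<in> carrier (fobj F (sobj Xs a))" for a b m m' f g f' g' x
    using ordinary_arr_comp[OF proj proj proj that(1,2,6)] ordinary_arr_comp[OF proj proj proj that(3,4,6)]
      ordinary_arr_cong[OF proj proj linear_map_comp[OF that(3,4)], of "\<lambda>x. g (f x)"] that(5) by simp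
  show ?thesis
  proof (rule simplicial_module.intro, goal_cases)
    case (1 n) show ?case by (simp add: apply_functor_simps fobj_module proj)
  next
    case (2 i n) then show ?case unfolding apply_functor_simps
      by (intro ordinary_arr_extensional proj face_linear)
  next
    case (3 i n) then show ?case unfolding apply_functor_simps
      by (intro ordinary_arr_extensional proj degen_linear)
  next
    case (4 i j n x) then show ?case unfolding apply_functor_simps
      by (intro comp_eq face_linear) (auto simp: face_face)
  next
    case (5 i j n x) then show ?case unfolding apply_functor_simps
      by (intro comp_eq face_linear degen_linear) (auto simp: face_degen_less)
  next
    case (6 i j n x)
    then have "ordinary_arr (sobj Xs n) (sobj Xs n) (\<lambda>x. face Xs n i (degen Xs n j x)) = ordinary_arr (sobj Xs n) (sobj Xs n) (\<lambda>x. x)"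
      by (intro ordinary_arr_cong proj linear_map_id face_degen_same) auto
    with 6 show ?case unfolding apply_functor_simps
      using ordinary_arr_comp[OF proj proj proj degen_linear[of j n] face_linear[of i n], of x] ordinary_arr_id[OF proj] by auto
  next
    case (7 j i n x) then show ?case unfolding apply_functor_simps
      by (intro comp_eq face_linear degen_linear) (auto simp: face_degen_greater)
  next
    case (8 i j n x) then show ?case unfolding apply_functor_simps
      by (intro comp_eq face_linear degen_linear) (auto simp: degen_degen)
  qed
qed

end

section \<open>Homotopies from chains of operators\<close>

text \<open>The additive extension of \<phi> to chains. Since G is given by a carrier, the extension
  is chosen from the universal property of the free abelian group, which applies once \<phi> takes
  its values in the carrier.\<close>

definition chain_eval :: "('b, 'c) ring_scheme \<Rightarrow> ('v \<Rightarrow> 'b) \<Rightarrow> ('v \<Rightarrow>\<^sub>0 int) \<Rightarrow> 'b" where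
  "chain_eval G \<phi> = (SOME h. h \<in> hom (free_Abelian_group UNIV) (add_monoid G) \<and> (\<forall>\<sigma>. h (frag_of \<sigma>) = \<phi> \<sigma>))"

fun alt_sum :: "('b, 'c) ring_scheme \<Rightarrow> (nat \<Rightarrow> 'b) \<Rightarrow> nat \<Rightarrow> 'b" where
  "alt_sum G f 0 = f 0"
| "alt_sum G f (Suc k) = alt_sum G f k \<oplus>\<^bsub>G\<^esub> (if even (Suc k) then f (Suc k) else \<ominus>\<^bsub>G\<^esub> f (Suc k))"

context abelian_group
begin

lemma minus_zero_right: "x \<in> carrier G \<Longrightarrow> x \<ominus> \<zero> = x"
  using add.inv_one by (simp add: a_minus_def)

lemma chain_eval_hom:
  assumes "range \<phi> \<subseteq> carrier G"
  shows "chain_eval G \<phi> \<in> hom (free_Abelian_group UNIV) (add_monoid G)" "chain_eval G \<phi> (frag_of \<sigma>) = \<phi> \<sigma>"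
proof -
  have *: "range \<phi> \<subseteq> carrier (add_monoid G)" using assms by auto
  obtain h where "h \<in> hom (free_Abelian_group UNIV) (add_monoid G)" "\<And>\<sigma>. \<sigma> \<in> UNIV \<Longrightarrow> h (frag_of \<sigma>) = \<phi> \<sigma>"
    using comm_group.free_Abelian_group_universal[OF a_comm_group *] by blast
  then have "\<exists>h. h \<in> hom (free_Abelian_group UNIV) (add_monoid G) \<and> (\<forall>\<sigma>. h (frag_of \<sigma>) = \<phi> \<sigma>)" by auto
  from someI_ex[OF this] show "chain_eval G \<phi> \<in> hom (free_Abelian_group UNIV) (add_monoid G)" "chain_eval G \<phi> (frag_of \<sigma>) = \<phi> \<sigma>"
    unfolding chain_eval_def by auto
qed

lemma chain_eval_closed: "range \<phi> \<subseteq> carrier G \<Longrightarrow> chain_eval G \<phi> z \<in> carrier G"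
  using hom_in_carrier[OF chain_eval_hom(1), of \<phi> z] by simp

lemma chain_eval_add:
  "range \<phi> \<subseteq> carrier G \<Longrightarrow> chain_eval G \<phi> (y + z) = chain_eval G \<phi> y \<oplus> chain_eval G \<phi> z"
  using hom_mult[OF chain_eval_hom(1), of \<phi> y z] by simp

lemma chain_eval_zero: "range \<phi> \<subseteq> carrier G \<Longrightarrow> chain_eval G \<phi> 0 = \<zero>"
  using chain_eval_add[of \<phi> 0 0] chain_eval_closed[of \<phi> 0] by (simp add: add.l_cancel_one')

lemma chain_eval_minus: 
  assumes "range \<phi> \<subseteq> carrier G" shows "chain_eval G \<phi> (- z) = \<ominus> chain_eval G \<phi> z"
proof -
  have "chain_eval G \<phi> (- z) \<oplus> chain_eval G \<phi> z = \<zero>"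
    using chain_eval_add[of \<phi> "- z" z] chain_eval_zero[of \<phi>] assms by simp
  then show ?thesis using chain_eval_closed[of \<phi>] assms by (metis minus_equality)
qed

lemma chain_eval_diff:
  "range \<phi> \<subseteq> carrier G \<Longrightarrow> chain_eval G \<phi> (y - z) = chain_eval G \<phi> y \<ominus> chain_eval G \<phi> z"
  using chain_eval_add[of \<phi> y "- z"] chain_eval_minus[of \<phi> z] by (simp add: a_minus_def)

lemma chain_eval_eq_zero:
  assumes "range \<phi> \<subseteq> carrier G" "\<And>\<sigma>. \<sigma> \<in> Poly_Mapping.keys z \<Longrightarrow> \<phi> \<sigma> = \<zero>"
  shows "chain_eval G \<phi> z = \<zero>"
proof -
  have "Poly_Mapping.keys z \<subseteq> {\<sigma>. \<phi> \<sigma> = \<zero>}" using assms(2) by auto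
  then show ?thesis
  proof (induction z rule: frag_induction)
    case zero then show ?case using chain_eval_zero assms(1) by blast
  next
    case (one x) then show ?case using chain_eval_hom(2)[OF assms(1)] by simp
  next
    case (diff a b) then show ?case using chain_eval_diff[of \<phi> a b] assms(1) by (simp add: a_minus_def)
  qed
qed

lemma alt_sum_closed: "(\<And>i. i \<le> k \<Longrightarrow> f i \<in> carrier G) \<Longrightarrow> alt_sum G f k \<in> carrier G"
  by (induction k) auto

lemma alt_sum_cong: "(\<And>i. i \<le> k \<Longrightarrow> f i = f' i) \<Longrightarrow> alt_sum G f k = alt_sum G f' k"
  by (induction k) auto

lemma alt_sum_eq_first:
  "(\<And>i. 1 \<le> i \<Longrightarrow> i \<le> k \<Longrightarrow> f i = \<zero>) \<Longrightarrow> f 0 \<in> carrier G \<Longrightarrow> alt_sum G f k = f 0"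
  by (induction k) auto

lemma alt_sum_add:
  "(\<And>i. i \<le> k \<Longrightarrow> f i \<in> carrier G \<and> f' i \<in> carrier G) \<Longrightarrow>
   alt_sum G (\<lambda>i. f i \<oplus> f' i) k = alt_sum G f k \<oplus> alt_sum G f' k"
proof (induction k)
  case (Suc k)
  have "alt_sum G f k \<in> carrier G" "alt_sum G f' k \<in> carrier G" using Suc.prems by (auto intro: alt_sum_closed)
  then show ?case using Suc by (auto simp: a_ac minus_add)
qed simp

lemma alt_sum_uminus:
  "(\<And>i. i \<le> k \<Longrightarrow> f i \<in> carrier G) \<Longrightarrow> alt_sum G (\<lambda>i. \<ominus> f i) k = \<ominus> alt_sum G f k"
proof (induction k)
  case (Suc k)
  have "alt_sum G f k \<in> carrier G" using Suc.prems by (auto intro: alt_sum_closed)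
  then show ?case using Suc by (auto simp: minus_add)
qed simp

lemma alt_sum_diff:
  "(\<And>i. i \<le> k \<Longrightarrow> f i \<in> carrier G \<and> f' i \<in> carrier G) \<Longrightarrow>
   alt_sum G (\<lambda>i. f i \<ominus> f' i) k = alt_sum G f k \<ominus> alt_sum G f' k"
  using alt_sum_add[of k f "\<lambda>i. \<ominus> f' i"] alt_sum_uminus[of k f'] by (simp add: a_minus_def)

lemma chain_eval_alternating:
  assumes "range \<phi> \<subseteq> carrier G"
  shows "chain_eval G \<phi> (\<Sum>i\<le>k. frag_cmul ((-1)^i) (z i)) = alt_sum G (\<lambda>i. chain_eval G \<phi> (z i)) k"
proof (induction k)
  case (Suc k)
  have "frag_cmul ((-1)^Suc k) (z (Suc k)) = (if even (Suc k) then z (Suc k) else - z (Suc k))"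
    by (simp add: minus_one_power_iff)
  then show ?case using Suc chain_eval_add[of \<phi>] chain_eval_minus[of \<phi>] assms by auto
qed simp

end

lemma linear_map_alt_sum:
  assumes "module R M" "module R N" "linear_map R M N f" "\<And>i. i \<le> k \<Longrightarrow> a i \<in> carrier M"
  shows "f (alt_sum M a k) = alt_sum N (\<lambda>i. f (a i)) k"
proof -
  interpret M: module R M by fact
  show ?thesis using assms(4)
  proof (induction k)
    case (Suc k)
    have "alt_sum M a k \<in> carrier M" using Suc.prems by (auto intro: M.alt_sum_closed)
    then show ?case using Suc by (auto simp: linear_map_add[OF assms(3)] linear_map_a_inv[OF assms(1-3)])
  qed simp
qed

lemma linear_map_chain_eval:
  assumes "module R M" "module R N" "linear_map R M N f" "range \<phi> \<subseteq> carrier M" "\<And>\<sigma>. \<psi> \<sigma> = f (\<phi> \<sigma>)"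
  shows "f (chain_eval M \<phi> z) = chain_eval N \<psi> z"
proof -
  interpret M: module R M by fact
  interpret N: module R N by fact
  have \<psi>: "range \<psi> \<subseteq> carrier N" using assms(4,5) linear_map_closed[OF assms(3)] by auto
  show ?thesis
  proof (induction z rule: frag_induct)
    case zero
    then show ?case using M.chain_eval_zero[OF assms(4)] N.chain_eval_zero[OF \<psi>] linear_map_zero[OF assms(1-3)] by simp
  next
    case (one x)
    show ?case unfolding M.chain_eval_hom(2)[OF assms(4)] N.chain_eval_hom(2)[OF \<psi>] by (rule assms(5)[symmetric])
  next
    case (diff a b)
    then show ?case
      using M.chain_eval_diff[OF assms(4)] N.chain_eval_diff[OF \<psi>] linear_map_diff[OF assms(1-3)]
        M.chain_eval_closed[OF assms(4)] by simp
  qed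
qed

text \<open>\<open>V j l\<close> singles out the simplices with l vertices of a test space over [j],
  functorial in [j] through the cofaces \<open>g i\<close>. To such a simplex and a letter c belongs
  an operator X_j -> X_(l-1), compatible with faces on both sides. The two instances are [j] x [1]
  and the D-fold power of [j].\<close>

locale operator_family = simplicial_module R Xs
  for R :: "('r, 'x) ring_scheme" and Xs :: "('r, 'm) simplicial_data" +
  fixes A :: "nat multiset" and V :: "nat \<Rightarrow> nat \<Rightarrow> 'v list \<Rightarrow> bool"
    and Op :: "nat \<Rightarrow> 'v list \<Rightarrow> nat \<Rightarrow> 'm \<Rightarrow> 'm" and g :: "nat \<Rightarrow> 'v \<Rightarrow> 'v"
  assumes valid_length: "V j l \<sigma> \<Longrightarrow> length \<sigma> = l"
    and valid_delete: "V j (Suc (Suc k)) \<sigma> \<Longrightarrow> i \<le> Suc k \<Longrightarrow> V j (Suc k) (delete_nth i \<sigma>)"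
    and valid_shift: "V j (Suc k) \<sigma> \<Longrightarrow> V (Suc j) (Suc k) (map (g i) \<sigma>)"
    and Op_linear: "V j (Suc k) \<sigma> \<Longrightarrow> c \<in># A \<Longrightarrow> linear_map R (sobj Xs j) (sobj Xs k) (Op j \<sigma> c)"
    and face_Op: "V j (Suc (Suc k)) \<sigma> \<Longrightarrow> i \<le> Suc k \<Longrightarrow> c \<in># A \<Longrightarrow> x \<in> carrier (sobj Xs j) \<Longrightarrow>
       face Xs k i (Op j \<sigma> c x) = Op j (delete_nth i \<sigma>) c x"
    and Op_shift: "V j (Suc k) \<sigma> \<Longrightarrow> i \<le> Suc j \<Longrightarrow> c \<in># A \<Longrightarrow> x \<in> carrier (sobj Xs (Suc j)) \<Longrightarrow>
       Op (Suc j) (map (g i) \<sigma>) c x = Op j \<sigma> c (face Xs j i x)"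

locale functor_operators = operator_family R Xs A V Op g + strict_poly_functor R s F
  for R :: "('r, 'x) ring_scheme" and Xs :: "('r, 'm) simplicial_data" and A
    and V :: "nat \<Rightarrow> nat \<Rightarrow> 'v list \<Rightarrow> bool" and Op and g
    and s :: nat and F :: "('r, 'm, 'n) poly_functor" +
  assumes proj: "sobj Xs j \<in> proj_objects R" and size_A: "size A = s"
begin

abbreviation "FX \<equiv> apply_functor (underlying_functor R s F) Xs"

sublocale FX: simplicial_module R FX
  by (rule apply_functor_simplicial[OF simplicial_module_axioms proj])

text \<open>Invalid lists get the value 0, so that all values lie in the carrier and
  \<open>chain_eval\<close> applies; the homotopies used below are supported on valid lists.\<close>

definition op_value :: "nat \<Rightarrow> nat \<Rightarrow> 'n \<Rightarrow> 'v list \<Rightarrow> 'n" where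
  "op_value j k x \<sigma> = (if V j (Suc k) \<sigma> then polarized_arr A (sobj Xs j) (sobj Xs k) (Op j \<sigma>) x
     else \<zero>\<^bsub>sobj FX k\<^esub>)"

definition op_eval :: "nat \<Rightarrow> nat \<Rightarrow> ('v list \<Rightarrow>\<^sub>0 int) \<Rightarrow> 'n \<Rightarrow> 'n" where
  "op_eval j k z x = chain_eval (sobj FX k) (op_value j k x) z"

lemma op_value_closed:
  assumes "x \<in> carrier (sobj FX j)" shows "range (op_value j k x) \<subseteq> carrier (sobj FX k)"
proof -
  interpret Y: module R "sobj FX k" by (rule FX.sobj_module)
  have "polarized_arr A (sobj Xs j) (sobj Xs k) (Op j \<sigma>) x \<in> carrier (sobj FX k)" if "V j (Suc k) \<sigma>" for \<sigma>
    using linear_map_closed[OF polarized_arr_linear[where fs = "Op j \<sigma>", OF proj proj size_A Op_linear[OF that]]] assms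
    by (simp add: apply_functor_simps)
  then show ?thesis by (auto simp: op_value_def)
qed

lemma op_eval_closed: "x \<in> carrier (sobj FX j) \<Longrightarrow> op_eval j k z x \<in> carrier (sobj FX k)"
proof -
  interpret Y: module R "sobj FX k" by (rule FX.sobj_module)
  show "x \<in> carrier (sobj FX j) \<Longrightarrow> ?thesis"
    unfolding op_eval_def by (rule Y.chain_eval_closed[OF op_value_closed])
qed

lemma op_eval_zero: "op_eval j k z \<zero>\<^bsub>sobj FX j\<^esub> = \<zero>\<^bsub>sobj FX k\<^esub>"
proof -
  interpret X: module R "sobj FX j" by (rule FX.sobj_module)
  interpret Y: module R "sobj FX k" by (rule FX.sobj_module)
  show ?thesis unfolding op_eval_def
  proof (rule Y.chain_eval_eq_zero)
    show "range (op_value j k \<zero>\<^bsub>sobj FX j\<^esub>) \<subseteq> carrier (sobj FX k)" by (rule op_value_closed) simp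
    show "op_value j k \<zero>\<^bsub>sobj FX j\<^esub> \<sigma> = \<zero>\<^bsub>sobj FX k\<^esub>" for \<sigma>
      using linear_map_zero[OF fobj_module[OF proj] fobj_module[OF proj] polarized_arr_linear[where fs = "Op j \<sigma>", OF proj proj size_A Op_linear]]
      by (auto simp: op_value_def apply_functor_simps)
  qed
qed

lemma face_op_value:
  assumes "V j (Suc (Suc k)) \<sigma>" "i \<le> Suc k" "x \<in> carrier (sobj FX j)"
  shows "face FX k i (op_value j (Suc k) x \<sigma>) = op_value j k x (delete_nth i \<sigma>)"
proof -
  have "face FX k i (op_value j (Suc k) x \<sigma>) = polarized_arr A (sobj Xs j) (sobj Xs k) (\<lambda>c x. face Xs k i (Op j \<sigma> c x)) x"
    using polarized_arr_comp_left[OF proj proj proj size_A Op_linear[OF assms(1)] face_linear[OF assms(2)]] assms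
    by (simp add: op_value_def apply_functor_simps)
  also have "polarized_arr A (sobj Xs j) (sobj Xs k) (\<lambda>c x. face Xs k i (Op j \<sigma> c x)) =
      polarized_arr A (sobj Xs j) (sobj Xs k) (Op j (delete_nth i \<sigma>))"
    by (rule polarized_arr_cong[OF proj proj size_A Op_linear[OF valid_delete[OF assms(1,2)]]])
      (simp_all add: face_Op[OF assms(1,2)])
  finally show ?thesis using valid_delete[OF assms(1,2)] by (simp add: op_value_def)
qed

lemma op_value_shift:
  assumes "V j (Suc k) \<sigma>" "i \<le> Suc j" "x \<in> carrier (sobj FX (Suc j))"
  shows "op_value (Suc j) k x (map (g i) \<sigma>) = op_value j k (face FX j i x) \<sigma>"
proof -
  have "op_value j k (face FX j i x) \<sigma> = polarized_arr A (sobj Xs (Suc j)) (sobj Xs k) (\<lambda>c x. Op j \<sigma> c (face Xs j i x)) x"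
    using polarized_arr_comp_right[OF proj proj proj size_A face_linear[OF assms(2)] Op_linear[OF assms(1)]] assms
    by (simp add: op_value_def apply_functor_simps)
  also have "polarized_arr A (sobj Xs (Suc j)) (sobj Xs k) (\<lambda>c x. Op j \<sigma> c (face Xs j i x)) =
      polarized_arr A (sobj Xs (Suc j)) (sobj Xs k) (Op (Suc j) (map (g i) \<sigma>))"
    by (rule polarized_arr_cong[OF proj proj size_A Op_linear[OF valid_shift[OF assms(1)]]])
      (simp_all add: Op_shift[OF assms(1,2)])
  finally show ?thesis using valid_shift[OF assms(1)] by (simp add: op_value_def)
qed

text \<open>On basis elements this is \<open>face_op_value\<close>: evaluation at x is a chain map
  from the chains of the test space to the unnormalized chains of F(X).\<close>

lemma op_eval_boundary:
  assumes "Poly_Mapping.keys z \<subseteq> {\<sigma>. V j (Suc (Suc k)) \<sigma>}" "x \<in> carrier (sobj FX j)"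
  shows "alt_sum (sobj FX k) (\<lambda>i. face FX k i (op_eval j (Suc k) z x)) (Suc k) = op_eval j k (boundary z) x"
proof -
  interpret Y: module R "sobj FX k" by (rule FX.sobj_module)
  interpret Y': module R "sobj FX (Suc k)" by (rule FX.sobj_module)
  note cl = op_value_closed[OF assms(2)]
  have ev_cl: "op_eval j k z x \<in> carrier (sobj FX k)" for k z by (rule op_eval_closed[OF assms(2)])
  have ev_diff: "op_eval j (Suc k) (a - b) x = op_eval j (Suc k) a x \<ominus>\<^bsub>sobj FX (Suc k)\<^esub> op_eval j (Suc k) b x" for a b
    unfolding op_eval_def by (rule Y'.chain_eval_diff[OF cl])
  have ev_diff': "op_eval j k (a - b) x = op_eval j k a x \<ominus>\<^bsub>sobj FX k\<^esub> op_eval j k b x" for a b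
    unfolding op_eval_def by (rule Y.chain_eval_diff[OF cl])
  have ev0: "op_eval j k 0 x = \<zero>\<^bsub>sobj FX k\<^esub>" "op_eval j (Suc k) 0 x = \<zero>\<^bsub>sobj FX (Suc k)\<^esub>"
    unfolding op_eval_def by (rule Y.chain_eval_zero[OF cl], rule Y'.chain_eval_zero[OF cl])
  show ?thesis using assms(1)
  proof (induction z rule: frag_induction)
    case zero
    have "alt_sum (sobj FX k) (\<lambda>i. face FX k i \<zero>\<^bsub>sobj FX (Suc k)\<^esub>) (Suc k) = face FX k 0 \<zero>\<^bsub>sobj FX (Suc k)\<^esub>"
      using linear_map_zero[OF FX.sobj_module FX.sobj_module FX.face_linear] by (intro Y.alt_sum_eq_first) auto
    then show ?case using linear_map_zero[OF FX.sobj_module FX.sobj_module FX.face_linear[of 0 k]] by (simp add: ev0)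
  next
    case (one \<sigma>)
    then have V: "V j (Suc (Suc k)) \<sigma>" by simp
    have ev1: "op_eval j k (frag_of \<tau>) x = op_value j k x \<tau>" for k \<tau>
    proof -
      interpret Z: module R "sobj FX k" by (rule FX.sobj_module)
      show ?thesis unfolding op_eval_def by (rule Z.chain_eval_hom(2)[OF cl])
    qed
    have "op_eval j k (boundary (frag_of \<sigma>)) x = alt_sum (sobj FX k) (\<lambda>i. op_eval j k (frag_of (delete_nth i \<sigma>)) x) (Suc k)"
      unfolding op_eval_def boundary_simps simplex_boundary_eq_sum valid_length[OF V] lessThan_Suc_atMost
      by (rule Y.chain_eval_alternating[OF cl])
    also have "\<dots> = alt_sum (sobj FX k) (\<lambda>i. face FX k i (op_eval j (Suc k) (frag_of \<sigma>) x)) (Suc k)"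
      by (rule Y.alt_sum_cong) (simp only: ev1 face_op_value[OF V _ assms(2)])
    finally show ?case by (rule sym)
  next
    case (diff a b)
    have "alt_sum (sobj FX k) (\<lambda>i. face FX k i (op_eval j (Suc k) (a - b) x)) (Suc k) =
      alt_sum (sobj FX k) (\<lambda>i. face FX k i (op_eval j (Suc k) a x) \<ominus>\<^bsub>sobj FX k\<^esub> face FX k i (op_eval j (Suc k) b x)) (Suc k)"
      using linear_map_diff[OF FX.sobj_module FX.sobj_module FX.face_linear ev_cl ev_cl]
      by (intro Y.alt_sum_cong) (simp add: ev_diff)
    also have "\<dots> = alt_sum (sobj FX k) (\<lambda>i. face FX k i (op_eval j (Suc k) a x)) (Suc k) \<ominus>\<^bsub>sobj FX k\<^esub>
        alt_sum (sobj FX k) (\<lambda>i. face FX k i (op_eval j (Suc k) b x)) (Suc k)"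
      using ev_cl by (intro Y.alt_sum_diff) auto
    also have "\<dots> = op_eval j k (boundary (a - b)) x"
      unfolding diff by (simp add: ev_diff')
    finally show ?case .
  qed
qed

text \<open>Cofaces of the test space act as faces on the argument, so the cosimplicial differential
  becomes an alternating sum over the faces of x.\<close>

lemma op_eval_coboundary:
  assumes "Poly_Mapping.keys z \<subseteq> {\<sigma>. V j (Suc k) \<sigma>}" "x \<in> carrier (sobj FX (Suc j))"
  shows "op_eval (Suc j) k (coboundary_sum g (Suc j) z) x = alt_sum (sobj FX k) (\<lambda>i. op_eval j k z (face FX j i x)) (Suc j)"
proof -
  interpret Y: module R "sobj FX k" by (rule FX.sobj_module)
  note cl = op_value_closed[OF assms(2)]
  have fx: "face FX j i x \<in> carrier (sobj FX j)" if "i \<le> Suc j" for i using assms(2) that by simp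
  have "op_eval (Suc j) k (push (g i) z) x = op_eval j k z (face FX j i x)" if i: "i \<le> Suc j" for i
    using assms(1)
  proof (induction z rule: frag_induction)
    case zero
    then show ?case using Y.chain_eval_zero[OF cl] Y.chain_eval_zero[OF op_value_closed[OF fx[OF i]]] by (simp add: op_eval_def)
  next
    case (one \<sigma>)
    then show ?case using op_value_shift[of j k \<sigma> i x] i assms(2)
      Y.chain_eval_hom(2)[OF cl] Y.chain_eval_hom(2)[OF op_value_closed[OF fx[OF i]]] by (simp add: op_eval_def)
  next
    case (diff a b)
    then show ?case
      using Y.chain_eval_diff[OF cl] Y.chain_eval_diff[OF op_value_closed[OF fx[OF i]]] by (simp add: op_eval_def)
  qed
  moreover have "op_eval (Suc j) k (coboundary_sum g (Suc j) z) x = alt_sum (sobj FX k) (\<lambda>i. op_eval (Suc j) k (push (g i) z) x) (Suc j)"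
    unfolding op_eval_def coboundary_sum_def by (rule Y.chain_eval_alternating[OF cl])
  ultimately show ?thesis by (simp cong: Y.alt_sum_cong)
qed

text \<open>The hypotheses describe a natural homotopy q between the families a and b; evaluation
  makes it a chain homotopy. On a Moore chain x all faces but d_0 x vanish, so its second term is q
  at d_0 x alone.\<close>

lemma op_eval_homotopy:
  assumes keys: "\<And>j. Poly_Mapping.keys (q j) \<subseteq> {\<sigma>. V j (Suc (Suc j)) \<sigma>}"
    and base: "boundary (q 0) = a 0 - b 0"
    and step: "\<And>j. boundary (q (Suc j)) = a (Suc j) - b (Suc j) - coboundary_sum g (Suc j) (q j)"
    and x: "x \<in> FX.moore_chains j"
  shows "alt_sum (sobj FX j) (\<lambda>i. face FX j i (op_eval j (Suc j) (q j) x)) (Suc j) =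
    op_eval j j (a j) x \<ominus>\<^bsub>sobj FX j\<^esub> op_eval j j (b j) x \<ominus>\<^bsub>sobj FX j\<^esub>
    (case j of 0 \<Rightarrow> \<zero>\<^bsub>sobj FX j\<^esub> | Suc k \<Rightarrow> op_eval k (Suc k) (q k) (face FX k 0 x))"
proof -
  interpret Y: module R "sobj FX j" by (rule FX.sobj_module)
  have xc: "x \<in> carrier (sobj FX j)" using x by (simp add: FX.moore_chains_def)
  note cl = op_value_closed[OF xc]
  have *: "alt_sum (sobj FX j) (\<lambda>i. face FX j i (op_eval j (Suc j) (q j) x)) (Suc j) = op_eval j j (boundary (q j)) x"
    by (rule op_eval_boundary[OF keys xc])
  note clj = op_eval_closed[OF xc, of j]
  show ?thesis
  proof (cases j)
    case 0
    have "op_eval j j (boundary (q j)) x = op_eval j j (a j) x \<ominus>\<^bsub>sobj FX j\<^esub> op_eval j j (b j) x"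
      using base by (simp only: 0 op_eval_def Y.chain_eval_diff[OF cl, unfolded 0])
    moreover have "op_eval j j (a j) x \<ominus>\<^bsub>sobj FX j\<^esub> op_eval j j (b j) x \<in> carrier (sobj FX j)"
      using clj by simp
    ultimately show ?thesis unfolding * using Y.minus_zero_right by (simp add: 0)
  next
    case (Suc k)
    have "op_eval (Suc k) (Suc k) (coboundary_sum g (Suc k) (q k)) x =
      alt_sum (sobj FX (Suc k)) (\<lambda>i. op_eval k (Suc k) (q k) (face FX k i x)) (Suc k)"
      using xc Suc by (intro op_eval_coboundary[OF keys]) simp
    also have "\<dots> = op_eval k (Suc k) (q k) (face FX k 0 x)"
      using x Suc op_eval_zero xc by (intro Y.alt_sum_eq_first[unfolded Suc] op_eval_closed) (auto simp: FX.moore_chains_def)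
    finally have "op_eval j j (boundary (q j)) x = op_eval j j (a j) x \<ominus>\<^bsub>sobj FX j\<^esub> op_eval j j (b j) x \<ominus>\<^bsub>sobj FX j\<^esub>
       op_eval k (Suc k) (q k) (face FX k 0 x)"
      using step[of k] Y.chain_eval_diff[OF cl] by (simp add: Suc op_eval_def)
    then show ?thesis unfolding * by (simp add: Suc)
  qed
qed

end

section \<open>The prism family and the product family\<close>

lemma prism_simplex_length: "prism_simplex j l \<sigma> \<Longrightarrow> length \<sigma> = l"
  by (auto simp: prism_simplex_def monotone_simplex_def)

lemma prism_simplex_delete:
  assumes "prism_simplex j (Suc (Suc k)) \<sigma>" "i \<le> Suc k"
  shows "prism_simplex j (Suc k) (delete_nth i \<sigma>)"
proof -
  obtain p u where *: "\<sigma> = map (\<lambda>v. (v, True)) p @ map (\<lambda>v. (v, False)) u" "monotone_simplex j (Suc (Suc k)) (p @ u)"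
    using assms(1) by (auto simp: prism_simplex_def)
  have d: "delete_nth i (p @ u) = (if i < length p then delete_nth i p @ u else p @ delete_nth (i - length p) u)" for p u :: "'b list"
    by (auto simp: delete_nth_def Suc_diff_le)
  have "delete_nth i \<sigma> = (if i < length p then map (\<lambda>v. (v, True)) (delete_nth i p) @ map (\<lambda>v. (v, False)) u
       else map (\<lambda>v. (v, True)) p @ map (\<lambda>v. (v, False)) (delete_nth (i - length p) u))"
    by (auto simp: *(1) delete_nth_def take_map drop_map Suc_diff_le)
  moreover have "monotone_simplex j (Suc k) (delete_nth i (p @ u))" by (rule monotone_simplex_delete[OF *(2) assms(2)])
  ultimately show ?thesis unfolding prism_simplex_def d by (auto split: if_splits)
qed

lemma prism_simplex_shift:
  assumes "prism_simplex j l \<sigma>"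
  shows "prism_simplex (Suc j) l (map (map_prod (shift i) id) \<sigma>)"
proof -
  obtain p u where *: "\<sigma> = map (\<lambda>v. (v, True)) p @ map (\<lambda>v. (v, False)) u" "monotone_simplex j l (p @ u)"
    using assms(1) by (auto simp: prism_simplex_def)
  show ?thesis unfolding prism_simplex_def
    by (rule exI[of _ "map (shift i) p"], rule exI[of _ "map (shift i) u"])
      (use monotone_simplex_shift[OF *(2), of i] * in simp)
qed

lemma product_simplex_delete:
  "product_simplex D j (Suc (Suc k)) \<sigma> \<Longrightarrow> i \<le> Suc k \<Longrightarrow> product_simplex D j (Suc k) (delete_nth i \<sigma>)"
  using monotone_simplex_delete[of j "Suc k"] by (auto simp: product_simplex_def map_delete_nth)

text \<open>The standard triangulation of Delta^j x Delta^1, obtained as the prism over the end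
  \<open>False\<close> for the map that pushes it to \<open>True\<close>.\<close>

definition prism_homotopy :: "nat \<Rightarrow> ((nat \<times> bool) list \<Rightarrow>\<^sub>0 int)" where
  "prism_homotopy j = prism (\<lambda>(v, b). (v, True)) (frag_of (map (\<lambda>v. (v, False)) [0..<Suc j]))"

lemma prism_coboundary_sum:
  assumes "\<And>i v. g i (e v) = e (g i v)"
  shows "prism e (coboundary_sum g k z) = coboundary_sum g k (prism e z)"
proof -
  have cmul: "prism e (frag_cmul c z) = frag_cmul c (prism e z)" for c z
    by (simp add: prism_def frag_extend_cmul)
  have sum: "prism e (\<Sum>i\<in>I. f i) = (\<Sum>i\<in>I. prism e (f i))" for f :: "nat \<Rightarrow> _" and I
    by (induction I rule: infinite_finite_induct) simp_all
  have "prism e (push (g i) z) = push (g i) (prism e z)" for i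
    by (induction z rule: frag_induct) (simp_all add: push_simplex_prism[of "g i" e, OF assms])
  then show ?thesis by (simp add: coboundary_sum_def sum cmul)
qed

text \<open>\<open>boundary_prism\<close> for the end \<open>False\<close>: the prism commutes with
  cofaces, so the prism over the boundary is the coboundary sum of the previous homotopy.\<close>

lemma boundary_prism_homotopy:
  "boundary (prism_homotopy 0) = frag_of (map (\<lambda>v. (v, False)) [0..<Suc 0]) - frag_of (map (\<lambda>v. (v, True)) [0..<Suc 0])"
  "boundary (prism_homotopy (Suc j)) = frag_of (map (\<lambda>v. (v, False)) [0..<Suc (Suc j)])
     - frag_of (map (\<lambda>v. (v, True)) [0..<Suc (Suc j)])
     - coboundary_sum (\<lambda>i. map_prod (shift i) id) (Suc j) (prism_homotopy j)"
proof -
  let ?e = "\<lambda>(v :: nat, b :: bool). (v, True)"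
  have *: "boundary (prism_homotopy j) = frag_of (map (\<lambda>v. (v, False)) [0..<Suc j])
     - frag_of (map (\<lambda>v. (v, True)) [0..<Suc j]) - prism ?e (boundary (frag_of (map (\<lambda>v. (v, False)) [0..<Suc j])))" for j
    using boundary_prism[of ?e "frag_of (map (\<lambda>v. (v, False)) [0..<Suc j])"]
    by (simp add: prism_homotopy_def comp_def algebra_simps del: upt_Suc)
  show "boundary (prism_homotopy 0) = frag_of (map (\<lambda>v. (v, False)) [0..<Suc 0]) - frag_of (map (\<lambda>v. (v, True)) [0..<Suc 0])"
    unfolding * by simp
  have "boundary (frag_of (map (\<lambda>v. (v, False)) [0..<Suc (Suc j)])) =
     coboundary_sum (\<lambda>i. map_prod (shift i) id) (Suc j) (frag_of (map (\<lambda>v. (v, False)) [0..<Suc j]))"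
    by (rule boundary_diagonal) simp
  moreover have "prism ?e (coboundary_sum (\<lambda>i. map_prod (shift i) id) (Suc j) z) =
      coboundary_sum (\<lambda>i. map_prod (shift i) id) (Suc j) (prism ?e z)" for z
    by (rule prism_coboundary_sum) auto
  ultimately show "boundary (prism_homotopy (Suc j)) = frag_of (map (\<lambda>v. (v, False)) [0..<Suc (Suc j)])
     - frag_of (map (\<lambda>v. (v, True)) [0..<Suc (Suc j)])
     - coboundary_sum (\<lambda>i. map_prod (shift i) id) (Suc j) (prism_homotopy j)"
    unfolding * by (simp only: prism_homotopy_def)
qed

lemma keys_prism_homotopy: "Poly_Mapping.keys (prism_homotopy j) \<subseteq> {\<sigma>. prism_simplex j (Suc (Suc j)) \<sigma>}"
proof
  fix \<tau> assume "\<tau> \<in> Poly_Mapping.keys (prism_homotopy j)"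
  then obtain a v b where *: "a @ v # b = map (\<lambda>v. (v, False)) [0..<Suc j]"
    "\<tau> = map (\<lambda>(v, b). (v, True)) a @ (\<lambda>(v, b). (v, True)) v # v # b"
    using keys_prismD[of \<tau> "\<lambda>(v, b). (v, True)"] unfolding prism_homotopy_def by (metis (no_types, lifting) keys_frag_of singletonD)
  from *(1) obtain a' v' b' where av: "a = map (\<lambda>v. (v, False)) a'" "v = (v', False)" "b = map (\<lambda>v. (v, False)) b'"
    "[0..<Suc j] = a' @ v' # b'"
    by (auto simp: append_eq_map_conv Cons_eq_map_conv simp del: upt_Suc)
  have s: "sorted (a' @ v' # b')" "\<forall>w\<in>set (a' @ v' # b'). w \<le> j" "length (a' @ v' # b') = Suc j"
    unfolding av(4)[symmetric] by (simp_all del: upt_Suc)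
  then have m: "monotone_simplex j (Suc (Suc j)) ((a' @ [v']) @ v' # b')"
    by (auto simp: monotone_simplex_def sorted_append)
  have "\<tau> = map (\<lambda>v. (v, True)) (a' @ [v']) @ map (\<lambda>v. (v, False)) (v' # b')"
    by (simp add: *(2) av)
  with m show "\<tau> \<in> {\<sigma>. prism_simplex j (Suc (Suc j)) \<sigma>}" unfolding prism_simplex_def by blast
qed

context coned_simplicial_module
begin

lemma prism_family: "operator_family R Xs A prism_simplex (\<lambda>j \<sigma> c. prism_op j \<sigma>) (\<lambda>i. map_prod (shift i) id)"
  by unfold_locales (auto intro: prism_simplex_length prism_simplex_delete prism_simplex_shift prism_op_linear
    simp: face_prism_op prism_op_shift)

text \<open>Letter c reads coordinate c of the product simplex, which is why the letters of A are
  the numbers below D. In \<open>prism_family\<close>, by contrast, all letters share one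
  operator.\<close>

lemma product_family:
  assumes "set_mset A = {..<D}"
  shows "operator_family R Xs A (product_simplex D)
    (\<lambda>j \<sigma> c x. simplicial_op Xs j (map (\<lambda>v. v c) \<sigma>) (trunc j x)) shift_vertex"
proof unfold_locales
  have c: "monotone_simplex j l (map (\<lambda>v. v c) \<sigma>)" if "product_simplex D j l \<sigma>" "c \<in># A" for j l c \<sigma>
    using that assms by (auto simp: product_simplex_def)
  show "length \<sigma> = l" if "product_simplex D j l \<sigma>" for j l \<sigma> using that by (simp add: product_simplex_def)
  show "product_simplex D j (Suc k) (delete_nth i \<sigma>)" if "product_simplex D j (Suc (Suc k)) \<sigma>" "i \<le> Suc k" for j k \<sigma> i
    using that by (rule product_simplex_delete)
  show "product_simplex D (Suc j) (Suc k) (map (shift_vertex i) \<sigma>)" if "product_simplex D j (Suc k) \<sigma>" for j k \<sigma> i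
    using that by (rule product_simplex_shift)
  show "linear_map R (sobj Xs j) (sobj Xs k) (\<lambda>x. simplicial_op Xs j (map (\<lambda>v. v c) \<sigma>) (trunc j x))"
    if "product_simplex D j (Suc k) \<sigma>" "c \<in># A" for j k \<sigma> c
    by (rule linear_map_comp[OF trunc_linear simplicial_op_linear[OF c[OF that]]])
  show "face Xs k i (simplicial_op Xs j (map (\<lambda>v. v c) \<sigma>) (trunc j x)) = simplicial_op Xs j (map (\<lambda>v. v c) (delete_nth i \<sigma>)) (trunc j x)"
    if "product_simplex D j (Suc (Suc k)) \<sigma>" "i \<le> Suc k" "c \<in># A" "x \<in> carrier (sobj Xs j)" for j k \<sigma> i c x
    using face_simplicial_op[OF c[OF that(1,3)] that(2) linear_map_closed[OF trunc_linear that(4)]] by (simp add: map_delete_nth)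
  show "simplicial_op Xs (Suc j) (map (\<lambda>v. v c) (map (shift_vertex i) \<sigma>)) (trunc (Suc j) x) =
     simplicial_op Xs j (map (\<lambda>v. v c) \<sigma>) (trunc j (face Xs j i x))"
    if "product_simplex D j (Suc k) \<sigma>" "i \<le> Suc j" "c \<in># A" "x \<in> carrier (sobj Xs (Suc j))" for j k \<sigma> i c x
    using simplicial_op_shift[OF c[OF that(1,3)] that(2) linear_map_closed[OF trunc_linear that(4)]]
    by (simp add: shift_vertex_def comp_def face_trunc[OF that(2,4)])
qed

end

section \<open>The null-homotopy of the multinomial coefficient\<close>

locale coned_functor = coned_simplicial_module R Xs n cone + strict_poly_functor R s F
  for R :: "('r, 'x) ring_scheme" and Xs :: "('r, 'm) simplicial_data" and n cone s
    and F :: "('r, 'm, 'n) poly_functor" +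
  fixes A :: "nat multiset" and D :: nat
  assumes proj: "sobj Xs j \<in> proj_objects R" and size_A: "size A = s" and set_A: "set_mset A = {..<D}"
begin

sublocale P: functor_operators R Xs A prism_simplex "\<lambda>j \<sigma> c. prism_op j \<sigma>" "\<lambda>i. map_prod (shift i) id" s F
  unfolding functor_operators_def functor_operators_axioms_def
  using prism_family strict_poly_functor_axioms proj size_A by blast

sublocale Q: functor_operators R Xs A "product_simplex D" "\<lambda>j \<sigma> c x. simplicial_op Xs j (map (\<lambda>v. v c) \<sigma>) (trunc j x)"
    shift_vertex s F
  unfolding functor_operators_def functor_operators_axioms_def
  using product_family[OF set_A] strict_poly_functor_axioms proj size_A by blast

abbreviation "FX \<equiv> apply_functor (underlying_functor R s F) Xs"

text \<open>Let t be the polarized power with \<open>trunc\<close> in every entry. In degrees below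
  n D the diagonal homotopy joins t to 0, the prism homotopy realizes t - m, and so the difference
  of the two realizes m.\<close>

definition contracting :: "nat \<Rightarrow> 'n \<Rightarrow> 'n" where
  "contracting j x = Q.op_eval j (Suc j) (diagonal_homotopy D j) x
     \<ominus>\<^bsub>sobj FX (Suc j)\<^esub> P.op_eval j (Suc j) (prism_homotopy j) x"

lemma contracting_closed: "x \<in> carrier (sobj FX j) \<Longrightarrow> contracting j x \<in> carrier (sobj FX (Suc j))"
proof -
  interpret Y: module R "sobj FX (Suc j)" by (rule P.FX.sobj_module)
  show "x \<in> carrier (sobj FX j) \<Longrightarrow> ?thesis"
    unfolding contracting_def by (intro Y.minus_closed P.op_eval_closed Q.op_eval_closed)
qed

text \<open>If every coordinate took n + 1 values, the width would be at least D (n + 1) = n D + D,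
  above its bound j + D.\<close>

lemma few_values:
  assumes "\<sigma> \<in> Poly_Mapping.keys (cellular_diagonal D j)" "j < n * D"
  shows "\<exists>c<D. card ((\<lambda>v. v c) ` set \<sigma>) \<le> n"
proof (rule ccontr)
  assume "\<not> ?thesis"
  then have "Suc n \<le> card ((\<lambda>v. v c) ` set \<sigma>)" if "c < D" for c using that by force
  then have "D * Suc n \<le> width D \<sigma>"
    unfolding width_def using sum_bounded_below[of "{..<D}" "Suc n" "\<lambda>c. card ((\<lambda>v. v c) ` set \<sigma>)"] by simp
  moreover have "width D \<sigma> \<le> j + D" using keys_cellular_diagonal[OF assms(1)] by simp
  ultimately show False using assms(2) by (simp add: mult.commute)
qed

text \<open>The full alternating sum of faces appears because \<open>contracting j x\<close> need
  not be a Moore chain; the Moore projector will turn that sum into d_0.\<close>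

lemma contracting_homotopy:
  assumes "j < n * D" and x: "x \<in> P.FX.moore_chains j"
  shows "[card (permutations_of_multiset A)] \<cdot>\<^bsub>sobj FX j\<^esub> x =
    alt_sum (sobj FX j) (\<lambda>i. face FX j i (contracting j x)) (Suc j) \<oplus>\<^bsub>sobj FX j\<^esub>
    (case j of 0 \<Rightarrow> \<zero>\<^bsub>sobj FX j\<^esub> | Suc k \<Rightarrow> contracting k (face FX k 0 x))"
proof -
  interpret Y: module R "sobj FX j" by (rule P.FX.sobj_module)
  interpret Y': module R "sobj FX (Suc j)" by (rule P.FX.sobj_module)
  have xc: "x \<in> carrier (sobj FX j)" using x by (simp add: P.FX.moore_chains_def)
  have xF: "x \<in> carrier (fobj F (sobj Xs j))" using xc by (simp add: apply_functor_simps)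
  let ?F = "\<lambda>j. frag_of (map (\<lambda>v. (v, False)) [0..<Suc j])" and ?T = "\<lambda>j. frag_of (map (\<lambda>v. (v, True)) [0..<Suc j])"
  let ?t = "polarized_arr A (sobj Xs j) (sobj Xs j) (\<lambda>_. trunc j) x"
  let ?p = "P.op_eval j (Suc j) (prism_homotopy j) x" and ?q = "Q.op_eval j (Suc j) (diagonal_homotopy D j) x"
  let ?p' = "case j of 0 \<Rightarrow> \<zero>\<^bsub>sobj FX j\<^esub> | Suc k \<Rightarrow> P.op_eval k (Suc k) (prism_homotopy k) (face FX k 0 x)"
  let ?q' = "case j of 0 \<Rightarrow> \<zero>\<^bsub>sobj FX j\<^esub> | Suc k \<Rightarrow> Q.op_eval k (Suc k) (diagonal_homotopy D k) (face FX k 0 x)"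
  let ?m = "[card (permutations_of_multiset A)] \<cdot>\<^bsub>sobj FX j\<^esub> x"
  have t: "?t \<in> carrier (sobj FX j)"
    using linear_map_closed[OF polarized_arr_linear[OF proj proj size_A trunc_linear] xF] by (simp add: apply_functor_simps)
  have mono: "monotone_simplex j (Suc j) [0..<Suc j]"
    unfolding monotone_simplex_def by (simp del: upt_Suc)
  have valid: "prism_simplex j (Suc j) (map (\<lambda>v. (v, False)) [0..<Suc j])" "prism_simplex j (Suc j) (map (\<lambda>v. (v, True)) [0..<Suc j])"
    unfolding prism_simplex_def
    by (rule exI[of _ "[]"], rule exI[of _ "[0..<Suc j]"], use mono in simp)
      (rule exI[of _ "[0..<Suc j]"], rule exI[of _ "[]"], use mono in simp)
  have pF: "P.op_eval j j (?F j) x = ?t"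
  proof -
    have "P.op_eval j j (?F j) x = polarized_arr A (sobj Xs j) (sobj Xs j) (\<lambda>c. prism_op j (map (\<lambda>v. (v, False)) [0..<Suc j])) x"
      unfolding P.op_eval_def Y.chain_eval_hom(2)[OF P.op_value_closed[OF xc]] using valid(1) by (simp only: P.op_value_def if_True)
    also have "\<dots> = ?t"
      using polarized_arr_cong[OF proj proj size_A trunc_linear prism_op_ends(2)] by simp
    finally show ?thesis .
  qed
  have pT: "P.op_eval j j (?T j) x = ?m"
  proof -
    have "P.op_eval j j (?T j) x = polarized_arr A (sobj Xs j) (sobj Xs j) (\<lambda>c. prism_op j (map (\<lambda>v. (v, True)) [0..<Suc j])) x"
      unfolding P.op_eval_def Y.chain_eval_hom(2)[OF P.op_value_closed[OF xc]] using valid(2) by (simp only: P.op_value_def if_True)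
    also have "\<dots> = polarized_arr A (sobj Xs j) (sobj Xs j) (\<lambda>c x. x) x"
      using polarized_arr_cong[OF proj proj size_A linear_map_id prism_op_ends(1)] by simp
    also have "\<dots> = ?m"
      using polarized_arr_const[OF proj proj size_A linear_map_id xF] ordinary_arr_id[OF proj xF]
      by (simp add: apply_functor_simps)
    finally show ?thesis .
  qed
  have qD: "Q.op_eval j j (frag_of (diagonal_simplex j)) x = ?t"
  proof -
    have "Q.op_eval j j (frag_of (diagonal_simplex j)) x =
       polarized_arr A (sobj Xs j) (sobj Xs j) (\<lambda>c x. simplicial_op Xs j (map (\<lambda>v. v c) (diagonal_simplex j)) (trunc j x)) x"
      unfolding Q.op_eval_def Y.chain_eval_hom(2)[OF Q.op_value_closed[OF xc]] using product_simplex_diagonal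
      by (simp only: Q.op_value_def if_True)
    also have "polarized_arr A (sobj Xs j) (sobj Xs j) (\<lambda>c x. simplicial_op Xs j (map (\<lambda>v. v c) (diagonal_simplex j)) (trunc j x)) =
       polarized_arr A (sobj Xs j) (sobj Xs j) (\<lambda>_. trunc j)"
    proof (rule polarized_arr_cong[OF proj proj size_A trunc_linear])
      fix c y assume "y \<in> carrier (sobj Xs j)"
      moreover have "map (\<lambda>v. v c) (diagonal_simplex j) = [0..<Suc j]"
        by (simp add: diagonal_simplex_def comp_def del: upt_Suc)
      ultimately show "simplicial_op Xs j (map (\<lambda>v. v c) (diagonal_simplex j)) (trunc j y) = trunc j y"
        using simplicial_op_id linear_map_closed[OF trunc_linear] by simp
    qed
    finally show ?thesis .
  qed
  \<comment> \<open>Each simplex of the cellular diagonal has a coordinate with at most n values.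
    The operator in that entry vanishes on the image of \<open>trunc\<close>, and with it the whole
    polarized power.\<close>
  have qC: "Q.op_eval j j (cellular_diagonal D j) x = \<zero>\<^bsub>sobj FX j\<^esub>"
    unfolding Q.op_eval_def
  proof (rule Y.chain_eval_eq_zero[OF Q.op_value_closed[OF xc]])
    fix \<sigma> assume \<sigma>: "\<sigma> \<in> Poly_Mapping.keys (cellular_diagonal D j)"
    then have V: "product_simplex D j (Suc j) \<sigma>" using keys_cellular_diagonal by blast
    obtain c where c: "c < D" "card ((\<lambda>v. v c) ` set \<sigma>) \<le> n" using few_values[OF \<sigma> assms(1)] by blast
    have "simplicial_op Xs j (map (\<lambda>v. v c) \<sigma>) (trunc j y) = \<zero>\<^bsub>sobj Xs j\<^esub>" if "y \<in> carrier (sobj Xs j)" for y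
      using V c by (intro simplicial_op_few_vertices[where n = n, OF trunc_linear face_trunc trunc_zero _ _ that])
        (auto simp: product_simplex_def)
    then have "polarized_arr A (sobj Xs j) (sobj Xs j) (\<lambda>c x. simplicial_op Xs j (map (\<lambda>v. v c) \<sigma>) (trunc j x)) x = \<zero>\<^bsub>fobj F (sobj Xs j)\<^esub>"
      using c(1) set_A xF by (intro polarized_arr_zero[OF proj proj size_A Q.Op_linear[OF V], where i = c]) auto
    then show "Q.op_value j j x \<sigma> = \<zero>\<^bsub>sobj FX j\<^esub>" by (simp add: Q.op_value_def apply_functor_simps)
  qed
  have homP: "alt_sum (sobj FX j) (\<lambda>i. face FX j i ?p) (Suc j) = ?t \<ominus>\<^bsub>sobj FX j\<^esub> ?m \<ominus>\<^bsub>sobj FX j\<^esub> ?p'"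
    using P.op_eval_homotopy[OF keys_prism_homotopy boundary_prism_homotopy x] pF pT by simp
  have homQ: "alt_sum (sobj FX j) (\<lambda>i. face FX j i ?q) (Suc j) = ?t \<ominus>\<^bsub>sobj FX j\<^esub> \<zero>\<^bsub>sobj FX j\<^esub> \<ominus>\<^bsub>sobj FX j\<^esub> ?q'"
  proof -
    have "boundary (diagonal_homotopy D 0) = frag_of (diagonal_simplex 0) - cellular_diagonal D 0"
      by (simp add: diagonal_simplex_def)
    moreover have "Poly_Mapping.keys (diagonal_homotopy D j) \<subseteq> {\<sigma>. product_simplex D j (Suc (Suc j)) \<sigma>}" for j
      using keys_diagonal_homotopy by auto
    ultimately show ?thesis
      using Q.op_eval_homotopy[of "diagonal_homotopy D", OF _ _ boundary_diagonal_homotopy x] by (simp only: qD qC)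
  qed
  have pq: "?p \<in> carrier (sobj FX (Suc j))" "?q \<in> carrier (sobj FX (Suc j))"
    by (rule P.op_eval_closed[OF xc], rule Q.op_eval_closed[OF xc])
  have pq': "?p' \<in> carrier (sobj FX j)" "?q' \<in> carrier (sobj FX j)"
    using xc Y.zero_closed by (cases j; auto intro!: P.op_eval_closed Q.op_eval_closed)+
  have m: "?m \<in> carrier (sobj FX j)" using xc by simp
  have "alt_sum (sobj FX j) (\<lambda>i. face FX j i (contracting j x)) (Suc j) =
     alt_sum (sobj FX j) (\<lambda>i. face FX j i ?q \<ominus>\<^bsub>sobj FX j\<^esub> face FX j i ?p) (Suc j)"
    unfolding contracting_def
    by (rule Y.alt_sum_cong) (simp add: linear_map_diff[OF P.FX.sobj_module P.FX.sobj_module P.FX.face_linear pq(2,1)])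
  also have "\<dots> = alt_sum (sobj FX j) (\<lambda>i. face FX j i ?q) (Suc j) \<ominus>\<^bsub>sobj FX j\<^esub> alt_sum (sobj FX j) (\<lambda>i. face FX j i ?p) (Suc j)"
    using pq by (intro Y.alt_sum_diff) auto
  also have "\<dots> = (?t \<ominus>\<^bsub>sobj FX j\<^esub> \<zero>\<^bsub>sobj FX j\<^esub> \<ominus>\<^bsub>sobj FX j\<^esub> ?q') \<ominus>\<^bsub>sobj FX j\<^esub> (?t \<ominus>\<^bsub>sobj FX j\<^esub> ?m \<ominus>\<^bsub>sobj FX j\<^esub> ?p')"
    by (simp only: homP homQ)
  also have "\<dots> = ?m \<ominus>\<^bsub>sobj FX j\<^esub> (?q' \<ominus>\<^bsub>sobj FX j\<^esub> ?p')"
  proof -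
    have cancel: "(a \<ominus>\<^bsub>sobj FX j\<^esub> \<zero>\<^bsub>sobj FX j\<^esub> \<ominus>\<^bsub>sobj FX j\<^esub> b) \<ominus>\<^bsub>sobj FX j\<^esub> (a \<ominus>\<^bsub>sobj FX j\<^esub> c \<ominus>\<^bsub>sobj FX j\<^esub> d) =
       c \<ominus>\<^bsub>sobj FX j\<^esub> (b \<ominus>\<^bsub>sobj FX j\<^esub> d)"
      if "a \<in> carrier (sobj FX j)" "b \<in> carrier (sobj FX j)" "c \<in> carrier (sobj FX j)" "d \<in> carrier (sobj FX j)" for a b c d
      using that by (simp add: Y.minus_zero_right) (simp add: a_minus_def Y.minus_add Y.a_ac Y.r_neg1 Y.r_neg2 Y.minus_minus)
    show ?thesis by (rule cancel[OF t pq'(2) m pq'(1)])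
  qed
  also have "?q' \<ominus>\<^bsub>sobj FX j\<^esub> ?p' = (case j of 0 \<Rightarrow> \<zero>\<^bsub>sobj FX j\<^esub> | Suc k \<Rightarrow> contracting k (face FX k 0 x))"
    using Y.minus_zero_right[OF Y.zero_closed] by (cases j) (simp_all add: contracting_def)
  finally have eq: "alt_sum (sobj FX j) (\<lambda>i. face FX j i (contracting j x)) (Suc j) =
    ?m \<ominus>\<^bsub>sobj FX j\<^esub> (case j of 0 \<Rightarrow> \<zero>\<^bsub>sobj FX j\<^esub> | Suc k \<Rightarrow> contracting k (face FX k 0 x))" .
  have "(case j of 0 \<Rightarrow> \<zero>\<^bsub>sobj FX j\<^esub> | Suc k \<Rightarrow> contracting k (face FX k 0 x)) \<in> carrier (sobj FX j)"
    using xc Y.zero_closed by (cases j) (auto intro!: contracting_closed)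
  then show ?thesis unfolding eq using m by (simp add: a_minus_def Y.a_assoc Y.l_neg)
qed

end

section \<open>Normalization\<close>

text \<open>The classical projector onto the Moore chains: the factors 1 - s_r d_(r+1) are applied
  from the largest r down to 0.\<close>

fun moore_step :: "('r, 'a) simplicial_data \<Rightarrow> nat \<Rightarrow> nat \<Rightarrow> 'a \<Rightarrow> 'a" where
  "moore_step Xs k 0 x = x"
| "moore_step Xs k (Suc r) x = moore_step Xs k r (x \<ominus>\<^bsub>sobj Xs (Suc k)\<^esub> degen Xs k r (face Xs k (Suc r) x))"

fun moore_proj :: "('r, 'a) simplicial_data \<Rightarrow> nat \<Rightarrow> 'a \<Rightarrow> 'a" where
  "moore_proj Xs 0 x = x"
| "moore_proj Xs (Suc k) x = moore_step Xs k (Suc k) x"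

context abelian_group
begin

lemma alt_sum_truncate:
  assumes "\<And>i. r < i \<Longrightarrow> i \<le> k \<Longrightarrow> f i = \<zero>" "r \<le> k" "\<And>i. i \<le> r \<Longrightarrow> f i \<in> carrier G"
  shows "alt_sum G f k = alt_sum G f r"
  using assms
proof (induction k)
  case (Suc k)
  show ?case
  proof (cases "r = Suc k")
    case False
    then have "alt_sum G f k = alt_sum G f r" "f (Suc k) = \<zero>" using Suc by auto
    moreover have "alt_sum G f r \<in> carrier G" using Suc.prems(3) by (rule alt_sum_closed)
    ultimately show ?thesis by auto
  qed simp
qed simp

lemma alt_sum_cancel:
  assumes "f (Suc r) = f (Suc (Suc r))" "\<And>i. i \<le> Suc (Suc r) \<Longrightarrow> f i \<in> carrier G"
  shows "alt_sum G f (Suc (Suc r)) = alt_sum G f r"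
proof -
  have "alt_sum G f r \<in> carrier G" using assms(2) by (intro alt_sum_closed) simp
  moreover have "f (Suc r) \<in> carrier G" using assms(2) by simp
  ultimately show ?thesis unfolding alt_sum.simps assms(1)[symmetric]
    by (cases "even r") (simp_all add: a_assoc r_neg l_neg)
qed

end

context simplicial_module
begin

lemma moore_step_linear: "r \<le> Suc k \<Longrightarrow> linear_map R (sobj Xs (Suc k)) (sobj Xs (Suc k)) (moore_step Xs k r)"
proof (induction r)
  case 0
  then show ?case by (simp add: linear_map_def)
next
  case (Suc r)
  have "linear_map R (sobj Xs (Suc k)) (sobj Xs (Suc k))
      (\<lambda>x. x \<ominus>\<^bsub>sobj Xs (Suc k)\<^esub> degen Xs k r (face Xs k (Suc r) x))"
    using Suc.prems by (intro linear_map_diff_fun sobj_module linear_map_id linear_map_comp[OF face_linear degen_linear]) auto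
  from linear_map_comp[OF this Suc.IH] Suc.prems show ?case by (simp add: linear_map_def)
qed

lemma moore_proj_linear: "linear_map R (sobj Xs k) (sobj Xs k) (moore_proj Xs k)"
proof (cases k)
  case 0
  then show ?thesis by (simp add: linear_map_def)
next
  case (Suc k')
  have "moore_proj Xs (Suc k') = moore_step Xs k' (Suc k')" by (rule ext) (rule moore_proj.simps(2))
  then show ?thesis using moore_step_linear[of "Suc k'" k'] by (simp only: Suc order.refl simp_thms)
qed

text \<open>The factor with index r kills face r + 1 and keeps the higher faces zero, since d_l s_r
  = s_r d_(l-1) and d_(l-1) d_(r+1) = d_(r+1) d_l for l > r + 1.\<close>

lemma face_moore_step:
  assumes "x \<in> carrier (sobj Xs (Suc k))" "r \<le> Suc k" "\<And>l. r < l \<Longrightarrow> l \<le> Suc k \<Longrightarrow> face Xs k l x = \<zero>\<^bsub>sobj Xs k\<^esub>"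
    and "1 \<le> l" "l \<le> Suc k"
  shows "face Xs k l (moore_step Xs k r x) = \<zero>\<^bsub>sobj Xs k\<^esub>"
  using assms
proof (induction r arbitrary: x)
  case (Suc r)
  interpret Y: module R "sobj Xs k" by (rule sobj_module)
  interpret Y': module R "sobj Xs (Suc k)" by (rule sobj_module)
  let ?u = "face Xs k (Suc r) x"
  let ?y = "x \<ominus>\<^bsub>sobj Xs (Suc k)\<^esub> degen Xs k r ?u"
  have u: "?u \<in> carrier (sobj Xs k)" and su: "degen Xs k r ?u \<in> carrier (sobj Xs (Suc k))" using Suc.prems by auto
  have "face Xs k l ?y = \<zero>\<^bsub>sobj Xs k\<^esub>" if l: "r < l" "l \<le> Suc k" for l
  proof -
    have split: "face Xs k l ?y = face Xs k l x \<ominus>\<^bsub>sobj Xs k\<^esub> face Xs k l (degen Xs k r ?u)"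
      using linear_map_diff[OF sobj_module sobj_module face_linear[OF l(2)] Suc.prems(1) su] .
    show ?thesis
    proof (cases "l = Suc r")
      case True
      then show ?thesis using split face_degen_same[of "Suc r" r k ?u] u Suc.prems by (simp add: a_minus_def Y.r_neg)
    next
      case False
      then obtain k' where k': "k = Suc k'" using l by (cases k) auto
      interpret Z: module R "sobj Xs k'" by (rule sobj_module)
      have "face Xs k l (degen Xs k r ?u) = degen Xs k' r (face Xs k' (l - 1) ?u)"
        using face_degen_greater[of r l k' ?u] False l u k' by simp
      also have "face Xs k' (l - 1) ?u = face Xs k' (Suc r) (face Xs k l x)"
        using face_face[of "Suc r" l k' x] False l Suc.prems k' by simp
      also have "face Xs k l x = \<zero>\<^bsub>sobj Xs k\<^esub>" using Suc.prems(3)[of l] False l by simp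
      also have "degen Xs k' r (face Xs k' (Suc r) \<zero>\<^bsub>sobj Xs k\<^esub>) = \<zero>\<^bsub>sobj Xs k\<^esub>"
        using linear_map_zero[OF sobj_module sobj_module face_linear, of "Suc r" k']
          linear_map_zero[OF sobj_module sobj_module degen_linear, of r k'] False l k' by auto
      finally show ?thesis using split Suc.prems(3)[of l] False l by (simp add: Y.minus_zero_right)
    qed
  qed
  then show ?case using Suc.IH[of ?y] Suc.prems su by simp
qed simp

lemma moore_proj_closed:
  assumes "x \<in> carrier (sobj Xs k)" shows "moore_proj Xs k x \<in> moore_chains k"
proof (cases k)
  case 0
  then show ?thesis using assms by (simp add: moore_chains_def)
next
  case (Suc k')
  then show ?thesis using assms face_moore_step[of x k' "Suc k'"] linear_map_closed[OF moore_proj_linear[of k] assms]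
    by (auto simp: moore_chains_def)
qed

lemma moore_proj_id:
  assumes "x \<in> moore_chains k" shows "moore_proj Xs k x = x"
proof (cases k)
  case (Suc k')
  interpret Y': module R "sobj Xs (Suc k')" by (rule sobj_module)
  have x: "x \<in> carrier (sobj Xs (Suc k'))" "\<And>l. 1 \<le> l \<Longrightarrow> l \<le> Suc k' \<Longrightarrow> face Xs k' l x = \<zero>\<^bsub>sobj Xs k'\<^esub>"
    using assms Suc by (auto simp: moore_chains_def)
  have "moore_step Xs k' r x = x" if "r \<le> Suc k'" for r
    using that
  proof (induction r)
    case (Suc r)
    then have "x \<ominus>\<^bsub>sobj Xs (Suc k')\<^esub> degen Xs k' r (face Xs k' (Suc r) x) = x"
      using x linear_map_zero[OF sobj_module sobj_module degen_linear, of r k'] by (simp add: Y'.minus_zero_right)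
    then show ?case using Suc by simp
  qed simp
  from this[of "Suc k'"] show ?thesis using Suc by (simp del: moore_step.simps)
qed simp

text \<open>The projector intertwines the alternating sum with d_0. A factor 1 - s_r d_(r+1)
  upstairs corresponds to 1 - s_(r-1) d_r downstairs, and the induction strips both; for r = 0 the
  remaining sum d_0 - d_1 is d_0 applied to 1 - s_0 d_1.\<close>

lemma face_0_moore_step:
  assumes "x \<in> carrier (sobj Xs (Suc (Suc k)))" "r \<le> Suc k"
    and "\<And>l. Suc r < l \<Longrightarrow> l \<le> Suc (Suc k) \<Longrightarrow> face Xs (Suc k) l x = \<zero>\<^bsub>sobj Xs (Suc k)\<^esub>"
  shows "face Xs (Suc k) 0 (moore_step Xs (Suc k) (Suc r) x) =
    moore_step Xs k r (alt_sum (sobj Xs (Suc k)) (\<lambda>i. face Xs (Suc k) i x) (Suc (Suc k)))"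
  using assms
proof (induction r arbitrary: x)
  case 0
  interpret Y: module R "sobj Xs (Suc k)" by (rule sobj_module)
  interpret Y': module R "sobj Xs (Suc (Suc k))" by (rule sobj_module)
  have "face Xs (Suc k) 0 (x \<ominus>\<^bsub>sobj Xs (Suc (Suc k))\<^esub> degen Xs (Suc k) 0 (face Xs (Suc k) (Suc 0) x)) =
     face Xs (Suc k) 0 x \<ominus>\<^bsub>sobj Xs (Suc k)\<^esub> face Xs (Suc k) (Suc 0) x"
    using linear_map_diff[OF sobj_module sobj_module face_linear, of 0 "Suc k" x] 0
      face_degen_same[of 0 0 "Suc k" "face Xs (Suc k) (Suc 0) x"] by simp
  also have "\<dots> = alt_sum (sobj Xs (Suc k)) (\<lambda>i. face Xs (Suc k) i x) 1" by (simp add: a_minus_def)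
  also have "\<dots> = alt_sum (sobj Xs (Suc k)) (\<lambda>i. face Xs (Suc k) i x) (Suc (Suc k))"
    using 0 by (intro Y.alt_sum_truncate[symmetric]) auto
  finally show ?case by simp
next
  case (Suc q)
  let ?Y = "sobj Xs (Suc k)"
  interpret Y: module R ?Y by (rule sobj_module)
  interpret Y': module R "sobj Xs (Suc (Suc k))" by (rule sobj_module)
  interpret Z: module R "sobj Xs k" by (rule sobj_module)
  let ?r = "Suc q"
  let ?u = "face Xs (Suc k) (Suc ?r) x"
  let ?y = "x \<ominus>\<^bsub>sobj Xs (Suc (Suc k))\<^esub> degen Xs (Suc k) ?r ?u"
  have r: "?r \<le> Suc k" and x: "x \<in> carrier (sobj Xs (Suc (Suc k)))" using Suc.prems by auto
  have u: "?u \<in> carrier ?Y" and su: "degen Xs (Suc k) ?r ?u \<in> carrier (sobj Xs (Suc (Suc k)))" using r x by auto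
  have y: "?y \<in> carrier (sobj Xs (Suc (Suc k)))" using x su by simp
  have u_faces: "face Xs k l ?u = \<zero>\<^bsub>sobj Xs k\<^esub>" if "?r < l" "l \<le> Suc k" for l
  proof -
    have "face Xs k l ?u = face Xs k (Suc ?r) (face Xs (Suc k) (Suc l) x)"
      using face_face[of "Suc ?r" "Suc l" k x] that x by simp
    also have "face Xs (Suc k) (Suc l) x = \<zero>\<^bsub>?Y\<^esub>" using Suc.prems(3)[of "Suc l"] that by simp
    finally show ?thesis using linear_map_zero[OF sobj_module sobj_module face_linear, of "Suc ?r" k] that by simp
  qed
  have y_split: "face Xs (Suc k) l ?y = face Xs (Suc k) l x \<ominus>\<^bsub>?Y\<^esub> face Xs (Suc k) l (degen Xs (Suc k) ?r ?u)"
    if "l \<le> Suc (Suc k)" for l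
    using linear_map_diff[OF sobj_module sobj_module face_linear[OF that] x su] .
  have su_high: "face Xs (Suc k) l (degen Xs (Suc k) ?r ?u) = \<zero>\<^bsub>?Y\<^esub>" if "Suc ?r < l" "l \<le> Suc (Suc k)" for l
    using face_degen_greater[of ?r l k ?u] that u u_faces[of "l - 1"]
      linear_map_zero[OF sobj_module sobj_module degen_linear, of ?r k] by simp
  have y_faces: "face Xs (Suc k) l ?y = \<zero>\<^bsub>?Y\<^esub>" if "?r < l" "l \<le> Suc (Suc k)" for l
  proof (cases "l = Suc ?r")
    case True
    then show ?thesis using y_split[of l] face_degen_same[of "Suc ?r" ?r "Suc k" ?u] u r
      by (simp add: a_minus_def Y.r_neg)
  next
    case False
    then have "Suc ?r < l" using that by simp
    then show ?thesis using y_split[OF that(2)] su_high that(2) Suc.prems(3) by (simp add: Y.minus_zero_right)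
  qed
  let ?D = "\<lambda>z. alt_sum ?Y (\<lambda>i. face Xs (Suc k) i z) (Suc (Suc k))"
  let ?B = "alt_sum (sobj Xs k) (\<lambda>i. face Xs k i ?u) q"
  have Dcl: "?D z \<in> carrier ?Y" if "z \<in> carrier (sobj Xs (Suc (Suc k)))" for z
    using that by (intro Y.alt_sum_closed) simp
  have Bcl: "?B \<in> carrier (sobj Xs k)" using u r by (intro Z.alt_sum_closed) simp
  \<comment> \<open>Faces r and r + 1 of s_r u are both u and cancel, the higher ones vanish, and
    the lower ones give s_(r-1) of the partial sum \<open>?B\<close>.\<close>
  have "?D (degen Xs (Suc k) ?r ?u) = alt_sum ?Y (\<lambda>i. face Xs (Suc k) i (degen Xs (Suc k) ?r ?u)) (Suc (Suc q))"
    using su r su_high by (intro Y.alt_sum_truncate) auto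
  also have "\<dots> = alt_sum ?Y (\<lambda>i. face Xs (Suc k) i (degen Xs (Suc k) ?r ?u)) q"
    using su r u face_degen_same[of ?r ?r "Suc k" ?u] face_degen_same[of "Suc ?r" ?r "Suc k" ?u]
    by (intro Y.alt_sum_cancel) auto
  also have "\<dots> = alt_sum ?Y (\<lambda>i. degen Xs k q (face Xs k i ?u)) q"
    using face_degen_less[of _ ?r k ?u] u r by (intro Y.alt_sum_cong) simp
  also have "\<dots> = degen Xs k q ?B"
    using u r by (intro linear_map_alt_sum[where R = R, symmetric] sobj_module degen_linear) auto
  finally have D_su: "?D (degen Xs (Suc k) ?r ?u) = degen Xs k q ?B" .
  \<comment> \<open>The same \<open>?B\<close> arises from d_r of the alternating sum of x, because
    d_r d_r = d_r d_(r+1) cancels the two top terms.\<close>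
  have "face Xs k ?r (?D x) = alt_sum (sobj Xs k) (\<lambda>i. face Xs k ?r (face Xs (Suc k) i x)) (Suc (Suc k))"
    using r x by (intro linear_map_alt_sum[where R = R] sobj_module face_linear) auto
  also have "\<dots> = alt_sum (sobj Xs k) (\<lambda>i. face Xs k ?r (face Xs (Suc k) i x)) (Suc (Suc q))"
    using r x Suc.prems(3) linear_map_zero[OF sobj_module sobj_module face_linear, of ?r k]
    by (intro Z.alt_sum_truncate) auto
  also have "\<dots> = alt_sum (sobj Xs k) (\<lambda>i. face Xs k ?r (face Xs (Suc k) i x)) q"
    using r x face_face[of ?r "Suc ?r" k x] by (intro Z.alt_sum_cancel) auto
  also have "\<dots> = ?B"
    using r x face_face[of _ "Suc ?r" k x] by (intro Z.alt_sum_cong) simp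
  finally have dDx: "face Xs k ?r (?D x) = ?B" .
  have "?D ?y = alt_sum ?Y (\<lambda>i. face Xs (Suc k) i x \<ominus>\<^bsub>?Y\<^esub> face Xs (Suc k) i (degen Xs (Suc k) ?r ?u)) (Suc (Suc k))"
    by (rule Y.alt_sum_cong) (rule y_split)
  also have "\<dots> = ?D x \<ominus>\<^bsub>?Y\<^esub> ?D (degen Xs (Suc k) ?r ?u)"
    using x su by (intro Y.alt_sum_diff) auto
  finally have Dy: "?D ?y = ?D x \<ominus>\<^bsub>?Y\<^esub> degen Xs k q (face Xs k ?r (?D x))" by (simp only: D_su dDx)
  have "face Xs (Suc k) 0 (moore_step Xs (Suc k) (Suc ?r) x) = face Xs (Suc k) 0 (moore_step Xs (Suc k) (Suc q) ?y)"
    by simp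
  also have "\<dots> = moore_step Xs k q (?D ?y)"
    using Suc.prems y_faces y by (intro Suc.IH) auto
  also have "\<dots> = moore_step Xs k ?r (?D x)" unfolding Dy by (simp del: alt_sum.simps)
  finally show ?case .
qed

text \<open>This is what converts the identity of \<open>contracting_homotopy\<close> into one
  inside the Moore complex, where the differential is d_0.\<close>

lemma face_0_moore_proj:
  assumes "x \<in> carrier (sobj Xs (Suc k))"
  shows "face Xs k 0 (moore_proj Xs (Suc k) x) = moore_proj Xs k (alt_sum (sobj Xs k) (\<lambda>i. face Xs k i x) (Suc k))"
proof (cases k)
  case 0
  interpret Y: module R "sobj Xs 0" by (rule sobj_module)
  interpret Y': module R "sobj Xs (Suc 0)" by (rule sobj_module)
  show ?thesis
    using linear_map_diff[OF sobj_module sobj_module face_linear, of 0 0 x] assms 0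
      face_degen_same[of 0 0 0 "face Xs 0 (Suc 0) x"] by (simp add: a_minus_def)
next
  case (Suc k')
  then show ?thesis using face_0_moore_step[of x k' "Suc k'"] assms by (simp del: moore_step.simps alt_sum.simps)
qed

end

text \<open>The projector is assembled from faces, degeneracies and subtractions, all of which
  commute with simplicial linear maps.\<close>

lemma moore_proj_natural:
  assumes "simplicial_module R Ys" "simplicial_module R Zs"
    and lin: "\<And>k. linear_map R (sobj Ys k) (sobj Zs k) (\<phi> k)"
    and face: "\<And>k i x. i \<le> Suc k \<Longrightarrow> x \<in> carrier (sobj Ys (Suc k)) \<Longrightarrow> \<phi> k (face Ys k i x) = face Zs k i (\<phi> (Suc k) x)"
    and degen: "\<And>k i x. i \<le> k \<Longrightarrow> x \<in> carrier (sobj Ys k) \<Longrightarrow> \<phi> (Suc k) (degen Ys k i x) = degen Zs k i (\<phi> k x)"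
    and "x \<in> carrier (sobj Ys k)"
  shows "\<phi> k (moore_proj Ys k x) = moore_proj Zs k (\<phi> k x)"
proof (cases k)
  case (Suc k')
  interpret Y: simplicial_module R Ys by fact
  interpret Z: simplicial_module R Zs by fact
  have "\<phi> (Suc k') (moore_step Ys k' r x) = moore_step Zs k' r (\<phi> (Suc k') x)"
    if "r \<le> Suc k'" "x \<in> carrier (sobj Ys (Suc k'))" for r x
    using that
  proof (induction r arbitrary: x)
    case (Suc r)
    interpret Y': module R "sobj Ys (Suc k')" by (rule Y.sobj_module)
    have "\<phi> (Suc k') (x \<ominus>\<^bsub>sobj Ys (Suc k')\<^esub> degen Ys k' r (face Ys k' (Suc r) x)) =
      \<phi> (Suc k') x \<ominus>\<^bsub>sobj Zs (Suc k')\<^esub> degen Zs k' r (face Zs k' (Suc r) (\<phi> (Suc k') x))"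
      using linear_map_diff[OF Y.sobj_module Z.sobj_module lin] Suc.prems face degen by simp
    then show ?case using Suc by simp
  qed simp
  from this[of "Suc k'" x] show ?thesis using Suc assms(6) by (simp del: moore_step.simps)
qed simp

section \<open>Signs, and naturality of the homotopy in the functor\<close>

context functor_operators
begin

text \<open>The total differential brings in signs that depend on the parity of i; the homotopy has
  to commute with them.\<close>

lemma op_eval_uminus:
  assumes x: "x \<in> carrier (sobj FX j)"
  shows "op_eval j k z (\<ominus>\<^bsub>sobj FX j\<^esub> x) = \<ominus>\<^bsub>sobj FX k\<^esub> op_eval j k z x"
proof -
  interpret X: module R "sobj FX j" by (rule FX.sobj_module)
  interpret Y: module R "sobj FX k" by (rule FX.sobj_module)
  have zero: "\<ominus>\<^bsub>sobj FX k\<^esub> \<zero>\<^bsub>sobj FX k\<^esub> = \<zero>\<^bsub>sobj FX k\<^esub>"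
    using Y.minus_zero_right[OF Y.zero_closed] by (simp add: a_minus_def)
  have "op_value j k (\<ominus>\<^bsub>sobj FX j\<^esub> x) \<sigma> = \<ominus>\<^bsub>sobj FX k\<^esub> op_value j k x \<sigma>" for \<sigma>
  proof (cases "V j (Suc k) \<sigma>")
    case True
    have "polarized_arr A (sobj Xs j) (sobj Xs k) (Op j \<sigma>) (\<ominus>\<^bsub>fobj F (sobj Xs j)\<^esub> x) =
        \<ominus>\<^bsub>fobj F (sobj Xs k)\<^esub> polarized_arr A (sobj Xs j) (sobj Xs k) (Op j \<sigma>) x"
      using x by (intro linear_map_a_inv[OF fobj_module[OF proj] fobj_module[OF proj]]
        polarized_arr_linear[OF proj proj size_A Op_linear[OF True]]) (simp_all add: apply_functor_simps)
    then show ?thesis using True by (simp add: op_value_def apply_functor_simps)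
  qed (simp add: op_value_def zero)
  then show ?thesis unfolding op_eval_def
    by (intro linear_map_chain_eval[where R = R, symmetric] linear_map_uminus_fun[where R = R] linear_map_id
      FX.sobj_module op_value_closed x)
qed

end

context strict_poly_transformation
begin

lemma polarized_arr_natural:
  assumes "M \<in> proj_objects R" "N \<in> proj_objects R" "size A = s" "\<And>i. i \<in># A \<Longrightarrow> linear_map R M N (fs i)"
    and "x \<in> carrier (fobj F M)"
  shows "\<eta> N (source.polarized_arr A M N fs x) = target.polarized_arr A M N fs (\<eta> M x)"
  unfolding source.polarized_arr_def target.polarized_arr_def
  by (rule natural[OF assms(1,2) cring.polarized_power_schur[OF source.cring_R[OF assms(1)]
     proj_objects_module[OF assms(1)] proj_objects_module[OF assms(2)] assms(3,4)] assms(5)])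

lemma ordinary_arr_natural:
  assumes "M \<in> proj_objects R" "N \<in> proj_objects R" "linear_map R M N f" "x \<in> carrier (fobj F M)"
  shows "\<eta> N (source.ordinary_arr M N f x) = target.ordinary_arr M N f (\<eta> M x)"
  unfolding source.ordinary_arr_def target.ordinary_arr_def
  by (rule natural[OF assms(1,2) cring.tensor_power_map_schur[OF source.cring_R[OF assms(1)]
     proj_objects_module[OF assms(1)] proj_objects_module[OF assms(2)] assms(3)] assms(4)])

lemma component_linear: "M \<in> proj_objects R \<Longrightarrow> linear_map R (fobj F M) (fobj G M) (\<eta> M)"
  using component lin_hom_linear_map by blast

lemma moore_proj_component:
  assumes "simplicial_module R Xs" and proj: "\<And>j. sobj Xs j \<in> proj_objects R"
    and x: "x \<in> carrier (fobj F (sobj Xs k))"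
  shows "\<eta> (sobj Xs k) (moore_proj (apply_functor (underlying_functor R s F) Xs) k x) =
    moore_proj (apply_functor (underlying_functor R s G) Xs) k (\<eta> (sobj Xs k) x)"
proof (rule moore_proj_natural[where \<phi> = "\<lambda>k. \<eta> (sobj Xs k)"])
  interpret simplicial_module R Xs by fact
  show "simplicial_module R (apply_functor (underlying_functor R s F) Xs)"
    by (rule source.apply_functor_simplicial[OF assms(1,2)])
  show "simplicial_module R (apply_functor (underlying_functor R s G) Xs)"
    by (rule target.apply_functor_simplicial[OF assms(1,2)])
qed (use assms in \<open>simp_all add: source.apply_functor_simps target.apply_functor_simps component_linear ordinary_arr_natural
   simplicial_module.face_linear simplicial_module.degen_linear\<close>)

end

locale functor_operators_transformation =
  strict_poly_transformation R s F G \<eta> + SF: functor_operators R Xs A V Op g s F + SG: functor_operators R Xs A V Op g s G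
  for R :: "('r, 'x) ring_scheme" and Xs :: "('r, 'm) simplicial_data" and A
    and V :: "nat \<Rightarrow> nat \<Rightarrow> 'v list \<Rightarrow> bool" and Op and g
    and s :: nat and F G :: "('r, 'm, 'n) poly_functor" and \<eta>
begin

lemma op_eval_natural:
  assumes x: "x \<in> carrier (fobj F (sobj Xs j))"
  shows "\<eta> (sobj Xs k) (SF.op_eval j k z x) = SG.op_eval j k z (\<eta> (sobj Xs j) x)"
proof -
  have xF: "x \<in> carrier (sobj SF.FX j)" using x by (simp add: source.apply_functor_simps)
  have lin: "linear_map R (sobj SF.FX k) (sobj SG.FX k) (\<eta> (sobj Xs k))"
    using component_linear[OF SF.proj] by (simp add: source.apply_functor_simps target.apply_functor_simps)
  have "SG.op_value j k (\<eta> (sobj Xs j) x) \<sigma> = \<eta> (sobj Xs k) (SF.op_value j k x \<sigma>)" for \<sigma>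
  proof (cases "V j (Suc k) \<sigma>")
    case True
    then show ?thesis
      using polarized_arr_natural[OF SF.proj SF.proj SF.size_A SF.Op_linear[OF True] x]
      by (simp add: SF.op_value_def SG.op_value_def)
  next
    case False
    then show ?thesis
      using linear_map_zero[OF SF.FX.sobj_module SG.FX.sobj_module lin] by (simp add: SF.op_value_def SG.op_value_def)
  qed
  then show ?thesis unfolding SF.op_eval_def SG.op_eval_def
    by (intro linear_map_chain_eval[OF SF.FX.sobj_module SG.FX.sobj_module lin SF.op_value_closed[OF xF]])
qed

end

locale coned_transformation =
  strict_poly_transformation R s F G \<eta> + CF: coned_functor R Xs n cone s F A D + CG: coned_functor R Xs n cone s G A D
  for R :: "('r, 'x) ring_scheme" and Xs :: "('r, 'm) simplicial_data" and n cone s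
    and F G :: "('r, 'm, 'n) poly_functor" and A D \<eta>
begin

sublocale TP: functor_operators_transformation R Xs A prism_simplex "\<lambda>j \<sigma> c. CF.prism_op j \<sigma>"
    "\<lambda>i. map_prod (shift i) id" s F G \<eta> ..

sublocale TQ: functor_operators_transformation R Xs A "product_simplex D"
    "\<lambda>j \<sigma> c x. simplicial_op Xs j (map (\<lambda>v. v c) \<sigma>) (CF.trunc j x)" shift_vertex s F G \<eta> ..

text \<open>The cone, the multiset and the chains are common to F and G, and a natural
  transformation commutes with the action of each polarized power.\<close>

lemma contracting_natural:
  assumes x: "x \<in> carrier (fobj F (sobj Xs j))"
  shows "\<eta> (sobj Xs (Suc j)) (CF.contracting j x) = CG.contracting j (\<eta> (sobj Xs j) x)"
proof -
  have xF: "x \<in> carrier (sobj CF.FX j)" using x by (simp add: source.apply_functor_simps)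
  have lin: "linear_map R (sobj CF.FX (Suc j)) (sobj CG.FX (Suc j)) (\<eta> (sobj Xs (Suc j)))"
    using component_linear[OF CF.proj] by (simp add: source.apply_functor_simps target.apply_functor_simps)
  show ?thesis unfolding CF.contracting_def CG.contracting_def
    using linear_map_diff[OF CF.P.FX.sobj_module CG.P.FX.sobj_module lin CF.Q.op_eval_closed[OF xF] CF.P.op_eval_closed[OF xF]]
    by (simp add: TP.op_eval_natural[OF x] TQ.op_eval_natural[OF x])
qed

end

lemma (in coned_functor) contracting_uminus:
  assumes x: "x \<in> carrier (sobj FX j)"
  shows "contracting j (\<ominus>\<^bsub>sobj FX j\<^esub> x) = \<ominus>\<^bsub>sobj FX (Suc j)\<^esub> contracting j x"
proof -
  interpret Y: module R "sobj FX (Suc j)" by (rule P.FX.sobj_module)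
  show ?thesis
    using P.op_eval_closed[OF x] Q.op_eval_closed[OF x]
    by (simp add: contracting_def P.op_eval_uminus[OF x] Q.op_eval_uminus[OF x] a_minus_def Y.minus_add)
qed

section \<open>The total complex\<close>

lemma direct_sum_simps:
  "carrier (direct_sum I M) = (\<Pi>\<^sub>E i\<in>I. carrier (M i))"
  "\<zero>\<^bsub>direct_sum I M\<^esub> = (\<lambda>i\<in>I. \<zero>\<^bsub>M i\<^esub>)"
  "f \<oplus>\<^bsub>direct_sum I M\<^esub> g = (\<lambda>i\<in>I. f i \<oplus>\<^bsub>M i\<^esub> g i)"
  "r \<odot>\<^bsub>direct_sum I M\<^esub> f = (\<lambda>i\<in>I. r \<odot>\<^bsub>M i\<^esub> f i)"
  by (simp_all add: direct_sum_def)

lemma direct_sum_module: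
  assumes "cring R" "\<And>i. i \<in> I \<Longrightarrow> module R (M i)"
  shows "module R (direct_sum I M)"
proof -
  have ag: "abelian_group (M i)" if "i \<in> I" for i using assms(2)[OF that] by (simp add: module_def)
  note cl = abelian_group.axioms(1)[OF ag] abelian_monoid.a_closed
  show ?thesis unfolding direct_sum_def
  proof (rule mk_moduleI[OF assms(1)], goal_cases)
    case (1 x y)
    then show ?case using abelian_monoid.a_closed[OF cl(1)] by (auto simp: PiE_def Pi_def)
  next
    case 2
    then show ?case using abelian_monoid.zero_closed[OF cl(1)] by auto
  next
    case (3 x y z)
    then show ?case using abelian_monoid.a_assoc[OF cl(1)] by (intro restrict_ext) (auto simp: PiE_def Pi_def)
  next
    case (4 x y)
    then show ?case using abelian_monoid.a_comm[OF cl(1)] by (intro restrict_ext) (auto simp: PiE_def Pi_def)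
  next
    case (5 x)
    then show ?case using abelian_monoid.l_zero[OF cl(1)]
      by (intro extensionalityI[of _ I]) (auto simp: PiE_def Pi_def)
  next
    case (6 x)
    then show ?case using abelian_group.l_neg[OF ag] abelian_group.a_inv_closed[OF ag]
      by (intro bexI[of _ "\<lambda>i\<in>I. \<ominus>\<^bsub>M i\<^esub> x i"]) (auto simp: PiE_def Pi_def intro!: restrict_ext)
  next
    case (7 r x)
    then show ?case using module.smult_closed[OF assms(2)] by (auto simp: PiE_def Pi_def)
  next
    case (8 r t x)
    then show ?case using module.smult_l_distr[OF assms(2)] by (intro restrict_ext) (auto simp: PiE_def Pi_def)
  next
    case (9 r x y)
    then show ?case using module.smult_r_distr[OF assms(2)] by (intro restrict_ext) (auto simp: PiE_def Pi_def)
  next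
    case (10 r t x)
    then show ?case using module.smult_assoc1[OF assms(2)] by (intro restrict_ext) (auto simp: PiE_def Pi_def)
  next
    case (11 x)
    then show ?case using module.smult_one[OF assms(2)]
      by (intro extensionalityI[of _ I]) (auto simp: PiE_def Pi_def)
  qed
qed

lemma linear_map_image_submodule:
  assumes "module R M" "module R N" "linear_map R M N f"
  shows "submodule (f ` carrier M) R N"
proof -
  interpret M: module R M by fact
  interpret N: module R N by fact
  show ?thesis
  proof (rule N.submoduleI, goal_cases)
    case 1 then show ?case using linear_map_closed[OF assms(3)] by auto
  next
    case 2 then show ?case using linear_map_zero[OF assms] by (metis M.zero_closed image_eqI)
  next
    case (3 a) then show ?case using linear_map_a_inv[OF assms] by (metis (no_types, lifting) M.a_inv_closed image_iff)
  next
    case (4 a b) then show ?case using linear_map_add[OF assms(3)] by (metis (no_types, lifting) M.a_closed image_iff)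
  next
    case (5 r x) then show ?case using linear_map_smult[OF assms(3)] by (metis (no_types, lifting) M.smult_closed image_iff)
  qed
qed

locale coned_complex = strict_poly_complex R s C \<delta> + coned_simplicial_module R Xs n cone
  for R :: "('r, 'x) ring_scheme" and s and C :: "nat \<Rightarrow> ('r, 'm, 'n) poly_functor" and \<delta>
    and Xs :: "('r, 'm) simplicial_data" and n cone +
  fixes A :: "nat multiset" and D :: nat
  assumes proj: "sobj Xs j \<in> proj_objects R" and size_A: "size A = s" and set_A: "set_mset A = {..<D}"
begin

sublocale T: strict_poly_transformation R s "C (Suc i)" "C i" "\<delta> i" for i
  by (rule differential)

sublocale CF: coned_functor R Xs n cone s "C i" A D for i
  unfolding coned_functor_def coned_functor_axioms_def
  using T.target.strict_poly_functor_axioms coned_simplicial_module_axioms proj size_A set_A by blast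

sublocale CT: coned_transformation R Xs n cone s "C (Suc i)" "C i" A D "\<delta> i" for i ..

abbreviation "FX i \<equiv> apply_functor (underlying_functor R s (C i)) Xs"

abbreviation "K \<equiv> c_complex (\<lambda>i. underlying_functor R s (C i)) \<delta> Xs"

abbreviation "multinomial \<equiv> card (permutations_of_multiset A)"

lemma FX_simps: "sobj (FX i) k = fobj (C i) (sobj Xs k)"
  by (rule T.target.apply_functor_simps)

lemma cobj_normalized: "cobj (normalized_chains (FX i)) j = (sobj (FX i) j)\<lparr>carrier := CF.P.FX.moore_chains i j\<rparr>"
  by (simp add: normalized_chains_def CF.P.FX.moore_chains_def)

lemma cobj_K: "cobj K k = direct_sum {..k} (\<lambda>i. (sobj (FX i) (k - i))\<lparr>carrier := CF.P.FX.moore_chains i (k - i)\<rparr>)"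
  by (simp add: c_complex_def Let_def cobj_normalized[symmetric])

lemma fobj_underlying: "fobj (underlying_functor R s (C i)) = fobj (C i)"
  by (simp add: underlying_functor_def)

lemma cdiff_K: "cdiff K k f = (\<lambda>i\<in>{..k}. \<delta> i (sobj Xs (k - i)) (f (Suc i)) \<oplus>\<^bsub>sobj (FX i) (k - i)\<^esub>
    (if even i then face (FX i) (k - i) 0 (f i) else \<ominus>\<^bsub>sobj (FX i) (k - i)\<^esub> face (FX i) (k - i) 0 (f i)))"
  by (simp add: c_complex_def Let_def normalized_chains_def FX_simps fobj_underlying cong: if_cong)

lemma cring_R: "cring R"
  using sobj_module[of 0] by (simp add: module_def)

lemma cobj_K_module: "module R (cobj K k)"
  unfolding cobj_K by (rule direct_sum_module[OF cring_R CF.P.FX.moore_chains_module])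

lemma delta_linear: "linear_map R (sobj (FX (Suc i)) k) (sobj (FX i) k) (\<delta> i (sobj Xs k))"
  unfolding FX_simps by (rule T.component_linear[OF proj])

lemma delta_face:
  assumes "l \<le> Suc k" "x \<in> carrier (sobj (FX (Suc i)) (Suc k))"
  shows "\<delta> i (sobj Xs k) (face (FX (Suc i)) k l x) = face (FX i) k l (\<delta> i (sobj Xs (Suc k)) x)"
  using T.ordinary_arr_natural[OF proj proj face_linear[OF assms(1)]] assms(2)
  by (simp add: T.source.apply_functor_simps T.target.apply_functor_simps)

lemma delta_moore:
  assumes "x \<in> CF.P.FX.moore_chains (Suc i) k"
  shows "\<delta> i (sobj Xs k) x \<in> CF.P.FX.moore_chains i k"
proof -
  have x: "x \<in> carrier (sobj (FX (Suc i)) k)" using assms by (simp add: CF.P.FX.moore_chains_def)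
  have "face (FX i) k' l (\<delta> i (sobj Xs (Suc k')) x) = \<zero>\<^bsub>sobj (FX i) k'\<^esub>" if "k = Suc k'" "l \<in> {1..Suc k'}" for k' l
    using delta_face[of l k' x i] assms that x linear_map_zero[OF CF.P.FX.sobj_module CF.P.FX.sobj_module delta_linear[of i k']]
    by (simp add: CF.P.FX.moore_chains_def)
  then show ?thesis using linear_map_closed[OF delta_linear x] by (auto simp: CF.P.FX.moore_chains_def)
qed

lemma face_moore:
  assumes "x \<in> CF.P.FX.moore_chains i (Suc k)"
  shows "face (FX i) k 0 x \<in> CF.P.FX.moore_chains i k"
proof -
  have x: "x \<in> carrier (sobj (FX i) (Suc k))" using assms by (simp add: CF.P.FX.moore_chains_def)
  have "face (FX i) k' l (face (FX i) k 0 x) = \<zero>\<^bsub>sobj (FX i) k'\<^esub>" if "k = Suc k'" "l \<in> {1..Suc k'}" for k' l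
  proof -
    have "face (FX i) k' l (face (FX i) k 0 x) = face (FX i) k' 0 (face (FX i) k (Suc l) x)"
      using CF.P.FX.face_face[of 0 "Suc l" k' x i] that x by simp
    also have "face (FX i) k (Suc l) x = \<zero>\<^bsub>sobj (FX i) k\<^esub>"
      using assms that by (simp add: CF.P.FX.moore_chains_def)
    finally show ?thesis
      using linear_map_zero[OF CF.P.FX.sobj_module CF.P.FX.sobj_module CF.P.FX.face_linear[of 0 k' i]] that by simp
  qed
  then show ?thesis using x by (auto simp: CF.P.FX.moore_chains_def)
qed

lemma cdiff_K_linear: "linear_map R (cobj K (Suc k)) (cobj K k) (cdiff K k)"
proof -
  let ?N = "\<lambda>i j. (sobj (FX i) j)\<lparr>carrier := CF.P.FX.moore_chains i j\<rparr>"
  have mod: "module R (?N i j)" for i j by (rule CF.P.FX.moore_chains_module)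
  have sub: "CF.P.FX.moore_chains i j \<subseteq> carrier (sobj (FX i) j)" for i j by (auto simp: CF.P.FX.moore_chains_def)
  \<comment> \<open>\<open>c_complex\<close> negates in the full module, whereas linearity is argued
    in the submodule of Moore chains; the two inverses agree.\<close>
  have inv: "\<ominus>\<^bsub>?N i j\<^esub> x = \<ominus>\<^bsub>sobj (FX i) j\<^esub> x" if "x \<in> CF.P.FX.moore_chains i j" for i j x
  proof -
    interpret Y: module R "sobj (FX i) j" by (rule CF.P.FX.sobj_module)
    interpret N: module R "?N i j" by (rule mod)
    have "\<ominus>\<^bsub>?N i j\<^esub> x \<oplus>\<^bsub>sobj (FX i) j\<^esub> x = \<zero>\<^bsub>sobj (FX i) j\<^esub>" using N.l_neg[of x] that by simp
    moreover have "\<ominus>\<^bsub>?N i j\<^esub> x \<in> carrier (sobj (FX i) j)" using N.a_inv_closed[of x] that sub by auto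
    moreover have "x \<in> carrier (sobj (FX i) j)" using that sub by blast
    ultimately show ?thesis by (intro Y.minus_equality[symmetric])
  qed
  have comp: "linear_map R (cobj K (Suc k)) (?N i (Suc k - i)) (\<lambda>f. f i)" if "i \<le> Suc k" for i
    using that unfolding cobj_K by (auto simp: linear_map_def direct_sum_simps)
  have d: "linear_map R (?N (Suc i) j) (?N i j) (\<delta> i (sobj Xs j))" for i j
    using delta_linear[of i j] delta_moore[of _ i j] sub by (auto simp: linear_map_def Pi_def subset_iff)
  have fc: "linear_map R (?N i (Suc j)) (?N i j) (face (FX i) j 0)" for i j
    using CF.P.FX.face_linear[of 0 j i] face_moore[of _ i j] sub by (auto simp: linear_map_def Pi_def subset_iff)
  have lin: "linear_map R (cobj K (Suc k)) (?N i (k - i)) (\<lambda>f. cdiff K k f i)" if "i \<le> k" for i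
  proof -
    have c1: "linear_map R (cobj K (Suc k)) (?N (Suc i) (k - i)) (\<lambda>f. f (Suc i))"
      using comp[of "Suc i"] that by simp
    have c2: "linear_map R (cobj K (Suc k)) (?N i (Suc (k - i))) (\<lambda>f. f i)"
      using comp[of i] that by (simp add: Suc_diff_le)
    have 1: "linear_map R (cobj K (Suc k)) (?N i (k - i)) (\<lambda>f. \<delta> i (sobj Xs (k - i)) (f (Suc i)))"
      by (rule linear_map_comp[OF c1 d])
    have 2: "linear_map R (cobj K (Suc k)) (?N i (k - i)) (\<lambda>f. face (FX i) (k - i) 0 (f i))"
      by (rule linear_map_comp[OF c2 fc])
    have 3: "linear_map R (cobj K (Suc k)) (?N i (k - i)) (\<lambda>f. \<ominus>\<^bsub>?N i (k - i)\<^esub> face (FX i) (k - i) 0 (f i))"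
      by (rule linear_map_uminus_fun[OF cobj_K_module mod 2])
    have "linear_map R (cobj K (Suc k)) (?N i (k - i)) (\<lambda>f. \<delta> i (sobj Xs (k - i)) (f (Suc i)) \<oplus>\<^bsub>?N i (k - i)\<^esub>
      (if even i then face (FX i) (k - i) 0 (f i) else \<ominus>\<^bsub>?N i (k - i)\<^esub> face (FX i) (k - i) 0 (f i)))"
      using 2 3 by (intro linear_map_add_fun[OF cobj_K_module mod 1]) (cases "even i"; simp)
    then show ?thesis
    proof (rule linear_map_cong[OF cobj_K_module, rotated])
      fix f assume "f \<in> carrier (cobj K (Suc k))"
      then have "face (FX i) (k - i) 0 (f i) \<in> CF.P.FX.moore_chains i (k - i)"
        using linear_map_closed[OF 2, of f] by simp
      then show "\<delta> i (sobj Xs (k - i)) (f (Suc i)) \<oplus>\<^bsub>?N i (k - i)\<^esub>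
        (if even i then face (FX i) (k - i) 0 (f i) else \<ominus>\<^bsub>?N i (k - i)\<^esub> face (FX i) (k - i) 0 (f i)) = cdiff K k f i"
        using that by (simp add: cdiff_K inv)
    qed
  qed
  have ext: "cdiff K k f \<in> extensional {..k}" for f by (simp add: cdiff_K)
  show ?thesis unfolding linear_map_def
  proof (intro conjI ballI)
    show "cdiff K k \<in> carrier (cobj K (Suc k)) \<rightarrow> carrier (cobj K k)"
      unfolding cobj_K[of k] direct_sum_simps using linear_map_closed[OF lin] ext
      by (auto simp: PiE_iff)
    show "cdiff K k (f \<oplus>\<^bsub>cobj K (Suc k)\<^esub> g) = cdiff K k f \<oplus>\<^bsub>cobj K k\<^esub> cdiff K k g"
      if "f \<in> carrier (cobj K (Suc k))" "g \<in> carrier (cobj K (Suc k))" for f g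
      unfolding cobj_K[of k] direct_sum_simps using linear_map_add[OF lin that] ext
      by (intro extensionalityI[of _ "{..k}"]) auto
    show "cdiff K k (r \<odot>\<^bsub>cobj K (Suc k)\<^esub> f) = r \<odot>\<^bsub>cobj K k\<^esub> cdiff K k f"
      if "r \<in> carrier R" "f \<in> carrier (cobj K (Suc k))" for r f
      unfolding cobj_K[of k] direct_sum_simps using linear_map_smult[OF lin that] ext
      by (intro extensionalityI[of _ "{..k}"]) auto
  qed
qed

text \<open>The sign (-1)^i on summand i cancels the sign of d_0 there, and the opposite signs of
  neighbouring summands match the sign in the cycle relation. The summand t + 1 has no counterpart
  in degree t and gets 0.\<close>

definition total_homotopy :: "nat \<Rightarrow> (nat \<Rightarrow> 'n) \<Rightarrow> nat \<Rightarrow> 'n" where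
  "total_homotopy t f = (\<lambda>i\<in>{..Suc t}. if i = Suc t then \<zero>\<^bsub>sobj (FX i) 0\<^esub> else
     moore_proj (FX i) (Suc (t - i)) (if even i then CF.contracting i (t - i) (f i)
       else \<ominus>\<^bsub>sobj (FX i) (Suc (t - i))\<^esub> CF.contracting i (t - i) (f i)))"

lemma total_homotopy_closed:
  assumes "f \<in> carrier (cobj K t)"
  shows "total_homotopy t f \<in> carrier (cobj K (Suc t))"
proof -
  have "total_homotopy t f i \<in> CF.P.FX.moore_chains i (Suc t - i)" if i: "i \<le> Suc t" for i
  proof (cases "i = Suc t")
    case True
    interpret Y: module R "sobj (FX (Suc t)) 0" by (rule CF.P.FX.sobj_module)
    show ?thesis using True Y.zero_closed by (simp add: total_homotopy_def CF.P.FX.moore_chains_def)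
  next
    case False
    then have i: "i \<le> t" using i by simp
    interpret Y: module R "sobj (FX i) (Suc (t - i))" by (rule CF.P.FX.sobj_module)
    have "f i \<in> carrier (sobj (FX i) (t - i))"
      using assms i by (auto simp: cobj_K direct_sum_simps CF.P.FX.moore_chains_def dest: PiE_mem)
    then have "CF.contracting i (t - i) (f i) \<in> carrier (sobj (FX i) (Suc (t - i)))" by (rule CF.contracting_closed)
    then show ?thesis using False i CF.P.FX.moore_proj_closed by (simp add: total_homotopy_def Suc_diff_le del: moore_proj.simps)
  qed
  then show ?thesis by (auto simp: cobj_K direct_sum_simps PiE_iff) (simp add: total_homotopy_def)
qed

text \<open>
  A cycle satisfies $d_0 f_i = \mp \delta f_{i+1}$, so naturality turns the second term of the
  simplicial contraction of $f_i$ into the $\delta$-component of the total differential.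
\<close>

lemma cdiff_total_homotopy:
  assumes f: "f \<in> cycles K t" and t: "t < n * D" and i: "i \<le> t"
  shows "cdiff K t (total_homotopy t f) i = [multinomial] \<cdot>\<^bsub>sobj (FX i) (t - i)\<^esub> f i"
proof -
  let ?Y = "\<lambda>i j. sobj (FX i) j"
  let ?h = "\<lambda>i. CF.contracting i"
  have fc: "f i \<in> CF.P.FX.moore_chains i (t - i)" if "i \<le> t" for i
    using f that by (auto simp: cycles_def cobj_K direct_sum_simps dest: PiE_mem)
  then have fc': "f i \<in> carrier (?Y i (t - i))" if "i \<le> t" for i using that by (auto simp: CF.P.FX.moore_chains_def)
  have hc: "?h i (t - i) (f i) \<in> carrier (?Y i (Suc (t - i)))" if "i \<le> t" for i
    by (rule CF.contracting_closed[OF fc'[OF that]])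
  interpret Y: module R "?Y i (t - i)" by (rule CF.P.FX.sobj_module)
  interpret Y': module R "?Y i (Suc (t - i))" by (rule CF.P.FX.sobj_module)
  let ?D = "\<lambda>z. alt_sum (?Y i (t - i)) (\<lambda>l. face (FX i) (t - i) l z) (Suc (t - i))"
  let ?z = "if even i then ?h i (t - i) (f i) else \<ominus>\<^bsub>?Y i (Suc (t - i))\<^esub> ?h i (t - i) (f i)"
  have zc: "?z \<in> carrier (?Y i (Suc (t - i)))" using hc[OF i] by simp
  have Dc: "?D x \<in> carrier (?Y i (t - i))" if "x \<in> carrier (?Y i (Suc (t - i)))" for x
    using that by (intro Y.alt_sum_closed) simp
  have Dneg: "?D (\<ominus>\<^bsub>?Y i (Suc (t - i))\<^esub> x) = \<ominus>\<^bsub>?Y i (t - i)\<^esub> ?D x" if "x \<in> carrier (?Y i (Suc (t - i)))" for x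
  proof -
    have "?D (\<ominus>\<^bsub>?Y i (Suc (t - i))\<^esub> x) = alt_sum (?Y i (t - i)) (\<lambda>l. \<ominus>\<^bsub>?Y i (t - i)\<^esub> face (FX i) (t - i) l x) (Suc (t - i))"
      by (rule Y.alt_sum_cong) (rule linear_map_a_inv[OF CF.P.FX.sobj_module CF.P.FX.sobj_module CF.P.FX.face_linear that])
    also have "\<dots> = \<ominus>\<^bsub>?Y i (t - i)\<^esub> ?D x" using that by (intro Y.alt_sum_uminus) simp
    finally show ?thesis .
  qed
  let ?m = "moore_proj (FX i) (t - i)"
  note ml = CF.P.FX.moore_proj_linear[of i "t - i"]
  have "face (FX i) (t - i) 0 (total_homotopy t f i) = face (FX i) (t - i) 0 (moore_proj (FX i) (Suc (t - i)) ?z)"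
    using i by (simp add: total_homotopy_def)
  also have "\<dots> = ?m (?D ?z)" by (rule CF.P.FX.face_0_moore_proj[OF zc])
  finally have face: "(if even i then face (FX i) (t - i) 0 (total_homotopy t f i)
      else \<ominus>\<^bsub>?Y i (t - i)\<^esub> face (FX i) (t - i) 0 (total_homotopy t f i)) = ?m (?D (?h i (t - i) (f i)))"
    using Dneg[OF hc[OF i]] Dc[OF hc[OF i]] linear_map_closed[OF ml]
    by (simp add: linear_map_a_inv[OF CF.P.FX.sobj_module CF.P.FX.sobj_module ml] del: alt_sum.simps)
  let ?E = "case t - i of 0 \<Rightarrow> \<zero>\<^bsub>?Y i (t - i)\<^esub> | Suc k \<Rightarrow> ?h i k (face (FX i) k 0 (f i))"
  have "\<delta> i (sobj Xs (t - i)) (total_homotopy t f (Suc i)) = ?m ?E"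
  proof (cases "t - i")
    \<comment> \<open>Here i = t: the component t + 1 of the homotopy is 0 by definition, matching
      the zero second term of the contraction in simplicial degree 0.\<close>
    case 0
    then have "i = t" using i by simp
    then show ?thesis
      using linear_map_zero[OF CF.P.FX.sobj_module CF.P.FX.sobj_module delta_linear, of t 0]
      by (simp add: total_homotopy_def)
  next
    case (Suc k)
    then have i': "Suc i \<le> t" and k: "t - Suc i = k" "Suc t - Suc i = Suc k" by auto
    obtain t' where t': "t = Suc t'" using i' by (cases t) auto
    have ti: "i \<le> t'" "t' - i = k" using i' k t' by auto
    interpret Z: module R "?Y i k" by (rule CF.P.FX.sobj_module)
    interpret Z': module R "?Y (Suc i) (Suc k)" by (rule CF.P.FX.sobj_module)
    have x: "f (Suc i) \<in> carrier (?Y (Suc i) k)" using fc'[OF i'] k by simp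
    have hx: "?h (Suc i) k (f (Suc i)) \<in> carrier (?Y (Suc i) (Suc k))" by (rule CF.contracting_closed[OF x])
    let ?v = "\<delta> i (sobj Xs k) (f (Suc i))" and ?w = "face (FX i) k 0 (f i)"
    have v: "?v \<in> carrier (?Y i k)" by (rule linear_map_closed[OF delta_linear x])
    have w: "?w \<in> carrier (?Y i k)" using fc'[OF i] Suc by simp
    have "cdiff K t' f = \<zero>\<^bsub>cobj K t'\<^esub>" using f t' by (simp add: cycles_def)
    then have "cdiff K t' f i = \<zero>\<^bsub>cobj K t'\<^esub> i" by simp
    then have "?v \<oplus>\<^bsub>?Y i k\<^esub> (if even i then ?w else \<ominus>\<^bsub>?Y i k\<^esub> ?w) = \<zero>\<^bsub>?Y i k\<^esub>"
      using ti by (simp add: cdiff_K cobj_K direct_sum_simps cong: if_cong)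
    then have v_eq: "?v = (if even i then \<ominus>\<^bsub>?Y i k\<^esub> ?w else ?w)"
      using v w Z.minus_equality[of ?v "if even i then ?w else \<ominus>\<^bsub>?Y i k\<^esub> ?w"] by (auto split: if_splits)
    have "total_homotopy t f (Suc i) = moore_proj (FX (Suc i)) (Suc k) (if even (Suc i) then ?h (Suc i) k (f (Suc i))
       else \<ominus>\<^bsub>?Y (Suc i) (Suc k)\<^esub> ?h (Suc i) k (f (Suc i)))"
      using i' k by (simp add: total_homotopy_def del: moore_proj.simps)
    then have "\<delta> i (sobj Xs (Suc k)) (total_homotopy t f (Suc i)) = moore_proj (FX i) (Suc k) (\<delta> i (sobj Xs (Suc k))
       (if even (Suc i) then ?h (Suc i) k (f (Suc i)) else \<ominus>\<^bsub>?Y (Suc i) (Suc k)\<^esub> ?h (Suc i) k (f (Suc i))))"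
      using T.moore_proj_component[OF simplicial_module_axioms proj, of _ i "Suc k"] hx Z'.a_inv_closed[OF hx]
      by (simp add: FX_simps del: moore_proj.simps)
    also have "\<delta> i (sobj Xs (Suc k)) (if even (Suc i) then ?h (Suc i) k (f (Suc i)) else \<ominus>\<^bsub>?Y (Suc i) (Suc k)\<^esub> ?h (Suc i) k (f (Suc i)))
       = (if even (Suc i) then ?h i k ?v else \<ominus>\<^bsub>?Y i (Suc k)\<^esub> ?h i k ?v)"
      using CT.contracting_natural[of "f (Suc i)" i k] x linear_map_a_inv[OF CF.P.FX.sobj_module CF.P.FX.sobj_module delta_linear hx]
      by (simp add: FX_simps)
    also have "\<dots> = ?h i k ?w"
      using v_eq CF.contracting_uminus[OF w] CF.contracting_closed[OF w] Suc Y.minus_minus by auto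
    finally show ?thesis using Suc by (simp del: moore_proj.simps)
  qed
  moreover have Ec: "?E \<in> carrier (?Y i (t - i))"
    using fc'[OF i] Y.zero_closed by (cases "t - i") (auto intro!: CF.contracting_closed)
  moreover have "t - i < n * D" using t by simp
  note CF.contracting_homotopy[OF this fc[OF i]]
  ultimately have "cdiff K t (total_homotopy t f) i = ?m ([multinomial] \<cdot>\<^bsub>?Y i (t - i)\<^esub> f i)"
    using face i linear_map_add[OF ml Dc[OF hc[OF i]] Ec] Dc[OF hc[OF i]] linear_map_closed[OF ml]
    by (simp add: cdiff_K Y.a_comm del: moore_proj.simps alt_sum.simps)
  also have "\<dots> = [multinomial] \<cdot>\<^bsub>?Y i (t - i)\<^esub> f i"
  proof (rule CF.P.FX.moore_proj_id)
    interpret N: module R "(?Y i (t - i))\<lparr>carrier := CF.P.FX.moore_chains i (t - i)\<rparr>" by (rule CF.P.FX.moore_chains_module)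
    have "[k] \<cdot>\<^bsub>?Y i (t - i)\<^esub> f i \<in> CF.P.FX.moore_chains i (t - i)" for k :: nat
      using N.zero_closed N.a_closed fc[OF i] by (induction k) simp_all
    then show "[multinomial] \<cdot>\<^bsub>?Y i (t - i)\<^esub> f i \<in> CF.P.FX.moore_chains i (t - i)" .
  qed
  finally show ?thesis .
qed

lemma carrier_homology: "carrier (homology K t) = (\<lambda>f. boundaries K t +>\<^bsub>cobj K t\<^esub> f) ` cycles K t"
  by (auto simp: homology_def quot_module_def A_RCOSETS_def' a_r_coset_def')

lemma homology_killed:
  assumes t: "t < n * D" and x: "x \<in> carrier (homology K t)"
  shows "[multinomial] \<cdot>\<^bsub>homology K t\<^esub> x = \<zero>\<^bsub>homology K t\<^esub>"
proof -
  let ?M = "cobj K t" and ?B = "boundaries K t"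
  interpret M: module R ?M by (rule cobj_K_module)
  \<comment> \<open>Homology is a subset of the quotient of all chains by the boundaries, with the
    same zero and addition, so multiples are computed in that module.\<close>
  interpret Q: quotient_module R ?M ?B
    unfolding quotient_module_def quotient_module_axioms_def boundaries_def
    using cobj_K_module linear_map_image_submodule[OF cobj_K_module cobj_K_module cdiff_K_linear] by blast
  obtain f where f: "f \<in> cycles K t" "x = ?B +>\<^bsub>?M\<^esub> f"
    using x by (auto simp: carrier_homology)
  have fM: "f \<in> carrier ?M" using f(1) by (simp add: cycles_def)
  have H: "\<zero>\<^bsub>homology K t\<^esub> = ?B" "ring.add (homology K t) = ring.add (quot_module ?M ?B)"
    by (auto simp: homology_def quot_module_def set_add_def set_mult_def fun_eq_iff)
  have pow: "[k] \<cdot>\<^bsub>homology K t\<^esub> x = ?B +>\<^bsub>?M\<^esub> ([k] \<cdot>\<^bsub>?M\<^esub> f)" for k :: nat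
  proof (induction k)
    case 0
    then show ?case using Q.coset_zero[OF Q.H.zero_closed] by (simp add: add_pow_def H)
  next
    case (Suc k)
    have "[Suc k] \<cdot>\<^bsub>homology K t\<^esub> x = [k] \<cdot>\<^bsub>homology K t\<^esub> x \<oplus>\<^bsub>homology K t\<^esub> x" by (simp add: add_pow_def)
    also have "\<dots> = (?B +>\<^bsub>?M\<^esub> ([k] \<cdot>\<^bsub>?M\<^esub> f)) \<oplus>\<^bsub>quot_module ?M ?B\<^esub> (?B +>\<^bsub>?M\<^esub> f)" unfolding Suc H by (simp only: f(2))
    also have "\<dots> = ?B +>\<^bsub>?M\<^esub> ([k] \<cdot>\<^bsub>?M\<^esub> f \<oplus>\<^bsub>?M\<^esub> f)" using fM by (intro Q.add_quot_module) simp_all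
    finally show ?case using fM by simp
  qed
  have fpow: "[k] \<cdot>\<^bsub>?M\<^esub> f = (\<lambda>i\<in>{..t}. [k] \<cdot>\<^bsub>sobj (FX i) (t - i)\<^esub> f i)" for k :: nat
  proof (induction k)
    case 0
    then show ?case by (simp add: add_pow_def cobj_K direct_sum_simps)
  next
    case (Suc k)
    have "[Suc k] \<cdot>\<^bsub>?M\<^esub> f = [k] \<cdot>\<^bsub>?M\<^esub> f \<oplus>\<^bsub>?M\<^esub> f" by (simp add: add_pow_def)
    also have "\<dots> = (\<lambda>i\<in>{..t}. [k] \<cdot>\<^bsub>sobj (FX i) (t - i)\<^esub> f i \<oplus>\<^bsub>sobj (FX i) (t - i)\<^esub> f i)"
      unfolding Suc unfolding cobj_K direct_sum_simps by (intro restrict_ext) simp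
    also have "\<dots> = (\<lambda>i\<in>{..t}. [Suc k] \<cdot>\<^bsub>sobj (FX i) (t - i)\<^esub> f i)" by (simp add: add_pow_def)
    finally show ?case .
  qed
  have "[multinomial] \<cdot>\<^bsub>?M\<^esub> f = cdiff K t (total_homotopy t f)"
    unfolding fpow using cdiff_total_homotopy[OF f(1) t]
    by (intro extensionalityI[of _ "{..t}"]) (auto simp: cdiff_K[abs_def])
  then have "[multinomial] \<cdot>\<^bsub>?M\<^esub> f \<in> ?B"
    unfolding boundaries_def using total_homotopy_closed[OF fM] by (intro image_eqI)
  then show ?thesis unfolding pow using Q.coset_zero by (simp add: H)
qed

lemma homology_zero_closed: "\<zero>\<^bsub>homology K t\<^esub> \<in> carrier (homology K t)"
proof -
  let ?M = "cobj K t" and ?B = "boundaries K t"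
  interpret M: module R ?M by (rule cobj_K_module)
  interpret Q: quotient_module R ?M ?B
    unfolding quotient_module_def quotient_module_axioms_def boundaries_def
    using cobj_K_module linear_map_image_submodule[OF cobj_K_module cobj_K_module cdiff_K_linear] by blast
  have "\<zero>\<^bsub>?M\<^esub> \<in> cycles K t"
    using linear_map_zero[OF cobj_K_module cobj_K_module cdiff_K_linear] by (auto simp: cycles_def)
  moreover have "?B +>\<^bsub>?M\<^esub> \<zero>\<^bsub>?M\<^esub> = ?B" by (rule Q.coset_zero[OF Q.H.zero_closed])
  moreover have "\<zero>\<^bsub>homology K t\<^esub> = ?B" by (simp add: homology_def quot_module_def)
  ultimately show ?thesis unfolding carrier_homology by (intro image_eqI[of _ _ "\<zero>\<^bsub>?M\<^esub>"]) simp_all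
qed

end

section \<open>Valuations of multinomial coefficients\<close>

lemma digit_sum_upper:
  assumes "p \<ge> 2" "s \<le> k" shows "digit_sum p s = (\<Sum>i\<le>k. (s div p ^ i) mod p)"
proof -
  have "(s div p ^ i) mod p = 0" if "s < i" for i
  proof -
    have "i < p ^ i" using assms(1) by (intro power_gt_expt) simp
    with that have "s div p ^ i = 0" by simp
    then show ?thesis by simp
  qed
  then show ?thesis unfolding digit_sum_def using assms(2) by (intro sum.mono_neutral_left) auto
qed

lemma digit_sum_rec:
  assumes "p \<ge> 2" shows "digit_sum p s = s mod p + digit_sum p (s div p)"
proof -
  have "digit_sum p s = (\<Sum>i\<le>Suc s. (s div p ^ i) mod p)" using digit_sum_upper[OF assms, of s "Suc s"] by simp
  also have "\<dots> = s mod p + (\<Sum>i\<le>s. (s div p ^ Suc i) mod p)" by (subst sum.atMost_Suc_shift) simp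
  also have "(\<Sum>i\<le>s. (s div p ^ Suc i) mod p) = digit_sum p (s div p)"
    using digit_sum_upper[OF assms, of "s div p" s] by (simp add: div_mult2_eq)
  finally show ?thesis .
qed

lemma digit_sum_0 [simp]: "digit_sum p 0 = 0" by (simp add: digit_sum_def)

text \<open>Adding 1 turns each trailing digit p - 1 into 0 and raises the next digit by 1; the
  number of such trailing digits is the valuation of the successor.\<close>

lemma digit_sum_Suc:
  assumes "prime p"
  shows "digit_sum p (Suc n) + (p - 1) * multiplicity p (Suc n) = Suc (digit_sum p n)"
proof (induction n rule: less_induct)
  case (less n)
  have p: "p \<ge> 2" using assms by (rule prime_ge_2_nat)
  show ?case
  proof (cases "p dvd Suc n")
    case False
    then have "multiplicity p (Suc n) = 0" by (rule not_dvd_imp_multiplicity_0)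
    moreover have "Suc n mod p = Suc (n mod p)" "Suc n div p = n div p"
      using False p by (auto simp: mod_Suc div_Suc dvd_eq_mod_eq_0 split: if_splits)
    ultimately show ?thesis using digit_sum_rec[OF p, of n] digit_sum_rec[OF p, of "Suc n"] by simp
  next
    case True
    then obtain q where q: "Suc n = p * q" by blast
    then obtain q' where q': "q = Suc q'" by (cases q) auto
    have n: "n = p * q' + (p - 1)" using q q' p by simp
    have "((p - 1) + p * q') mod p = p - 1" "((p - 1) + p * q') div p = q'"
      using p by (simp_all only: mod_mult_self2 div_mult_self2) simp_all
    then have "n mod p = p - 1" "n div p = q'" by (simp_all only: n add.commute)
    then have d1: "digit_sum p n = (p - 1) + digit_sum p q'" using digit_sum_rec[OF p, of n] by simp
    have d2: "digit_sum p (Suc n) = digit_sum p q" using digit_sum_rec[OF p, of "Suc n"] p by (simp add: q)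
    have "p \<noteq> 0" using p by simp
    have "multiplicity p (Suc n) = Suc (multiplicity p q)"
      unfolding q using q' assms p by (intro multiplicity_times_same) auto
    moreover have "q' < n" using mult_le_mono1[OF p, of q] q q' by simp
    from less.IH[OF this] have "digit_sum p q + (p - 1) * multiplicity p q = Suc (digit_sum p q')" by (simp add: q')
    ultimately show ?thesis using d1 d2 by simp
  qed
qed

text \<open>Telescopes \<open>digit_sum_Suc\<close> over the factors of the factorial.\<close>

lemma legendre_formula:
  assumes "prime p"
  shows "(p - 1) * multiplicity p (fact n :: nat) + digit_sum p n = n"
proof (induction n)
  case (Suc n)
  have "multiplicity p (fact (Suc n) :: nat) = multiplicity p (Suc n) + multiplicity p (fact n :: nat)"
    unfolding fact_Suc using assms
    by (subst prime_elem_multiplicity_mult_distrib) (auto simp: prime_imp_prime_elem)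
  then show ?case using Suc digit_sum_Suc[OF assms, of n] by (simp add: algebra_simps)
qed simp

lemma digit_sum_le: "prime p \<Longrightarrow> digit_sum p n \<le> n"
  using legendre_formula[of p n] by simp

lemma digit_sum_power:
  assumes "p \<ge> 2" shows "digit_sum p (p ^ e) = 1"
proof (induction e)
  case 0
  then show ?case using digit_sum_rec[OF assms, of 1] assms by simp
next
  case (Suc e)
  then show ?case using digit_sum_rec[OF assms, of "p ^ Suc e"] assms by simp
qed

text \<open>The base p expansion read as a list of powers: those for n div p are multiplied by p,
  and the last digit adds as many ones.\<close>

lemma ex_sum_powers_digit_sum:
  assumes "p \<ge> 2"
  shows "\<exists>as. length as = digit_sum p n \<and> sum_list as = n \<and> (\<forall>a\<in>set as. \<exists>e. a = p ^ e)"
proof (induction n rule: less_induct)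
  case (less n)
  show ?case
  proof (cases "n = 0")
    case True
    then show ?thesis by (intro exI[of _ "[]"]) simp
  next
    case False
    then have "n div p < n" using assms by simp
    from less.IH[OF this] obtain as where as: "length as = digit_sum p (n div p)" "sum_list as = n div p"
      "\<And>a. a \<in> set as \<Longrightarrow> \<exists>e. a = p ^ e" by blast
    let ?bs = "replicate (n mod p) 1 @ map ((*) p) as"
    have "sum_list ?bs = n mod p + p * (n div p)"
      using as(2) by (simp add: sum_list_replicate sum_list_const_mult[of p "\<lambda>a. a", simplified])
    moreover have "\<exists>e. b = p ^ e" if b: "b \<in> set ?bs" for b
    proof (cases "b \<in> set as \<or> b = 1")
      case True
      then show ?thesis using as(3) power_0[of p] by metis
    next
      case False
      then obtain a where "a \<in> set as" "b = p * a" using b by auto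
      then show ?thesis using as(3) power_Suc by metis
    qed
    ultimately show ?thesis using as(1) digit_sum_rec[OF assms, of n] by (intro exI[of _ ?bs]) simp
  qed
qed

text \<open>Replacing a part p^(e+1) by p parts p^e adds p - 1 parts and keeps the sum. A part other
  than 1 exists as long as there are fewer than n parts.\<close>

lemma ex_sum_powers:
  assumes "p \<ge> 2" "digit_sum p n + (p - 1) * r \<le> n"
  shows "\<exists>as. length as = digit_sum p n + (p - 1) * r \<and> sum_list as = n \<and> (\<forall>a\<in>set as. \<exists>e. a = p ^ e)"
  using assms(2)
proof (induction r)
  case 0
  then show ?case using ex_sum_powers_digit_sum[OF assms(1)] by simp
next
  case (Suc r)
  then obtain as where as: "length as = digit_sum p n + (p - 1) * r" "sum_list as = n" "\<And>a. a \<in> set as \<Longrightarrow> \<exists>e. a = p ^ e"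
    by auto
  have "length as < sum_list as" using as(1,2) Suc.prems assms(1) by simp
  have "\<exists>a\<in>set as. a \<noteq> 1"
  proof (rule ccontr)
    assume "\<not> ?thesis"
    then have "as = replicate (length as) 1" by (intro replicate_eqI) auto
    from arg_cong[OF this, of sum_list] have "sum_list as = length as" by (simp only: sum_list_replicate mult_1_right of_nat_id)
    with \<open>length as < sum_list as\<close> show False by simp
  qed
  then obtain a where a: "a \<in> set as" "a \<noteq> 1" by blast
  then obtain e' where "a = p ^ e'" "e' \<noteq> 0" using as(3)[OF a(1)] by (auto intro: gr0I)
  then obtain e where "a = p ^ Suc e" by (cases e') auto
  obtain xs ys where xy: "as = xs @ a # ys" using a(1) by (meson split_list)
  let ?bs = "xs @ replicate p (p ^ e) @ ys"
  have "length ?bs = digit_sum p n + (p - 1) * Suc r" using as(1) assms(1) by (simp add: xy)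
  moreover have "sum_list ?bs = n" using as(2) by (simp add: xy \<open>a = p ^ Suc e\<close> sum_list_replicate)
  moreover have "\<forall>b\<in>set ?bs. \<exists>e. b = p ^ e" using as(3) by (auto simp: xy)
  ultimately show ?case by blast
qed

text \<open>The letters are the positions in the list; nonzero parts make every letter
  occur.\<close>

lemma ex_multiset_counts:
  fixes as :: "nat list"
  assumes "0 \<notin> set as"
  shows "\<exists>A. size A = sum_list as \<and> set_mset A = {..<length as} \<and> (\<forall>i<length as. count A i = as ! i)"
  using assms
proof (induction as rule: rev_induct)
  case Nil
  then show ?case by (intro exI[of _ "{#}"]) simp
next
  case (snoc a as)
  then obtain A where A: "size A = sum_list as" "set_mset A = {..<length as}" "\<And>i. i < length as \<Longrightarrow> count A i = as ! i"
    by auto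
  let ?A = "A + replicate_mset a (length as)"
  have "count A (length as) = 0" using A(2) by (simp add: count_eq_zero_iff)
  then have "\<forall>i<length (as @ [a]). count ?A i = (as @ [a]) ! i" using A(3) by (auto simp: nth_append less_Suc_eq)
  moreover have "a \<noteq> 0" using snoc.prems by simp
  then have "set_mset ?A = {..<length (as @ [a])}" by (simp add: A(2) lessThan_Suc)
  ultimately show ?case using A(1) by (intro exI[of _ ?A]) simp
qed

text \<open>By Legendre (p - 1) v(n!) = n - \<open>digit_sum p n\<close>, and a part a that is a
  power of p has (p - 1) v(a!) = a - 1, so the parts together contribute n minus their number. The
  difference is (p - 1) r.\<close>

lemma multiplicity_multinomial:
  assumes p: "prime p" and "size A = n" "set_mset A = {..<length as}" "\<And>i. i < length as \<Longrightarrow> count A i = as ! i"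
    and pow: "\<And>a. a \<in> set as \<Longrightarrow> \<exists>e. a = p ^ e" and len: "length as = digit_sum p n + (p - 1) * r"
  shows "multiplicity p (card (permutations_of_multiset A)) = r"
proof -
  have p2: "p \<ge> 2" using p by (rule prime_ge_2_nat)
  let ?m = "card (permutations_of_multiset A)" and ?L = "length as"
  let ?F = "\<Prod>i<?L. fact (as ! i) :: nat"
  have F: "?m * ?F = fact n"
    using card_permutations_of_multiset_aux[of A] assms(2-4) by simp
  have m: "?m \<noteq> 0" by (simp add: card_eq_0_iff)
  have v: "(p - 1) * multiplicity p (fact (as ! i) :: nat) + 1 = as ! i" if i: "i < ?L" for i
  proof -
    obtain e where e: "as ! i = p ^ e" using pow[OF nth_mem[OF i]] by blast
    show ?thesis using legendre_formula[OF p, of "as ! i"] digit_sum_power[OF p2, of e] by (simp add: e)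
  qed
  have sum_as: "(\<Sum>i<?L. as ! i) = n"
  proof -
    have "n = sum (count A) (set_mset A)" using assms(2) by (simp add: size_multiset_overloaded_eq)
    also have "\<dots> = (\<Sum>i<?L. as ! i)" unfolding assms(3) by (rule sum.cong) (auto simp: assms(4))
    finally show ?thesis by simp
  qed
  have "multiplicity p (fact n :: nat) = multiplicity p ?m + multiplicity p ?F"
    unfolding F[symmetric] using m p by (subst prime_elem_multiplicity_mult_distrib) (auto simp: prime_imp_prime_elem)
  also have "multiplicity p ?F = (\<Sum>i<?L. multiplicity p (fact (as ! i) :: nat))"
    using p by (subst prime_elem_multiplicity_prod_distrib) (auto simp: prime_imp_prime_elem)
  finally have "(p - 1) * multiplicity p (fact n :: nat) + ?L =
      (p - 1) * multiplicity p ?m + (\<Sum>i<?L. (p - 1) * multiplicity p (fact (as ! i) :: nat) + 1)"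
    by (simp only: sum.distrib sum_distrib_left add_mult_distrib2) simp
  also have "(\<Sum>i<?L. (p - 1) * multiplicity p (fact (as ! i) :: nat) + 1) = n"
    using sum_as v by simp
  finally have "(p - 1) * multiplicity p (fact n :: nat) + ?L = (p - 1) * multiplicity p ?m + n" .
  then have "(p - 1) * multiplicity p ?m = (p - 1) * r" using legendre_formula[OF p, of n] len by linarith
  then show ?thesis using p2 by simp
qed

lemma ex_multinomial:
  assumes p: "prime p" and "digit_sum p n + (p - 1) * r \<le> n"
  shows "\<exists>A. size A = n \<and> set_mset A = {..<digit_sum p n + (p - 1) * r} \<and>
    multiplicity p (card (permutations_of_multiset A)) = r"
proof -
  have p2: "p \<ge> 2" using p by (rule prime_ge_2_nat)
  obtain as where as: "length as = digit_sum p n + (p - 1) * r" "sum_list as = n" "\<And>a. a \<in> set as \<Longrightarrow> \<exists>e. a = p ^ e"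
    using ex_sum_powers[OF p2 assms(2)] by blast
  have "0 \<notin> set as" using as(3)[of 0] p2 by auto
  then obtain A where A: "size A = n" "set_mset A = {..<length as}" "\<And>i. i < length as \<Longrightarrow> count A i = as ! i"
    using ex_multiset_counts[of as] as(2) by auto
  show ?thesis using A multiplicity_multinomial[OF p A as(3) as(1)] as(1) by auto
qed

section \<open>Torsion in homology\<close>

lemma (in abelian_group) prime_power_torsion:
  assumes "prime p" "x \<in> carrier G" "[m] \<cdot> x = \<zero>" "[(p ^ k)] \<cdot> x = \<zero>" "m \<noteq> (0::nat)" "multiplicity p m \<le> r"
  shows "[(p ^ r)] \<cdot> x = \<zero>"
proof -
  have iff: "[(l::nat)] \<cdot> x = \<zero> \<longleftrightarrow> group.ord (add_monoid G) x dvd l" for l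
    using group.pow_eq_id[OF a_group, of x l] assms(2) by (simp add: add_pow_def)
  \<comment> \<open>The order of x divides a power of p and also divides m, so it is p^j with j at
    most the valuation of m.\<close>
  obtain j where j: "group.ord (add_monoid G) x = p ^ j" using iff assms(1,4) divides_primepow_nat by blast
  then have "p ^ j dvd m" using iff assms(3) by simp
  then have "j \<le> multiplicity p m" using assms(1,5) by (subst power_dvd_iff_le_multiplicity[symmetric]) auto
  then have "p ^ j dvd p ^ r" using assms(6) by (intro le_imp_power_dvd) simp
  then show ?thesis using iff j by simp
qed

lemma (in coned_complex) homology_prime_power_torsion:
  assumes "prime p" "t < n * D" "x \<in> primary_part p (homology K t)" "multiplicity p multinomial \<le> r"
  shows "[(p ^ r)] \<cdot>\<^bsub>homology K t\<^esub> x = \<zero>\<^bsub>homology K t\<^esub>"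
proof -
  let ?Q = "quot_module (cobj K t) (boundaries K t)"
  interpret Q: quotient_module R "cobj K t" "boundaries K t"
    unfolding quotient_module_def quotient_module_axioms_def boundaries_def
    using cobj_K_module linear_map_image_submodule[OF cobj_K_module cobj_K_module cdiff_K_linear] by blast
  interpret QM: module R ?Q by (rule Q.quot_module_module)
  have eq: "\<zero>\<^bsub>homology K t\<^esub> = \<zero>\<^bsub>?Q\<^esub>" "[(k::nat)] \<cdot>\<^bsub>homology K t\<^esub> y = [k] \<cdot>\<^bsub>?Q\<^esub> y" for k y
    by (auto simp: homology_def quot_module_def set_add_def set_mult_def add_pow_def nat_pow_def)
  have "carrier (homology K t) \<subseteq> carrier ?Q"
    unfolding carrier_homology Q.carrier_quot_module by (auto simp: cycles_def)
  then have x: "x \<in> carrier (homology K t)" "x \<in> carrier ?Q" using assms(3) by (auto simp: primary_part_def)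
  obtain k where k: "[(p ^ k)] \<cdot>\<^bsub>?Q\<^esub> x = \<zero>\<^bsub>?Q\<^esub>" using assms(3) by (auto simp: primary_part_def eq)
  have "[multinomial] \<cdot>\<^bsub>?Q\<^esub> x = \<zero>\<^bsub>?Q\<^esub>" using homology_killed[OF assms(2) x(1)] by (simp add: eq)
  from QM.prime_power_torsion[OF assms(1) x(2) this k _ assms(4)] show ?thesis
    by (simp add: eq card_eq_0_iff)
qed

lemma (in coned_complex) homology_killed_by_1:
  assumes "x \<in> carrier (homology K t)"
  shows "[(1::nat)] \<cdot>\<^bsub>homology K t\<^esub> x = x"
proof -
  let ?Q = "quot_module (cobj K t) (boundaries K t)"
  interpret Q: quotient_module R "cobj K t" "boundaries K t"
    unfolding quotient_module_def quotient_module_axioms_def boundaries_def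
    using cobj_K_module linear_map_image_submodule[OF cobj_K_module cobj_K_module cdiff_K_linear] by blast
  interpret QM: module R ?Q by (rule Q.quot_module_module)
  have eq: "[(k::nat)] \<cdot>\<^bsub>homology K t\<^esub> y = [k] \<cdot>\<^bsub>?Q\<^esub> y" for k y
    by (auto simp: homology_def quot_module_def set_add_def set_mult_def add_pow_def nat_pow_def)
  have "carrier (homology K t) \<subseteq> carrier ?Q"
    unfolding carrier_homology Q.carrier_quot_module by (auto simp: cycles_def)
  then show ?thesis using assms by (auto simp: eq)
qed

theorem theorem4p11:
  fixes R :: "('r, 'x) ring_scheme" and s n :: nat
    and C :: "nat \<Rightarrow> ('r, 'm, 'n) poly_functor"
    and \<delta> :: "nat \<Rightarrow> ('r, 'm) module \<Rightarrow> 'n \<Rightarrow> 'n"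
    and Xs :: "('r, 'm) simplicial_data"
    and H :: "nat \<Rightarrow> ('r, (nat \<Rightarrow> 'n) set) module"
  assumes "cring R"
    and "s > 0"
    and "strict_poly_complex R s C \<delta>"
    and "simplicial_module R Xs"
    and "\<And>j. sobj Xs j \<in> proj_objects R"
    and "\<And>i. i < n \<Longrightarrow> trivial_module (homotopy_group Xs i)"
  defines "H \<equiv> homology (c_complex (\<lambda>i. underlying_functor R s (C i)) \<delta> Xs)"
  shows "(\<forall>i < n * s. torsion_group (H i)) \<and>
    (\<forall>p d. prime p \<and> digit_sum p s \<le> d \<and> d < s \<longrightarrow>
       (\<forall>i < n * d. \<forall>x \<in> primary_part p (H i).
          [(p ^ nat \<lceil>(real d - real (digit_sum p s)) / (real p - 1)\<rceil>)] \<cdot>\<^bsub>H i\<^esub> x = \<zero>\<^bsub>H i\<^esub>)) \<and>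
    (\<forall>p. prime p \<longrightarrow> (\<forall>i < n * digit_sum p s. primary_part p (H i) = {\<zero>\<^bsub>H i\<^esub>})) \<and>
    (\<forall>i < n. trivial_module (H i))"
proof -
  interpret X: connected_simplicial_module R Xs n
    unfolding connected_simplicial_module_def connected_simplicial_module_axioms_def
    using assms(4-6) by (auto simp: proj_objects_def)
  obtain cone where cone: "\<And>k. linear_map R (sobj Xs k) (sobj Xs (Suc k)) (cone k)"
    "\<And>k x. k < n \<Longrightarrow> x \<in> carrier (sobj Xs k) \<Longrightarrow> face Xs k 0 (cone k x) = x"
    "\<And>x. x \<in> carrier (sobj Xs 0) \<Longrightarrow> face Xs 0 1 (cone 0 x) = \<zero>\<^bsub>sobj Xs 0\<^esub>"
    "\<And>k i x. 1 \<le> i \<Longrightarrow> i \<le> Suc (Suc k) \<Longrightarrow> x \<in> carrier (sobj Xs (Suc k)) \<Longrightarrow>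
       face Xs (Suc k) i (cone (Suc k) x) = cone k (face Xs k (i - 1) x)"
    using X.ex_cone by (elim exE conjE) (simp only: Ball_def atLeastAtMost_iff, blast)
  have "coned_simplicial_module R Xs n cone"
    unfolding coned_simplicial_module_def coned_simplicial_module_axioms_def
    by (intro conjI allI impI assms(4) cone)
  then have coned: "coned_complex R s C \<delta> Xs n cone A D" if "size A = s" "set_mset A = {..<D}" for A D
    using that assms(3,5) by (simp add: coned_complex_def coned_complex_axioms_def)
  have zero: "\<zero>\<^bsub>H i\<^esub> \<in> carrier (H i)" and one: "x \<in> carrier (H i) \<Longrightarrow> [(1::nat)] \<cdot>\<^bsub>H i\<^esub> x = x" for i x
  proof -
    \<comment> \<open>These two facts do not mention A; any partition of s gives access to the
      locale.\<close>
    interpret coned_complex R s C \<delta> Xs n cone "mset [0..<s]" s by (rule coned) auto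
    show "\<zero>\<^bsub>H i\<^esub> \<in> carrier (H i)" "x \<in> carrier (H i) \<Longrightarrow> [(1::nat)] \<cdot>\<^bsub>H i\<^esub> x = x"
      unfolding H_def by (rule homology_zero_closed, rule homology_killed_by_1)
  qed
  have prime_torsion: "[(p ^ r)] \<cdot>\<^bsub>H i\<^esub> x = \<zero>\<^bsub>H i\<^esub>"
    if p: "prime p" "digit_sum p s + (p - 1) * r \<le> s" and i: "i < n * (digit_sum p s + (p - 1) * r)"
      and x: "x \<in> primary_part p (H i)" for p r i x
  proof -
    obtain A where A: "size A = s" "set_mset A = {..<digit_sum p s + (p - 1) * r}"
      "multiplicity p (card (permutations_of_multiset A)) = r"
      using ex_multinomial[OF p] by blast
    interpret coned_complex R s C \<delta> Xs n cone A "digit_sum p s + (p - 1) * r" by (rule coned[OF A(1,2)])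
    show ?thesis unfolding H_def
      by (rule homology_prime_power_torsion[OF p(1) i]) (use x A(3) in \<open>simp_all add: H_def\<close>)
  qed
  have torsion: "torsion_group (H i)" if "i < n * s" for i
  proof -
    \<comment> \<open>The partition into s ones: D = s, and the multinomial coefficient s! is
      positive.\<close>
    interpret coned_complex R s C \<delta> Xs n cone "mset [0..<s]" s by (rule coned) auto
    have "card (permutations_of_multiset (mset [0..<s])) > 0" by (simp add: card_gt_0_iff)
    then show ?thesis unfolding torsion_group_def H_def using homology_killed[OF that] by blast
  qed
  have bounded: "[(p ^ nat \<lceil>(real d - real (digit_sum p s)) / (real p - 1)\<rceil>)] \<cdot>\<^bsub>H i\<^esub> x = \<zero>\<^bsub>H i\<^esub>"
    if p: "prime p" and d: "digit_sum p s \<le> d" "d < s" and i: "i < n * d" and x: "x \<in> primary_part p (H i)" for p d i x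
  proof -
    \<comment> \<open>The least r with d \<le> \<open>digit_sum p s\<close> + (p - 1) r; a partition
      with that many parts covers all i < n d.\<close>
    define r where "r = nat \<lceil>(real d - real (digit_sum p s)) / (real p - 1)\<rceil>"
    have p1: "real p - 1 > 0" using prime_gt_1_nat[OF p] by simp
    have cast: "real (p - 1) = real p - 1" using prime_gt_1_nat[OF p] by simp
    have q: "(real d - real (digit_sum p s)) / (real p - 1) \<le> real r"
      unfolding r_def using d(1) p1 by linarith
    then have "real d \<le> real (digit_sum p s) + (real p - 1) * real r"
      using p1 by (simp add: field_simps)
    then have "real d \<le> real (digit_sum p s + (p - 1) * r)" by (simp only: of_nat_add of_nat_mult cast)
    then have dD: "d \<le> digit_sum p s + (p - 1) * r" by (simp only: of_nat_le_iff)
    \<comment> \<open>Such a partition can have at most s parts. By Legendre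
      \<open>digit_sum p s\<close> + (p - 1) v_p(s!) = s > d, so v_p(s!) bounds the quotient and,
      being an integer, also its ceiling r.\<close>
    let ?v = "multiplicity p (fact s :: nat)"
    have s: "s = digit_sum p s + (p - 1) * ?v" using legendre_formula[OF p, of s] by simp
    have "real d \<le> real (digit_sum p s + (p - 1) * ?v)" using d(2) s by simp
    then have "real d \<le> real (digit_sum p s) + (real p - 1) * real ?v" by (simp only: of_nat_add of_nat_mult cast)
    then have "real d - real (digit_sum p s) \<le> real ?v * (real p - 1)" by (simp add: algebra_simps)
    then have "(real d - real (digit_sum p s)) / (real p - 1) \<le> real ?v"
      using p1 by (simp add: pos_divide_le_eq)
    then have "r \<le> ?v" unfolding r_def by (simp add: ceiling_le_iff nat_le_iff)
    then have "digit_sum p s + (p - 1) * r \<le> s" using s by (metis add_le_cancel_left mult_le_mono2)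
    moreover have "i < n * (digit_sum p s + (p - 1) * r)"
      using i dD by (meson less_le_trans mult_le_mono2)
    ultimately show ?thesis using prime_torsion[OF p _ _ x] unfolding r_def by blast
  qed
  \<comment> \<open>The case r = 0: the base p expansion itself, whose multinomial coefficient is
    prime to p.\<close>
  have primary_zero: "primary_part p (H i) = {\<zero>\<^bsub>H i\<^esub>}" if p: "prime p" and i: "i < n * digit_sum p s" for p i
  proof
    show "primary_part p (H i) \<subseteq> {\<zero>\<^bsub>H i\<^esub>}"
    proof
      fix x assume x: "x \<in> primary_part p (H i)"
      then have "[(p ^ 0)] \<cdot>\<^bsub>H i\<^esub> x = \<zero>\<^bsub>H i\<^esub>"
        using prime_torsion[OF p, of 0 i x] digit_sum_le[OF p, of s] i by simp
      then show "x \<in> {\<zero>\<^bsub>H i\<^esub>}" using one[of x i] x by (simp add: primary_part_def)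
    qed
    have "[(p ^ 0)] \<cdot>\<^bsub>H i\<^esub> \<zero>\<^bsub>H i\<^esub> = \<zero>\<^bsub>H i\<^esub>" using one[OF zero] by simp
    then show "{\<zero>\<^bsub>H i\<^esub>} \<subseteq> primary_part p (H i)" using zero unfolding primary_part_def by blast
  qed
  have trivial: "trivial_module (H i)" if i: "i < n" for i
  proof -
    \<comment> \<open>A single part s: D = 1 and the coefficient is 1, so the identity itself is
      null-homotopic below degree n. Positivity of s ensures that the letter 0 occurs.\<close>
    interpret coned_complex R s C \<delta> Xs n cone "replicate_mset s 0" 1
      by (rule coned) (use assms(2) in auto)
    have "card (permutations_of_multiset (replicate_mset s (0::nat))) = 1"
      using card_permutations_of_multiset_aux[of "replicate_mset s (0::nat)"] assms(2) by simp
    then have "x = \<zero>\<^bsub>H i\<^esub>" if "x \<in> carrier (H i)" for x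
      using homology_killed[of i x] one[OF that] i that by (simp add: H_def)
    then show ?thesis using zero[of i] unfolding trivial_module_def by blast
  qed
  show ?thesis using torsion bounded primary_zero trivial by blast
qed

end
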